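(* Let $s>1$, let $M$ be a connected, non-compact, oriented real-analytic manifold of dimension $n$, and let $\omega_1,\ldots,\omega_m$ be real-valued closed $1$-forms on $M$ of Gevrey order $s$. Then the operator $$\mathbb{L}^{n-1}:\mathsf{\Lambda}^{0,n-1}\mathscr{D}_s'(M\times\mathbb{T}^m)\longrightarrow \mathsf{\Lambda}^{0,n}\mathscr{D}_s'(M\times\mathbb{T}^m),\qquad \mathbb{L}^{n-1}u=\mathrm{d}_tu+\sum_{k=1}^m\omega_k\wedge\partial_{x_k}u,$$ is globally solvable in Gevrey ultradistributions; that is, for every $f\in\mathsf{\Lambda}^{0,n}\mathscr{D}_s'(M\times\mathbb{T}^m)$ there exists $u\in\mathsf{\Lambda}^{0,n-1}\mathscr{D}_s'(M\times\mathbb{T}^m)$ such that $\mathbb{L}^{n-1}u=f$.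
   Context: Manifolds are finite-dimensional, Hausdorff and second countable. $\mathbb{T}^m=\mathbb{R}^m/(2\pi\mathbb{Z}^m)$, $X=M\times\mathbb{T}^m$, and $\pi_M:X\to M$ is the projection. Gevrey functions (Roumieu type, $s>1$ fixed): for $\mathcal{U}\subset\mathbb{R}^d$ open, $\mathscr{G}^s(\mathcal{U})$ is the set of $f\in C^\infty(\mathcal{U})$ such that for every compact $K\subset\mathcal{U}$ there is $h>0$ with $\|f\|_{K,h}:=\sup_{\alpha\in\mathbb{N}_0^d}h^{-|\alpha|}(\alpha!)^{-s}\sup_{K}|\partial^\alpha f|<\infty$. For a real-analytic complex vector bundle $\mathbb{E}$ over a real-analytic manifold $Y$, $\mathscr{G}^s(Y;\mathbb{E})$ is the space of smooth sections whose coefficients in analytic charts and analytic local frames are in $\mathscr{G}^s$; $\mathscr{G}^s_c(Y;\mathbb{E})$ is the subspace of compactly supported sections. It carries the locally convex inductive limit topology over a compact exhaustion $(K_\ell)$ of $Y$ and over $h\to\infty$ of the Banach spaces of smooth sections $u$ supported in $K_\ell$ with $\|u\|_{\ell,h}<\infty$, where $\|u\|_{\ell,h}$ is the finite sum of the norms $\|\cdot\|_{K',h}$ of the coefficients of $u$ in analytic charts and frames, over finitely many compact pieces $K'$ of charts covering $K_\ell$. A $1$-form of Gevrey order $s$ on $M$ is an element of $\mathscr{G}^s(M;\Lambda^1\mathbb{C}T^*M)$. Ultradistributions: fixing a positive real-analytic density on $Y$, $\mathscr{D}_s'(Y;\mathbb{E}):=(\mathscr{G}^s_c(Y;\mathbb{E}^*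 ))'_b$ (strong dual), where $\mathbb{E}^*$ is the dual bundle. Tube complex: $\mathsf{\Lambda}^{0,q}X:=\pi_M^*(\Lambda^q\mathbb{C}T^*M)$, whose sections are locally $u=\sum_{|J|=q}u_J(t,x)\,\mathrm{d}t_J$ with $t$ local coordinates on $M$ and $x\in\mathbb{T}^m$. For $\mathscr{F}\in\{\mathscr{G}^s,\mathscr{G}^s_c,\mathscr{D}'_s,C^\infty,C_c^\infty\}$, $\mathsf{\Lambda}^{0,q}\mathscr{F}(X):=\mathscr{F}(X;\mathsf{\Lambda}^{0,q}X)$. For $q=0,\ldots,n-1$, $\mathbb{L}^qu=\mathrm{d}_tu+\sum_{k=1}^m\omega_k\wedge\partial_{x_k}u$, where $\mathrm{d}_t$ is the exterior derivative in the $M$-variable, $\partial_{x_k}$ acts coefficientwise, and $\omega_k$ is identified with its pullback to $X$. On ultradistributions, $\mathbb{L}^q$ is defined by transposition: $\langle\mathbb{L}^qu,\varphi\rangle=\langle u,{}^t\mathbb{L}^q\varphi\rangle$ for test sections $\varphi$, with ${}^t\mathbb{L}^q$ the formal transpose. Concretely, using the orientation of $M$ and the normalized Haar density $\mathrm{d}x$ on $\mathbb{T}^m$, via the pairing $\langle u,v\rangle=\int_{\mathbb{T}^m}(\int_M u\wedge v)\,\mathrm{d}x$, $\mathsf{\Lambda}^{0,q}\mathscr{D}_s'(X)$ is identified with the dual of $\mathsf{\Lambda}^{0,n-q}\mathscr{G}^s_c(X)$, and ${}^t\mathbb{L}^q=(-1)^{q+1}\mathbb{L}^{n-q-1}$.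 *)

theory Defs
  imports "HOL-Analysis.Analysis" "HOL-Library.Function_Algebras"
begin

section \<open>The torus\<close>

definition torus_rel :: "real^'m \<Rightarrow> real^'m \<Rightarrow> bool" where
  "torus_rel x y \<longleftrightarrow> (\<forall>i. \<exists>z::int. x $ i - y $ i = 2 * pi * of_int z)"

lemma equivp_torus_rel: "equivp torus_rel"
proof (rule equivpI)
  show "reflp torus_rel"
    by (auto simp: reflp_def torus_rel_def intro: exI[of _ 0])
  show "symp torus_rel"
  proof (rule sympI)
    fix x y :: "real^'m" assume xy: "torus_rel x y"
    show "torus_rel y x" unfolding torus_rel_def
    proof
      fix i
      from xy obtain z :: int where "x $ i - y $ i = 2 * pi * of_int z"
        unfolding torus_rel_def by blast
      then have "y $ i - x $ i = 2 * pi * of_int (- z)" by simp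
      then show "\<exists>z::int. y $ i - x $ i = 2 * pi * of_int z" by blast
    qed
  qed
  show "transp torus_rel"
  proof (rule transpI)
    fix x y w :: "real^'m" assume xy: "torus_rel x y" and yw: "torus_rel y w"
    show "torus_rel x w" unfolding torus_rel_def
    proof
      fix i
      from xy obtain a :: int where "x $ i - y $ i = 2 * pi * of_int a"
        unfolding torus_rel_def by blast
      moreover from yw obtain b :: int where "y $ i - w $ i = 2 * pi * of_int b"
        unfolding torus_rel_def by blast
      ultimately have "x $ i - w $ i = 2 * pi * of_int (a + b)"
        by (simp add: algebra_simps)
      then show "\<exists>z::int. x $ i - w $ i = 2 * pi * of_int z" by blast
    qed
  qed
qed

quotient_type 'm torus = "real^('m::finite)" / torus_rel
  by (rule equivp_torus_rel)

lift_definition torus_class :: "real^'m \<Rightarrow> ('m::finite) torus" is "\<lambda>x. x" .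

lift_definition torus_translate :: "real^'m \<Rightarrow> 'm torus \<Rightarrow> ('m::finite) torus" is "\<lambda>h x. x + h"
  by (simp add: torus_rel_def)

instantiation torus :: (finite) topological_space
begin

definition open_torus_def: "open (W :: 'a torus set) \<longleftrightarrow> open (torus_class -` W)"

instance
proof
  show "open (UNIV :: 'a torus set)" by (simp add: open_torus_def)
next
  fix S T :: "'a torus set" assume "open S" "open T"
  then show "open (S \<inter> T)" by (auto simp: open_torus_def vimage_Int)
next
  fix F :: "'a torus set set" assume "\<forall>S\<in>F. open S"
  then show "open (\<Union>F)" by (auto simp: open_torus_def vimage_Union)
qed

end


section \<open>Real-analytic, smooth and Gevrey functions on open subsets of Euclidean spaces\<close>

definition real_analytic_on :: "(real^'n \<Rightarrow> 'b::real_normed_vector) \<Rightarrow> (real^'n) set \<Rightarrow> bool" where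
  "real_analytic_on f S \<longleftrightarrow>
     (\<forall>a\<in>S. \<exists>r>0. \<exists>c :: ('n \<Rightarrow> nat) \<Rightarrow> 'b. \<forall>x\<in>ball a r.
        ((\<lambda>\<alpha>. (\<Prod>i\<in>UNIV. (x $ i - a $ i) ^ \<alpha> i) *\<^sub>R c \<alpha>) has_sum f x) UNIV)"

definition dir_deriv :: "'e::real_normed_vector \<Rightarrow> ('e \<Rightarrow> complex) \<Rightarrow> 'e \<Rightarrow> complex" where
  "dir_deriv v f x = vector_derivative (\<lambda>r. f (x + r *\<^sub>R v)) (at 0)"

text \<open>Multi-indices are encoded by lists of standard basis vectors: the list \<open>bs\<close> stands for the
  multi-index \<open>\<alpha>\<close> whose entry at the coordinate \<open>b\<close> is \<open>count_list bs b\<close>, so that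
  \<open>iter_deriv bs f\<close> is \<open>\<partial>\<^sup>\<alpha> f\<close>, \<open>length bs\<close> is \<open>|\<alpha>|\<close> and \<open>multi_fact bs\<close> is \<open>\<alpha>!\<close>.  Each \<open>\<alpha>\<close> is
  encoded by several lists, but they all give the same derivative of a smooth function.\<close>

primrec iter_deriv :: "'e::real_normed_vector list \<Rightarrow> ('e \<Rightarrow> complex) \<Rightarrow> 'e \<Rightarrow> complex" where
  "iter_deriv [] f = f"
| "iter_deriv (b # bs) f = dir_deriv b (iter_deriv bs f)"

definition multi_fact :: "'e::euclidean_space list \<Rightarrow> nat" where
  "multi_fact bs = (\<Prod>b\<in>Basis. fact (count_list bs b))"

definition smooth_on :: "('e::euclidean_space \<Rightarrow> complex) \<Rightarrow> 'e set \<Rightarrow> bool" where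
  "smooth_on f S \<longleftrightarrow> (\<forall>bs\<in>lists Basis. \<forall>x\<in>S. iter_deriv bs f differentiable (at x))"

definition gevrey_norm :: "real \<Rightarrow> 'e::euclidean_space set \<Rightarrow> real \<Rightarrow> ('e \<Rightarrow> complex) \<Rightarrow> ennreal" where
  "gevrey_norm s K h f =
     (SUP bs\<in>lists Basis. SUP x\<in>K.
        ennreal (norm (iter_deriv bs f x) / (h ^ length bs * real (multi_fact bs) powr s)))"

definition gevrey_on :: "real \<Rightarrow> ('e::euclidean_space \<Rightarrow> complex) \<Rightarrow> 'e set \<Rightarrow> bool" where
  "gevrey_on s f S \<longleftrightarrow> smooth_on f S \<and>
     (\<forall>K. compact K \<longrightarrow> K \<subseteq> S \<longrightarrow> (\<exists>h>0. gevrey_norm s K h f < \<infinity>))"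


section \<open>Oriented real-analytic manifolds\<close>

text \<open>The manifold is the type \<open>'a\<close> (Hausdorff and second countable by its type class); its
  real-analytic structure and its orientation are given by an atlas of charts \<open>(U, \<phi>)\<close>.\<close>

type_synonym ('a, 'n) chart = "'a set \<times> ('a \<Rightarrow> real^'n)"

definition chart_inv :: "('a, 'n) chart \<Rightarrow> real^'n \<Rightarrow> 'a" where
  "chart_inv c = inv_into (fst c) (snd c)"

definition transition :: "('a, 'n) chart \<Rightarrow> ('a, 'n) chart \<Rightarrow> real^'n \<Rightarrow> real^'n" where
  "transition c c' = snd c' \<circ> chart_inv c"

definition is_chart :: "('a::topological_space, 'n::finite) chart \<Rightarrow> bool" where
  "is_chart c \<longleftrightarrow> open (fst c) \<and> open (snd c ` fst c) \<and>
     homeomorphism (fst c) (snd c ` fst c) (snd c) (chart_inv c)"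

definition analytically_compatible :: "('a, 'n::finite) chart \<Rightarrow> ('a, 'n) chart \<Rightarrow> bool" where
  "analytically_compatible c c' \<longleftrightarrow>
     real_analytic_on (transition c c') (snd c ` (fst c \<inter> fst c')) \<and>
     real_analytic_on (transition c' c) (snd c' ` (fst c \<inter> fst c'))"

definition analytic_atlas :: "('a::topological_space, 'n::finite) chart set \<Rightarrow> bool" where
  "analytic_atlas A \<longleftrightarrow> (\<forall>c\<in>A. is_chart c) \<and> (\<Union>c\<in>A. fst c) = UNIV \<and>
     (\<forall>c\<in>A. \<forall>c'\<in>A. analytically_compatible c c')"

definition jacobian :: "('a, 'n::finite) chart \<Rightarrow> ('a, 'n) chart \<Rightarrow> 'a \<Rightarrow> real^'n \<Rightarrow> real^'n" where
  "jacobian c c' p = frechet_derivative (transition c c') (at (snd c p))"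

definition oriented_analytic_atlas :: "('a::topological_space, 'n::finite) chart set \<Rightarrow> bool" where
  "oriented_analytic_atlas A \<longleftrightarrow> analytic_atlas A \<and>
     (\<forall>c\<in>A. \<forall>c'\<in>A. \<forall>p\<in>fst c \<inter> fst c'. det (matrix (jacobian c c' p)) > 0)"

text \<open>The maximal analytic atlas: all analytic charts, not only the positively oriented ones.\<close>

definition analytic_charts ::
    "('a::topological_space, 'n::finite) chart set \<Rightarrow> ('a, 'n) chart set" where
  "analytic_charts A = {c. is_chart c \<and> (\<forall>c'\<in>A. analytically_compatible c c')}"

definition charts_at ::
    "('a::topological_space, 'n::finite) chart set \<Rightarrow> 'a \<Rightarrow> ('a, 'n) chart set" where
  "charts_at A p = {c \<in> analytic_charts A. p \<in> fst c}"


section \<open>Complex differential forms\<close>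

text \<open>An element of the fibre of \<open>\<Lambda>\<^sup>q\<complex>T\<^sup>*M\<close> at \<open>p\<close> is given by its expression in each analytic chart
  around \<open>p\<close>, an alternating real-multilinear map from \<open>q\<close>-tuples (lists of length \<open>q\<close>) of vectors
  of \<open>\<real>\<^sup>n\<close> to the complex numbers; the expressions are related by the differentials of the
  transition maps.  Values at irrelevant arguments are \<open>0\<close>, so that equality of elements is
  equality of functions, and the vector space operations are pointwise.\<close>

type_synonym ('a, 'n) form_value = "('a, 'n) chart \<Rightarrow> (real^'n) list \<Rightarrow> complex"

definition alternating_form :: "nat \<Rightarrow> ((real^'n) list \<Rightarrow> complex) \<Rightarrow> bool" where
  "alternating_form q w \<longleftrightarrow>
     (\<forall>vs. length vs \<noteq> q \<longrightarrow> w vs = 0) \<and>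
     (\<forall>vs i. length vs = q \<longrightarrow> i < q \<longrightarrow> linear (\<lambda>v. w (vs[i := v]))) \<and>
     (\<forall>vs i j. length vs = q \<longrightarrow> i < j \<longrightarrow> j < q \<longrightarrow> vs ! i = vs ! j \<longrightarrow> w vs = 0)"

definition form_fibre ::
    "('a::topological_space, 'n::finite) chart set \<Rightarrow> nat \<Rightarrow> 'a \<Rightarrow> ('a, 'n) form_value set" where
  "form_fibre A q p =
     {w. (\<forall>c. c \<notin> charts_at A p \<longrightarrow> w c = 0) \<and>
         (\<forall>c\<in>charts_at A p. alternating_form q (w c)) \<and>
         (\<forall>c\<in>charts_at A p. \<forall>c'\<in>charts_at A p. \<forall>vs. w c vs = w c' (map (jacobian c c' p) vs))}"

definition drop_nth :: "nat \<Rightarrow> 'b list \<Rightarrow> 'b list" where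
  "drop_nth i vs = take i vs @ drop (Suc i) vs"

text \<open>In a chart, \<open>d\<eta>(v\<^sub>0,\<dots>,v\<^sub>q)\<close> is the alternating sum of the derivatives in direction \<open>v\<^sub>i\<close> of the
  coefficients \<open>\<eta>(v\<^sub>0,\<dots>,v\<^sub>q)\<close> with \<open>v\<^sub>i\<close> omitted, the \<open>v\<^sub>i\<close> being constant vector fields; likewise
  for the wedge product with a 1-form (without factorials: \<open>dt\<^sub>1 \<and> dt\<^sub>2\<close> is \<open>1\<close> on \<open>(e\<^sub>1, e\<^sub>2)\<close>).
  These formulas apply to forms of every degree.\<close>

definition ext_deriv ::
    "('a::topological_space, 'n::finite) chart set \<Rightarrow> ('a \<Rightarrow> ('a, 'n) form_value)
       \<Rightarrow> 'a \<Rightarrow> ('a, 'n) form_value" where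
  "ext_deriv A \<eta> p c vs =
     (if c \<in> charts_at A p then
        (\<Sum>i<length vs. (-1) ^ i *
           dir_deriv (vs ! i) (\<lambda>t. \<eta> (chart_inv c t) c (drop_nth i vs)) (snd c p))
      else 0)"

definition wedge1 :: "('a, 'n) form_value \<Rightarrow> ('a, 'n) form_value \<Rightarrow> ('a, 'n) form_value" where
  "wedge1 \<omega> \<eta> c vs = (\<Sum>i<length vs. (-1) ^ i * \<omega> c [vs ! i] * \<eta> c (drop_nth i vs))"

definition gevrey_one_form ::
    "('a::topological_space, 'n::finite) chart set \<Rightarrow> real \<Rightarrow> ('a \<Rightarrow> ('a, 'n) form_value) \<Rightarrow> bool" where
  "gevrey_one_form A s \<omega> \<longleftrightarrow>
     (\<forall>p. \<omega> p \<in> form_fibre A 1 p) \<and>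
     (\<forall>c\<in>analytic_charts A. \<forall>b\<in>Basis.
        gevrey_on s (\<lambda>t. \<omega> (chart_inv c t) c [b]) (snd c ` fst c))"

definition real_form :: "('a \<Rightarrow> ('a, 'n) form_value) \<Rightarrow> bool" where
  "real_form \<omega> \<longleftrightarrow> (\<forall>p c vs. \<omega> p c vs \<in> \<real>)"

definition closed_form ::
    "('a::topological_space, 'n::finite) chart set \<Rightarrow> ('a \<Rightarrow> ('a, 'n) form_value) \<Rightarrow> bool" where
  "closed_form A \<omega> \<longleftrightarrow> ext_deriv A \<omega> = 0"


section \<open>The tube complex on the product of the manifold and the torus\<close>

text \<open>Sections of the pullback of \<open>\<Lambda>\<^sup>q\<complex>T\<^sup>*M\<close> to \<open>X = M \<times> \<T>\<^sup>m\<close>.  The coefficient \<open>u\<^sub>J\<close> with respect to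
  \<open>dt\<^sub>J\<close> in the chart \<open>c\<close> is \<open>tube_coeff u c J\<close>, where \<open>J\<close> is a list of \<open>q\<close> standard basis vectors;
  it is a function on \<open>\<phi>(U) \<times> \<real>\<^sup>m\<close>, the covering \<open>\<real>\<^sup>m \<rightarrow> \<T>\<^sup>m\<close> providing the local coordinates on the
  torus.\<close>

type_synonym ('a, 'm, 'n) tube_section = "'a \<times> 'm torus \<Rightarrow> ('a, 'n) form_value"

definition tube_param :: "('a, 'n) chart \<Rightarrow> (real^'n) \<times> (real^'m) \<Rightarrow> 'a \<times> ('m::finite) torus" where
  "tube_param c = (\<lambda>(t, x). (chart_inv c t, torus_class x))"

definition tube_coeff ::
    "('a, 'm::finite, 'n) tube_section \<Rightarrow> ('a, 'n) chart \<Rightarrow> (real^'n) list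
       \<Rightarrow> (real^'n) \<times> (real^'m) \<Rightarrow> complex" where
  "tube_coeff u c J y = u (tube_param c y) c J"

definition tube_domain :: "('a, 'n) chart \<Rightarrow> ((real^'n) \<times> (real^'m)) set" where
  "tube_domain c = (snd c ` fst c) \<times> UNIV"

definition frame_indices :: "nat \<Rightarrow> (real^'n) list set" where
  "frame_indices q = {J \<in> lists Basis. length J = q}"

definition smooth_tube_sections ::
    "('a::topological_space, 'n::finite) chart set \<Rightarrow> nat \<Rightarrow> ('a, 'm::finite, 'n) tube_section set" where
  "smooth_tube_sections A q =
     {u. (\<forall>p x. u (p, x) \<in> form_fibre A q p) \<and>
         (\<forall>c\<in>analytic_charts A. \<forall>J\<in>frame_indices q. smooth_on (tube_coeff u c J) (tube_domain c))}"

definition gevrey_tube_sections ::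
    "('a::topological_space, 'n::finite) chart set \<Rightarrow> real \<Rightarrow> nat
       \<Rightarrow> ('a, 'm::finite, 'n) tube_section set" where
  "gevrey_tube_sections A s q =
     {u. (\<forall>p x. u (p, x) \<in> form_fibre A q p) \<and>
         (\<forall>c\<in>analytic_charts A. \<forall>J\<in>frame_indices q. gevrey_on s (tube_coeff u c J) (tube_domain c))}"

definition section_support ::
    "('a::topological_space, 'm::finite, 'n) tube_section \<Rightarrow> ('a \<times> 'm torus) set" where
  "section_support u = closure {y. u y \<noteq> 0}"

definition gevrey_test_sections ::
    "('a::topological_space, 'n::finite) chart set \<Rightarrow> real \<Rightarrow> nat
       \<Rightarrow> ('a, 'm::finite, 'n) tube_section set" where
  "gevrey_test_sections A s q = {u \<in> gevrey_tube_sections A s q. compact (section_support u)}"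

definition partial_x ::
    "'m::finite \<Rightarrow> ('a, 'm, 'n) tube_section \<Rightarrow> ('a, 'm, 'n) tube_section" where
  "partial_x k u = (\<lambda>(p, x) c vs.
     vector_derivative (\<lambda>r. u (p, torus_translate (r *\<^sub>R axis k 1) x) c vs) (at 0))"

definition deriv_t ::
    "('a::topological_space, 'n::finite) chart set \<Rightarrow> ('a, 'm::finite, 'n) tube_section
       \<Rightarrow> ('a, 'm, 'n) tube_section" where
  "deriv_t A u = (\<lambda>(p, x). ext_deriv A (\<lambda>p'. u (p', x)) p)"

text \<open>\<open>\<L>\<^sup>q\<close> on smooth sections, in any degree \<open>q\<close>.\<close>

definition tube_L ::
    "('a::topological_space, 'n::finite) chart set \<Rightarrow> ('m::finite \<Rightarrow> 'a \<Rightarrow> ('a, 'n) form_value)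
       \<Rightarrow> ('a, 'm, 'n) tube_section \<Rightarrow> ('a, 'm, 'n) tube_section" where
  "tube_L A \<omega> u = (\<lambda>y. deriv_t A u y + (\<Sum>k\<in>UNIV. wedge1 (\<omega> k (fst y)) (partial_x k u y)))"


section \<open>The topology of the space of test sections\<close>

definition section_scale ::
    "complex \<Rightarrow> ('a, 'm::finite, 'n) tube_section \<Rightarrow> ('a, 'm, 'n) tube_section" where
  "section_scale a u = (\<lambda>y c vs. a * u y c vs)"

definition absolutely_convex :: "('a, 'm::finite, 'n) tube_section set \<Rightarrow> bool" where
  "absolutely_convex V \<longleftrightarrow>
     (\<forall>u\<in>V. \<forall>v\<in>V. \<forall>a b. cmod a + cmod b \<le> 1 \<longrightarrow> section_scale a u + section_scale b v \<in> V)"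

text \<open>The locally convex inductive limit topology on \<open>G\<close> with respect to the family of subspaces
  \<open>E i\<close>, \<open>i \<in> I\<close>, normed by \<open>N i\<close>: the absolutely convex sets that contain a ball around \<open>0\<close> of each
  \<open>E i\<close> form a basis of neighbourhoods of \<open>0\<close>.\<close>

definition inductive_limit_open ::
    "('a, 'm::finite, 'n) tube_section set \<Rightarrow> 'i set \<Rightarrow> ('i \<Rightarrow> ('a, 'm, 'n) tube_section set)
       \<Rightarrow> ('i \<Rightarrow> ('a, 'm, 'n) tube_section \<Rightarrow> ennreal) \<Rightarrow> ('a, 'm, 'n) tube_section set \<Rightarrow> bool" where
  "inductive_limit_open G I E N W \<longleftrightarrow> W \<subseteq> G \<and>
     (\<forall>u\<in>W. \<exists>V. absolutely_convex V \<and> V \<subseteq> G \<and>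
        (\<forall>i\<in>I. \<exists>\<epsilon>>0. {v \<in> E i. N i v < \<epsilon>} \<subseteq> V) \<and> (\<lambda>v. u + v) ` V \<subseteq> W)"

lemma istopology_inductive_limit_open: "istopology (inductive_limit_open G I E N)"
  unfolding istopology_def
proof (intro conjI allI impI)
  fix S T
  assume S: "inductive_limit_open G I E N S" and T: "inductive_limit_open G I E N T"
  show "inductive_limit_open G I E N (S \<inter> T)"
    unfolding inductive_limit_open_def
  proof (intro conjI ballI)
    show "S \<inter> T \<subseteq> G" using S by (auto simp: inductive_limit_open_def)
  next
    fix u assume u: "u \<in> S \<inter> T"
    obtain V where V: "absolutely_convex V" "V \<subseteq> G"
      "\<forall>i\<in>I. \<exists>\<epsilon>>0. {v \<in> E i. N i v < \<epsilon>} \<subseteq> V" "(\<lambda>v. u + v) ` V \<subseteq> S"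
      using S u unfolding inductive_limit_open_def by (meson IntD1)
    obtain V' where V': "absolutely_convex V'" "V' \<subseteq> G"
      "\<forall>i\<in>I. \<exists>\<epsilon>>0. {v \<in> E i. N i v < \<epsilon>} \<subseteq> V'" "(\<lambda>v. u + v) ` V' \<subseteq> T"
      using T u unfolding inductive_limit_open_def by (meson IntD2)
    have "\<exists>\<epsilon>>0. {v \<in> E i. N i v < \<epsilon>} \<subseteq> V \<inter> V'" if i: "i \<in> I" for i
    proof -
      obtain \<epsilon> where "\<epsilon> > 0" "{v \<in> E i. N i v < \<epsilon>} \<subseteq> V"
        using bspec[OF V(3) i] by blast
      moreover obtain \<epsilon>' where "\<epsilon>' > 0" "{v \<in> E i. N i v < \<epsilon>'} \<subseteq> V'"
        using bspec[OF V'(3) i] by blast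
      ultimately show ?thesis by (intro exI[of _ "min \<epsilon> \<epsilon>'"]) (auto simp: subset_iff)
    qed
    moreover have "absolutely_convex (V \<inter> V')"
      using V(1) V'(1) by (auto simp: absolutely_convex_def)
    moreover have "V \<inter> V' \<subseteq> G" using V(2) by blast
    moreover have "(\<lambda>v. u + v) ` (V \<inter> V') \<subseteq> S \<inter> T" using V(4) V'(4) by blast
    ultimately show "\<exists>V. absolutely_convex V \<and> V \<subseteq> G \<and>
        (\<forall>i\<in>I. \<exists>\<epsilon>>0. {v \<in> E i. N i v < \<epsilon>} \<subseteq> V) \<and> (\<lambda>v. u + v) ` V \<subseteq> S \<inter> T"
      by meson
  qed
next
  fix \<K> assume K: "\<forall>S\<in>\<K>. inductive_limit_open G I E N S"
  show "inductive_limit_open G I E N (\<Union>\<K>)"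
    unfolding inductive_limit_open_def
  proof (intro conjI ballI)
    show "\<Union>\<K> \<subseteq> G" using K by (auto simp: inductive_limit_open_def)
  next
    fix u assume "u \<in> \<Union>\<K>"
    then obtain S where S: "S \<in> \<K>" "u \<in> S" by blast
    then obtain V where V: "absolutely_convex V" "V \<subseteq> G"
      "\<forall>i\<in>I. \<exists>\<epsilon>>0. {v \<in> E i. N i v < \<epsilon>} \<subseteq> V" "(\<lambda>v. u + v) ` V \<subseteq> S"
      using K unfolding inductive_limit_open_def by meson
    have "(\<lambda>v. u + v) ` V \<subseteq> \<Union>\<K>" using V(4) S(1) by blast
    with V(1-3) show "\<exists>V. absolutely_convex V \<and> V \<subseteq> G \<and>
        (\<forall>i\<in>I. \<exists>\<epsilon>>0. {v \<in> E i. N i v < \<epsilon>} \<subseteq> V) \<and> (\<lambda>v. u + v) ` V \<subseteq> \<Union>\<K>"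
      by meson
  qed
qed

definition compact_exhaustion :: "(nat \<Rightarrow> 'y::topological_space set) \<Rightarrow> bool" where
  "compact_exhaustion K \<longleftrightarrow>
     (\<forall>l. compact (K l)) \<and> (\<forall>l. K l \<subseteq> interior (K (Suc l))) \<and> (\<Union>l. K l) = UNIV"

text \<open>A finite set of pairs \<open>(c, K')\<close>, with \<open>K'\<close> a compact subset (in coordinates) of the domain of the
  chart \<open>c\<close>, that together cover \<open>L\<close>.\<close>

definition chart_pieces ::
    "('a::topological_space, 'n::finite) chart set \<Rightarrow> ('a \<times> ('m::finite) torus) set
       \<Rightarrow> (('a, 'n) chart \<times> ((real^'n) \<times> (real^'m)) set) set \<Rightarrow> bool" where
  "chart_pieces A L P \<longleftrightarrow> finite P \<and>
     (\<forall>(c, K')\<in>P. c \<in> analytic_charts A \<and> compact K' \<and> K' \<subseteq> tube_domain c) \<and>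
     L \<subseteq> (\<Union>(c, K')\<in>P. tube_param c ` K')"

definition section_norm ::
    "real \<Rightarrow> nat \<Rightarrow> (('a, 'n) chart \<times> ((real^'n) \<times> (real^'m)) set) set \<Rightarrow> real
       \<Rightarrow> ('a, 'm::finite, 'n::finite) tube_section \<Rightarrow> ennreal" where
  "section_norm s q P h u =
     (\<Sum>(c, K')\<in>P. \<Sum>J\<in>frame_indices q. gevrey_norm s K' h (tube_coeff u c J))"

definition section_step ::
    "('a::topological_space, 'n::finite) chart set \<Rightarrow> real \<Rightarrow> nat \<Rightarrow> ('a \<times> ('m::finite) torus) set
       \<Rightarrow> (('a, 'n) chart \<times> ((real^'n) \<times> (real^'m)) set) set \<Rightarrow> real
       \<Rightarrow> ('a, 'm, 'n) tube_section set" where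
  "section_step A s q L P h =
     {u \<in> smooth_tube_sections A q. section_support u \<subseteq> L \<and> section_norm s q P h u < \<infinity>}"

definition gevrey_test_topology ::
    "('a::topological_space, 'n::finite) chart set \<Rightarrow> real \<Rightarrow> (nat \<Rightarrow> ('a \<times> ('m::finite) torus) set)
       \<Rightarrow> (nat \<Rightarrow> (('a, 'n) chart \<times> ((real^'n) \<times> (real^'m)) set) set) \<Rightarrow> nat
       \<Rightarrow> ('a, 'm, 'n) tube_section topology" where
  "gevrey_test_topology A s K P q = topology (inductive_limit_open
     (gevrey_test_sections A s q) (UNIV \<times> {0<..})
     (\<lambda>(l, h). section_step A s q (K l) (P l) h)
     (\<lambda>(l, h). section_norm s q (P l) h))"

lemma openin_gevrey_test_topology:
  "openin (gevrey_test_topology A s K P q) = inductive_limit_open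
     (gevrey_test_sections A s q) (UNIV \<times> {0<..})
     (\<lambda>(l, h). section_step A s q (K l) (P l) h)
     (\<lambda>(l, h). section_norm s q (P l) h)"
  unfolding gevrey_test_topology_def
  by (rule topology_inverse'[OF istopology_inductive_limit_open])


section \<open>Ultradistribution sections\<close>

text \<open>Via the orientation of \<open>M\<close>, the Haar density of the torus and the pairing
  \<open>\<langle>u, v\<rangle> = \<integral>\<integral> u \<and> v dx\<close>, ultradistribution sections of degree \<open>q\<close> are the continuous linear
  functionals on the test sections of degree \<open>n - q\<close> (for \<open>q \<le> n = CARD('n)\<close>).  Functionals are
  \<open>undefined\<close> off the test sections, so that their equality is equality of functions.\<close>

definition ultradistributions ::
    "('a::topological_space, 'n::finite) chart set \<Rightarrow> real \<Rightarrow> (nat \<Rightarrow> ('a \<times> ('m::finite) torus) set)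
       \<Rightarrow> (nat \<Rightarrow> (('a, 'n) chart \<times> ((real^'n) \<times> (real^'m)) set) set) \<Rightarrow> nat
       \<Rightarrow> (('a, 'm, 'n) tube_section \<Rightarrow> complex) set" where
  "ultradistributions A s K P q =
     (let G = gevrey_test_sections A s (CARD('n) - q) in
      {T \<in> extensional G.
         (\<forall>\<phi>\<in>G. \<forall>\<psi>\<in>G. T (\<phi> + \<psi>) = T \<phi> + T \<psi>) \<and>
         (\<forall>a. \<forall>\<phi>\<in>G. T (section_scale a \<phi>) = a * T \<phi>) \<and>
         continuous_map (gevrey_test_topology A s K P (CARD('n) - q)) euclidean T})"

text \<open>\<open>\<L>\<^sup>q\<close> on ultradistributions (for \<open>q < n\<close>) is the transpose of its formal transpose
  \<open>(-1)\<^sup>q\<^sup>+\<^sup>1 \<L>\<^sup>n\<^sup>-\<^sup>q\<^sup>-\<^sup>1\<close> with respect to the pairing above.\<close>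

definition ultra_L ::
    "('a::topological_space, 'n::finite) chart set \<Rightarrow> real \<Rightarrow> ('m::finite \<Rightarrow> 'a \<Rightarrow> ('a, 'n) form_value)
       \<Rightarrow> nat \<Rightarrow> (('a, 'm, 'n) tube_section \<Rightarrow> complex) \<Rightarrow> ('a, 'm, 'n) tube_section \<Rightarrow> complex" where
  "ultra_L A s \<omega> q T =
     (\<lambda>\<phi>\<in>gevrey_test_sections A s (CARD('n) - q - 1).
        T (section_scale ((-1) ^ (q + 1)) (tube_L A \<omega> \<phi>)))"

end

theory Submission
  imports Defs "HOL-Complex_Analysis.Cauchy_Integral_Formula" "HOL-Combinatorics.Multiset_Permutations"
begin

text \<open>The transpose of \<open>\<L>\<close> in top degree is, up to sign, \<open>\<L>\<close> on functions, so it suffices to construct a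
  continuous left inverse \<open>S\<close> of the latter on compactly supported Gevrey sections and to take
  \<open>u = \<plusminus> f \<circ> S\<close>; neither the Hahn-Banach theorem nor an estimate on arbitrary sections in the range
  is needed.  Locally \<open>\<omega>\<^sub>k = d\<psi>\<^sub>k\<close> with \<open>\<psi>\<^sub>k\<close> real, and the shear \<open>x \<mapsto> x + \<psi>(t)\<close> reduces \<open>\<L>\<close> to \<open>d\<^sub>t\<close>,
  so the difference of the (sheared) values of \<open>\<phi>\<close> at two points of a convex chart domain is a line
  integral of \<open>\<L>\<phi>\<close>.  Since \<open>M\<close> is connected and not compact, every point is joined by a chain of
  such domains to points outside the support of \<open>\<phi>\<close>, and \<open>\<phi>\<close> is recovered from \<open>\<L>\<phi>\<close> by adding
  up the line integrals along the chain.  Infinite chains that eventually leave every compact set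
  serve all supports at once, and a Gevrey partition of unity glues the formulas obtained near the
  points of a locally finite cover into one linear operator \<open>S\<close>.\<close>

section \<open>Iterated partial derivatives\<close>

text \<open>The left inverse must be one linear operator on all compactly supported sections of
  degree one, in the range of the operator or not, so the end of a chain may not depend on the
  support of the argument; this forces infinite chains. For the glued sum to be finite on sections
  carried by a fixed compact set, and to have values with compact support, the chain that starts in
  the j-th coordinate cube must itself avoid compact sets that grow with j. The obstacle is that the
  complement of a compact set may have relatively compact components, from which no chain escapes.
  They are filled in by \<open>escape_hull\<close>, and \<open>lev j\<close> is the highest level up
  to j whose hull misses the centre of cube j. For continuity it is enough that the operator maps
  the unit ball of each step of the inductive limit into a ball of another step; this is why bounds
  must be common to whole families of sections.\<close>

declare in_lists_conv_set [simp del] in_listsD [rule del] in_listsI [rule del]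

lemma dir_deriv_eq:
  assumes "(f has_derivative D) (at x)"
  shows "dir_deriv v f x = D v"
proof -
  have "((\<lambda>r. x + r *\<^sub>R v) has_derivative (\<lambda>r. r *\<^sub>R v)) (at (0::real))"
    by (auto intro!: derivative_eq_intros)
  from has_derivative_compose[OF this, of f D] assms
  have "((\<lambda>r. f (x + r *\<^sub>R v)) has_derivative (\<lambda>r. D (r *\<^sub>R v))) (at (0::real))" by simp
  moreover have "(\<lambda>r. D (r *\<^sub>R v)) = (\<lambda>r. r *\<^sub>R D v)"
    using assms has_derivative_linear linear_scale by blast
  ultimately show ?thesis
    unfolding dir_deriv_def has_vector_derivative_def[symmetric]
    by (simp add: vector_derivative_at has_vector_derivative_def)
qed

lemma dir_deriv_frechet:
  assumes "f differentiable (at x)"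
  shows "dir_deriv v f x = frechet_derivative f (at x) v"
  using assms dir_deriv_eq frechet_derivative_works by blast

lemma has_derivative_dir_deriv:
  assumes "f differentiable (at x)"
  shows "(f has_derivative (\<lambda>v. dir_deriv v f x)) (at x)"
  using assms dir_deriv_frechet[OF assms] frechet_derivative_works
  by (metis (no_types, lifting) ext)

lemma dir_deriv_cong:
  assumes "open S" "x \<in> S" "\<And>y. y \<in> S \<Longrightarrow> f y = g y"
  shows "dir_deriv v f x = dir_deriv v g x"
proof -
  have "((\<lambda>r::real. x + r *\<^sub>R v) \<longlongrightarrow> x + 0 *\<^sub>R v) (nhds 0)"
    by (intro tendsto_intros filterlim_ident)
  then have "\<forall>\<^sub>F r::real in nhds 0. x + r *\<^sub>R v \<in> S"
    using assms(1,2) by (simp add: tendsto_def)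
  then have "\<forall>\<^sub>F r::real in nhds 0. f (x + r *\<^sub>R v) = g (x + r *\<^sub>R v)"
    by eventually_elim (use assms(3) in auto)
  then show ?thesis
    unfolding dir_deriv_def by (intro vector_derivative_cong_eq) auto
qed

lemma differentiable_cong_open:
  assumes "open S" "x \<in> S" "\<And>y. y \<in> S \<Longrightarrow> f y = g y" "g differentiable (at x)"
  shows "f differentiable (at x)"
  using assms has_derivative_transform_within_open[of g _ x UNIV S f]
  by (metis differentiable_def)

lemma iter_deriv_append: "iter_deriv (bs @ cs) f = iter_deriv bs (iter_deriv cs f)"
  by (induction bs) auto

lemma iter_deriv_cong:
  assumes "open S" "x \<in> S" "\<And>y. y \<in> S \<Longrightarrow> f y = g y"
  shows "iter_deriv bs f x = iter_deriv bs g x"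
proof -
  have "\<forall>x\<in>S. iter_deriv bs f x = iter_deriv bs g x"
    by (induction bs) (use assms in \<open>auto intro!: dir_deriv_cong[OF assms(1)]\<close>)
  then show ?thesis using assms(2) by blast
qed

lemma iter_deriv_shift: "iter_deriv bs (\<lambda>y. f (y + w)) y = iter_deriv bs f (y + w)"
proof (induction bs arbitrary: y)
  case (Cons b bs)
  then have "iter_deriv bs (\<lambda>y. f (y + w)) = (\<lambda>y. iter_deriv bs f (y + w))" by blast
  then show ?case by (simp add: dir_deriv_def algebra_simps)
qed simp

lemma dir_deriv_const: "dir_deriv v (\<lambda>x. c) = (\<lambda>x. 0)"
  by (simp add: dir_deriv_def fun_eq_iff)

lemma iter_deriv_0: "iter_deriv bs (\<lambda>x. 0) = (\<lambda>x. 0)"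
  by (induction bs) (simp_all add: dir_deriv_const)

text \<open>Finite order makes closure properties accessible to induction, by
  \<open>smoothN_Suc\<close>. The count is shifted by one: derivatives of order up to N are
  themselves differentiable, so the sum rule holds for lists of length up to
  \<open>Suc N\<close>.\<close>

definition smoothN :: "nat \<Rightarrow> ('e::euclidean_space \<Rightarrow> complex) \<Rightarrow> 'e set \<Rightarrow> bool" where
  "smoothN N f S \<longleftrightarrow>
     (\<forall>bs\<in>lists Basis. length bs \<le> N \<longrightarrow> (\<forall>x\<in>S. iter_deriv bs f differentiable (at x)))"

lemma smoothND:
  "smoothN N f S \<Longrightarrow> bs \<in> lists Basis \<Longrightarrow> length bs \<le> N \<Longrightarrow> x \<in> S \<Longrightarrow>
    iter_deriv bs f differentiable (at x)"
  unfolding smoothN_def by blast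

lemma smooth_on_iff_smoothN: "smooth_on f S \<longleftrightarrow> (\<forall>N. smoothN N f S)"
  unfolding smooth_on_def smoothN_def by blast

lemma smoothN_mono: "smoothN N f S \<Longrightarrow> M \<le> N \<Longrightarrow> T \<subseteq> S \<Longrightarrow> smoothN M f T"
  unfolding smoothN_def by (meson order_trans subsetD)

lemma smoothN_0: "smoothN 0 f S \<longleftrightarrow> (\<forall>x\<in>S. f differentiable (at x))"
  unfolding smoothN_def by (force simp: lists_def)

text \<open>The last entry of a list is the derivative that is taken first. Lists are therefore
  split at their end, here and in later inductions that replace a function by its partial
  derivatives.\<close>

lemma smoothN_Suc:
  "smoothN (Suc N) f S \<longleftrightarrow> (\<forall>x\<in>S. f differentiable (at x)) \<and> (\<forall>b\<in>Basis. smoothN N (dir_deriv b f) S)"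
  (is "?l \<longleftrightarrow> ?r")
proof
  assume l: ?l
  have "iter_deriv (bs @ [b]) f differentiable (at x)"
    if "b \<in> Basis" "bs \<in> lists Basis" "length bs \<le> N" "x \<in> S" for b bs x
    using l that unfolding smoothN_def
    by (metis append_in_lists_conv length_append_singleton lists.Cons lists.Nil not_less_eq_eq)
  then have "\<forall>b\<in>Basis. smoothN N (dir_deriv b f) S"
    unfolding smoothN_def by (simp add: iter_deriv_append)
  moreover have "\<forall>x\<in>S. f differentiable (at x)"
    using l smoothN_0 smoothN_mono[OF l, of 0 S] by auto
  ultimately show ?r by blast
next
  assume r: ?r
  show ?l unfolding smoothN_def
  proof (intro ballI impI)
    fix bs :: "'a list" and x assume bs: "bs \<in> lists Basis" "length bs \<le> Suc N" and x: "x \<in> S"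
    show "iter_deriv bs f differentiable (at x)"
    proof (cases bs rule: rev_cases)
      case Nil with r x show ?thesis by simp
    next
      case (snoc cs c)
      with r x bs show ?thesis unfolding smoothN_def by (simp add: iter_deriv_append)
    qed
  qed
qed

lemma smoothN_imp_differentiable: "smoothN N f S \<Longrightarrow> x \<in> S \<Longrightarrow> f differentiable (at x)"
  using smoothN_mono[of N f S 0 S] by (simp add: smoothN_0)

lemma smooth_on_imp_differentiable: "smooth_on f S \<Longrightarrow> x \<in> S \<Longrightarrow> f differentiable (at x)"
  using smooth_on_iff_smoothN smoothN_imp_differentiable by blast

lemma smooth_on_dir_deriv: "smooth_on f S \<Longrightarrow> b \<in> Basis \<Longrightarrow> smooth_on (dir_deriv b f) S"
  using smooth_on_iff_smoothN smoothN_Suc by blast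

lemma smooth_on_subset: "smooth_on f S \<Longrightarrow> T \<subseteq> S \<Longrightarrow> smooth_on f T"
  unfolding smooth_on_def by blast

lemma smoothN_cong:
  assumes "open S" "\<And>y. y \<in> S \<Longrightarrow> f y = g y" "smoothN N g S"
  shows "smoothN N f S"
  unfolding smoothN_def
proof (intro ballI impI)
  fix bs :: "'a list" and x assume "bs \<in> lists Basis" "length bs \<le> N" and x: "x \<in> S"
  then have "iter_deriv bs g differentiable (at x)" using assms(3) by (auto simp: smoothN_def)
  moreover have "iter_deriv bs f y = iter_deriv bs g y" if "y \<in> S" for y
    by (rule iter_deriv_cong[OF assms(1) that assms(2)])
  ultimately show "iter_deriv bs f differentiable (at x)"
    using differentiable_cong_open[OF assms(1) x] by blast
qed

lemma smooth_on_cong: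
  assumes "open S" "\<And>y. y \<in> S \<Longrightarrow> f y = g y" "smooth_on g S"
  shows "smooth_on f S"
  using assms smoothN_cong unfolding smooth_on_iff_smoothN by blast

lemma smoothN_const: "smoothN N (\<lambda>x. c) S"
  by (induction N arbitrary: c) (auto simp: smoothN_0 smoothN_Suc dir_deriv_const)

lemma dir_deriv_add:
  assumes "f differentiable (at x)" "g differentiable (at x)"
  shows "dir_deriv v (\<lambda>x. f x + g x) x = dir_deriv v f x + dir_deriv v g x"
  by (intro dir_deriv_eq has_derivative_add has_derivative_dir_deriv assms)

lemma dir_deriv_mult:
  assumes "f differentiable (at x)" "g differentiable (at x)"
  shows "dir_deriv v (\<lambda>x. f x * g x) x = f x * dir_deriv v g x + dir_deriv v f x * g x"
  by (intro dir_deriv_eq has_derivative_mult has_derivative_dir_deriv assms)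

lemma iter_deriv_add:
  assumes "open S" "smoothN N f S" "smoothN N g S" "bs \<in> lists Basis" "length bs \<le> Suc N" "x \<in> S"
  shows "iter_deriv bs (\<lambda>x. f x + g x) x = iter_deriv bs f x + iter_deriv bs g x"
  using assms(4-6)
proof (induction bs arbitrary: x)
  case (Cons b bs)
  have "dir_deriv b (iter_deriv bs (\<lambda>x. f x + g x)) x
      = dir_deriv b (\<lambda>x. iter_deriv bs f x + iter_deriv bs g x) x"
    by (rule dir_deriv_cong[OF assms(1)]) (use Cons in auto)
  also have "\<dots> = iter_deriv (b # bs) f x + iter_deriv (b # bs) g x"
  proof -
    have bs: "bs \<in> lists Basis" using Cons.hyps by blast
    have len: "length bs \<le> N" using Cons.prems by simp
    show ?thesis
      using dir_deriv_add[OF smoothND[OF assms(2) bs len] smoothND[OF assms(3) bs len]] Cons.prems(2) by simp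
  qed
  finally show ?case by simp
qed simp

lemma smoothN_add:
  assumes "open S" "smoothN N f S" "smoothN N g S"
  shows "smoothN N (\<lambda>x. f x + g x) S"
  unfolding smoothN_def
proof (intro ballI impI)
  fix bs :: "'a list" and x assume bs: "bs \<in> lists Basis" "length bs \<le> N" and x: "x \<in> S"
  show "iter_deriv bs (\<lambda>x. f x + g x) differentiable (at x)"
    by (rule differentiable_cong_open[OF assms(1) x iter_deriv_add[OF assms(1-3) bs(1)]])
      (use bs x in \<open>auto intro!: differentiable_add smoothND[OF assms(2)] smoothND[OF assms(3)]
          simp del: in_lists_conv_set\<close>)
qed

lemma smoothN_sum:
  assumes "open S" "finite I" "\<And>i. i \<in> I \<Longrightarrow> smoothN N (f i) S"
  shows "smoothN N (\<lambda>x. \<Sum>i\<in>I. f i x) S"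
  using assms(2,3) by (induction I) (auto simp: smoothN_const intro!: smoothN_add[OF assms(1)])

lemma iter_deriv_sum:
  assumes "open S" "finite I" "\<And>i. i \<in> I \<Longrightarrow> smoothN N (f i) S"
    "bs \<in> lists Basis" "length bs \<le> Suc N" "x \<in> S"
  shows "iter_deriv bs (\<lambda>x. \<Sum>i\<in>I. f i x) x = (\<Sum>i\<in>I. iter_deriv bs (f i) x)"
  using assms(2,3)
proof (induction I)
  case (insert i I)
  have "iter_deriv bs (\<lambda>x. f i x + (\<Sum>i\<in>I. f i x)) x
      = iter_deriv bs (f i) x + iter_deriv bs (\<lambda>x. \<Sum>i\<in>I. f i x) x"
    by (rule iter_deriv_add[OF assms(1) _ smoothN_sum[OF assms(1)], of N])
      (use insert assms(4-6) in auto)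
  with insert show ?case by simp
qed (simp add: iter_deriv_0)

lemma smoothN_mult:
  assumes "open S" "smoothN N f S" "smoothN N g S"
  shows "smoothN N (\<lambda>x. f x * g x) S"
  using assms(2,3)
proof (induction N arbitrary: f g)
  case (Suc N)
  have d: "f differentiable (at x)" "g differentiable (at x)" if "x \<in> S" for x
    using Suc.prems that smoothN_imp_differentiable by blast+
  have "smoothN N (dir_deriv b (\<lambda>x. f x * g x)) S" if b: "b \<in> Basis" for b
  proof (rule smoothN_cong[OF assms(1) dir_deriv_mult[OF d]])
    have "smoothN N f S" "smoothN N g S" "smoothN N (dir_deriv b f) S" "smoothN N (dir_deriv b g) S"
      using Suc.prems b smoothN_mono[of "Suc N" _ S N S] by (simp_all add: smoothN_Suc)
    then show "smoothN N (\<lambda>x. f x * dir_deriv b g x + dir_deriv b f x * g x) S"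
      by (intro smoothN_add[OF assms(1)] Suc.IH)
  qed
  then show ?case using d by (auto simp: smoothN_Suc)
qed (auto simp: smoothN_0)

text \<open>Pascal's rule, summed. It joins the two products that one more differentiation creates
  in the Leibniz formula, p and q standing for bounds on the derivatives of the two factors.\<close>

lemma sum_choose_Suc:
  fixes p q :: "nat \<Rightarrow> real"
  shows "(\<Sum>l\<le>N. real (N choose l) * (p (Suc l) * q (N - l) + p l * q (Suc (N - l))))
    = (\<Sum>l\<le>Suc N. real (Suc N choose l) * p l * q (Suc N - l))"
proof -
  have "(\<Sum>l\<le>Suc N. real (Suc N choose l) * p l * q (Suc N - l))
     = p 0 * q (Suc N) + (\<Sum>l\<le>N. real (Suc N choose Suc l) * p (Suc l) * q (N - l))"
    by (subst sum.atMost_Suc_shift) simp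
  also have "\<dots> = p 0 * q (Suc N) + (\<Sum>l\<le>N. real (N choose Suc l) * p (Suc l) * q (N - l))
      + (\<Sum>l\<le>N. real (N choose l) * p (Suc l) * q (N - l))"
    by (simp add: algebra_simps sum.distrib)
  also have "p 0 * q (Suc N) + (\<Sum>l\<le>N. real (N choose Suc l) * p (Suc l) * q (N - l))
     = (\<Sum>l\<le>Suc N. real (N choose l) * p l * q (Suc N - l))"
    using sum.atMost_Suc_shift[of "\<lambda>l. real (N choose l) * p l * q (Suc N - l)" N] by simp
  also have "\<dots> = (\<Sum>l\<le>N. real (N choose l) * p l * q (Suc (N - l)))"
    by (simp add: Suc_diff_le)
  finally show ?thesis by (simp add: algebra_simps sum.distrib)
qed

text \<open>Because p and q depend on the order only, the Leibniz formula collapses to a single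
  binomial sum, whatever the directions are. The induction generalises f, g, p and q:
  differentiating a factor once shifts its sequence of bounds by one.\<close>

lemma norm_iter_deriv_mult_le:
  assumes "open S" "y \<in> S" "smooth_on f S" "smooth_on g S" "bs \<in> lists Basis"
    and "\<And>cs. cs \<in> lists Basis \<Longrightarrow> length cs \<le> length bs \<Longrightarrow> norm (iter_deriv cs f y) \<le> p (length cs)"
    and "\<And>cs. cs \<in> lists Basis \<Longrightarrow> length cs \<le> length bs \<Longrightarrow> norm (iter_deriv cs g y) \<le> q (length cs)"
  shows "norm (iter_deriv bs (\<lambda>x. f x * g x) y)
     \<le> (\<Sum>l\<le>length bs. real (length bs choose l) * p l * q (length bs - l))"
proof -
  have f: "smoothN (length bs) f S" and g: "smoothN (length bs) g S"
    using assms(3,4) smooth_on_iff_smoothN by blast+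
  show ?thesis using f g assms(5-7)
  proof (induction bs arbitrary: f g p q rule: rev_induct)
    case Nil
    have "norm (f y * g y) \<le> p 0 * q 0"
      using Nil(4)[of "[]"] Nil(5)[of "[]"] norm_ge_zero
      by (simp add: norm_mult) (meson mult_mono norm_ge_zero order_trans)
    then show ?case by simp
  next
    case (snoc b bs)
    let ?N = "length bs"
    have b: "b \<in> Basis" and bs: "bs \<in> lists Basis" using snoc.prems(3) by auto
    have sf: "smoothN (Suc ?N) f S" and sg: "smoothN (Suc ?N) g S" using snoc.prems by auto
    have d: "f differentiable (at x)" "g differentiable (at x)" if "x \<in> S" for x
      using sf sg that smoothN_imp_differentiable by blast+
    have sf': "smoothN ?N f S" "smoothN ?N (dir_deriv b f) S"
      and sg': "smoothN ?N g S" "smoothN ?N (dir_deriv b g) S"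
      using sf sg b smoothN_mono[of "Suc ?N" _ S ?N S] by (simp_all add: smoothN_Suc)
    have bf: "norm (iter_deriv cs (dir_deriv b f) y) \<le> p (Suc (length cs))"
      and bg: "norm (iter_deriv cs (dir_deriv b g) y) \<le> q (Suc (length cs))"
      if "cs \<in> lists Basis" "length cs \<le> ?N" for cs
      using snoc.prems(4)[of "cs @ [b]"] snoc.prems(5)[of "cs @ [b]"] that b
      by (simp_all add: iter_deriv_append)
    have "iter_deriv (bs @ [b]) (\<lambda>x. f x * g x) y = iter_deriv bs (dir_deriv b (\<lambda>x. f x * g x)) y"
      by (simp add: iter_deriv_append)
    also have "\<dots> = iter_deriv bs (\<lambda>x. f x * dir_deriv b g x + dir_deriv b f x * g x) y"
      by (rule iter_deriv_cong[OF assms(1,2)]) (rule dir_deriv_mult[OF d])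
    also have "\<dots> = iter_deriv bs (\<lambda>x. f x * dir_deriv b g x) y + iter_deriv bs (\<lambda>x. dir_deriv b f x * g x) y"
      by (rule iter_deriv_add[OF assms(1), of ?N])
        (use sf' sg' bs assms(2) in \<open>auto intro!: smoothN_mult[OF assms(1)]\<close>)
    also have "norm \<dots> \<le> (\<Sum>l\<le>?N. real (?N choose l) * p l * q (Suc (?N - l)))
        + (\<Sum>l\<le>?N. real (?N choose l) * p (Suc l) * q (?N - l))"
    proof (rule norm_triangle_mono)
      show "norm (iter_deriv bs (\<lambda>x. f x * dir_deriv b g x) y)
         \<le> (\<Sum>l\<le>?N. real (?N choose l) * p l * q (Suc (?N - l)))"
        by (rule snoc.IH[OF sf'(1) sg'(2) bs _ bg, where p = p]) (use snoc.prems(4) in auto)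
      show "norm (iter_deriv bs (\<lambda>x. dir_deriv b f x * g x) y)
         \<le> (\<Sum>l\<le>?N. real (?N choose l) * p (Suc l) * q (?N - l))"
        by (rule snoc.IH[OF sf'(2) sg'(1) bs bf, where q = q]) (use snoc.prems(5) in auto)
    qed
    also have "\<dots> = (\<Sum>l\<le>Suc ?N. real (Suc ?N choose l) * p l * q (Suc ?N - l))"
      unfolding sum_choose_Suc[symmetric] by (simp add: sum.distrib algebra_simps)
    finally show ?case by simp
  qed
qed

section \<open>Pointwise Gevrey bounds\<close>

text \<open>With \<open>fact (length bs)\<close> in place of \<open>multi_fact bs\<close> the bound
  depends on the order alone, so that product and chain rule estimates look as in one variable. The
  two factorials differ by at most a power of the dimension
  (\<open>fact_length_le_multi_fact\<close>), which h absorbs.\<close>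

definition deriv_bound :: "real \<Rightarrow> ('e::euclidean_space \<Rightarrow> complex) \<Rightarrow> 'e \<Rightarrow> real \<Rightarrow> real \<Rightarrow> bool" where
  "deriv_bound s f y C h \<longleftrightarrow>
     (\<forall>bs\<in>lists Basis. norm (iter_deriv bs f y) \<le> C * h ^ length bs * fact (length bs) powr s)"

lemma deriv_bound_mono:
  assumes "deriv_bound s f y C h" "C \<le> C'" "0 \<le> C'" "0 \<le> h" "h \<le> h'"
  shows "deriv_bound s f y C' h'"
  unfolding deriv_bound_def
proof
  fix bs :: "'a list" assume "bs \<in> lists Basis"
  then have "norm (iter_deriv bs f y) \<le> C * h ^ length bs * fact (length bs) powr s"
    using assms(1) by (auto simp: deriv_bound_def)
  also have "\<dots> \<le> C' * h' ^ length bs * fact (length bs) powr s"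
    using assms by (intro mult_right_mono mult_mono power_mono) auto
  finally show "norm (iter_deriv bs f y) \<le> \<dots>" .
qed

lemma deriv_bound_cong:
  assumes "open S" "y \<in> S" "\<And>x. x \<in> S \<Longrightarrow> f x = g x" "deriv_bound s g y C h"
  shows "deriv_bound s f y C h"
  using assms unfolding deriv_bound_def by (simp add: iter_deriv_cong[OF assms(1,2,3)])

lemma deriv_bound_0: "0 \<le> C \<Longrightarrow> 0 \<le> h \<Longrightarrow> deriv_bound s (\<lambda>x. 0) y C h"
  by (simp add: deriv_bound_def iter_deriv_0)

text \<open>Because \<open>s \<ge> 1\<close>, the factor \<open>(N choose l)\<close> of the Leibniz rule is absorbed by the factorials.\<close>

lemma choose_fact_powr_le:
  assumes "s \<ge> 1" "l \<le> N"
  shows "real (N choose l) * (fact l powr s * fact (n + (N - l)) powr s) \<le> fact (n + N) powr s"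
proof -
  have "(N choose l) \<le> (n + N choose l)" by (rule binomial_right_mono) simp
  then have "real (N choose l) \<le> real (n + N choose l)" by simp
  also have "\<dots> = real (n + N choose l) powr 1" using assms by simp
  also have "\<dots> \<le> real (n + N choose l) powr s"
    by (rule powr_mono) (use assms zero_less_binomial[of l "n+N"] in \<open>auto simp del: zero_less_binomial_iff\<close>)
  finally have "real (N choose l) * (fact l powr s * fact (n + (N - l)) powr s)
     \<le> real (n + N choose l) powr s * (fact l powr s * fact (n + (N - l)) powr s)"
    by (intro mult_right_mono) auto
  also have "\<dots> = (real (n + N choose l) * (fact l * fact (n + (N - l)))) powr s"
    by (simp add: powr_mult)
  also have "real (n + N choose l) * (fact l * fact (n + (N - l))) = fact (n + N)"
    using binomial_fact_lemma[of l "n + N"] assms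
    by (metis (no_types, lifting) Nat.add_diff_assoc mult.commute of_nat_fact of_nat_mult trans_le_add2)
  finally show ?thesis .
qed

lemma sum_power_le_2:
  fixes x :: real
  assumes "0 \<le> x" "x \<le> 1/2"
  shows "(\<Sum>l\<le>N. x ^ l) \<le> 2"
proof -
  have "(\<Sum>l\<le>N. x ^ l) \<le> (\<Sum>l\<le>N. (1/2) ^ l)"
    using assms by (intro sum_mono power_mono) auto
  also have "\<dots> = 2 - (1/2) ^ N" by (induction N) auto
  also have "\<dots> \<le> 2" by simp
  finally show ?thesis .
qed

text \<open>Every derivative that falls on f costs a factor b / H \<le> 1/2, so a geometric series
  yields the constant 2 and the rate H of g is kept. The unchanged rate and the shift n of the
  factorial are what the induction for compositions relies on.\<close>

lemma norm_iter_deriv_mult_gevrey: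
  assumes s: "s \<ge> 1" and S: "open S" "y \<in> S"
    and sm: "smooth_on f S" "smooth_on g S" and bs: "bs \<in> lists Basis"
    and f: "\<And>cs. cs \<in> lists Basis \<Longrightarrow> length cs \<le> length bs \<Longrightarrow>
          norm (iter_deriv cs f y) \<le> A * b ^ length cs * fact (length cs) powr s"
    and g: "\<And>cs. cs \<in> lists Basis \<Longrightarrow> length cs \<le> length bs \<Longrightarrow>
          norm (iter_deriv cs g y) \<le> C * H ^ length cs * fact (n + length cs) powr s"
    and nn: "0 \<le> A" "0 \<le> C" "0 \<le> b" "2 * b \<le> H" "0 < H"
  shows "norm (iter_deriv bs (\<lambda>x. f x * g x) y) \<le> 2 * A * C * H ^ length bs * fact (n + length bs) powr s"
proof -
  let ?N = "length bs"
  have "norm (iter_deriv bs (\<lambda>x. f x * g x) y)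
     \<le> (\<Sum>l\<le>?N. real (?N choose l) * (A * b ^ l * fact l powr s) * (C * H ^ (?N - l) * fact (n + (?N - l)) powr s))"
    by (rule norm_iter_deriv_mult_le[OF S sm bs f g]) auto
  also have "\<dots> \<le> (\<Sum>l\<le>?N. (A * C * H ^ ?N * fact (n + ?N) powr s) * (b / H) ^ l)"
  proof (rule sum_mono)
    fix l assume "l \<in> {..?N}"
    then have l: "l \<le> ?N" by simp
    have "real (?N choose l) * (A * b ^ l * fact l powr s) * (C * H ^ (?N - l) * fact (n + (?N - l)) powr s)
       = A * b ^ l * C * H ^ (?N - l) * (real (?N choose l) * (fact l powr s * fact (n + (?N - l)) powr s))"
      by (simp add: algebra_simps)
    also have "\<dots> \<le> A * b ^ l * C * H ^ (?N - l) * fact (n + ?N) powr s"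
      by (rule mult_left_mono[OF choose_fact_powr_le[OF s l]]) (use nn in auto)
    also have "\<dots> = A * C * H ^ ?N * fact (n + ?N) powr s * (b / H) ^ l"
      using nn l by (simp add: power_diff power_divide field_simps)
    finally show "real (?N choose l) * (A * b ^ l * fact l powr s) * (C * H ^ (?N - l) * fact (n + (?N - l)) powr s) \<le> \<dots>" .
  qed
  also have "\<dots> = (A * C * H ^ ?N * fact (n + ?N) powr s) * (\<Sum>l\<le>?N. (b / H) ^ l)"
    by (simp add: sum_distrib_left)
  also have "\<dots> \<le> (A * C * H ^ ?N * fact (n + ?N) powr s) * 2"
    by (intro mult_left_mono sum_power_le_2) (use nn in \<open>auto simp: field_simps\<close>)
  finally show ?thesis by (simp add: algebra_simps)
qed

section \<open>Composition\<close>

lemma differentiable_components: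
  fixes \<Phi> :: "'d::euclidean_space \<Rightarrow> 'e::euclidean_space"
  assumes "\<And>k. k \<in> Basis \<Longrightarrow> (\<lambda>z. complex_of_real (\<Phi> z \<bullet> k)) differentiable (at x)"
  shows "\<Phi> differentiable (at x)"
proof -
  have "(\<lambda>z. \<Phi> z \<bullet> k) differentiable (at x)" if k: "k \<in> Basis" for k
  proof -
    obtain D where "((\<lambda>z. complex_of_real (\<Phi> z \<bullet> k)) has_derivative D) (at x)"
      using assms[OF k] by (auto simp: differentiable_def)
    from bounded_linear.has_derivative[OF bounded_linear_Re this]
    show ?thesis by (auto simp: differentiable_def)
  qed
  then show ?thesis by (subst differentiable_componentwise_within) auto
qed

lemma dir_deriv_compose:
  fixes \<Phi> :: "'d::euclidean_space \<Rightarrow> 'e::euclidean_space"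
  assumes \<Phi>: "\<And>k. k \<in> Basis \<Longrightarrow> (\<lambda>z. complex_of_real (\<Phi> z \<bullet> k)) differentiable (at x)"
    and F: "F differentiable (at (\<Phi> x))"
  shows "(\<lambda>z. F (\<Phi> z)) differentiable (at x)"
    and "dir_deriv v (\<lambda>z. F (\<Phi> z)) x
       = (\<Sum>k\<in>Basis. dir_deriv v (\<lambda>z. complex_of_real (\<Phi> z \<bullet> k)) x * dir_deriv k F (\<Phi> x))"
proof -
  obtain D where D: "(\<Phi> has_derivative D) (at x)"
    using differentiable_components[OF \<Phi>] by (auto simp: differentiable_def)
  note c = has_derivative_compose[OF D has_derivative_dir_deriv[OF F]]
  show "(\<lambda>z. F (\<Phi> z)) differentiable (at x)" using c by (auto simp: differentiable_def)
  have lin: "linear (\<lambda>v. dir_deriv v F (\<Phi> x))"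
    using has_derivative_dir_deriv[OF F] has_derivative_linear by blast
  have comp: "dir_deriv v (\<lambda>z. complex_of_real (\<Phi> z \<bullet> k)) x = complex_of_real (D v \<bullet> k)" for k
    by (intro dir_deriv_eq has_derivative_of_real has_derivative_inner_left D)
  have "dir_deriv v (\<lambda>z. F (\<Phi> z)) x = dir_deriv (D v) F (\<Phi> x)" by (rule dir_deriv_eq[OF c])
  also have "\<dots> = dir_deriv (\<Sum>k\<in>Basis. (D v \<bullet> k) *\<^sub>R k) F (\<Phi> x)" by (simp add: euclidean_representation)
  also have "\<dots> = (\<Sum>k\<in>Basis. complex_of_real (D v \<bullet> k) * dir_deriv k F (\<Phi> x))"
    by (simp add: linear_sum[OF lin] linear_scale[OF lin] scaleR_conv_of_real)
  finally show "dir_deriv v (\<lambda>z. F (\<Phi> z)) x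
       = (\<Sum>k\<in>Basis. dir_deriv v (\<lambda>z. complex_of_real (\<Phi> z \<bullet> k)) x * dir_deriv k F (\<Phi> x))"
    by (simp add: comp)
qed

lemma smoothN_compose:
  fixes \<Phi> :: "'d::euclidean_space \<Rightarrow> 'e::euclidean_space"
  assumes U: "open U" and \<Phi>: "\<And>k. k \<in> Basis \<Longrightarrow> smooth_on (\<lambda>z. complex_of_real (\<Phi> z \<bullet> k)) U"
    and "\<Phi> ` U \<subseteq> S" "smooth_on F S"
  shows "smoothN N (\<lambda>z. F (\<Phi> z)) U"
  using assms(4)
proof (induction N arbitrary: F)
  case 0
  have "(\<lambda>z. F (\<Phi> z)) differentiable (at x)" if x: "x \<in> U" for x
    by (rule dir_deriv_compose(1)[of \<Phi> x F])
      (use x assms(3) in \<open>auto intro!: smooth_on_imp_differentiable[OF \<Phi>] smooth_on_imp_differentiable[OF 0]\<close>)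
  then show ?case by (auto simp: smoothN_0)
next
  case (Suc N)
  have d: "(\<lambda>z. complex_of_real (\<Phi> z \<bullet> k)) differentiable (at x)" "F differentiable (at (\<Phi> x))"
    if "x \<in> U" "k \<in> Basis" for x k
    using that assms(3) smooth_on_imp_differentiable[OF \<Phi>] smooth_on_imp_differentiable[OF Suc.prems]
    by auto
  have dF: "F differentiable (at (\<Phi> x))" if "x \<in> U" for x
    using that assms(3) smooth_on_imp_differentiable[OF Suc.prems] by auto
  have "smoothN N (dir_deriv b (\<lambda>z. F (\<Phi> z))) U" if b: "b \<in> Basis" for b
  proof (rule smoothN_cong[OF U])
    show "dir_deriv b (\<lambda>z. F (\<Phi> z)) x
        = (\<Sum>k\<in>Basis. dir_deriv b (\<lambda>z. complex_of_real (\<Phi> z \<bullet> k)) x * dir_deriv k F (\<Phi> x))"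
      if x: "x \<in> U" for x
      by (rule dir_deriv_compose(2)[of \<Phi> x F, OF d(1)[OF x] dF[OF x]])
    show "smoothN N (\<lambda>x. \<Sum>k\<in>Basis. dir_deriv b (\<lambda>z. complex_of_real (\<Phi> z \<bullet> k)) x * dir_deriv k F (\<Phi> x)) U"
      using smooth_on_dir_deriv[OF \<Phi> b] smooth_on_dir_deriv[OF Suc.prems]
      by (intro smoothN_sum[OF U] smoothN_mult[OF U] Suc.IH) (auto simp: smooth_on_iff_smoothN)
  qed
  moreover have "(\<lambda>z. F (\<Phi> z)) differentiable (at x)" if x: "x \<in> U" for x
    by (rule dir_deriv_compose(1)[of \<Phi> x F, OF d(1)[OF x] dF[OF x]])
  ultimately show ?case by (auto simp: smoothN_Suc)
qed

lemma smooth_on_compose: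
  fixes \<Phi> :: "'d::euclidean_space \<Rightarrow> 'e::euclidean_space"
  assumes "open U" "\<And>k. k \<in> Basis \<Longrightarrow> smooth_on (\<lambda>z. complex_of_real (\<Phi> z \<bullet> k)) U"
    "\<Phi> ` U \<subseteq> S" "smooth_on F S"
  shows "smooth_on (\<lambda>z. F (\<Phi> z)) U"
  using smoothN_compose[OF assms] smooth_on_iff_smoothN by blast

text \<open>The induction on the order of differentiation replaces \<open>F\<close> by its partial derivatives, whose
  order is recorded by the shift \<open>n\<close> of the factorials; this avoids the Faa di Bruno formula.\<close>

lemma deriv_bound_compose_aux:
  fixes \<Phi> :: "'d::euclidean_space \<Rightarrow> 'e::euclidean_space" and A b h H C :: real
  assumes s: "s \<ge> 1" and U: "open U" "y \<in> U"
    and \<Phi>: "\<And>k. k \<in> Basis \<Longrightarrow> smooth_on (\<lambda>z. complex_of_real (\<Phi> z \<bullet> k)) U" "\<Phi> ` U \<subseteq> S"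
    and F: "smooth_on F S"
    and a: "\<And>k i. k \<in> Basis \<Longrightarrow> i \<in> Basis \<Longrightarrow>
          deriv_bound s (dir_deriv i (\<lambda>z. complex_of_real (\<Phi> z \<bullet> k))) y A b"
    and nn: "0 \<le> A" "0 \<le> b" "0 \<le> h" "2 * b \<le> H" "2 * DIM('e) * A * h \<le> H" "0 < H"
    and Fb: "0 \<le> C" "\<And>cs. cs \<in> lists Basis \<Longrightarrow>
          norm (iter_deriv cs F (\<Phi> y)) \<le> C * h ^ length cs * fact (n + length cs) powr s"
    and bs: "bs \<in> lists Basis"
  shows "norm (iter_deriv bs (\<lambda>z. F (\<Phi> z)) y) \<le> C * H ^ length bs * fact (n + length bs) powr s"
  using F Fb bs
proof (induction "length bs" arbitrary: bs F C n rule: less_induct)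
  case less
  show ?case
  proof (cases bs rule: rev_cases)
    case Nil
    then show ?thesis using less.prems(3)[of "[]"] by simp
  next
    case (snoc ds i)
    let ?N = "length ds"
    let ?a = "\<lambda>k. dir_deriv i (\<lambda>z. complex_of_real (\<Phi> z \<bullet> k))"
    have i: "i \<in> Basis" and ds: "ds \<in> lists Basis" using snoc less.prems by auto
    have sa: "smooth_on (?a k) U" if "k \<in> Basis" for k
      using \<Phi>(1)[OF that] i smooth_on_dir_deriv by blast
    have sF: "smooth_on (\<lambda>x. dir_deriv k F (\<Phi> x)) U" if "k \<in> Basis" for k
      by (rule smooth_on_compose[OF U(1) \<Phi> smooth_on_dir_deriv[OF less.prems(1) that]])
    have trm: "norm (iter_deriv ds (\<lambda>x. ?a k x * dir_deriv k F (\<Phi> x)) y)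
         \<le> 2 * A * (C * h) * H ^ ?N * fact (Suc n + ?N) powr s" if k: "k \<in> Basis" for k
    proof (rule norm_iter_deriv_mult_gevrey[OF s U sa[OF k] sF[OF k] ds])
      fix cs :: "'d list" assume cs: "cs \<in> lists Basis" "length cs \<le> ?N"
      show "norm (iter_deriv cs (?a k) y) \<le> A * b ^ length cs * fact (length cs) powr s"
        using a[OF k i] cs by (auto simp: deriv_bound_def)
      show "norm (iter_deriv cs (\<lambda>x. dir_deriv k F (\<Phi> x)) y) \<le> C * h * H ^ length cs * fact (Suc n + length cs) powr s"
      proof (rule less.hyps)
        show "length cs < length bs" using cs snoc by simp
        show "smooth_on (dir_deriv k F) S" using smooth_on_dir_deriv[OF less.prems(1) k] .
        show "norm (iter_deriv es (dir_deriv k F) (\<Phi> y)) \<le> C * h * h ^ length es * fact (Suc n + length es) powr s"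
          if "es \<in> lists Basis" for es
          using less.prems(3)[of "es @ [k]"] that k by (simp add: iter_deriv_append algebra_simps)
      qed (use cs nn less.prems in auto)
    qed (use nn less.prems in auto)
    have "iter_deriv bs (\<lambda>z. F (\<Phi> z)) y = iter_deriv ds (dir_deriv i (\<lambda>z. F (\<Phi> z))) y"
      by (simp add: snoc iter_deriv_append)
    also have "\<dots> = iter_deriv ds (\<lambda>x. \<Sum>k\<in>Basis. ?a k x * dir_deriv k F (\<Phi> x)) y"
    proof (rule iter_deriv_cong[OF U])
      fix x assume x: "x \<in> U"
      show "dir_deriv i (\<lambda>z. F (\<Phi> z)) x = (\<Sum>k\<in>Basis. ?a k x * dir_deriv k F (\<Phi> x))"
        by (rule dir_deriv_compose(2)[of \<Phi> x F])
          (use x \<Phi>(2) in \<open>auto intro!: smooth_on_imp_differentiable[OF \<Phi>(1)]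
            smooth_on_imp_differentiable[OF less.prems(1)]\<close>)
    qed
    also have "\<dots> = (\<Sum>k\<in>Basis. iter_deriv ds (\<lambda>x. ?a k x * dir_deriv k F (\<Phi> x)) y)"
      by (rule iter_deriv_sum[OF U(1) _ _ ds, of _ ?N])
        (use U sa sF in \<open>auto intro!: smoothN_mult[OF U(1)] simp: smooth_on_iff_smoothN\<close>)
    also have "norm \<dots> \<le> (\<Sum>k\<in>(Basis::'e set). 2 * A * (C * h) * H ^ ?N * fact (Suc n + ?N) powr s)"
      by (rule sum_norm_le[OF trm])
    also have "\<dots> = (2 * DIM('e) * A * h) * (C * H ^ ?N * fact (Suc n + ?N) powr s)"
      by (simp add: algebra_simps)
    \<comment> \<open>The second lower bound on H enters here: one application of the chain rule,
      summed over the coordinates, costs at most one power of H, and \<open>length bs\<close> is one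
      more than \<open>?N\<close>.\<close>
    also have "\<dots> \<le> H * (C * H ^ ?N * fact (Suc n + ?N) powr s)"
      by (rule mult_right_mono) (use nn less.prems in auto)
    finally show ?thesis by (simp add: snoc algebra_simps)
  qed
qed

text \<open>The sum in the new rate dominates both lower bounds required of H, and it is positive
  because b is. The constant C of F survives and the rate involves only h and the derivatives of the
  inner map, so uniform bounds for a family of outer functions persist.\<close>

lemma deriv_bound_compose:
  fixes \<Phi> :: "'d::euclidean_space \<Rightarrow> 'e::euclidean_space" and A b h H C :: real
  assumes s: "s \<ge> 1" and U: "open U" "y \<in> U"
    and \<Phi>: "\<And>k. k \<in> Basis \<Longrightarrow> smooth_on (\<lambda>z. complex_of_real (\<Phi> z \<bullet> k)) U" "\<Phi> ` U \<subseteq> S"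
    and F: "smooth_on F S"
    and a: "\<And>k i. k \<in> Basis \<Longrightarrow> i \<in> Basis \<Longrightarrow>
          deriv_bound s (dir_deriv i (\<lambda>z. complex_of_real (\<Phi> z \<bullet> k))) y A b"
    and nn: "0 \<le> A" "0 < b" "0 \<le> h" "0 \<le> C"
    and Fb: "deriv_bound s F (\<Phi> y) C h"
  shows "deriv_bound s (\<lambda>z. F (\<Phi> z)) y C (2 * b + 2 * DIM('e) * A * h)"
  unfolding deriv_bound_def
proof
  fix bs :: "'d list" assume bs: "bs \<in> lists Basis"
  have "0 < 2 * b + real (2 * DIM('e)) * A * h" using nn by (intro add_pos_nonneg) auto
  then show "norm (iter_deriv bs (\<lambda>z. F (\<Phi> z)) y)
     \<le> C * (2 * b + real (2 * DIM('e)) * A * h) ^ length bs * fact (length bs) powr s"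
    using deriv_bound_compose_aux[OF s U \<Phi> F a nn(1) _ nn(3), where H = "2 * b + 2 * DIM('e) * A * h"
      and C = C and n = 0 and bs = bs] nn Fb bs
    by (auto simp: deriv_bound_def)
qed

lemma deriv_bound_mult:
  assumes "s \<ge> 1" "open S" "y \<in> S" "smooth_on f S" "smooth_on g S"
    and "deriv_bound s f y A b" "deriv_bound s g y C h" "0 \<le> A" "0 \<le> C" "0 \<le> b" "0 < h"
  shows "deriv_bound s (\<lambda>x. f x * g x) y (2 * A * C) (2 * b + h)"
  unfolding deriv_bound_def
proof
  fix bs :: "'a list" assume bs: "bs \<in> lists Basis"
  have g: "deriv_bound s g y C (2 * b + h)"
    by (rule deriv_bound_mono[OF assms(7)]) (use assms in auto)
  show "norm (iter_deriv bs (\<lambda>x. f x * g x) y) \<le> 2 * A * C * (2 * b + h) ^ length bs * fact (length bs) powr s"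
    using norm_iter_deriv_mult_gevrey[OF assms(1-4) assms(5) bs, of A b C "2 * b + h" 0]
      assms g by (auto simp: deriv_bound_def)
qed

lemma deriv_bound_add:
  assumes "open S" "y \<in> S" "smooth_on f S" "smooth_on g S"
    and "deriv_bound s f y A b" "deriv_bound s g y C h" "0 \<le> A" "0 \<le> C" "0 \<le> b" "0 \<le> h"
  shows "deriv_bound s (\<lambda>x. f x + g x) y (A + C) (max b h)"
  unfolding deriv_bound_def
proof
  fix bs :: "'a list" assume bs: "bs \<in> lists Basis"
  have f: "deriv_bound s f y A (max b h)" and g: "deriv_bound s g y C (max b h)"
    using assms by (auto intro: deriv_bound_mono)
  have "iter_deriv bs (\<lambda>x. f x + g x) y = iter_deriv bs f y + iter_deriv bs g y"
    by (rule iter_deriv_add[OF assms(1), of "length bs"]) (use assms bs smooth_on_iff_smoothN in auto)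
  also have "norm \<dots> \<le> A * max b h ^ length bs * fact (length bs) powr s + C * max b h ^ length bs * fact (length bs) powr s"
    using f g bs by (intro norm_triangle_mono) (auto simp: deriv_bound_def)
  finally show "norm (iter_deriv bs (\<lambda>x. f x + g x) y) \<le> (A + C) * max b h ^ length bs * fact (length bs) powr s"
    by (simp add: algebra_simps)
qed

section \<open>Locally uniformly Gevrey families\<close>

text \<open>Continuity on the steps of the inductive limit is handled by proving all regularity statements
  for families \<open>(f i)\<close>, \<open>i \<in> I\<close>, with bounds that are uniform in \<open>i\<close>.\<close>

definition ugev :: "real \<Rightarrow> 'i set \<Rightarrow> ('i \<Rightarrow> 'e::euclidean_space \<Rightarrow> complex) \<Rightarrow> 'e set \<Rightarrow> bool" where
  "ugev s I f U \<longleftrightarrow> (\<forall>i\<in>I. smooth_on (f i) U) \<and>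
     (\<forall>x\<in>U. \<exists>C\<ge>0. \<exists>h>0. \<exists>V. open V \<and> x \<in> V \<and> (\<forall>i\<in>I. \<forall>y\<in>V. deriv_bound s (f i) y C h))"

abbreviation gev :: "real \<Rightarrow> ('e::euclidean_space \<Rightarrow> complex) \<Rightarrow> 'e set \<Rightarrow> bool" where
  "gev s f U \<equiv> ugev s {()} (\<lambda>_. f) U"

lemma ugevD:
  assumes "ugev s I f U" "x \<in> U"
  obtains C h V where "C \<ge> 0" "h > 0" "open V" "x \<in> V"
    "\<forall>i\<in>I. \<forall>y\<in>V. deriv_bound s (f i) y C h"
  using assms unfolding ugev_def by metis

lemma ugev_subset: "ugev s I f U \<Longrightarrow> V \<subseteq> U \<Longrightarrow> J \<subseteq> I \<Longrightarrow> ugev s J f V"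
  unfolding ugev_def by (meson smooth_on_subset subsetD)

lemma ugev_reindex: "ugev s I (\<lambda>i. f (\<sigma> i)) U \<longleftrightarrow> ugev s (\<sigma> ` I) f U"
  unfolding ugev_def by simp

lemma ugev_of_gev: "gev s f U \<Longrightarrow> ugev s I (\<lambda>_. f) U"
  unfolding ugev_def by (simp, meson)

lemma gev_of_ugev: "ugev s I f U \<Longrightarrow> i \<in> I \<Longrightarrow> gev s (f i) U"
  unfolding ugev_def by (meson singletonD)

lemma ugev_cong:
  assumes "open U" "\<And>i x. i \<in> I \<Longrightarrow> x \<in> U \<Longrightarrow> f i x = g i x" "ugev s I g U"
  shows "ugev s I f U"
  unfolding ugev_def
proof (intro conjI ballI)
  fix i assume "i \<in> I"
  then show "smooth_on (f i) U"
    using assms smooth_on_cong[OF assms(1), of "f i" "g i"] by (auto simp: ugev_def)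
next
  fix x assume x: "x \<in> U"
  obtain C h V where V: "C \<ge> 0" "h > 0" "open V" "x \<in> V"
    "\<forall>i\<in>I. \<forall>y\<in>V. deriv_bound s (g i) y C h"
    using ugevD[OF assms(3) x] .
  have "deriv_bound s (f i) y C h" if "i \<in> I" "y \<in> V \<inter> U" for i y
    using that by (intro deriv_bound_cong[OF assms(1) _ assms(2)] V(5)[rule_format]) auto
  then show "\<exists>C\<ge>0. \<exists>h>0. \<exists>V. open V \<and> x \<in> V \<and> (\<forall>i\<in>I. \<forall>y\<in>V. deriv_bound s (f i) y C h)"
    using V(1-4) x assms(1) by (meson IntI open_Int)
qed

lemma ugev_local:
  assumes "\<And>x. x \<in> U \<Longrightarrow> \<exists>V. open V \<and> x \<in> V \<and> ugev s I f V"
  shows "ugev s I f U"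
  unfolding ugev_def
proof (intro conjI ballI)
  fix i assume "i \<in> I"
  then show "smooth_on (f i) U"
    using assms unfolding ugev_def smooth_on_def by blast
next
  fix x assume "x \<in> U"
  then obtain V where "x \<in> V" "ugev s I f V" using assms by blast
  then show "\<exists>C\<ge>0. \<exists>h>0. \<exists>V. open V \<and> x \<in> V \<and> (\<forall>i\<in>I. \<forall>y\<in>V. deriv_bound s (f i) y C h)"
    unfolding ugev_def by blast
qed

lemma ugev_Un:
  assumes "ugev s I f U" "ugev s J f U"
  shows "ugev s (I \<union> J) f U"
  unfolding ugev_def
proof (intro conjI ballI)
  fix i assume "i \<in> I \<union> J"
  then show "smooth_on (f i) U" using assms by (auto simp: ugev_def)
next
  fix x assume x: "x \<in> U"
  obtain C h V where V: "C \<ge> 0" "h > 0" "open V" "x \<in> V"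
    "\<forall>i\<in>I. \<forall>y\<in>V. deriv_bound s (f i) y C h"
    using ugevD[OF assms(1) x] .
  obtain C' h' V' where V': "C' \<ge> 0" "h' > 0" "open V'" "x \<in> V'"
    "\<forall>i\<in>J. \<forall>y\<in>V'. deriv_bound s (f i) y C' h'"
    using ugevD[OF assms(2) x] .
  show "\<exists>C\<ge>0. \<exists>h>0. \<exists>V. open V \<and> x \<in> V \<and> (\<forall>i\<in>I \<union> J. \<forall>y\<in>V. deriv_bound s (f i) y C h)"
  proof (intro exI conjI ballI)
    fix i y assume "i \<in> I \<union> J" "y \<in> V \<inter> V'"
    then have "deriv_bound s (f i) y C h \<or> deriv_bound s (f i) y C' h'" using V(5) V'(5) by blast
    then show "deriv_bound s (f i) y (max C C') (max h h')"
    proof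
      assume "deriv_bound s (f i) y C h"
      then show ?thesis by (rule deriv_bound_mono) (use V V' in auto)
    next
      assume "deriv_bound s (f i) y C' h'"
      then show ?thesis by (rule deriv_bound_mono) (use V V' in auto)
    qed
  qed (use V V' in auto)
qed

lemma ugev_empty: "ugev s {} f U"
  unfolding ugev_def by (auto intro: exI[of _ UNIV] exI[of _ 1] exI[of _ 0])

text \<open>Merging finitely many families into one replaces their separate constants by a common
  pair, for instance for all partial derivatives or all coefficients at once.\<close>

lemma ugev_finite:
  assumes "finite J" "\<And>j. j \<in> J \<Longrightarrow> ugev s I (f j) U"
  shows "ugev s (J \<times> I) (\<lambda>(j, i). f j i) U"
  using assms
proof (induction J)
  case (insert j J)
  have "ugev s (Pair j ` I) (\<lambda>(j, i). f j i) U"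
    unfolding ugev_reindex[symmetric] using insert by simp
  moreover have "insert j J \<times> I = Pair j ` I \<union> J \<times> I" by auto
  moreover have "ugev s (J \<times> I) (\<lambda>(j, i). f j i) U" using insert by simp
  ultimately show ?case using ugev_Un by metis
qed (simp add: ugev_empty)

lemma ugev_compact:
  assumes "ugev s I f U" "compact K" "K \<subseteq> U"
  obtains C h where "C \<ge> 0" "h > 0" "\<forall>i\<in>I. \<forall>y\<in>K. deriv_bound s (f i) y C h"
proof -
  have "\<forall>x\<in>K. \<exists>C h V. C \<ge> 0 \<and> h > 0 \<and> open V \<and> x \<in> V \<and> (\<forall>i\<in>I. \<forall>y\<in>V. deriv_bound s (f i) y C h)"
    using assms(1,3) unfolding ugev_def by (meson subsetD)
  then obtain C h V where *: "\<And>x. x \<in> K \<Longrightarrow> C x \<ge> 0 \<and> h x > 0 \<and> open (V x) \<and> x \<in> V x \<and>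
      (\<forall>i\<in>I. \<forall>y\<in>V x. deriv_bound s (f i) y (C x) (h x))"
    by metis
  obtain T where T: "T \<subseteq> K" "finite T" "K \<subseteq> (\<Union>x\<in>T. V x)"
    using compactE_image[OF assms(2), of K V] * by blast
  show thesis
  proof (rule that)
    show nn: "(\<Sum>x\<in>T. C x) \<ge> 0" using * T by (auto intro: sum_nonneg)
    have hh: "(\<Sum>x\<in>T. h x) \<ge> 0" by (rule sum_nonneg) (use * T in \<open>auto intro: less_imp_le\<close>)
    \<comment> \<open>The summand 1 keeps the rate positive when the finite cover is empty.\<close>
    then show "1 + (\<Sum>x\<in>T. h x) > 0" by (rule add_pos_nonneg[OF zero_less_one])
    show "\<forall>i\<in>I. \<forall>y\<in>K. deriv_bound s (f i) y (\<Sum>x\<in>T. C x) (1 + (\<Sum>x\<in>T. h x))"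
    proof (intro ballI)
    fix i y assume i: "i \<in> I" "y \<in> K"
    then obtain x where x: "x \<in> T" "y \<in> V x" using T by blast
    then have xK: "x \<in> K" using T by blast
    have "C x \<le> (\<Sum>x\<in>T. C x)" "h x \<le> (\<Sum>x\<in>T. h x)"
      by (rule member_le_sum; use x T * in \<open>auto intro: less_imp_le\<close>)+
    then show "deriv_bound s (f i) y (\<Sum>x\<in>T. C x) (1 + (\<Sum>x\<in>T. h x))"
      using *[OF xK] i x nn by (rule_tac deriv_bound_mono[of s "f i" y "C x" "h x"]) auto
    qed
  qed
qed

lemma ugev_add:
  assumes "open U" "ugev s I f U" "ugev s I g U"
  shows "ugev s I (\<lambda>i x. f i x + g i x) U"
  unfolding ugev_def
proof (intro conjI ballI)
  fix i assume "i \<in> I"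
  then show "smooth_on (\<lambda>x. f i x + g i x) U"
    using assms smoothN_add[OF assms(1)] by (auto simp: ugev_def smooth_on_iff_smoothN)
next
  fix x assume x: "x \<in> U"
  obtain C h V where V: "C \<ge> 0" "h > 0" "open V" "x \<in> V"
    "\<forall>i\<in>I. \<forall>y\<in>V. deriv_bound s (f i) y C h"
    using ugevD[OF assms(2) x] .
  obtain C' h' V' where V': "C' \<ge> 0" "h' > 0" "open V'" "x \<in> V'"
    "\<forall>i\<in>I. \<forall>y\<in>V'. deriv_bound s (g i) y C' h'"
    using ugevD[OF assms(3) x] .
  show "\<exists>C\<ge>0. \<exists>h>0. \<exists>V. open V \<and> x \<in> V \<and> (\<forall>i\<in>I. \<forall>y\<in>V. deriv_bound s (\<lambda>x. f i x + g i x) y C h)"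
  proof (intro exI conjI ballI)
    fix i y assume "i \<in> I" "y \<in> V \<inter> V' \<inter> U"
    then show "deriv_bound s (\<lambda>x. f i x + g i x) y (C + C') (max h h')"
      using V V' assms by (intro deriv_bound_add[OF assms(1)]) (auto simp: ugev_def)
  qed (use V V' x assms(1) in auto)
qed

lemma smooth_on_mult:
  "open U \<Longrightarrow> smooth_on f U \<Longrightarrow> smooth_on g U \<Longrightarrow> smooth_on (\<lambda>x. f x * g x) U"
  by (simp add: smooth_on_iff_smoothN smoothN_mult)

lemma ugev_mult:
  assumes "s \<ge> 1" "open U" "ugev s I f U" "ugev s I g U"
  shows "ugev s I (\<lambda>i x. f i x * g i x) U"
  unfolding ugev_def
proof (intro conjI ballI)
  fix i assume "i \<in> I"
  then show "smooth_on (\<lambda>x. f i x * g i x) U"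
    using assms smooth_on_mult[OF assms(2)] by (auto simp: ugev_def)
next
  fix x assume x: "x \<in> U"
  obtain C h V where V: "C \<ge> 0" "h > 0" "open V" "x \<in> V"
    "\<forall>i\<in>I. \<forall>y\<in>V. deriv_bound s (f i) y C h"
    using ugevD[OF assms(3) x] .
  obtain C' h' V' where V': "C' \<ge> 0" "h' > 0" "open V'" "x \<in> V'"
    "\<forall>i\<in>I. \<forall>y\<in>V'. deriv_bound s (g i) y C' h'"
    using ugevD[OF assms(4) x] .
  show "\<exists>C\<ge>0. \<exists>h>0. \<exists>V. open V \<and> x \<in> V \<and> (\<forall>i\<in>I. \<forall>y\<in>V. deriv_bound s (\<lambda>x. f i x * g i x) y C h)"
  proof (intro exI conjI ballI)
    fix i y assume "i \<in> I" "y \<in> V \<inter> V' \<inter> U"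
    then show "deriv_bound s (\<lambda>x. f i x * g i x) y (2 * C * C') (2 * h + h')"
      using V V' assms by (intro deriv_bound_mult[OF assms(1,2)]) (auto simp: ugev_def)
  qed (use V V' x assms(2) in auto)
qed

lemma ugev_const:
  fixes U :: "'e::euclidean_space set"
  assumes "\<And>i. i \<in> I \<Longrightarrow> norm (c i) \<le> B"
  shows "ugev s I (\<lambda>i x. c i) U"
  unfolding ugev_def
proof (intro conjI ballI)
  show "smooth_on (\<lambda>x. c i) U" for i by (simp add: smooth_on_iff_smoothN smoothN_const)
next
  fix x :: 'e
  have "iter_deriv bs (\<lambda>x. c i) y = (if bs = [] then c i else 0)" for bs i and y :: 'e
    by (cases bs rule: rev_cases) (auto simp: iter_deriv_append dir_deriv_const iter_deriv_0)
  then have "deriv_bound s (\<lambda>x. c i) y (max B 0) 1" if "i \<in> I" for i and y :: 'e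
    using assms[OF that] by (auto simp: deriv_bound_def)
  then show "\<exists>C\<ge>0. \<exists>h>0. \<exists>V. open V \<and> x \<in> V \<and> (\<forall>i\<in>I. \<forall>y\<in>V. deriv_bound s (\<lambda>x. c i) y C h)"
    by (rule_tac exI[of _ "max B 0"], intro conjI, simp, rule_tac exI[of _ 1], intro conjI, simp,
        rule_tac exI[of _ UNIV]) auto
qed

lemma ugev_constant: "ugev s I (\<lambda>i x. c) U"
  by (rule ugev_const[of _ _ "norm c"]) auto

lemma ugev_sum:
  assumes "open U" "finite J" "\<And>j. j \<in> J \<Longrightarrow> ugev s I (f j) U"
  shows "ugev s I (\<lambda>i x. \<Sum>j\<in>J. f j i x) U"
  using assms(2,3) by (induction J) (auto simp: ugev_constant intro!: ugev_add[OF assms(1)])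

lemma ugev_prod:
  assumes "s \<ge> 1" "open U" "finite J" "\<And>j. j \<in> J \<Longrightarrow> ugev s I (f j) U"
  shows "ugev s I (\<lambda>i x. \<Prod>j\<in>J. f j i x) U"
  using assms(3,4) by (induction J) (auto simp: ugev_constant intro!: ugev_mult[OF assms(1,2)])

lemma ugev_cmult:
  assumes "s \<ge> 1" "open U" "ugev s I f U"
  shows "ugev s I (\<lambda>i x. c * f i x) U"
  by (rule ugev_mult[OF assms(1,2) ugev_constant assms(3)])

lemma ugev_diff:
  assumes "s \<ge> 1" "open U" "ugev s I f U" "ugev s I g U"
  shows "ugev s I (\<lambda>i x. f i x - g i x) U"
  using ugev_add[OF assms(2,3) ugev_cmult[OF assms(1,2,4), of "-1"]] by simp

text \<open>Differentiation raises the factorial by a factor N + 1 \<le> 2^N, whose s-th power goes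
  into the rate.\<close>

lemma deriv_bound_dir_deriv:
  assumes "s \<ge> 0" "deriv_bound s f y C h" "b \<in> Basis" "C \<ge> 0" "h > 0"
  shows "deriv_bound s (dir_deriv b f) y (C * h) (2 powr s * h)"
  unfolding deriv_bound_def
proof
  fix bs :: "'a list" assume bs: "bs \<in> lists Basis"
  let ?N = "length bs"
  have "norm (iter_deriv bs (dir_deriv b f) y) \<le> C * h ^ Suc ?N * fact (Suc ?N) powr s"
    using assms(2,3) bs unfolding deriv_bound_def
    by (drule_tac x = "bs @ [b]" in bspec) (auto simp: iter_deriv_append)
  also have "fact (Suc ?N) powr s \<le> (2 ^ ?N * fact ?N) powr s"
  proof (rule powr_mono2[OF assms(1)])
    have "real (Suc ?N) \<le> 2 ^ ?N"
      using less_exp[of ?N] by (metis Suc_leI of_nat_le_iff of_nat_numeral of_nat_power)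
    then show "fact (Suc ?N) \<le> 2 ^ ?N * (fact ?N :: real)"
      using mult_right_mono[of "real (Suc ?N)" "2 ^ ?N" "fact ?N"] by simp
  qed simp
  also have "(2 ^ ?N * fact ?N) powr s = (2 powr s) ^ ?N * fact ?N powr s"
    by (simp add: powr_mult powr_power powr_powr powr_realpow[symmetric] mult.commute)
  finally have "norm (iter_deriv bs (dir_deriv b f) y)
      \<le> C * h ^ Suc ?N * ((2 powr s) ^ ?N * fact ?N powr s)"
    using assms by (simp add: mult_left_mono)
  then show "norm (iter_deriv bs (dir_deriv b f) y) \<le> C * h * (2 powr s * h) ^ ?N * fact ?N powr s"
    by (simp add: power_mult_distrib algebra_simps)
qed

lemma ugev_dir_deriv:
  assumes "s \<ge> 0" "ugev s I f U" "b \<in> Basis"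
  shows "ugev s I (\<lambda>i. dir_deriv b (f i)) U"
  unfolding ugev_def
proof (intro conjI ballI)
  fix i assume "i \<in> I"
  then show "smooth_on (dir_deriv b (f i)) U"
    using assms by (auto simp: ugev_def intro: smooth_on_dir_deriv)
next
  fix x assume x: "x \<in> U"
  obtain C h V where V: "C \<ge> 0" "h > 0" "open V" "x \<in> V"
    "\<forall>i\<in>I. \<forall>y\<in>V. deriv_bound s (f i) y C h"
    using ugevD[OF assms(2) x] .
  show "\<exists>C\<ge>0. \<exists>h>0. \<exists>V. open V \<and> x \<in> V \<and> (\<forall>i\<in>I. \<forall>y\<in>V. deriv_bound s (dir_deriv b (f i)) y C h)"
  proof (intro exI conjI ballI)
    fix i y assume "i \<in> I" "y \<in> V"
    then show "deriv_bound s (dir_deriv b (f i)) y (C * h) (2 powr s * h)"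
      using V assms by (intro deriv_bound_dir_deriv) auto
  qed (use V in auto)
qed

text \<open>A nonempty list ends in a first partial derivative, so only order zero needs the
  separate local bound. The coordinate functions, whose first derivatives are constant, are obtained
  in this way.\<close>

lemma ugev_from_derivs:
  fixes f :: "'i \<Rightarrow> 'e::euclidean_space \<Rightarrow> complex"
  assumes s: "s \<ge> 0"
    and diff: "\<And>i x. i \<in> I \<Longrightarrow> x \<in> U \<Longrightarrow> f i differentiable (at x)"
    and der: "\<And>b. b \<in> Basis \<Longrightarrow> ugev s I (\<lambda>i. dir_deriv b (f i)) U"
    and bdd: "\<And>x. x \<in> U \<Longrightarrow> \<exists>B V. open V \<and> x \<in> V \<and> (\<forall>i\<in>I. \<forall>y\<in>V. norm (f i y) \<le> B)"
  shows "ugev s I f U"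
  unfolding ugev_def
proof (intro conjI ballI)
  fix i assume i: "i \<in> I"
  have "smoothN N (f i) U" for N
  proof (cases N)
    case 0
    then show ?thesis using diff i by (simp add: smoothN_0)
  next
    case (Suc M)
    then show ?thesis using diff i der by (auto simp: smoothN_Suc ugev_def smooth_on_iff_smoothN)
  qed
  then show "smooth_on (f i) U" by (simp add: smooth_on_iff_smoothN)
next
  fix x assume x: "x \<in> U"
  have "ugev s (Basis \<times> I) (\<lambda>(b, i). dir_deriv b (f i)) U"
    using ugev_finite[OF finite_Basis der] .
  then obtain C h V where V: "C \<ge> 0" "h > 0" "open V" "x \<in> V"
    "\<forall>i\<in>Basis \<times> I. \<forall>y\<in>V. deriv_bound s ((\<lambda>(b, i). dir_deriv b (f i)) i) y C h"
    using ugevD[OF _ x] by blast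
  obtain B V' where V': "open V'" "x \<in> V'" "\<forall>i\<in>I. \<forall>y\<in>V'. norm (f i y) \<le> B"
    using bdd[OF x] by blast
  let ?C = "max B C" let ?h = "max h 1"
  have "deriv_bound s (f i) y ?C ?h" if i: "i \<in> I" and y: "y \<in> V \<inter> V'" for i y
    unfolding deriv_bound_def
  proof
    fix bs :: "'e list" assume bs: "bs \<in> lists Basis"
    show "norm (iter_deriv bs (f i) y) \<le> ?C * ?h ^ length bs * fact (length bs) powr s"
    proof (cases bs rule: rev_cases)
      case Nil
      then show ?thesis using V' i y by (auto simp: le_max_iff_disj)
    next
      case (snoc ds b)
      let ?N = "length ds"
      have "norm (iter_deriv bs (f i) y) \<le> C * h ^ ?N * fact ?N powr s"
        using V(5)[rule_format, of "(b, i)" y] i y bs snoc by (auto simp: iter_deriv_append deriv_bound_def)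
      also have "\<dots> \<le> ?C * ?h ^ Suc ?N * fact (Suc ?N) powr s"
      proof (intro mult_mono powr_mono2[OF s])
        have "h ^ ?N \<le> ?h ^ ?N" using V by (intro power_mono) auto
        also have "\<dots> \<le> ?h ^ Suc ?N" by (rule power_increasing) auto
        finally show "h ^ ?N \<le> ?h ^ Suc ?N" .
        show "fact ?N \<le> (fact (Suc ?N) :: real)" by (rule fact_mono) simp
      qed (use V in auto)
      finally show ?thesis by (simp add: snoc)
    qed
  qed
  then show "\<exists>C\<ge>0. \<exists>h>0. \<exists>V. open V \<and> x \<in> V \<and> (\<forall>i\<in>I. \<forall>y\<in>V. deriv_bound s (f i) y C h)"
    using V V' by (intro exI[of _ ?C] conjI exI[of _ ?h] exI[of _ "V \<inter> V'"]) auto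
qed

lemma gev_inner: "s \<ge> 0 \<Longrightarrow> gev s (\<lambda>z. complex_of_real (z \<bullet> k)) U"
proof (rule ugev_from_derivs)
  have D: "((\<lambda>z. complex_of_real (z \<bullet> k)) has_derivative (\<lambda>v. complex_of_real (v \<bullet> k))) (at x)" for x
    by (auto intro!: derivative_eq_intros)
  then show "(\<lambda>z. complex_of_real (z \<bullet> k)) differentiable (at x)" for x
    by (auto simp: differentiable_def)
  have "dir_deriv b (\<lambda>z. complex_of_real (z \<bullet> k)) = (\<lambda>x. complex_of_real (b \<bullet> k))" for b
    using dir_deriv_eq[OF D] by blast
  then show "gev s (dir_deriv b (\<lambda>z. complex_of_real (z \<bullet> k))) U" for b
    by (simp add: ugev_constant)
  show "\<exists>B V. open V \<and> x \<in> V \<and> (\<forall>i\<in>{()}. \<forall>y\<in>V. cmod (complex_of_real (y \<bullet> k)) \<le> B)" for x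
  proof (intro exI conjI ballI)
    fix y assume "y \<in> ball x 1"
    then have "norm y \<le> norm x + 1"
      using norm_triangle_ineq2[of y x] by (auto simp: dist_norm norm_minus_commute)
    then have "norm y * norm k \<le> (norm x + 1) * norm k" by (rule mult_right_mono) simp
    then show "cmod (complex_of_real (y \<bullet> k)) \<le> (norm x + 1) * norm k"
      using Cauchy_Schwarz_ineq2[of y k] by simp
  qed auto
qed

section \<open>Gevrey maps and composition of Gevrey families\<close>

definition gev_map :: "real \<Rightarrow> ('d::euclidean_space \<Rightarrow> 'e::euclidean_space) \<Rightarrow> 'd set \<Rightarrow> bool" where
  "gev_map s \<Phi> U \<longleftrightarrow> (\<forall>k\<in>Basis. gev s (\<lambda>z. complex_of_real (\<Phi> z \<bullet> k)) U)"

lemma gev_map_smooth: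
  "gev_map s \<Phi> U \<Longrightarrow> k \<in> Basis \<Longrightarrow> smooth_on (\<lambda>z. complex_of_real (\<Phi> z \<bullet> k)) U"
  unfolding gev_map_def ugev_def by simp

lemma gev_map_differentiable:
  "gev_map s \<Phi> U \<Longrightarrow> x \<in> U \<Longrightarrow> \<Phi> differentiable (at x)"
  using differentiable_components smooth_on_imp_differentiable[OF gev_map_smooth] by blast

lemma gev_map_continuous: "gev_map s \<Phi> U \<Longrightarrow> continuous_on U \<Phi>"
  by (meson continuous_at_imp_continuous_on differentiable_imp_continuous_within gev_map_differentiable)

text \<open>With all entries of the Jacobian in one family, \<open>ugev\<close> provides the single
  pair A, b that the composition estimate takes as input.\<close>

lemma gev_map_derivs:
  assumes "s \<ge> 0" "gev_map s (\<Phi> :: 'd::euclidean_space \<Rightarrow> 'e::euclidean_space) U"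
  shows "ugev s ((Basis \<times> Basis) \<times> {()}) (\<lambda>((k, i), _). dir_deriv i (\<lambda>z. complex_of_real (\<Phi> z \<bullet> k))) U"
proof -
  have "ugev s ((Basis \<times> Basis) \<times> {()}) (\<lambda>(ki, j). (\<lambda>_. dir_deriv (snd ki) (\<lambda>z. complex_of_real (\<Phi> z \<bullet> fst ki))) j) U"
    by (rule ugev_finite) (use assms in \<open>auto simp: gev_map_def intro!: ugev_dir_deriv\<close>)
  then show ?thesis by (simp add: case_prod_unfold)
qed

lemma ugev_compose:
  fixes \<Phi> :: "'d::euclidean_space \<Rightarrow> 'e::euclidean_space"
  assumes s: "s \<ge> 1" and U: "open U" and S: "open S" and f: "ugev s I f S"
    and \<Phi>: "gev_map s \<Phi> U" "\<Phi> ` U \<subseteq> S"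
  shows "ugev s I (\<lambda>i z. f i (\<Phi> z)) U"
  unfolding ugev_def
proof (intro conjI ballI)
  fix i assume "i \<in> I"
  then show "smooth_on (\<lambda>z. f i (\<Phi> z)) U"
    using smooth_on_compose[OF U gev_map_smooth[OF \<Phi>(1)] \<Phi>(2)] f by (auto simp: ugev_def)
next
  fix x assume x: "x \<in> U"
  obtain C h V where V: "C \<ge> 0" "h > 0" "open V" "\<Phi> x \<in> V"
    "\<forall>i\<in>I. \<forall>y\<in>V. deriv_bound s (f i) y C h"
  proof -
    have "\<Phi> x \<in> S" using x \<Phi>(2) by auto
    from ugevD[OF f this] show ?thesis using that .
  qed
  obtain A b W where W: "A \<ge> 0" "b > 0" "open W" "x \<in> W"
    "\<forall>i\<in>(Basis \<times> Basis) \<times> {()}. \<forall>y\<in>W. deriv_bound s ((\<lambda>((k, i), _). dir_deriv i (\<lambda>z. complex_of_real (\<Phi> z \<bullet> k))) i) y A b"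
    using ugevD[OF gev_map_derivs[OF _ \<Phi>(1)] x] s by auto
  have op: "open (U \<inter> \<Phi> -` V)"
    by (rule continuous_open_preimage[OF gev_map_continuous[OF \<Phi>(1)] U V(3)])
  show "\<exists>C\<ge>0. \<exists>h>0. \<exists>V. open V \<and> x \<in> V \<and> (\<forall>i\<in>I. \<forall>y\<in>V. deriv_bound s (\<lambda>z. f i (\<Phi> z)) y C h)"
  proof (intro exI conjI ballI)
    fix i y assume i: "i \<in> I" and y: "y \<in> (U \<inter> \<Phi> -` V) \<inter> W"
    show "deriv_bound s (\<lambda>z. f i (\<Phi> z)) y C (2 * b + 2 * DIM('e) * A * h)"
    proof (rule deriv_bound_compose[OF s U _ gev_map_smooth[OF \<Phi>(1)] \<Phi>(2)])
      show "smooth_on (f i) S" using f i by (simp add: ugev_def)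
      show "deriv_bound s (f i) (\<Phi> y) C h" using V i y by auto
      show "deriv_bound s (dir_deriv j (\<lambda>z. complex_of_real (\<Phi> z \<bullet> k))) y A b"
        if "k \<in> Basis" "j \<in> Basis" for k j
        using W(5)[rule_format, of "((k, j), ())" y] that y by auto
    qed (use y V W in auto)
  next
    have "0 \<le> real (2 * DIM('e)) * A * h" using V W by simp
    then show "2 * b + real (2 * DIM('e)) * A * h > 0" using W by linarith
  qed (use V W op x in auto)
qed

lemma gev_map_compose:
  assumes "s \<ge> 1" "open U" "open S" "gev_map s \<Psi> S" "gev_map s \<Phi> U" "\<Phi> ` U \<subseteq> S"
  shows "gev_map s (\<lambda>z. \<Psi> (\<Phi> z)) U"
  unfolding gev_map_def
  by (intro ballI ugev_compose[OF assms(1-3) _ assms(5,6)]) (use assms(4) in \<open>auto simp: gev_map_def\<close>)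

lemma gev_map_linear:
  fixes \<Phi> :: "'d::euclidean_space \<Rightarrow> 'e::euclidean_space"
  assumes "bounded_linear \<Phi>" "s \<ge> 0"
  shows "gev_map s \<Phi> U"
  unfolding gev_map_def
proof
  fix k :: 'e
  have "\<Phi> z \<bullet> k = z \<bullet> adjoint \<Phi> k" for z
    using adjoint_works[OF bounded_linear.linear[OF assms(1)], of z k] by simp
  then show "gev s (\<lambda>z. complex_of_real (\<Phi> z \<bullet> k)) U" using gev_inner[OF assms(2)] by simp
qed

lemma gev_map_add:
  assumes "open U" "gev_map s \<Phi> U" "gev_map s \<Psi> U"
  shows "gev_map s (\<lambda>z. \<Phi> z + \<Psi> z) U"
  unfolding gev_map_def inner_add_left of_real_add
  by (intro ballI ugev_add[OF assms(1)]) (use assms in \<open>auto simp: gev_map_def\<close>)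

lemma gev_map_const: "gev_map s (\<lambda>z. c) U"
  unfolding gev_map_def by (simp add: ugev_constant)

lemma gev_map_Pair:
  assumes "gev_map s \<Phi> U" "gev_map s \<Psi> U"
  shows "gev_map s (\<lambda>z. (\<Phi> z, \<Psi> z)) U"
  using assms unfolding gev_map_def Basis_prod_def by (auto simp: ugev_constant)

section \<open>Comparison with the Gevrey norms\<close>

text \<open>The quotient of the two factorials is a multinomial coefficient. It counts the
  rearrangements of the list, and these are among the \<open>DIM('e) ^ length bs\<close> words of
  the same length in the basis vectors.\<close>

lemma fact_length_le_multi_fact:
  fixes bs :: "'e::euclidean_space list"
  assumes bs: "bs \<in> lists Basis"
  shows "fact (length bs) \<le> DIM('e) ^ length bs * multi_fact bs"
    and "multi_fact bs \<le> fact (length bs)" and "multi_fact bs > 0"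
proof -
  let ?A = "mset bs" let ?P = "\<Prod>x\<in>set_mset ?A. fact (count ?A x)"
  have sub: "set bs \<subseteq> Basis" using bs by (auto simp: in_lists_conv_set)
  have P: "?P = multi_fact bs"
    unfolding multi_fact_def
    by (rule prod.mono_neutral_cong_left) (use sub in \<open>auto simp: count_mset count_list_0_iff\<close>)
  have dvd: "multi_fact bs dvd fact (length bs)"
    using card_permutations_of_multiset(2)[of ?A] P by simp
  show pos: "multi_fact bs > 0" by (simp add: multi_fact_def prod_pos)
  show "multi_fact bs \<le> fact (length bs)" using dvd by (simp add: dvd_imp_le)
  have "card (permutations_of_multiset ?A) \<le> card {xs. set xs \<subseteq> (Basis :: 'e set) \<and> length xs = length bs}"
  proof (rule card_mono)
    show "permutations_of_multiset ?A \<subseteq> {xs. set xs \<subseteq> Basis \<and> length xs = length bs}"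
      using sub by (auto simp: permutations_of_multiset_def dest: mset_eq_setD mset_eq_length)
  qed (simp add: finite_lists_length_eq)
  also have "\<dots> = DIM('e) ^ length bs" by (simp add: card_lists_length_eq)
  finally have "fact (length bs) div multi_fact bs \<le> DIM('e) ^ length bs"
    using card_permutations_of_multiset(1)[of ?A] P by simp
  then have "(fact (length bs) div multi_fact bs) * multi_fact bs \<le> DIM('e) ^ length bs * multi_fact bs"
    by (rule mult_right_mono) simp
  with dvd show "fact (length bs) \<le> DIM('e) ^ length bs * multi_fact bs" by simp
qed

lemma gevrey_norm_le_iff:
  assumes "h > 0" "B \<ge> 0"
  shows "gevrey_norm s K h f \<le> ennreal B \<longleftrightarrow>
    (\<forall>bs\<in>lists Basis. \<forall>x\<in>K. norm (iter_deriv bs f x) \<le> B * (h ^ length bs * real (multi_fact bs) powr s))"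
proof -
  have "0 < h ^ length bs * real (multi_fact bs) powr s" for bs :: "'a list"
    using assms by (simp add: multi_fact_def prod_pos)
  then show ?thesis
    unfolding gevrey_norm_def SUP_le_iff using assms
    by (simp add: ennreal_le_iff pos_divide_le_eq)
qed

lemma deriv_bound_of_gevrey_norm:
  assumes "s \<ge> 0" "h > 0" "B \<ge> 0" "gevrey_norm s K h f \<le> ennreal B" "x \<in> K"
  shows "deriv_bound s f x B h"
  unfolding deriv_bound_def
proof
  fix bs :: "'a list" assume bs: "bs \<in> lists Basis"
  then have "norm (iter_deriv bs f x) \<le> B * (h ^ length bs * real (multi_fact bs) powr s)"
    using assms gevrey_norm_le_iff by blast
  moreover have "real (multi_fact bs) powr s \<le> real (fact (length bs)) powr s"
    using fact_length_le_multi_fact[OF bs] assms by (intro powr_mono2) (auto simp del: of_nat_fact)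
  then have "B * h ^ length bs * real (multi_fact bs) powr s \<le> B * h ^ length bs * fact (length bs) powr s"
    using assms by (intro mult_left_mono) auto
  ultimately show "norm (iter_deriv bs f x) \<le> B * h ^ length bs * fact (length bs) powr s"
    by (simp add: mult.assoc)
qed

text \<open>The multinomial coefficient costs a factor \<open>DIM('e) powr s\<close> in the rate;
  this is harmless because the Gevrey spaces and their topology run over all rates.\<close>

lemma gevrey_norm_le_of_deriv_bound:
  fixes f :: "'e::euclidean_space \<Rightarrow> complex"
  assumes "s \<ge> 0" "h > 0" "B \<ge> 0" "\<And>x. x \<in> K \<Longrightarrow> deriv_bound s f x B h"
  shows "gevrey_norm s K (h * DIM('e) powr s) f \<le> ennreal B"
proof -
  have "norm (iter_deriv bs f x) \<le> B * ((h * DIM('e) powr s) ^ length bs * real (multi_fact bs) powr s)"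
    if bs: "bs \<in> lists Basis" and x: "x \<in> K" for bs x
  proof -
    have "norm (iter_deriv bs f x) \<le> B * h ^ length bs * fact (length bs) powr s"
      using assms(4)[OF x] bs by (auto simp: deriv_bound_def)
    moreover have "fact (length bs) powr s \<le> real (DIM('e) ^ length bs * multi_fact bs) powr s"
    proof (rule powr_mono2[OF assms(1)])
      have "real (fact (length bs)) \<le> real (DIM('e) ^ length bs * multi_fact bs)"
        using fact_length_le_multi_fact(1)[OF bs] of_nat_le_iff by blast
      then show "fact (length bs) \<le> real (DIM('e) ^ length bs * multi_fact bs)" by simp
    qed simp
    moreover have "real (DIM('e) ^ length bs * multi_fact bs) powr s
        = (DIM('e) powr s) ^ length bs * real (multi_fact bs) powr s"
      by (simp add: powr_mult powr_power powr_powr powr_realpow[symmetric] mult.commute)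
    ultimately have "norm (iter_deriv bs f x)
        \<le> B * h ^ length bs * ((DIM('e) powr s) ^ length bs * real (multi_fact bs) powr s)"
      using assms mult_left_mono[of "fact (length bs) powr s" _ "B * h ^ length bs"]
      by (smt (verit, best) mult_nonneg_nonneg zero_le_power)
    then show ?thesis by (simp add: power_mult_distrib algebra_simps)
  qed
  then show ?thesis using assms by (subst gevrey_norm_le_iff) auto
qed

text \<open>Small closed balls are compact, which gives local constants; conversely local constants
  can be made uniform on a compact set by a finite cover.\<close>

lemma gevrey_on_iff_gev:
  fixes f :: "'e::euclidean_space \<Rightarrow> complex"
  assumes "s \<ge> 0" "open S"
  shows "gevrey_on s f S \<longleftrightarrow> gev s f S"
proof
  assume f: "gevrey_on s f S"
  show "gev s f S"
    unfolding ugev_def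
  proof (intro conjI ballI)
    show "smooth_on f S" using f by (simp add: gevrey_on_def)
    fix x assume "x \<in> S"
    then obtain e where e: "e > 0" "cball x e \<subseteq> S" using assms(2) open_contains_cball by blast
    then obtain h where h: "h > 0" "gevrey_norm s (cball x e) h f < \<infinity>"
      using f compact_cball unfolding gevrey_on_def by metis
    then obtain B where B: "B \<ge> 0" "gevrey_norm s (cball x e) h f = ennreal B"
      by (metis ennreal_cases infinity_ennreal_def less_irrefl)
    show "\<exists>C\<ge>0. \<exists>h>0. \<exists>V. open V \<and> x \<in> V \<and> (\<forall>i\<in>{()}. \<forall>y\<in>V. deriv_bound s f y C h)"
      using B h e assms
      by (intro exI[of _ B] conjI exI[of _ h] exI[of _ "ball x e"])
        (auto intro!: deriv_bound_of_gevrey_norm[where K = "cball x e"])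
  qed
next
  assume f: "gev s f S"
  show "gevrey_on s f S"
    unfolding gevrey_on_def
  proof (intro conjI allI impI)
    show "smooth_on f S" using f by (simp add: ugev_def)
    fix K assume "compact K" "K \<subseteq> S"
    then obtain C h where C: "C \<ge> 0" "h > 0" "\<forall>i\<in>{()}. \<forall>y\<in>K. deriv_bound s f y C h"
      using ugev_compact[OF f] by metis
    have "gevrey_norm s K (h * DIM('e) powr s) f \<le> ennreal C"
      by (rule gevrey_norm_le_of_deriv_bound) (use C assms in auto)
    then show "\<exists>h>0. gevrey_norm s K h f < \<infinity>"
      using C by (intro exI[of _ "h * DIM('e) powr s"]) (auto simp: top.not_eq_extremum[symmetric] top_unique)
  qed
qed

section \<open>Real-analytic maps are Gevrey\<close>

text \<open>The k-th derivative of t^m. The falling factorial is written as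
  \<open>fact k * real (m choose k)\<close>, so that it vanishes by itself for k > m.\<close>

definition power_deriv :: "nat \<Rightarrow> nat \<Rightarrow> real \<Rightarrow> real" where
  "power_deriv m k t = fact k * real (m choose k) * t ^ (m - k)"

lemma has_derivative_power_deriv:
  "(power_deriv m k has_real_derivative power_deriv m (Suc k) t) (at t)"
proof -
  have "(power_deriv m k has_real_derivative fact k * real (m choose k) * (real (m - k) * t ^ (m - k - 1))) (at t)"
    unfolding power_deriv_def by (auto intro!: derivative_eq_intros)
  moreover have c: "real (m choose k) * real (m - k) = real (Suc k) * real (m choose Suc k)"
    by (metis binomial_absorb_comp mult.commute of_nat_mult binomial_absorption diff_Suc_Suc
        Suc_times_binomial_add binomial_eq_0_iff not_less_eq times_binomial_minus1_eq choose_one)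
  have "fact k * real (m choose k) * (real (m - k) * t ^ (m - k - 1))
      = fact k * (real (m choose k) * real (m - k)) * t ^ (m - Suc k)" by simp
  also have "\<dots> = power_deriv m (Suc k) t" unfolding c by (simp add: power_deriv_def)
  ultimately show ?thesis by simp
qed

text \<open>A Cauchy estimate by the binomial theorem:
  \<open>(m choose k) * (R - R') ^ k * R' ^ (m - k)\<close> is one of the nonnegative terms in the
  expansion of R^m = ((R - R') + R')^m.\<close>

lemma abs_power_deriv_le:
  assumes "\<bar>t\<bar> \<le> R'" "R' < R"
  shows "\<bar>power_deriv m k t\<bar> \<le> fact k * R ^ m / (R - R') ^ k"
proof (cases "k \<le> m")
  case True
  have "real (m choose k) * (R - R') ^ k * R' ^ (m - k)
      \<le> (\<Sum>j\<le>m. real (m choose j) * (R - R') ^ j * R' ^ (m - j))"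
    by (rule member_le_sum[of k _ "\<lambda>j. real (m choose j) * (R - R') ^ j * R' ^ (m - j)"])
      (use assms True in auto)
  also have "\<dots> = R ^ m" using binomial_ring[of "R - R'" R' m] by simp
  finally have "real (m choose k) * R' ^ (m - k) \<le> R ^ m / (R - R') ^ k"
    using assms by (simp add: pos_le_divide_eq algebra_simps)
  moreover have "real (m choose k) * \<bar>t\<bar> ^ (m - k) \<le> real (m choose k) * R' ^ (m - k)"
    using assms by (intro mult_left_mono power_mono) auto
  ultimately have "fact k * (real (m choose k) * \<bar>t\<bar> ^ (m - k)) \<le> fact k * (R ^ m / (R - R') ^ k)"
    by (intro mult_left_mono) auto
  then show ?thesis by (simp add: power_deriv_def abs_mult power_abs algebra_simps)
next
  case False
  then have "real (m choose k) = 0" by (simp only: of_nat_eq_0_iff binomial_eq_0)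
  then have "power_deriv m k t = 0" by (simp only: power_deriv_def mult_zero_left mult_zero_right)
  then show ?thesis using assms by simp
qed

text \<open>A power series in several variables, enumerated as an ordinary series: \<alpha> n is the
  n-th exponent and c n its coefficient. Absolute convergence at the corner of the cube of radius R
  controls all derivatives on the smaller cube of radius R'.\<close>

locale power_series_at =
  fixes a :: "real^'n" and \<alpha> :: "nat \<Rightarrow> 'n \<Rightarrow> nat" and c :: "nat \<Rightarrow> complex" and R R' :: real
  assumes R': "0 < R'" "R' < R"
    and summ: "summable (\<lambda>n. R ^ (\<Sum>i\<in>UNIV. \<alpha> n i) * norm (c n))"
begin

text \<open>Short for monomial: the partial derivative of order k of the n-th monomial centred at
  a.\<close>

definition mono :: "('n \<Rightarrow> nat) \<Rightarrow> nat \<Rightarrow> real^'n \<Rightarrow> real" where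
  "mono k n x = (\<Prod>i\<in>UNIV. power_deriv (\<alpha> n i) (k i) (x $ i - a $ i))"

definition series :: "('n \<Rightarrow> nat) \<Rightarrow> real^'n \<Rightarrow> complex" where
  "series k x = (\<Sum>n. mono k n x *\<^sub>R c n)"

definition cube :: "(real^'n) set" where
  "cube = box (a - vec R') (a + vec R')"

lemma mem_cube: "x \<in> cube \<longleftrightarrow> (\<forall>i. \<bar>x $ i - a $ i\<bar> < R')"
  by (auto simp: cube_def mem_box_cart abs_diff_less_iff algebra_simps)

text \<open>The loss at order k when \<open>abs_power_deriv_le\<close> is applied in every
  coordinate.\<close>

definition const :: "('n \<Rightarrow> nat) \<Rightarrow> real" where
  "const k = (\<Prod>i\<in>UNIV. fact (k i)) / (R - R') ^ (\<Sum>i\<in>UNIV. k i)"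

lemma norm_mono_le:
  assumes "x \<in> cube"
  shows "norm (mono k n x *\<^sub>R c n) \<le> const k * (R ^ (\<Sum>i\<in>UNIV. \<alpha> n i) * norm (c n))"
proof -
  have "\<bar>mono k n x\<bar> \<le> (\<Prod>i\<in>UNIV. fact (k i) * R ^ \<alpha> n i / (R - R') ^ k i)"
    unfolding mono_def abs_prod
    by (rule prod_mono) (use assms R' in \<open>auto intro!: abs_power_deriv_le simp: mem_cube less_imp_le\<close>)
  also have "\<dots> = const k * R ^ (\<Sum>i\<in>UNIV. \<alpha> n i)"
    by (simp add: const_def prod_dividef prod.distrib power_sum)
  finally have "\<bar>mono k n x\<bar> * norm (c n) \<le> const k * R ^ (\<Sum>i\<in>UNIV. \<alpha> n i) * norm (c n)"
    by (rule mult_right_mono) simp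
  then show ?thesis by (simp add: mult.assoc)
qed

lemma summable_mono:
  assumes "x \<in> cube"
  shows "summable (\<lambda>n. mono k n x *\<^sub>R c n)"
  by (rule summable_comparison_test[OF _ summable_mult[OF summ, of "const k"]])
    (use norm_mono_le[OF assms] in blast)

lemma norm_series_tail_le:
  assumes "x \<in> cube"
  shows "norm (series k x - (\<Sum>n<N. mono k n x *\<^sub>R c n))
     \<le> const k * (\<Sum>n. R ^ (\<Sum>i\<in>UNIV. \<alpha> (n + N) i) * norm (c (n + N)))"
proof -
  let ?b = "\<lambda>n. R ^ (\<Sum>i\<in>UNIV. \<alpha> n i) * norm (c n)"
  have "series k x - (\<Sum>n<N. mono k n x *\<^sub>R c n) = (\<Sum>n. mono k (n + N) x *\<^sub>R c (n + N))"
    using suminf_minus_initial_segment[OF summable_mono[OF assms], of k N] by (simp add: series_def)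
  also have "norm \<dots> \<le> (\<Sum>n. const k * ?b (n + N))"
    by (rule norm_suminf_le)
      (use norm_mono_le[OF assms] summable_mult[OF summable_ignore_initial_segment[OF summ], of "const k"] in auto)
  also have "\<dots> = const k * (\<Sum>n. ?b (n + N))"
    by (rule suminf_mult) (rule summable_ignore_initial_segment[OF summ])
  finally show ?thesis .
qed

lemma norm_series_le:
  "x \<in> cube \<Longrightarrow> norm (series k x) \<le> const k * (\<Sum>n. R ^ (\<Sum>i\<in>UNIV. \<alpha> n i) * norm (c n))"
  using norm_series_tail_le[of x k 0] by simp

lemma has_derivative_mono:
  "(mono k n has_derivative (\<lambda>h. \<Sum>i\<in>UNIV. h $ i * mono (k(i := Suc (k i))) n x)) (at x within S)"
proof -
  have "((\<lambda>x. power_deriv (\<alpha> n i) (k i) (x $ i - a $ i)) has_derivative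
      (\<lambda>h. h $ i * power_deriv (\<alpha> n i) (Suc (k i)) (x $ i - a $ i))) (at x within S)" for i
  proof -
    have "((\<lambda>x. x $ i - a $ i) has_derivative (\<lambda>h. h $ i)) (at x within S)"
      by (auto intro!: derivative_eq_intros bounded_linear.has_derivative[OF bounded_linear_vec_nth])
    from has_derivative_compose[OF this has_derivative_power_deriv[of "\<alpha> n i" "k i", unfolded has_field_derivative_def]]
    show ?thesis by (simp add: mult.commute)
  qed
  then have "(mono k n has_derivative
      (\<lambda>h. \<Sum>i\<in>UNIV. h $ i * power_deriv (\<alpha> n i) (Suc (k i)) (x $ i - a $ i) *
        (\<Prod>j\<in>UNIV - {i}. power_deriv (\<alpha> n j) (k j) (x $ j - a $ j)))) (at x within S)"
    unfolding mono_def by (rule has_derivative_prod)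
  moreover have "power_deriv (\<alpha> n i) (Suc (k i)) (x $ i - a $ i) *
        (\<Prod>j\<in>UNIV - {i}. power_deriv (\<alpha> n j) (k j) (x $ j - a $ j)) = mono (k(i := Suc (k i))) n x" for i
    unfolding mono_def by (subst prod.remove[of UNIV i]) (auto intro!: prod.cong)
  ultimately show ?thesis by (simp add: mult.assoc)
qed

text \<open>Termwise differentiation requires the differentiated partial sums to converge uniformly
  on the cube. The tail bound gives this: it is independent of the point, and it tends to zero as a
  tail of the convergent majorant.\<close>

lemma has_derivative_series_cube:
  assumes x: "x \<in> cube"
  shows "(series k has_derivative (\<lambda>h. \<Sum>i\<in>UNIV. h $ i *\<^sub>R series (k(i := Suc (k i))) x)) (at x)"
proof -
  let ?k = "\<lambda>i. k(i := Suc (k i))"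
  let ?f' = "\<lambda>n x h. (\<Sum>i\<in>UNIV. h $ i * mono (?k i) n x) *\<^sub>R c n"
  let ?g' = "\<lambda>x h. \<Sum>i\<in>UNIV. h $ i *\<^sub>R series (?k i) x"
  let ?b = "\<lambda>n. R ^ (\<Sum>i\<in>UNIV. \<alpha> n i) * norm (c n)"
  let ?T = "\<lambda>N. \<Sum>n. ?b (n + N)"
  let ?Q = "\<Sum>i\<in>UNIV. const (?k i)"
  have Tnn: "?T N \<ge> 0" for N
    using R' by (intro suminf_nonneg summable_ignore_initial_segment[OF summ]) auto
  have "\<exists>g. \<forall>x\<in>cube. (\<lambda>n. mono k n x *\<^sub>R c n) sums g x \<and> (g has_derivative ?g' x) (at x within cube)"
  proof (rule has_derivative_series[OF _ _ _ x])
    show "convex cube" by (simp add: cube_def convex_box)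
    show "((\<lambda>x. mono k n x *\<^sub>R c n) has_derivative ?f' n x) (at x within cube)" for n x
      by (rule has_derivative_scaleR_left[OF has_derivative_mono])
    show "(\<lambda>n. mono k n x *\<^sub>R c n) sums series k x"
      using summable_mono[OF x] by (simp add: series_def summable_sums)
    have bound: "norm ((\<Sum>n<N. ?f' n x h) - ?g' x h) \<le> ?Q * ?T N * norm h" if "x \<in> cube" for N x h
    proof -
      have "(\<Sum>n<N. ?f' n x h) = (\<Sum>i\<in>UNIV. h $ i *\<^sub>R (\<Sum>n<N. mono (?k i) n x *\<^sub>R c n))"
        by (simp add: scaleR_sum_left scaleR_sum_right sum.swap[of _ "{..<N}"])
      then have "norm ((\<Sum>n<N. ?f' n x h) - ?g' x h)
          = norm (\<Sum>i\<in>UNIV. h $ i *\<^sub>R ((\<Sum>n<N. mono (?k i) n x *\<^sub>R c n) - series (?k i) x))"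
        by (simp add: sum_subtractf scaleR_diff_right)
      also have "\<dots> \<le> (\<Sum>i\<in>UNIV. norm h * (const (?k i) * ?T N))"
      proof (rule sum_norm_le)
        fix i
        have "norm ((\<Sum>n<N. mono (?k i) n x *\<^sub>R c n) - series (?k i) x) \<le> const (?k i) * ?T N"
          using norm_series_tail_le[OF that, of "?k i" N] by (simp add: norm_minus_commute)
        moreover have "\<bar>h $ i\<bar> \<le> norm h" by (rule component_le_norm_cart)
        ultimately show "norm (h $ i *\<^sub>R ((\<Sum>n<N. mono (?k i) n x *\<^sub>R c n) - series (?k i) x))
            \<le> norm h * (const (?k i) * ?T N)"
          by (simp add: mult_mono)
      qed
      also have "\<dots> = ?Q * ?T N * norm h"
        by (simp add: sum_distrib_right sum_distrib_left algebra_simps)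
      finally show ?thesis .
    qed
    have "(\<lambda>N. ?Q * ?T N) \<longlonglongrightarrow> ?Q * 0"
      by (intro tendsto_intros suminf_exist_split2 summ)
    fix e :: real assume "e > 0"
    then have "\<forall>\<^sub>F N in sequentially. ?Q * ?T N < e"
      using order_tendstoD(2)[OF \<open>(\<lambda>N. ?Q * ?T N) \<longlonglongrightarrow> ?Q * 0\<close>] by simp
    then show "\<forall>\<^sub>F N in sequentially. \<forall>x\<in>cube. \<forall>h. norm ((\<Sum>n<N. ?f' n x h) - ?g' x h) \<le> e * norm h"
    proof eventually_elim
      case (elim N)
      have "?Q * ?T N * norm h \<le> e * norm h" for h :: "real^'n"
        using elim by (intro mult_right_mono) auto
      then show ?case using bound order_trans by blast
    qed
  qed
  then obtain g where g: "\<And>x. x \<in> cube \<Longrightarrow> (\<lambda>n. mono k n x *\<^sub>R c n) sums g x"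
    "\<And>x. x \<in> cube \<Longrightarrow> (g has_derivative ?g' x) (at x within cube)"
    by blast
  have op: "open cube" by (simp add: cube_def open_box)
  have "(g has_derivative ?g' x) (at x)" using g(2)[OF x] at_within_open[OF x op] by simp
  then show ?thesis
    by (rule has_derivative_transform_within_open[OF _ op x]) (use g(1) in \<open>simp add: series_def sums_iff\<close>)
qed

lemma iter_deriv_series:
  assumes "bs \<in> lists Basis" "x \<in> cube" "\<And>x. x \<in> cube \<Longrightarrow> f x = series (\<lambda>_. 0) x"
  shows "iter_deriv bs f x = series (\<lambda>i. count_list bs (axis i 1)) x"
  using assms(1,2)
proof (induction bs arbitrary: x)
  case (Cons b bs)
  then obtain i where i: "b = axis i 1" by (auto simp: Basis_vec_def)
  let ?k = "\<lambda>i. count_list bs (axis i 1 :: real^'n)"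
  have op: "open cube" by (simp add: cube_def open_box)
  have "iter_deriv (b # bs) f x = dir_deriv b (series ?k) x"
    by (simp, rule dir_deriv_cong[OF op]) (use Cons in auto)
  also have "\<dots> = (\<Sum>j\<in>UNIV. b $ j *\<^sub>R series (?k(j := Suc (?k j))) x)"
    using dir_deriv_eq[OF has_derivative_series_cube[OF Cons.prems(1)]] by simp
  also have "\<dots> = (\<Sum>j\<in>UNIV. if j = i then series (?k(j := Suc (?k j))) x else 0)"
    by (intro sum.cong) (auto simp: i axis_def)
  also have "\<dots> = series (?k(i := Suc (?k i))) x" by simp
  also have "?k(i := Suc (?k i)) = (\<lambda>j. count_list (b # bs) (axis j 1))"
    by (auto simp: i fun_eq_iff axis_eq_axis)
  finally show ?case .
qed (use assms(3) in simp)

text \<open>The loss at the order encoded by bs is \<open>multi_fact bs\<close> over a power of R -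
  R'. Now \<open>multi_fact bs\<close> is at most \<open>fact (length bs)\<close>, and this is at
  most its own s-th power because s \<ge> 1.\<close>

lemma deriv_bound_series:
  assumes "s \<ge> 1" "x \<in> cube" "\<And>x. x \<in> cube \<Longrightarrow> f x = series (\<lambda>_. 0) x"
  shows "deriv_bound s f x (\<Sum>n. R ^ (\<Sum>i\<in>UNIV. \<alpha> n i) * norm (c n)) (1 / (R - R'))"
  unfolding deriv_bound_def
proof
  fix bs :: "(real^'n) list" assume bs: "bs \<in> lists Basis"
  let ?M = "\<Sum>n. R ^ (\<Sum>i\<in>UNIV. \<alpha> n i) * norm (c n)"
  let ?k = "\<lambda>i. count_list bs (axis i 1 :: real^'n)"
  have Mnn: "?M \<ge> 0" using R' by (intro suminf_nonneg summ) auto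
  have bij: "bij_betw (\<lambda>i. axis i 1 :: real^'n) UNIV Basis"
    by (auto simp: bij_betw_def inj_on_def axis_eq_axis Basis_vec_def)
  have "(\<Sum>i\<in>UNIV. ?k i) = (\<Sum>b\<in>Basis. count_list bs b)"
    by (rule sum.reindex_bij_betw[OF bij])
  also have "\<dots> = length bs"
    using bs by (intro sum_count_set) (auto simp: in_lists_conv_set)
  finally have len: "(\<Sum>i\<in>UNIV. ?k i) = length bs" .
  have "(\<Prod>i\<in>UNIV. fact (?k i)) = multi_fact bs"
    unfolding multi_fact_def by (rule prod.reindex_bij_betw[OF bij])
  then have "(\<Prod>i\<in>UNIV. fact (?k i)) = real (multi_fact bs)"
    by (metis (mono_tags, lifting) of_nat_fact of_nat_prod prod.cong)
  then have "const ?k = real (multi_fact bs) * (1 / (R - R')) ^ length bs"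
    by (simp add: const_def len power_one_over)
  also have "\<dots> \<le> fact (length bs) powr s * (1 / (R - R')) ^ length bs"
  proof (rule mult_right_mono)
    have "real (multi_fact bs) \<le> fact (length bs)"
      using fact_length_le_multi_fact(2)[OF bs] by (metis of_nat_fact of_nat_le_iff)
    also have "\<dots> = fact (length bs) powr 1" by simp
    also have "\<dots> \<le> fact (length bs) powr s" by (rule powr_mono) (use assms in auto)
    finally show "real (multi_fact bs) \<le> fact (length bs) powr s" .
  qed (use R' in simp)
  finally have "const ?k * ?M \<le> fact (length bs) powr s * (1 / (R - R')) ^ length bs * ?M"
    by (rule mult_right_mono[OF _ Mnn])
  then show "norm (iter_deriv bs f x) \<le> ?M * (1 / (R - R')) ^ length bs * fact (length bs) powr s"
    using norm_series_le[OF assms(2), of ?k] iter_deriv_series[OF bs assms(2,3)]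
    by (simp add: algebra_simps)
qed

lemma smooth_on_series:
  assumes "\<And>x. x \<in> cube \<Longrightarrow> f x = series (\<lambda>_. 0) x"
  shows "smooth_on f cube"
  unfolding smooth_on_def
proof (intro ballI)
  fix bs :: "(real^'n) list" and x assume bs: "bs \<in> lists Basis" and x: "x \<in> cube"
  have op: "open cube" by (simp add: cube_def open_box)
  show "iter_deriv bs f differentiable (at x)"
  proof (rule differentiable_cong_open[OF op x])
    show "iter_deriv bs f y = series (\<lambda>i. count_list bs (axis i 1)) y" if "y \<in> cube" for y
      by (rule iter_deriv_series[OF bs that assms])
  qed (use has_derivative_series_cube[OF x] in \<open>auto simp: differentiable_def\<close>)
qed

end

lemma real_analytic_imp_gev:
  fixes f :: "real^'n \<Rightarrow> complex"
  assumes f: "real_analytic_on f S" and s: "s \<ge> 1"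
  shows "gev s f S"
proof (rule ugev_local)
  fix a assume "a \<in> S"
  then obtain r c where r: "r > 0" and c: "\<And>x. x \<in> ball a r \<Longrightarrow>
      ((\<lambda>\<alpha>. (\<Prod>i\<in>UNIV. (x $ i - a $ i) ^ \<alpha> i) *\<^sub>R c \<alpha>) has_sum f x) UNIV"
    using f unfolding real_analytic_on_def by blast
  \<comment> \<open>Comparison with the sum of the absolute values of the coordinates shows that the
    closed cube of radius R lies in the ball of radius r.\<close>
  define R where "R = r / (2 * CARD('n))"
  have R: "R > 0" using r by (simp add: R_def)
  have in_ball: "x \<in> ball a r" if "\<And>i. \<bar>x $ i - a $ i\<bar> \<le> R" for x
  proof -
    have "norm (x - a) \<le> (\<Sum>i\<in>UNIV. \<bar>(x - a) $ i\<bar>)" by (rule norm_le_l1_cart)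
    also have "\<dots> \<le> (\<Sum>i\<in>(UNIV::'n set). R)" using that by (intro sum_mono) auto
    also have "\<dots> = r / 2" by (simp add: R_def)
    finally show ?thesis using r by (simp add: dist_norm norm_minus_commute)
  qed
  define \<alpha> where "\<alpha> = (from_nat_into UNIV :: nat \<Rightarrow> 'n \<Rightarrow> nat)"
  have "infinite (UNIV :: ('n \<Rightarrow> nat) set)" by (simp add: infinite_UNIV_char_0 finite_UNIV_fun)
  then have bij: "bij_betw \<alpha> UNIV UNIV"
    unfolding \<alpha>_def by (intro bij_betw_from_nat_into) auto
  \<comment> \<open>At the corner of the cube the monomial of exponent \<alpha> has the value
    R^|\<alpha>|. The series converges unconditionally there, and for complex terms this is absolute
    convergence.\<close>
  have "((\<lambda>\<alpha>. R ^ (\<Sum>i\<in>UNIV. \<alpha> i) *\<^sub>R c \<alpha>) summable_on UNIV)"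
    using c[of "\<chi> i. a $ i + R"] in_ball[of "\<chi> i. a $ i + R"] R
    by (auto simp: power_sum summable_on_def)
  then have "(\<lambda>\<alpha>. norm (R ^ (\<Sum>i\<in>UNIV. \<alpha> i) *\<^sub>R c \<alpha>)) summable_on UNIV"
    by (rule iffD1[OF summable_on_iff_abs_summable_on_complex])
  then have "(\<lambda>n. norm (R ^ (\<Sum>i\<in>UNIV. \<alpha> n i) *\<^sub>R c (\<alpha> n))) summable_on UNIV"
    using summable_on_reindex_bij_betw[OF bij, of "\<lambda>\<alpha>. norm (R ^ (\<Sum>i\<in>UNIV. \<alpha> i) *\<^sub>R c \<alpha>)"] by simp
  then have "summable (\<lambda>n. norm (R ^ (\<Sum>i\<in>UNIV. \<alpha> n i) *\<^sub>R c (\<alpha> n)))"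
    by (rule summable_on_imp_summable)
  then interpret power_series_at a \<alpha> "\<lambda>n. c (\<alpha> n)" R "R / 2"
    using R by unfold_locales (auto simp: power_abs)
  have op: "open cube" by (simp add: cube_def open_box)
  have ac: "a \<in> cube" using R by (simp add: mem_cube)
  have eq: "f x = series (\<lambda>_. 0) x" if "x \<in> cube" for x
  proof -
    have "\<bar>x $ i - a $ i\<bar> \<le> R" for i
    proof -
      have "\<bar>x $ i - a $ i\<bar> < R / 2" using that mem_cube by blast
      then show ?thesis using R by simp
    qed
    then have "x \<in> ball a r" by (rule in_ball)
    from has_sum_imp_sums[OF has_sum_reindex_bij_betw[OF bij, THEN iffD2, OF c[OF this]]]
    show ?thesis by (simp add: series_def mono_def power_deriv_def sums_iff)
  qed
  have nn: "(\<Sum>n. R ^ (\<Sum>i\<in>UNIV. \<alpha> n i) * cmod (c (\<alpha> n))) \<ge> 0"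
    using R by (intro suminf_nonneg summ) auto
  have "gev s f cube"
    unfolding ugev_def
    using smooth_on_series[OF eq] deriv_bound_series[OF s _ eq] R nn op
    by (intro conjI ballI exI[of _ "\<Sum>n. R ^ (\<Sum>i\<in>UNIV. \<alpha> n i) * norm (c (\<alpha> n))"] exI[of _ "1 / (R - R / 2)"]
        exI[of _ cube]) auto
  then show "\<exists>V. open V \<and> a \<in> V \<and> gev s f V" using op ac by blast
qed

lemma real_analytic_imp_gev_map:
  fixes \<Phi> :: "real^'n \<Rightarrow> 'e::euclidean_space"
  assumes \<Phi>: "real_analytic_on \<Phi> S" and s: "s \<ge> 1"
  shows "gev_map s \<Phi> S"
  unfolding gev_map_def
proof
  fix k :: 'e
  have lin: "bounded_linear (\<lambda>v :: 'e. complex_of_real (v \<bullet> k))"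
    by (rule bounded_linear_compose[OF bounded_linear_of_real bounded_linear_inner_left[of k]])
  have "real_analytic_on (\<lambda>z. complex_of_real (\<Phi> z \<bullet> k)) S"
    unfolding real_analytic_on_def
  proof
    fix a assume "a \<in> S"
    then obtain r c where r: "r > 0" and c: "\<And>x. x \<in> ball a r \<Longrightarrow>
        ((\<lambda>\<alpha>. (\<Prod>i\<in>UNIV. (x $ i - a $ i) ^ \<alpha> i) *\<^sub>R c \<alpha>) has_sum \<Phi> x) UNIV"
      using \<Phi> unfolding real_analytic_on_def by blast
    have "((\<lambda>\<alpha>. (\<Prod>i\<in>UNIV. (x $ i - a $ i) ^ \<alpha> i) *\<^sub>R complex_of_real (c \<alpha> \<bullet> k))
        has_sum complex_of_real (\<Phi> x \<bullet> k)) UNIV" if "x \<in> ball a r" for x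
      using has_sum_bounded_linear[OF lin c[OF that]] by (simp add: o_def scaleR_conv_of_real)
    then show "\<exists>r>0. \<exists>c. \<forall>x\<in>ball a r. ((\<lambda>\<alpha>. (\<Prod>i\<in>UNIV. (x $ i - a $ i) ^ \<alpha> i) *\<^sub>R c \<alpha>)
        has_sum complex_of_real (\<Phi> x \<bullet> k)) UNIV"
      using r by (intro exI[of _ r] conjI exI[of _ "\<lambda>\<alpha>. complex_of_real (c \<alpha> \<bullet> k)"]) auto
  qed
  then show "gev s (\<lambda>z. complex_of_real (\<Phi> z \<bullet> k)) S" by (rule real_analytic_imp_gev[OF _ s])
qed

section \<open>Gevrey cutoff functions\<close>

text \<open>The only basis vector of the real line is 1, so a list carries no information besides
  its length.\<close>

lemma iter_deriv_real_line:
  fixes f :: "nat \<Rightarrow> real \<Rightarrow> complex"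
  assumes S: "open S" and f: "\<And>N x. x \<in> S \<Longrightarrow> (f N has_vector_derivative f (Suc N) x) (at x)"
  shows "smooth_on (f 0) S"
    and "bs \<in> lists Basis \<Longrightarrow> x \<in> S \<Longrightarrow> iter_deriv bs (f 0) x = f (length bs) x"
proof -
  have *: "iter_deriv bs (f 0) x = f (length bs) x" if "bs \<in> lists Basis" "x \<in> S" for bs x
    using that
  proof (induction bs arbitrary: x)
    case (Cons b bs)
    have "iter_deriv (b # bs) (f 0) x = dir_deriv b (f (length bs)) x"
      by (simp, rule dir_deriv_cong[OF S]) (use Cons in auto)
    also have "\<dots> = f (Suc (length bs)) x"
      using dir_deriv_eq[OF f[OF Cons.prems(1), unfolded has_vector_derivative_def]] Cons.hyps by simp
    finally show ?case by simp
  qed simp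
  then show "bs \<in> lists Basis \<Longrightarrow> x \<in> S \<Longrightarrow> iter_deriv bs (f 0) x = f (length bs) x" .
  show "smooth_on (f 0) S"
    unfolding smooth_on_def
  proof (intro ballI)
    fix bs :: "real list" and x assume bs: "bs \<in> lists Basis" and x: "x \<in> S"
    show "iter_deriv bs (f 0) differentiable (at x)"
    proof (rule differentiable_cong_open[OF S x])
      show "iter_deriv bs (f 0) y = f (length bs) y" if "y \<in> S" for y by (rule *[OF bs that])
    qed (use f[OF x] in \<open>auto simp: has_vector_derivative_def differentiable_def\<close>)
  qed
qed

text \<open>Serves to divide by a positive Gevrey function when the cutoff is normalised. The N-th
  derivative is N! / y^(N+1) in absolute value, and y > x / 2 near x.\<close>

lemma gev_inverse:
  assumes s: "s \<ge> 1"
  shows "gev s (\<lambda>t::real. complex_of_real (1 / t)) {0<..}"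
proof -
  define f where "f N t = complex_of_real ((-1) ^ N * fact N * inverse t ^ Suc N)" for N and t :: real
  have "(f N has_vector_derivative f (Suc N) t) (at t)" if "t > 0" for N t
  proof -
    have "((\<lambda>t. (-1) ^ N * fact N * inverse t ^ Suc N) has_real_derivative
        (-1) ^ Suc N * fact (Suc N) * inverse t ^ Suc (Suc N)) (at t)"
      using DERIV_cmult[OF DERIV_power_Suc[OF DERIV_inverse[of t UNIV]], of "(-1) ^ N * fact N" N] that
      by (simp add: algebra_simps)
    then show ?thesis unfolding f_def by (intro has_vector_derivative_of_real) (simp add: has_real_derivative_iff_has_vector_derivative)
  qed
  then have f: "smooth_on (f 0) {0<..}"
    "\<And>bs x. bs \<in> lists Basis \<Longrightarrow> x > 0 \<Longrightarrow> iter_deriv bs (f 0) x = f (length bs) x"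
    using iter_deriv_real_line[of "{0<..}" f] by auto
  have f0: "f 0 = (\<lambda>t. complex_of_real (1 / t))" by (simp add: f_def fun_eq_iff divide_inverse)
  show ?thesis
    unfolding ugev_def f0[symmetric]
  proof (intro conjI ballI)
    fix x :: real assume x: "x \<in> {0<..}"
    show "\<exists>C\<ge>0. \<exists>h>0. \<exists>V. open V \<and> x \<in> V \<and> (\<forall>i\<in>{()}. \<forall>y\<in>V. deriv_bound s (f 0) y C h)"
    proof (intro exI conjI ballI)
      fix y assume y: "y \<in> {x / 2<..}"
      show "deriv_bound s (f 0) y (2 / x) (2 / x)"
        unfolding deriv_bound_def
      proof
        fix bs :: "real list" assume bs: "bs \<in> lists Basis"
        let ?N = "length bs"
        have y0: "y > 0" using x y by (simp add: field_simps)
        have "norm (iter_deriv bs (f 0) y) = fact ?N * (1 / y) ^ Suc ?N"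
          using f(2)[OF bs y0] y0 by (simp add: f_def norm_mult norm_power norm_inverse divide_inverse)
        also have "\<dots> \<le> fact ?N powr s * (2 / x) ^ Suc ?N"
        proof (intro mult_mono power_mono)
          show "1 / y \<le> 2 / x" using x y y0 by (simp add: field_simps)
          have "fact ?N = (fact ?N :: real) powr 1" by simp
          also have "\<dots> \<le> fact ?N powr s" by (rule powr_mono) (use s in auto)
          finally show "(fact ?N :: real) \<le> fact ?N powr s" .
        qed (use y0 in auto)
        finally show "norm (iter_deriv bs (f 0) y) \<le> 2 / x * (2 / x) ^ ?N * fact ?N powr s"
          by (simp add: algebra_simps)
      qed
    qed (use x in auto)
  qed (use f(1) in simp)
qed

lemma exp_minus_le:
  fixes y :: real
  assumes "y > 0"
  shows "exp (- y) \<le> fact N / y ^ N"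
proof -
  have "(\<Sum>n\<in>{N}. y ^ n /\<^sub>R fact n) \<le> (\<Sum>n. y ^ n /\<^sub>R fact n)"
    by (rule sum_le_suminf) (use summable_exp_generic[of y] assms in auto)
  then have "y ^ N / fact N \<le> exp y" by (simp add: exp_def divide_inverse mult.commute)
  then show ?thesis using assms by (simp add: exp_minus field_simps)
qed

lemma power_powr_commute:
  fixes y b :: real
  assumes "y > 0"
  shows "(y ^ N) powr b = (y powr b) ^ N"
proof -
  have "(y ^ N) powr b = y powr (real N * b)"
    using assms by (simp add: powr_powr flip: powr_realpow)
  also have "\<dots> = (y powr b) ^ N" using assms by (simp add: powr_power mult.commute)
  finally show ?thesis .
qed

text \<open>The classical flat function exp(-x^(-a)) has Gevrey order 1 + 1/a, which is s for a =
  1/(s - 1). Its derivatives at x > 0 are estimated by Cauchy's inequality on a complex disc of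
  radius proportional to x.\<close>

locale gevrey_bump =
  fixes a :: real
  assumes a: "a > 0"
begin

definition bump :: "complex \<Rightarrow> complex" where
  "bump z = exp (- (z powr (- of_real a)))"

lemma bump_holomorphic: "bump holomorphic_on {z. Re z > 0}"
  unfolding bump_def
  by (intro holomorphic_intros) (auto simp: complex_nonpos_Reals_iff)

text \<open>The power function is 1 at the point 1, so continuity keeps its real part above one half
  on a small disc. By homogeneity the same c serves every disc of radius c x about x > 0: the
  exponent keeps at least half of its size there.\<close>

lemma Re_powr_near_1: "\<exists>c. 0 < c \<and> c < 1 \<and> (\<forall>w. norm (w - 1) \<le> c \<longrightarrow> Re (w powr (- of_real a)) \<ge> 1 / 2)"
proof -
  have "isCont (\<lambda>w. Re (w powr (- of_real a))) 1"
  proof -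
    have "(\<lambda>w. w powr (- complex_of_real a)) holomorphic_on {z. Re z > 0}"
      by (intro holomorphic_intros) (auto simp: complex_nonpos_Reals_iff)
    then have "isCont (\<lambda>w. w powr (- complex_of_real a)) 1"
      using continuous_on_eq_continuous_at[OF open_halfspace_Re_gt[of 0]] holomorphic_on_imp_continuous_on
      by (metis mem_Collect_eq one_complex.sel(1) zero_less_one)
    then show ?thesis by (rule isCont_Re)
  qed
  then obtain d where d: "d > 0"
    "\<And>w. dist w 1 < d \<Longrightarrow> dist (Re (w powr (- of_real a))) (Re (1 powr (- of_real a))) < 1/2"
    unfolding continuous_at_eps_delta by (metis half_gt_zero zero_less_one)
  show ?thesis
  proof (intro exI[of _ "min (d / 2) (1 / 2)"] conjI allI impI)
    fix w :: complex assume "norm (w - 1) \<le> min (d / 2) (1 / 2)"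
    then have "dist w 1 < d" using d by (simp add: dist_norm)
    from d(2)[OF this] show "Re (w powr (- of_real a)) \<ge> 1 / 2"
      by (simp add: dist_real_def abs_if split: if_splits)
  qed (use d in auto)
qed

definition c :: real where
  "c = (SOME c. 0 < c \<and> c < 1 \<and> (\<forall>w. norm (w - 1) \<le> c \<longrightarrow> Re (w powr (- of_real a)) \<ge> 1 / 2))"

lemma c: "0 < c" "c < 1" "\<And>w. norm (w - 1) \<le> c \<Longrightarrow> Re (w powr (- of_real a)) \<ge> 1 / 2"
  using someI_ex[OF Re_powr_near_1] unfolding c_def by auto

lemma Re_pos_near:
  assumes "x > 0" "dist (of_real x) w \<le> c * x"
  shows "Re w > 0"
proof -
  have "\<bar>x - Re w\<bar> \<le> c * x"
    using assms abs_Re_le_cmod[of "of_real x - w"] by (simp add: dist_norm)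
  moreover have "c * x < x" using c assms by simp
  ultimately show ?thesis by linarith
qed

lemma norm_bump_le:
  assumes x: "x > 0" and w: "dist (of_real x) w \<le> c * x"
  shows "norm (bump w) \<le> exp (- (x powr (- a)) / 2)"
proof -
  define v where "v = w / of_real x"
  have v: "w = of_real x * v" "v \<noteq> 0" using x Re_pos_near[OF x w] by (auto simp: v_def)
  have "norm (v - 1) = dist (of_real x) w / x"
  proof -
    have "v - 1 = (w - of_real x) / of_real x" using x by (simp add: v_def diff_divide_distrib)
    then show ?thesis using x by (simp add: norm_divide dist_norm norm_minus_commute)
  qed
  then have "norm (v - 1) \<le> c" using w x by (simp add: pos_divide_le_eq)
  note Re = c(3)[OF this]
  have "w powr (- of_real a) = exp (- of_real a * (of_real (ln x) + Ln v))"
    using v x by (simp add: powr_def Ln_times_of_real Ln_of_real)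
  also have "\<dots> = of_real (x powr (- a)) * v powr (- of_real a)"
    using v x by (simp add: powr_def exp_add[symmetric] exp_of_real[symmetric] algebra_simps)
  finally have "Re (w powr (- of_real a)) = x powr (- a) * Re (v powr (- of_real a))" by simp
  also have "\<dots> \<ge> x powr (- a) * (1 / 2)" by (rule mult_left_mono[OF Re]) simp
  finally show ?thesis by (simp add: bump_def)
qed

lemma norm_deriv_bump_le:
  assumes x: "x > 0"
  shows "norm ((deriv ^^ N) bump (of_real x)) \<le> fact N * exp (- (x powr (- a)) / 2) / (c * x) ^ N"
proof (rule Cauchy_inequality)
  have sub: "cball (of_real x) (c * x) \<subseteq> {z. Re z > 0}" using Re_pos_near[OF x] by auto
  show "bump holomorphic_on ball (of_real x) (c * x)"
    by (rule holomorphic_on_subset[OF bump_holomorphic]) (use sub ball_subset_cball in blast)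
  show "continuous_on (cball (of_real x) (c * x)) bump"
    by (rule holomorphic_on_imp_continuous_on[OF holomorphic_on_subset[OF bump_holomorphic sub]])
  show "norm (bump w) \<le> exp (- (x powr (- a)) / 2)" if "norm (of_real x - w) = c * x" for w
    using norm_bump_le[OF x, of w] that by (simp add: dist_norm)
qed (use c x in auto)

definition L :: real where "L = (2 / a) powr (1 / a)"

text \<open>Take exp(-y) \<le> N! / y^N with y = (a/2) x^(-a) and raise it to the power 1/a. The
  left side becomes exp(-x^(-a)/2) and y^(1/a) becomes 1 / (L x); this is the origin of L.\<close>

lemma exp_decay:
  assumes x: "x > 0"
  shows "exp (- (x powr (- a)) / 2) / x ^ N \<le> L ^ N * fact N powr (1 / a)"
proof -
  let ?y = "a / 2 * x powr (- a)"
  have y: "?y > 0" using a x by simp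
  have "exp (- ?y) \<le> fact N / ?y ^ N" by (rule exp_minus_le[OF y])
  then have "exp (- ?y) powr (1 / a) \<le> (fact N / ?y ^ N) powr (1 / a)"
    by (rule powr_mono2[rotated 2]) (use a in auto)
  moreover have "exp (- ?y) powr (1 / a) = exp (- (x powr (- a)) / 2)"
    using a by (simp add: powr_def)
  moreover have "(?y ^ N) powr (1 / a) = (?y powr (1 / a)) ^ N"
    by (rule power_powr_commute[OF y])
  moreover have "?y powr (1 / a) = 1 / (L * x)"
    using a x by (simp add: L_def powr_mult powr_powr powr_divide powr_minus field_simps)
  ultimately have "exp (- (x powr (- a)) / 2) \<le> fact N powr (1 / a) / (1 / (L * x)) ^ N"
    using y by (simp only: powr_divide)
  also have "\<dots> = L ^ N * fact N powr (1 / a) * x ^ N"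
    by (simp add: power_one_over power_mult_distrib)
  finally show ?thesis using x by (simp add: pos_divide_le_eq)
qed

definition bump_deriv :: "nat \<Rightarrow> real \<Rightarrow> complex" where
  "bump_deriv N x = (if x > 0 then (deriv ^^ N) bump (of_real x) else 0)"

lemma norm_bump_deriv_le:
  "norm (bump_deriv N x) \<le> (L / c) ^ N * fact N powr (1 + 1 / a)"
proof (cases "x > 0")
  case x: True
  have "norm (bump_deriv N x) \<le> fact N / c ^ N * (exp (- (x powr (- a)) / 2) / x ^ N)"
    using norm_deriv_bump_le[OF x, of N] x by (simp add: bump_deriv_def power_mult_distrib field_simps)
  also have "\<dots> \<le> fact N / c ^ N * (L ^ N * fact N powr (1 / a))"
    by (intro mult_left_mono exp_decay[OF x]) (use c in auto)
  also have "\<dots> = (L / c) ^ N * fact N powr (1 + 1 / a)"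
    by (simp add: powr_add power_divide)
  finally show ?thesis .
next
  case False
  then show ?thesis using c a by (simp add: bump_deriv_def L_def)
qed

text \<open>Spending two powers of \<open>x\<close> from the exponential decay gives differentiability at \<open>0\<close>.\<close>

lemma norm_bump_deriv_le_square:
  "norm (bump_deriv N x) \<le> fact N / c ^ N * (L ^ (N + 2) * fact (N + 2) powr (1 / a)) * x\<^sup>2"
proof (cases "x > 0")
  case x: True
  have "exp (- (x powr (- a)) / 2) / x ^ N = exp (- (x powr (- a)) / 2) / x ^ (N + 2) * x\<^sup>2"
    using x by (simp add: power_add power2_eq_square)
  moreover have "norm (bump_deriv N x) \<le> fact N / c ^ N * (exp (- (x powr (- a)) / 2) / x ^ N)"
    using norm_deriv_bump_le[OF x, of N] x by (simp add: bump_deriv_def power_mult_distrib field_simps)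
  ultimately have "norm (bump_deriv N x) \<le> fact N / c ^ N * (exp (- (x powr (- a)) / 2) / x ^ (N + 2)) * x\<^sup>2"
    by (simp only: mult.assoc)
  also have "\<dots> \<le> fact N / c ^ N * (L ^ (N + 2) * fact (N + 2) powr (1 / a)) * x\<^sup>2"
    by (intro mult_left_mono mult_right_mono exp_decay[OF x]) (use c in auto)
  finally show ?thesis .
next
  case False
  then show ?thesis using c a by (simp add: bump_deriv_def L_def)
qed

lemma has_vector_derivative_bump_deriv:
  "(bump_deriv N has_vector_derivative bump_deriv (Suc N) x) (at x)"
proof -
  consider "x > 0" | "x < 0" | "x = 0" by linarith
  then show ?thesis
  proof cases
    case 1
    have op: "open {z. Re z > 0}" by (simp add: open_halfspace_Re_gt)
    have "(deriv ^^ N) bump holomorphic_on {z. Re z > 0}"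
      by (rule holomorphic_higher_deriv[OF bump_holomorphic op])
    then have "((deriv ^^ N) bump has_field_derivative (deriv ^^ Suc N) bump (of_real x)) (at (of_real x))"
      using holomorphic_derivI[OF _ op, of "(deriv ^^ N) bump" "of_real x"] 1 by simp
    from has_vector_derivative_real_field[OF this]
    have "((\<lambda>x. (deriv ^^ N) bump (of_real x)) has_vector_derivative bump_deriv (Suc N) x) (at x)"
      using 1 by (simp add: bump_deriv_def)
    then show ?thesis
      by (rule has_vector_derivative_transform_within_open[of _ _ _ "{0<..}"]) (use 1 in \<open>auto simp: bump_deriv_def\<close>)
  next
    case 2
    have "((\<lambda>_. 0) has_vector_derivative bump_deriv (Suc N) x) (at x)"
      using 2 by (simp add: bump_deriv_def)
    then show ?thesis
      by (rule has_vector_derivative_transform_within_open[of _ _ _ "{..<0}"]) (use 2 in \<open>auto simp: bump_deriv_def\<close>)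
  next
    case 3
    define K where "K = fact N / c ^ N * (L ^ (N + 2) * fact (N + 2) powr (1 / a))"
    have "(bump_deriv N has_derivative (\<lambda>_. 0)) (at 0)"
    proof (rule has_derivativeI_sandwich[of 1 _ _ _ _ "\<lambda>y. K * \<bar>y\<bar>"])
      show "norm (bump_deriv N y - bump_deriv N 0 - 0) / norm (y - 0) \<le> K * \<bar>y\<bar>" if "y \<noteq> 0" for y
      proof -
        have "norm (bump_deriv N y) \<le> K * y\<^sup>2" unfolding K_def by (rule norm_bump_deriv_le_square)
        moreover have "bump_deriv N 0 = 0" by (simp add: bump_deriv_def)
        ultimately show ?thesis using that by (simp add: pos_divide_le_eq power2_eq_square mult.assoc)
      qed
      have "((\<lambda>y. K * \<bar>y\<bar>) \<longlongrightarrow> K * \<bar>0\<bar>) (at (0::real))" by (intro tendsto_intros)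
      then show "((\<lambda>y. K * \<bar>y\<bar>) \<longlongrightarrow> 0) (at (0::real))" by simp
    qed auto
    then show ?thesis by (simp add: 3 has_vector_derivative_def bump_deriv_def)
  qed
qed

lemma gev_bump_deriv: "gev (1 + 1 / a) (bump_deriv 0) U"
proof -
  note * = iter_deriv_real_line[of UNIV bump_deriv, OF open_UNIV has_vector_derivative_bump_deriv]
  have Lc: "L / c > 0" using c a by (simp add: L_def)
  have "deriv_bound (1 + 1 / a) (bump_deriv 0) y 1 (L / c)" for y
    using norm_bump_deriv_le *(2) by (simp add: deriv_bound_def)
  then have "gev (1 + 1 / a) (bump_deriv 0) UNIV"
    unfolding ugev_def using *(1) Lc
    by (intro conjI ballI exI[of _ "1::real"] exI[of _ "L / c"] exI[of _ UNIV]) auto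
  then show ?thesis by (rule ugev_subset) auto
qed

lemma bump_deriv_0: "bump_deriv 0 x = of_real (if x > 0 then exp (- (x powr (- a))) else 0)"
proof -
  have "complex_of_real x powr (- of_real a) = of_real (x powr (- a))" if "x > 0"
    using that powr_of_real[of x "- a"] by simp
  then show ?thesis by (simp add: bump_deriv_def bump_def exp_of_real[symmetric])
qed

end

lemma gevrey_cutoff:
  assumes s: "s > 1"
  shows "\<exists>\<kappa> :: real \<Rightarrow> complex. gev s \<kappa> UNIV \<and> (\<forall>x\<le>0. \<kappa> x = 0) \<and> (\<forall>x\<ge>1. \<kappa> x = 1)"
proof -
  interpret gevrey_bump "1 / (s - 1)" using s by unfold_locales simp
  define b where "b x = (if x > 0 then exp (- (x powr (- (1 / (s - 1))))) else 0)" for x :: real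
  have s1: "s \<ge> 1" "s \<ge> 0" using s by auto
  have gb: "gev s (\<lambda>x. complex_of_real (b x)) UNIV"
  proof -
    have "bump_deriv 0 = (\<lambda>x. complex_of_real (b x))" by (simp add: fun_eq_iff bump_deriv_0 b_def)
    then show ?thesis using gev_bump_deriv[of UNIV] by simp
  qed
  have rfl: "gev_map s (\<lambda>x::real. 1 - x) UNIV"
    using gev_map_add[OF open_UNIV gev_map_const[of s 1 UNIV] gev_map_linear[OF bounded_linear_minus[OF bounded_linear_ident] s1(2)]]
    by simp
  have gb1: "gev s (\<lambda>x. complex_of_real (b (1 - x))) UNIV"
    by (rule ugev_compose[OF s1(1) open_UNIV open_UNIV gb rfl]) auto
  \<comment> \<open>At least one of x and 1 - x is positive, so the quotient b(x) / (b(x) + b(1 -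
    x)) is defined everywhere. It is 0 for x \<le> 0 and 1 for x \<ge> 1.\<close>
  have pos: "b x + b (1 - x) > 0" for x
    by (auto simp: b_def intro: add_pos_pos)
  have sum: "gev_map s (\<lambda>x. b x + b (1 - x)) UNIV"
    using ugev_add[OF open_UNIV gb gb1] by (simp add: gev_map_def)
  have inv: "gev s (\<lambda>x. complex_of_real (1 / (b x + b (1 - x)))) UNIV"
    by (rule ugev_compose[OF s1(1) open_UNIV open_greaterThan gev_inverse[OF s1(1)] sum]) (use pos in auto)
  show ?thesis
  proof (intro exI conjI)
    show "gev s (\<lambda>x. complex_of_real (b x) * complex_of_real (1 / (b x + b (1 - x)))) UNIV"
      by (rule ugev_mult[OF s1(1) open_UNIV gb inv])
    show "\<forall>x\<ge>1. complex_of_real (b x) * complex_of_real (1 / (b x + b (1 - x))) = 1"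
    proof (intro allI impI)
      fix x :: real assume "x \<ge> 1"
      then have "b (1 - x) = 0" "b x > 0" by (auto simp: b_def)
      then show "complex_of_real (b x) * complex_of_real (1 / (b x + b (1 - x))) = 1" by simp
    qed
  qed (auto simp: b_def)
qed

lemma gevrey_box_cutoff:
  fixes q :: "real^'n"
  assumes s: "s > 1" and r: "r > 0"
  shows "\<exists>\<kappa> :: real^'n \<Rightarrow> complex. gev s \<kappa> UNIV \<and>
    (\<forall>t. (\<forall>i. \<bar>t $ i - q $ i\<bar> \<le> r) \<longrightarrow> \<kappa> t = 1) \<and> (\<forall>t i. \<bar>t $ i - q $ i\<bar> \<ge> 2 * r \<longrightarrow> \<kappa> t = 0)"
proof -
  obtain \<kappa> :: "real \<Rightarrow> complex" where \<kappa>: "gev s \<kappa> UNIV" "\<forall>x\<le>0. \<kappa> x = 0" "\<forall>x\<ge>1. \<kappa> x = 1"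
    using gevrey_cutoff[OF s] by blast
  have s1: "s \<ge> 1" "s \<ge> 0" using s by auto
  \<comment> \<open>For \<tau> = (t_i - q_i) / r the product of the values of \<kappa> at 2 + \<tau>
    and 2 - \<tau> is 1 if |\<tau>| \<le> 1 and 0 if |\<tau>| \<ge> 2.\<close>
  define f where "f t = (\<Prod>i\<in>UNIV. \<kappa> (2 + (t $ i - q $ i) / r) * \<kappa> (2 - (t $ i - q $ i) / r))" for t
  have aff: "gev s (\<lambda>t :: real^'n. \<kappa> (c + d * t $ i)) UNIV" for c d i
  proof (rule ugev_compose[OF s1(1) open_UNIV open_UNIV \<kappa>(1)])
    have "bounded_linear (\<lambda>t :: real^'n. d * t $ i)"
      by (intro bounded_linear_const_mult bounded_linear_vec_nth)
    from gev_map_add[OF open_UNIV gev_map_const gev_map_linear[OF this s1(2)]]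
    show "gev_map s (\<lambda>t. c + d * t $ i) UNIV" .
  qed auto
  have "gev s f UNIV"
    unfolding f_def
  proof (rule ugev_prod[OF s1(1) open_UNIV finite], rule ugev_mult[OF s1(1) open_UNIV])
    fix i
    show "gev s (\<lambda>t. \<kappa> (2 + (t $ i - q $ i) / r)) UNIV"
      using aff[of "2 - q $ i / r" "1 / r" i] by (simp add: diff_divide_distrib algebra_simps)
    show "gev s (\<lambda>t. \<kappa> (2 - (t $ i - q $ i) / r)) UNIV"
      using aff[of "2 + q $ i / r" "- 1 / r" i] by (simp add: diff_divide_distrib algebra_simps)
  qed
  moreover have "f t = 1" if "\<And>i. \<bar>t $ i - q $ i\<bar> \<le> r" for t
  proof -
    have "(t $ i - q $ i) / r \<ge> -1 \<and> (t $ i - q $ i) / r \<le> 1" for i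
      using that[of i] r by (simp add: abs_le_iff field_simps)
    then have "\<kappa> (2 + (t $ i - q $ i) / r) = 1" "\<kappa> (2 - (t $ i - q $ i) / r) = 1" for i
      by (intro \<kappa>(3)[rule_format]; smt (verit))+
    then show ?thesis by (simp add: f_def)
  qed
  moreover have "f t = 0" if "\<bar>t $ i - q $ i\<bar> \<ge> 2 * r" for t i
  proof -
    have "(t $ i - q $ i) / r \<ge> 2 \<or> (t $ i - q $ i) / r \<le> -2"
      using that r by (auto simp: abs_if field_simps split: if_splits)
    then have "\<kappa> (2 + (t $ i - q $ i) / r) = 0 \<or> \<kappa> (2 - (t $ i - q $ i) / r) = 0"
      using \<kappa>(2)[rule_format, of "2 + (t $ i - q $ i) / r"] \<kappa>(2)[rule_format, of "2 - (t $ i - q $ i) / r"] by linarith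
    then show ?thesis unfolding f_def by (intro prod_zero) auto
  qed
  ultimately show ?thesis by blast
qed

section \<open>Parameter integrals and line integrals\<close>

lemma smooth_on_iter_deriv: "smooth_on f S \<Longrightarrow> bs \<in> lists Basis \<Longrightarrow> smooth_on (iter_deriv bs f) S"
proof (induction bs)
  case (Cons b bs)
  then show ?case using smooth_on_dir_deriv[of "iter_deriv bs f" S b] by auto
qed simp

lemma smooth_on_imp_continuous_on: "smooth_on f S \<Longrightarrow> continuous_on S f"
  by (meson continuous_at_imp_continuous_on differentiable_imp_continuous_within smooth_on_imp_differentiable)

text \<open>Differentiability at a point is two-sided, so the integrand has to live on an open set W
  that contains the closed interval of integration times U.\<close>

context
  fixes W :: "(real \<times> 'e::euclidean_space) set" and U :: "'e set"
  assumes W: "open W" "{0..1} \<times> U \<subseteq> W" and U: "open U"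
begin

lemma continuous_on_slice:
  assumes "continuous_on W g" "y \<in> U"
  shows "continuous_on {0..1} (\<lambda>r. g (r, y))"
  by (rule continuous_on_compose2[OF assms(1)]) (use W assms(2) in \<open>auto intro!: continuous_intros\<close>)

lemma has_derivative_parameter_integral:
  assumes g: "smooth_on g W" and y: "y \<in> U"
  shows "((\<lambda>y. integral {0..1} (\<lambda>r. g (r, y))) has_derivative
      (\<lambda>h. integral {0..1} (\<lambda>r. dir_deriv (0, h) g (r, y)))) (at y)"
proof -
  obtain e where e: "e > 0" "ball y e \<subseteq> U" using U y open_contains_ball by blast
  define D where "D = (\<lambda>y r. Blinfun (\<lambda>h. dir_deriv (0, h) g (r, y)))"
  have der: "((\<lambda>y. g (r, y)) has_derivative (\<lambda>h. dir_deriv (0, h) g (r, z))) (at z)"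
    if "z \<in> ball y e" "r \<in> {0..1}" for r z
  proof -
    have "z \<in> U" using that e by blast
    then have "(r, z) \<in> W" using that(2) W(2) by blast
    then have "(g has_derivative (\<lambda>v. dir_deriv v g (r, z))) (at (r, z))"
      by (intro has_derivative_dir_deriv smooth_on_imp_differentiable[OF g])
    moreover have "((\<lambda>y. (r, y)) has_derivative (\<lambda>h. (0, h))) (at z)"
      by (auto intro!: derivative_eq_intros)
    ultimately show ?thesis using has_derivative_compose[of "\<lambda>y. (r, y)" "\<lambda>h. (0, h)" z UNIV g] by simp
  qed
  have D: "blinfun_apply (D z r) = (\<lambda>h. dir_deriv (0, h) g (r, z))"
    if "z \<in> ball y e" "r \<in> {0..1}" for r z
    unfolding D_def
    by (rule bounded_linear_Blinfun_apply) (use der[OF that] has_derivative_bounded_linear in blast)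
  \<comment> \<open>The Leibniz rule asks for continuity of the derivative as a bounded linear map;
    in finite dimension it can be checked on the basis vectors.\<close>
  have cont: "continuous_on (ball y e \<times> cbox 0 1) (\<lambda>(z, r). D z r)"
  proof (rule continuous_on_blinfun_componentwise)
    fix b :: 'e assume b: "b \<in> Basis"
    have "(0, b) \<in> (Basis :: (real \<times> 'e) set)" using b by (auto simp: Basis_prod_def)
    then have c: "continuous_on W (dir_deriv (0, b) g)"
      by (intro smooth_on_imp_continuous_on smooth_on_dir_deriv g)
    have "continuous_on (ball y e \<times> cbox 0 1) (\<lambda>p. dir_deriv (0, b) g (snd p, fst p))"
    proof (rule continuous_on_compose2[OF c])
      show "(\<lambda>p. (snd p, fst p)) ` (ball y e \<times> cbox 0 1) \<subseteq> W"
        using W(2) e(2) by (force simp del: mem_ball)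
    qed (auto intro!: continuous_intros)
    then show "continuous_on (ball y e \<times> cbox 0 1) (\<lambda>p. blinfun_apply ((\<lambda>(z, r). D z r) p) b)"
      by (rule continuous_on_eq) (auto simp: D)
  qed
  have "((\<lambda>y. integral (cbox 0 1) (\<lambda>r. g (r, y))) has_derivative
      blinfun_apply (integral (cbox 0 1) (D y))) (at y within ball y e)"
  proof (rule leibniz_rule[OF _ _ cont])
    show "((\<lambda>y. g (r, y)) has_derivative blinfun_apply (D z r)) (at z within ball y e)"
      if "z \<in> ball y e" "r \<in> cbox 0 1" for z r
      using der[of z r] D[of z r] that by (auto intro: has_derivative_at_withinI)
    show "(\<lambda>r. g (r, z)) integrable_on cbox 0 1" if "z \<in> ball y e" for z
      using continuous_on_slice[OF smooth_on_imp_continuous_on[OF g], of z] that e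
      by (auto intro!: integrable_continuous_real)
  qed (use e in auto)
  moreover have "blinfun_apply (integral (cbox 0 1) (D y)) h = integral {0..1} (\<lambda>r. dir_deriv (0, h) g (r, y))" for h
  proof -
    have "continuous_on (cbox 0 1) (\<lambda>r. (\<lambda>(z, r). D z r) (y, r))"
      by (rule continuous_on_compose2[OF cont]) (use e in \<open>auto intro!: continuous_intros\<close>)
    then have "D y integrable_on cbox 0 1" by (simp add: integrable_continuous_real)
    then have "blinfun_apply (integral (cbox 0 1) (D y)) h = integral (cbox 0 1) (\<lambda>r. blinfun_apply (D y r) h)"
      by (rule blinfun_apply_integral)
    also have "\<dots> = integral (cbox 0 1) (\<lambda>r. dir_deriv (0, h) g (r, y))"
      by (rule integral_cong) (use D e in auto)
    finally show ?thesis by simp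
  qed
  then have "blinfun_apply (integral (cbox 0 1) (D y)) = (\<lambda>h. integral {0..1} (\<lambda>r. dir_deriv (0, h) g (r, y)))"
    by blast
  ultimately show ?thesis using e at_within_open[of y "ball y e"] by simp
qed

lemma iter_deriv_parameter_integral:
  assumes g: "smooth_on g W" and bs: "bs \<in> lists Basis" and y: "y \<in> U"
  shows "iter_deriv bs (\<lambda>y. integral {0..1} (\<lambda>r. g (r, y))) y
      = integral {0..1} (\<lambda>r. iter_deriv (map (Pair 0) bs) g (r, y))"
    and "map (Pair 0) bs \<in> lists (Basis :: (real \<times> 'e) set)"
proof -
  have bs': "map (Pair 0) bs \<in> lists (Basis :: (real \<times> 'e) set)" if "bs \<in> lists (Basis :: 'e set)" for bs
    using that by (induction bs) (auto simp: Basis_prod_def)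
  then show "map (Pair 0) bs \<in> lists (Basis :: (real \<times> 'e) set)" using bs .
  show "iter_deriv bs (\<lambda>y. integral {0..1} (\<lambda>r. g (r, y))) y
      = integral {0..1} (\<lambda>r. iter_deriv (map (Pair 0) bs) g (r, y))"
    using bs y
  proof (induction bs arbitrary: y)
    case (Cons b bs)
    let ?g = "iter_deriv (map (Pair 0) bs) g"
    have "iter_deriv (b # bs) (\<lambda>y. integral {0..1} (\<lambda>r. g (r, y))) y
        = dir_deriv b (\<lambda>y. integral {0..1} (\<lambda>r. ?g (r, y))) y"
      by (simp, rule dir_deriv_cong[OF U]) (use Cons in auto)
    also have "\<dots> = integral {0..1} (\<lambda>r. dir_deriv (0, b) ?g (r, y))"
      by (rule dir_deriv_eq[OF has_derivative_parameter_integral])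
        (use Cons bs' in \<open>auto intro!: smooth_on_iter_deriv[OF g]\<close>)
    finally show ?case by simp
  qed simp
qed

text \<open>The constants are uniform on the compact product of [0, 1] with a closed ball, and
  integration over an interval of length 1 preserves them.\<close>

lemma ugev_parameter_integral:
  assumes f: "ugev s I f W"
  shows "ugev s I (\<lambda>i y. integral {0..1} (\<lambda>r. f i (r, y))) U"
  unfolding ugev_def
proof (intro conjI ballI)
  fix i assume i: "i \<in> I"
  have g: "smooth_on (f i) W" using f i by (simp add: ugev_def)
  show "smooth_on (\<lambda>y. integral {0..1} (\<lambda>r. f i (r, y))) U"
    unfolding smooth_on_def
  proof (intro ballI)
    fix bs :: "'e list" and y assume bs: "bs \<in> lists Basis" and y: "y \<in> U"
    note it = iter_deriv_parameter_integral[OF g bs]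
    show "iter_deriv bs (\<lambda>y. integral {0..1} (\<lambda>r. f i (r, y))) differentiable (at y)"
    proof (rule differentiable_cong_open[OF U y it(1)])
      show "(\<lambda>y. integral {0..1} (\<lambda>r. iter_deriv (map (Pair 0) bs) (f i) (r, y))) differentiable (at y)"
        using has_derivative_parameter_integral[OF smooth_on_iter_deriv[OF g it(2)[OF y]] y]
        by (auto simp: differentiable_def)
    qed
  qed
next
  fix y assume y: "y \<in> U"
  obtain e where e: "e > 0" "cball y e \<subseteq> U" using U y open_contains_cball by blast
  have "compact ({0..1::real} \<times> cball y e)" by (intro compact_Times) auto
  then obtain C h where C: "C \<ge> 0" "h > 0"
    "\<forall>i\<in>I. \<forall>z\<in>{0..1} \<times> cball y e. deriv_bound s (f i) z C h"
  proof (rule ugev_compact[OF f])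
    show "{0..1} \<times> cball y e \<subseteq> W" using e W(2) by blast
  qed blast
  show "\<exists>C\<ge>0. \<exists>h>0. \<exists>V. open V \<and> y \<in> V \<and>
      (\<forall>i\<in>I. \<forall>z\<in>V. deriv_bound s (\<lambda>y. integral {0..1} (\<lambda>r. f i (r, y))) z C h)"
  proof (intro exI conjI ballI)
    fix i z assume i: "i \<in> I" and z: "z \<in> ball y e"
    have g: "smooth_on (f i) W" using f i by (simp add: ugev_def)
    have zU: "z \<in> U" using z e by auto
    show "deriv_bound s (\<lambda>y. integral {0..1} (\<lambda>r. f i (r, y))) z C h"
      unfolding deriv_bound_def
    proof
      fix bs :: "'e list" assume bs: "bs \<in> lists Basis"
      note it = iter_deriv_parameter_integral[OF g bs zU]
      have "norm (integral {0..1} (\<lambda>r. iter_deriv (map (Pair 0) bs) (f i) (r, z)))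
          \<le> (C * h ^ length bs * fact (length bs) powr s) * (1 - 0)"
      proof (rule integral_bound)
        show "continuous_on {0..1} (\<lambda>r. iter_deriv (map (Pair 0) bs) (f i) (r, z))"
          by (intro continuous_on_slice smooth_on_imp_continuous_on smooth_on_iter_deriv g it zU)
        show "norm (iter_deriv (map (Pair 0) bs) (f i) (r, z)) \<le> C * h ^ length bs * fact (length bs) powr s"
          if "r \<in> {0..1}" for r
        proof -
          have "deriv_bound s (f i) (r, z) C h" using C(3) i that z by auto
          then show ?thesis using it(2) unfolding deriv_bound_def by (metis length_map)
        qed
      qed simp
      then show "norm (iter_deriv bs (\<lambda>y. integral {0..1} (\<lambda>r. f i (r, y))) z) \<le> C * h ^ length bs * fact (length bs) powr s"
        using it(1) by simp
    qed
  qed (use C e in auto)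
qed

end

section \<open>The homotopy operator along segments from a centre\<close>

definition line_point :: "'n::euclidean_space \<Rightarrow> real \<times> 'n \<times> 'x \<Rightarrow> 'n \<times> 'x" where
  "line_point q z = (q + fst z *\<^sub>R (fst (snd z) - q), snd (snd z))"

text \<open>The one-form with coefficients \<open>h b\<close>, pulled back to the segment from q to
  t, with x as a parameter; arguments are ordered as (r, t, x). Its integral over r is the homotopy
  operator of the Poincare lemma in degree one.\<close>

definition line_integrand ::
    "'n::euclidean_space \<Rightarrow> ('n \<Rightarrow> 'n \<times> 'x \<Rightarrow> complex) \<Rightarrow> real \<times> 'n \<times> 'x \<Rightarrow> complex" where
  "line_integrand q h z = (\<Sum>b\<in>Basis. complex_of_real ((fst (snd z) - q) \<bullet> b) * h b (line_point q z))"

definition line_integral ::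
    "'n::euclidean_space \<Rightarrow> ('n \<Rightarrow> 'n \<times> 'x \<Rightarrow> complex) \<Rightarrow> 'n \<times> 'x \<Rightarrow> complex" where
  "line_integral q h y = integral {0..1} (\<lambda>r. line_integrand q h (r, y))"

lemma has_derivative_line_point:
  fixes q :: "'n::euclidean_space" and z :: "real \<times> 'n \<times> 'x::euclidean_space"
  shows "(line_point q has_derivative
    (\<lambda>v. (fst v *\<^sub>R (fst (snd z) - q) + fst z *\<^sub>R fst (snd v), snd (snd v)))) (at z)"
  unfolding line_point_def[abs_def]
  by (auto intro!: derivative_eq_intros simp: algebra_simps)

lemma gev_map_scaleR:
  assumes "s \<ge> 1" "open U" "gev s (\<lambda>z. complex_of_real (\<rho> z)) U" "gev_map s \<Phi> U"
  shows "gev_map s (\<lambda>z. \<rho> z *\<^sub>R \<Phi> z) U"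
  unfolding gev_map_def inner_scaleR_left of_real_mult
  by (intro ballI ugev_mult[OF assms(1,2)]) (use assms in \<open>auto simp: gev_map_def\<close>)

context
  fixes q :: "'n::euclidean_space" and B :: "'n set"
  assumes B: "open B" "convex B" "q \<in> B"
begin

lemma line_point_in:
  assumes "t \<in> B" "r \<in> {0..1}"
  shows "line_point q (r, t, x) \<in> B \<times> UNIV"
proof -
  have "(1 - r) *\<^sub>R q + r *\<^sub>R t \<in> B" using B assms by (auto intro: convexD)
  then show ?thesis by (simp add: line_point_def algebra_simps)
qed

text \<open>The open set that plays the role of W for parameter integrals. By convexity of B it
  contains all r in [0, 1] when t is in B.\<close>

definition line_domain :: "(real \<times> 'n \<times> 'x::euclidean_space) set" where
  "line_domain = line_point q -` (B \<times> UNIV)"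

lemma gev_map_line_point:
  assumes s: "s \<ge> 1"
  shows "gev_map s (line_point q :: _ \<Rightarrow> 'n \<times> 'x::euclidean_space) U"
proof -
  have s0: "s \<ge> 0" using s by simp
  have 1: "gev s (\<lambda>z :: real \<times> 'n \<times> 'x. complex_of_real (fst z)) UNIV"
    using gev_map_linear[OF bounded_linear_fst s0, of "UNIV :: (real \<times> 'n \<times> 'x) set"] by (simp add: gev_map_def)
  have 2: "gev_map s (\<lambda>z :: real \<times> 'n \<times> 'x. fst (snd z) - q) UNIV"
    using gev_map_add[OF open_UNIV gev_map_linear[OF bounded_linear_fst_comp[OF bounded_linear_snd] s0] gev_map_const[of s "- q"]]
    by simp
  have 3: "gev_map s (\<lambda>z :: real \<times> 'n \<times> 'x. snd (snd z)) UNIV"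
    by (rule gev_map_linear[OF bounded_linear_snd_comp[OF bounded_linear_snd] s0])
  have "gev_map s (line_point q :: _ \<Rightarrow> 'n \<times> 'x) UNIV"
    unfolding line_point_def[abs_def]
    by (intro gev_map_Pair gev_map_add[OF open_UNIV] gev_map_const gev_map_scaleR[OF s open_UNIV] 1 2 3)
  then show ?thesis unfolding gev_map_def using ugev_subset by blast
qed

lemma open_line_domain: "open (line_domain :: (real \<times> 'n \<times> 'x::euclidean_space) set)"
  unfolding line_domain_def
  by (rule open_vimage) (use B gev_map_continuous[OF gev_map_line_point[of 1 UNIV]] in \<open>auto intro: open_Times\<close>)

lemma line_domain_sub: "{0..1} \<times> (B \<times> UNIV) \<subseteq> (line_domain :: (real \<times> 'n \<times> 'x::euclidean_space) set)"
  unfolding line_domain_def using line_point_in by fast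

lemma ugev_line_integrand:
  fixes h :: "'i \<Rightarrow> 'n \<Rightarrow> 'n \<times> 'x::euclidean_space \<Rightarrow> complex"
  assumes s: "s \<ge> 1" and h: "\<And>b. b \<in> Basis \<Longrightarrow> ugev s I (\<lambda>i. h i b) (B \<times> UNIV)"
  shows "ugev s I (\<lambda>i. line_integrand q (h i)) line_domain"
  unfolding line_integrand_def[abs_def]
proof (rule ugev_sum[OF open_line_domain finite_Basis], rule ugev_mult[OF s open_line_domain])
  fix b :: 'n assume b: "b \<in> Basis"
  have s0: "s \<ge> 0" using s by simp
  have "gev_map s (\<lambda>z :: real \<times> 'n \<times> 'x. fst (snd z) + - q) UNIV"
    by (rule gev_map_add[OF open_UNIV gev_map_linear[OF bounded_linear_fst_comp[OF bounded_linear_snd] s0] gev_map_const[of s "- q"]])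
  then have "gev s (\<lambda>z :: real \<times> 'n \<times> 'x. complex_of_real ((fst (snd z) - q) \<bullet> b)) UNIV"
    using b by (simp add: gev_map_def)
  then have "gev s (\<lambda>z :: real \<times> 'n \<times> 'x. complex_of_real ((fst (snd z) - q) \<bullet> b)) line_domain"
    by (rule ugev_subset) auto
  then show "ugev s I (\<lambda>i (z :: real \<times> 'n \<times> 'x). complex_of_real ((fst (snd z) - q) \<bullet> b)) line_domain"
    by (rule ugev_of_gev)
  show "ugev s I (\<lambda>i z. h i b (line_point q z)) line_domain"
    by (rule ugev_compose[OF s open_line_domain _ h[OF b] gev_map_line_point[OF s]])
      (use B in \<open>auto simp: line_domain_def intro: open_Times\<close>)
qed

lemma ugev_line_integral:
  fixes h :: "'i \<Rightarrow> 'n \<Rightarrow> 'n \<times> 'x::euclidean_space \<Rightarrow> complex"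
  assumes s: "s \<ge> 1" and h: "\<And>b. b \<in> Basis \<Longrightarrow> ugev s I (\<lambda>i. h i b) (B \<times> UNIV)"
  shows "ugev s I (\<lambda>i. line_integral q (h i)) (B \<times> UNIV)"
  unfolding line_integral_def[abs_def]
  by (rule ugev_parameter_integral[OF open_line_domain line_domain_sub _ ugev_line_integrand[OF s h]])
    (use B in \<open>auto intro: open_Times\<close>)

lemma continuous_line_integrand:
  fixes h :: "'n \<Rightarrow> 'n \<times> 'x::euclidean_space \<Rightarrow> complex"
  assumes "\<And>b. b \<in> Basis \<Longrightarrow> continuous_on (B \<times> UNIV) (h b)" "t \<in> B"
  shows "continuous_on {0..1} (\<lambda>r. line_integrand q h (r, t, x))"
  unfolding line_integrand_def
proof (intro continuous_intros)
  fix b :: 'n assume b: "b \<in> Basis"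
  show "continuous_on {0..1} (\<lambda>r. h b (line_point q (r, t, x)))"
    by (rule continuous_on_compose2[OF assms(1)[OF b]])
      (use line_point_in[OF assms(2)] in \<open>auto simp: line_point_def intro!: continuous_intros\<close>)
qed

lemma line_integral_add:
  fixes h :: "'n \<Rightarrow> 'n \<times> 'x::euclidean_space \<Rightarrow> complex"
  assumes "\<And>b. b \<in> Basis \<Longrightarrow> continuous_on (B \<times> UNIV) (h b)"
    and "\<And>b. b \<in> Basis \<Longrightarrow> continuous_on (B \<times> UNIV) (k b)" and "t \<in> B"
  shows "line_integral q (\<lambda>b y. h b y + k b y) (t, x) = line_integral q h (t, x) + line_integral q k (t, x)"
proof -
  have "line_integrand q (\<lambda>b y. h b y + k b y) z = line_integrand q h z + line_integrand q k z" for z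
    by (simp add: line_integrand_def distrib_left sum.distrib)
  then show ?thesis
    unfolding line_integral_def
    using integral_add[OF integrable_continuous_real[OF continuous_line_integrand[of h, OF assms(1,3)]]
        integrable_continuous_real[OF continuous_line_integrand[of k, OF assms(2,3)]]] by simp
qed

lemma line_integral_cong:
  fixes h :: "'n \<Rightarrow> 'n \<times> 'x::euclidean_space \<Rightarrow> complex"
  assumes "\<And>b r. b \<in> Basis \<Longrightarrow> r \<in> {0..1} \<Longrightarrow> h b (line_point q (r, t, x)) = k b (line_point q (r, t, x'))"
  shows "line_integral q h (t, x) = line_integral q k (t, x')"
  unfolding line_integral_def line_integrand_def
  by (intro integral_cong sum.cong arg_cong2[of _ _ _ _ "(*)"]) (use assms in auto)

lemma line_integral_scale:
  "line_integral q (\<lambda>b y. a * h b y) y = a * line_integral q h y"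
proof -
  have "line_integrand q (\<lambda>b y. a * h b y) z = a * line_integrand q h z" for z
    by (simp add: line_integrand_def algebra_simps sum_distrib_left)
  then show ?thesis by (simp add: line_integral_def)
qed

lemma line_integral_gradient:
  fixes \<phi> :: "'n \<times> 'x::euclidean_space \<Rightarrow> complex"
  assumes \<phi>: "smooth_on \<phi> (B \<times> UNIV)" and t: "t \<in> B"
  shows "line_integral q (\<lambda>b. dir_deriv (b, 0) \<phi>) (t, x) = \<phi> (t, x) - \<phi> (q, x)"
proof -
  have "((\<lambda>r. line_integrand q (\<lambda>b. dir_deriv (b, 0) \<phi>) (r, t, x)) has_integral
      \<phi> (line_point q (1, t, x)) - \<phi> (line_point q (0, t, x))) {0..1}"
  proof (rule fundamental_theorem_of_calculus)
    fix r :: real assume r: "r \<in> {0..1}"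
    let ?y = "line_point q (r, t, x)"
    have D: "(\<phi> has_derivative (\<lambda>v. dir_deriv v \<phi> ?y)) (at ?y)"
      by (rule has_derivative_dir_deriv[OF smooth_on_imp_differentiable[OF \<phi> line_point_in[OF t r]]])
    have lin: "linear (\<lambda>v. dir_deriv v \<phi> ?y)" using D has_derivative_linear by blast
    have "((\<lambda>r. (r, t, x)) has_derivative (\<lambda>\<rho>. (\<rho>, 0, 0))) (at r)"
      by (auto intro!: derivative_eq_intros simp: zero_prod_def)
    from has_derivative_compose[OF has_derivative_compose[OF this has_derivative_line_point] D]
    have "((\<lambda>r. \<phi> (line_point q (r, t, x))) has_derivative (\<lambda>\<rho>. dir_deriv (\<rho> *\<^sub>R (t - q), 0) \<phi> ?y)) (at r)"
      by simp
    moreover have "dir_deriv (\<rho> *\<^sub>R (t - q), 0) \<phi> ?y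
        = \<rho> *\<^sub>R line_integrand q (\<lambda>b. dir_deriv (b, 0) \<phi>) (r, t, x)" for \<rho>
    proof -
      have "(\<rho> *\<^sub>R (t - q), 0) = \<rho> *\<^sub>R (\<Sum>b\<in>Basis. ((t - q) \<bullet> b) *\<^sub>R (b, 0 :: 'x))"
        by (simp add: sum_prod[symmetric] euclidean_representation prod_eq_iff fst_sum snd_sum)
      then have "dir_deriv (\<rho> *\<^sub>R (t - q), 0) \<phi> ?y
          = \<rho> *\<^sub>R (\<Sum>b\<in>Basis. ((t - q) \<bullet> b) *\<^sub>R dir_deriv (b, 0) \<phi> ?y)"
        by (simp only: linear_scale[OF lin] linear_sum[OF lin])
      then show ?thesis by (simp add: line_integrand_def scaleR_conv_of_real)
    qed
    ultimately show "((\<lambda>r. \<phi> (line_point q (r, t, x))) has_vector_derivative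
        line_integrand q (\<lambda>b. dir_deriv (b, 0) \<phi>) (r, t, x)) (at r within {0..1})"
      by (simp add: has_vector_derivative_def has_derivative_at_withinI)
  qed simp
  then show ?thesis by (simp add: line_integral_def integral_unique line_point_def)
qed

text \<open>Closedness turns the derivative of the integrand in direction b into the r-derivative of
  r h_b along the segment, so the fundamental theorem of calculus gives the value of h_b at the
  endpoint r = 1.\<close>

lemma dir_deriv_line_integral:
  fixes h :: "'n \<Rightarrow> 'n \<times> 'x::euclidean_space \<Rightarrow> complex"
  assumes s: "s \<ge> 1" and h: "\<And>b. b \<in> Basis \<Longrightarrow> gev s (h b) (B \<times> UNIV)"
    and closed: "\<And>a b y. a \<in> Basis \<Longrightarrow> b \<in> Basis \<Longrightarrow> y \<in> B \<times> UNIV \<Longrightarrow>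
        dir_deriv (a, 0) (h b) y = dir_deriv (b, 0) (h a) y"
    and b: "b \<in> Basis" and t: "t \<in> B"
  shows "dir_deriv (b, 0) (line_integral q h) (t, x) = h b (t, x)"
proof -
  let ?f = "line_integrand q h"
  have sh: "smooth_on (h a) (B \<times> UNIV)" if "a \<in> Basis" for a
    using h[OF that] by (simp add: ugev_def)
  have "gev s ?f (line_domain :: (real \<times> 'n \<times> 'x) set)"
    using ugev_line_integrand[OF s, of "{()}" "\<lambda>_. h"] h by simp
  then have sf: "smooth_on ?f (line_domain :: (real \<times> 'n \<times> 'x) set)" by (simp add: ugev_def)
  have op: "open (B \<times> (UNIV :: 'x set))" using B by (auto intro: open_Times)
  have "dir_deriv (b, 0) (line_integral q h) (t, x) = integral {0..1} (\<lambda>r. dir_deriv (0, (b, 0)) ?f (r, (t, x)))"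
    unfolding line_integral_def[abs_def]
    by (rule dir_deriv_eq[OF has_derivative_parameter_integral[OF open_line_domain line_domain_sub op sf]])
      (use t in auto)
  also have "((\<lambda>r. dir_deriv (0, (b, 0)) ?f (r, (t, x))) has_integral
      1 *\<^sub>R h b (line_point q (1, t, x)) - 0 *\<^sub>R h b (line_point q (0, t, x))) {0..1}"
  proof (rule fundamental_theorem_of_calculus)
    fix r :: real assume r: "r \<in> {0..1}"
    let ?z = "(r, t, x)" let ?y = "line_point q ?z"
    have yB: "?y \<in> B \<times> UNIV" by (rule line_point_in[OF t r])
    have D: "(h a has_derivative (\<lambda>v. dir_deriv v (h a) ?y)) (at ?y)" if "a \<in> Basis" for a
      by (rule has_derivative_dir_deriv[OF smooth_on_imp_differentiable[OF sh[OF that] yB]])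
    have lin: "linear (\<lambda>v. dir_deriv v (h a) ?y)" if "a \<in> Basis" for a
      using D[OF that] has_derivative_linear by blast
    have dc: "((\<lambda>z. h a (line_point q z)) has_derivative
        (\<lambda>v. dir_deriv (fst v *\<^sub>R (t - q) + r *\<^sub>R fst (snd v), snd (snd v)) (h a) ?y)) (at ?z)"
      if "a \<in> Basis" for a
      using has_derivative_compose[OF has_derivative_line_point D[OF that]] by simp
    have dl: "((\<lambda>z. complex_of_real ((fst (snd z) - q) \<bullet> a)) has_derivative
        (\<lambda>v. complex_of_real (fst (snd v) \<bullet> a))) (at ?z)" for a
      by (auto intro!: derivative_eq_intros)
    have "dir_deriv (0, (b, 0)) ?f ?z
       = (\<Sum>a\<in>Basis. complex_of_real ((t - q) \<bullet> a) * dir_deriv (r *\<^sub>R b, 0) (h a) ?y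
            + complex_of_real (b \<bullet> a) * h a ?y)"
    proof -
      have "(?f has_derivative (\<lambda>v. \<Sum>a\<in>Basis.
          complex_of_real ((fst (snd ?z) - q) \<bullet> a) * dir_deriv (fst v *\<^sub>R (t - q) + r *\<^sub>R fst (snd v), snd (snd v)) (h a) ?y
          + complex_of_real (fst (snd v) \<bullet> a) * h a ?y)) (at ?z)"
        unfolding line_integrand_def[abs_def]
        by (intro has_derivative_sum has_derivative_mult[OF dl dc])
      from dir_deriv_eq[OF this, of "(0, (b, 0))"] show ?thesis by simp
    qed
    also have "\<dots> = (\<Sum>a\<in>Basis. complex_of_real ((t - q) \<bullet> a) * dir_deriv (r *\<^sub>R b, 0) (h a) ?y)
        + (\<Sum>a\<in>Basis. if a = b then h a ?y else 0)"
      unfolding sum.distrib using b by (intro arg_cong2[of _ _ _ _ "(+)"] refl sum.cong) (auto simp: inner_Basis)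
    also have "\<dots> = (\<Sum>a\<in>Basis. complex_of_real ((t - q) \<bullet> a) * dir_deriv (r *\<^sub>R b, 0) (h a) ?y) + h b ?y"
      using b by simp
    also have "(\<Sum>a\<in>Basis. complex_of_real ((t - q) \<bullet> a) * dir_deriv (r *\<^sub>R b, 0) (h a) ?y)
        = r *\<^sub>R dir_deriv (t - q, 0) (h b) ?y"
    proof -
      have "dir_deriv (r *\<^sub>R b, 0) (h a) ?y = r *\<^sub>R dir_deriv (a, 0) (h b) ?y" if "a \<in> Basis" for a
        using linear_scale[OF lin[OF that], of r "(b, 0)"] closed[OF that b yB] by simp
      moreover have "(t - q, 0) = (\<Sum>a\<in>Basis. ((t - q) \<bullet> a) *\<^sub>R (a, 0 :: 'x))"
        by (simp add: euclidean_representation prod_eq_iff fst_sum snd_sum)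
      then have "dir_deriv (t - q, 0) (h b) ?y = (\<Sum>a\<in>Basis. ((t - q) \<bullet> a) *\<^sub>R dir_deriv (a, 0) (h b) ?y)"
        by (simp only: linear_scale[OF lin[OF b]] linear_sum[OF lin[OF b]])
      ultimately show ?thesis by (simp add: scaleR_conv_of_real sum_distrib_left algebra_simps)
    qed
    finally have eq: "dir_deriv (0, (b, 0)) ?f ?z = r *\<^sub>R dir_deriv (t - q, 0) (h b) ?y + h b ?y" .
    have "((\<lambda>r. (r, t, x)) has_derivative (\<lambda>\<rho>. (\<rho>, 0, 0))) (at r)"
      by (auto intro!: derivative_eq_intros simp: zero_prod_def)
    from has_derivative_compose[OF this dc[OF b]]
    have "((\<lambda>r. h b (line_point q (r, t, x))) has_derivative (\<lambda>\<rho>. dir_deriv (\<rho> *\<^sub>R (t - q), 0) (h b) ?y)) (at r)"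
      by simp
    moreover have "dir_deriv (\<rho> *\<^sub>R (t - q), 0) (h b) ?y = \<rho> *\<^sub>R dir_deriv (t - q, 0) (h b) ?y" for \<rho>
      using linear_scale[OF lin[OF b], of \<rho> "(t - q, 0)"] by simp
    ultimately have "((\<lambda>r. h b (line_point q (r, t, x))) has_vector_derivative dir_deriv (t - q, 0) (h b) ?y) (at r)"
      by (simp add: has_vector_derivative_def)
    from has_vector_derivative_scaleR[OF DERIV_ident this]
    show "((\<lambda>r. r *\<^sub>R h b (line_point q (r, t, x))) has_vector_derivative
        dir_deriv (0, (b, 0)) ?f (r, (t, x))) (at r within {0..1})"
      unfolding eq by (simp add: has_vector_derivative_at_within)
  qed simp
  then have "integral {0..1} (\<lambda>r. dir_deriv (0, (b, 0)) ?f (r, (t, x))) = h b (t, x)"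
    by (simp add: integral_unique line_point_def)
  finally show ?thesis .
qed

lemma line_integral_real:
  fixes h :: "'n \<Rightarrow> 'n \<times> 'x::euclidean_space \<Rightarrow> complex"
  assumes "\<And>b. b \<in> Basis \<Longrightarrow> continuous_on (B \<times> UNIV) (h b)"
    and "\<And>b y. h b y \<in> \<real>" and "t \<in> B"
  shows "line_integral q h (t, x) \<in> \<real>"
proof -
  have "line_integrand q h z \<in> \<real>" for z
    unfolding line_integrand_def using assms(2) by (intro sum_in_Reals Reals_mult) auto
  then have im: "Im (line_integrand q h z) = 0" for z by (simp add: complex_is_Real_iff)
  have "integral {0..1} (Im \<circ> (\<lambda>r. line_integrand q h (r, t, x))) = Im (line_integral q h (t, x))"
    unfolding line_integral_def
    by (rule integral_linear[OF integrable_continuous_real[OF continuous_line_integrand[of h, OF assms(1,3)]] bounded_linear_Im])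
  then show ?thesis by (simp add: o_def im complex_is_Real_iff)
qed

lemma line_integral_center: "line_integral q h (q, x) = 0"
  by (simp add: line_integral_def line_integrand_def)

end

section \<open>The torus and analytic charts\<close>

lemma torus_class_eq_iff: "torus_class x = torus_class y \<longleftrightarrow> torus_rel x y"
  by transfer (rule refl)

lemma torus_class_cases: obtains x where "\<xi> = torus_class x"
proof -
  have "\<exists>x. \<xi> = torus_class x" by transfer (rule exI, rule equivp_reflp[OF equivp_torus_rel])
  then show thesis using that by blast
qed

lemma torus_translate_class [simp]: "torus_translate h (torus_class x) = torus_class (x + h)"
  by transfer (simp add: torus_rel_def exI[of _ 0])

lemma torus_translate_translate: "torus_translate a (torus_translate b \<xi>) = torus_translate (b + a) \<xi>"
  by (cases \<xi> rule: torus_class_cases) (simp add: add.assoc)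

lemma torus_translate_0 [simp]: "torus_translate 0 \<xi> = \<xi>"
  by (cases \<xi> rule: torus_class_cases) simp

lemma continuous_on_torus_class: "continuous_on S torus_class"
  by (rule continuous_on_subset[of UNIV]) (auto simp: continuous_on_open_vimage open_torus_def)

lemma compact_torus: "compact (UNIV :: 'm::finite torus set)"
proof -
  have "torus_class ` cbox 0 (vec (2 * pi)) = (UNIV :: 'm torus set)"
  proof -
    have "\<xi> \<in> torus_class ` cbox 0 (vec (2 * pi))" for \<xi> :: "'m torus"
    proof -
      obtain x where x: "\<xi> = torus_class x" using torus_class_cases .
      \<comment> \<open>Reduction of each coordinate modulo 2 pi: the compact cube with edges
        [0, 2 pi] already maps onto the torus.\<close>
      define y where "y = (\<chi> i. x $ i - 2 * pi * of_int \<lfloor>x $ i / (2 * pi)\<rfloor>)"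
      have "0 \<le> y $ i \<and> y $ i \<le> 2 * pi" for i
      proof -
        have "of_int \<lfloor>x $ i / (2 * pi)\<rfloor> \<le> x $ i / (2 * pi)" "x $ i / (2 * pi) \<le> of_int \<lfloor>x $ i / (2 * pi)\<rfloor> + 1"
          by linarith+
        then have "of_int \<lfloor>x $ i / (2 * pi)\<rfloor> * (2 * pi) \<le> x $ i / (2 * pi) * (2 * pi)"
          "x $ i / (2 * pi) * (2 * pi) \<le> (of_int \<lfloor>x $ i / (2 * pi)\<rfloor> + 1) * (2 * pi)"
          by (intro mult_right_mono; simp)+
        moreover have "x $ i / (2 * pi) * (2 * pi) = x $ i" by simp
        ultimately have "of_int \<lfloor>x $ i / (2 * pi)\<rfloor> * (2 * pi) \<le> x $ i"
          "x $ i \<le> (of_int \<lfloor>x $ i / (2 * pi)\<rfloor> + 1) * (2 * pi)" by simp_all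
        then show ?thesis by (simp add: y_def algebra_simps)
      qed
      then have "y \<in> cbox 0 (vec (2 * pi))" by (simp add: mem_box_cart)
      moreover have "torus_rel x y" by (auto simp: torus_rel_def y_def)
      then have "\<xi> = torus_class y" using x torus_class_eq_iff[of x y] by blast
      ultimately show ?thesis by blast
    qed
    then show ?thesis by blast
  qed
  then show ?thesis using compact_continuous_image[OF continuous_on_torus_class compact_cbox] by metis
qed

lemma gev_map_cong:
  assumes "open U" "\<And>x. x \<in> U \<Longrightarrow> \<Phi> x = \<Psi> x" "gev_map s \<Psi> U"
  shows "gev_map s \<Phi> U"
  unfolding gev_map_def
proof
  fix k :: 'b assume "k \<in> Basis"
  then have "gev s (\<lambda>z. complex_of_real (\<Psi> z \<bullet> k)) U" using assms(3) by (simp add: gev_map_def)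
  then show "gev s (\<lambda>z. complex_of_real (\<Phi> z \<bullet> k)) U"
    by (rule ugev_cong[OF assms(1), rotated]) (simp add: assms(2))
qed

lemma gev_map_local:
  assumes "\<And>x. x \<in> U \<Longrightarrow> \<exists>V. open V \<and> x \<in> V \<and> gev_map s \<Phi> V"
  shows "gev_map s \<Phi> U"
  unfolding gev_map_def
proof (intro ballI ugev_local)
  fix k :: 'b and x assume "k \<in> Basis" "x \<in> U"
  then show "\<exists>V. open V \<and> x \<in> V \<and> gev s (\<lambda>z. complex_of_real (\<Phi> z \<bullet> k)) V"
    using assms[of x] unfolding gev_map_def by blast
qed

lemma gev_map_subset: "gev_map s \<Phi> U \<Longrightarrow> V \<subseteq> U \<Longrightarrow> gev_map s \<Phi> V"
  unfolding gev_map_def using ugev_subset by blast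

section \<open>Charts, overlaps and transition maps\<close>

locale analytic_manifold =
  fixes A :: "('a::{t2_space, second_countable_topology}, 'n::finite) chart set" and s :: real
  assumes s: "s > 1" and atlas: "analytic_atlas A"
begin

lemma s1: "s \<ge> 1" and s0: "s \<ge> 0" using s by auto

lemma atlas_subset: "A \<subseteq> analytic_charts A"
  using atlas by (auto simp: analytic_charts_def analytic_atlas_def)

lemma atlas_cover: obtains c where "c \<in> A" "p \<in> fst c"
  using atlas unfolding analytic_atlas_def by blast

lemma charts_at_nonempty: "\<exists>c. c \<in> charts_at A p"
  by (metis (mono_tags, lifting) atlas_cover atlas_subset charts_at_def mem_Collect_eq subsetD)

lemma chart:
  assumes "c \<in> analytic_charts A"
  shows "open (fst c)" "open (snd c ` fst c)" "continuous_on (fst c) (snd c)"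
    "continuous_on (snd c ` fst c) (chart_inv c)"
    "p \<in> fst c \<Longrightarrow> chart_inv c (snd c p) = p"
    "t \<in> snd c ` fst c \<Longrightarrow> chart_inv c t \<in> fst c"
    "t \<in> snd c ` fst c \<Longrightarrow> snd c (chart_inv c t) = t"
proof -
  have *: "open (fst c)" "open (snd c ` fst c)" "homeomorphism (fst c) (snd c ` fst c) (snd c) (chart_inv c)"
    using assms unfolding analytic_charts_def is_chart_def by blast+
  show "open (fst c)" "open (snd c ` fst c)" by fact+
  show "continuous_on (fst c) (snd c)" "continuous_on (snd c ` fst c) (chart_inv c)"
    using *(3) by (simp_all add: homeomorphism_def)
  show inv: "p \<in> fst c \<Longrightarrow> chart_inv c (snd c p) = p" for p
    using *(3) by (simp add: homeomorphism_def)
  show "t \<in> snd c ` fst c \<Longrightarrow> chart_inv c t \<in> fst c" "t \<in> snd c ` fst c \<Longrightarrow> snd c (chart_inv c t) = t"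
    using inv by auto
qed

definition overlap :: "('a, 'n) chart \<Rightarrow> ('a, 'n) chart \<Rightarrow> (real^'n) set" where
  "overlap c c' = snd c ` (fst c \<inter> fst c')"

lemma mem_overlap:
  "c \<in> analytic_charts A \<Longrightarrow> t \<in> overlap c c' \<longleftrightarrow> t \<in> snd c ` fst c \<and> chart_inv c t \<in> fst c'"
  unfolding overlap_def using chart(5,6,7) by (smt (verit) IntE IntI image_iff)

lemma open_chart_vimage:
  assumes "c \<in> analytic_charts A" "open V"
  shows "open {t \<in> snd c ` fst c. chart_inv c t \<in> V}"
proof -
  have "{t \<in> snd c ` fst c. chart_inv c t \<in> V} = snd c ` fst c \<inter> chart_inv c -` V" by blast
  then show ?thesis
    using continuous_open_preimage[OF chart(4)[OF assms(1)] chart(2)[OF assms(1)] assms(2)] by (simp only:)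
qed

lemma open_overlap:
  assumes "c \<in> analytic_charts A" "c' \<in> analytic_charts A"
  shows "open (overlap c c')"
proof -
  have "overlap c c' = {t \<in> snd c ` fst c. chart_inv c t \<in> fst c'}"
    using mem_overlap[OF assms(1)] by blast
  then show ?thesis using open_chart_vimage[OF assms(1) chart(1)[OF assms(2)]] by simp
qed

lemma open_chart_inv_image:
  assumes "c \<in> analytic_charts A" "open B" "B \<subseteq> snd c ` fst c"
  shows "open (chart_inv c ` B)"
proof -
  have "chart_inv c ` B = fst c \<inter> snd c -` B"
    using chart(5-7)[OF assms(1)] assms(3) by (force simp: image_iff)
  then show ?thesis
    using continuous_open_preimage[OF chart(3)[OF assms(1)] chart(1)[OF assms(1)] assms(2)] by simp
qed

lemma transition:
  assumes "c \<in> analytic_charts A" "c' \<in> analytic_charts A" "t \<in> overlap c c'"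
  shows "transition c c' t \<in> overlap c' c" "chart_inv c' (transition c c' t) = chart_inv c t"
proof -
  have p: "chart_inv c t \<in> fst c" "chart_inv c t \<in> fst c'"
    using assms mem_overlap chart(6) by blast+
  then show "chart_inv c' (transition c c' t) = chart_inv c t"
    using chart(5)[OF assms(2)] by (simp add: transition_def)
  show "transition c c' t \<in> overlap c' c"
    using p by (simp add: overlap_def transition_def)
qed

text \<open>Charts of the maximal atlas are by definition compatible with those of \<open>A\<close>
  only. Near each point the transition map is therefore factored through a chart of
  \<open>A\<close>, which is enough for a local property.\<close>

lemma gev_map_transition:
  assumes c: "c \<in> analytic_charts A" and c': "c' \<in> analytic_charts A"
  shows "gev_map s (transition c c') (overlap c c')"
proof (rule gev_map_local)
  fix t assume t: "t \<in> overlap c c'"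
  then have p: "chart_inv c t \<in> fst c" "chart_inv c t \<in> fst c'" using mem_overlap[OF c] chart(6)[OF c] by blast+
  obtain a where a: "a \<in> A" "chart_inv c t \<in> fst a" using atlas_cover .
  then have a': "a \<in> analytic_charts A" using atlas_subset by blast
  define V where "V = {t \<in> snd c ` fst c. chart_inv c t \<in> fst a \<inter> fst c'}"
  have V: "open V" "t \<in> V"
    unfolding V_def using open_chart_vimage[OF c open_Int[OF chart(1)[OF a'] chart(1)[OF c']]]
      p a t mem_overlap[OF c] by blast+
  have Vsub: "V \<subseteq> overlap c a" using mem_overlap[OF c] by (simp add: V_def subset_iff)
  have "real_analytic_on (transition c a) (overlap c a)" "real_analytic_on (transition a c') (overlap a c')"
    using c c' a(1) unfolding analytic_charts_def analytically_compatible_def overlap_def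
    by (auto simp: Int_commute)
  then have ca: "gev_map s (transition c a) V" and ac': "gev_map s (transition a c') (overlap a c')"
    using real_analytic_imp_gev_map s1 gev_map_subset Vsub by blast+
  have img: "transition c a ` V \<subseteq> overlap a c'"
  proof
    fix y assume "y \<in> transition c a ` V"
    then obtain z where z: "z \<in> V" "y = transition c a z" by blast
    then show "y \<in> overlap a c'"
      by (auto simp: V_def overlap_def transition_def)
  qed
  have "gev_map s (\<lambda>z. transition a c' (transition c a z)) V"
    by (rule gev_map_compose[OF s1 V(1) open_overlap[OF a' c'] ac' ca img])
  then have "gev_map s (transition c c') V"
  proof (rule gev_map_cong[OF V(1), rotated])
    fix z assume z: "z \<in> V"
    have "chart_inv a (transition c a z) = chart_inv c z"
      by (rule transition(2)[OF c a']) (use z Vsub in blast)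
    then show "transition c c' z = transition a c' (transition c a z)" by (simp add: transition_def)
  qed
  then show "\<exists>V. open V \<and> t \<in> V \<and> gev_map s (transition c c') V" using V by blast
qed

lemma jacobian:
  assumes c: "c \<in> analytic_charts A" and c': "c' \<in> analytic_charts A" and t: "t \<in> overlap c c'"
  shows "(transition c c' has_derivative jacobian c c' (chart_inv c t)) (at t)"
    and "dir_deriv v (\<lambda>t. complex_of_real (transition c c' t \<bullet> k)) t
       = complex_of_real (jacobian c c' (chart_inv c t) v \<bullet> k)"
proof -
  have t': "snd c (chart_inv c t) = t" using t mem_overlap[OF c] chart(7)[OF c] by blast
  have "transition c c' differentiable (at t)"
    by (rule gev_map_differentiable[OF gev_map_transition[OF c c'] t])
  then show D: "(transition c c' has_derivative jacobian c c' (chart_inv c t)) (at t)"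
    by (simp add: jacobian_def t' frechet_derivative_works)
  show "dir_deriv v (\<lambda>t. complex_of_real (transition c c' t \<bullet> k)) t
       = complex_of_real (jacobian c c' (chart_inv c t) v \<bullet> k)"
    by (intro dir_deriv_eq has_derivative_of_real has_derivative_inner_left D)
qed

lemma open_tube_domain: "c \<in> analytic_charts A \<Longrightarrow> open (tube_domain c)"
  unfolding tube_domain_def by (intro open_Times chart open_UNIV)

lemma continuous_on_tube_param:
  assumes "c \<in> analytic_charts A"
  shows "continuous_on (tube_domain c) (tube_param c)"
proof -
  have "continuous_on (tube_domain c) (\<lambda>y. (chart_inv c (fst y), torus_class (snd y)))"
    by (intro continuous_on_Pair continuous_on_compose2[OF chart(4)[OF assms]]
        continuous_on_compose2[OF continuous_on_torus_class[of UNIV]] continuous_intros)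
      (auto simp: tube_domain_def)
  then show ?thesis by (simp add: tube_param_def case_prod_unfold)
qed

lemma open_tube_vimage:
  assumes "c \<in> analytic_charts A" "open W"
  shows "open {y \<in> tube_domain c. tube_param c y \<in> W}"
proof -
  have "{y \<in> tube_domain c. tube_param c y \<in> W} = tube_domain c \<inter> tube_param c -` W" by blast
  then show ?thesis
    using continuous_open_preimage[OF continuous_on_tube_param[OF assms(1)] open_tube_domain[OF assms(1)] assms(2)]
    by (simp only:)
qed

lemma gev_map_tube_transition:
  fixes U :: "((real^'n) \<times> (real^'m::finite)) set"
  assumes c: "c \<in> analytic_charts A" and c': "c' \<in> analytic_charts A" and "U \<subseteq> overlap c c' \<times> UNIV"
  shows "gev_map s (\<lambda>y. (transition c c' (fst y), snd y)) U"
proof -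
  have op: "open (overlap c c' \<times> (UNIV :: (real^'m) set))" by (intro open_Times open_overlap c c' open_UNIV)
  have "gev_map s (\<lambda>y. transition c c' (fst y)) (overlap c c' \<times> (UNIV :: (real^'m) set))"
    by (rule gev_map_compose[OF s1 op open_overlap[OF c c'] gev_map_transition[OF c c'] gev_map_linear[OF bounded_linear_fst s0]])
      auto
  then have "gev_map s (\<lambda>y. (transition c c' (fst y), snd y)) (overlap c c' \<times> (UNIV :: (real^'m) set))"
    by (rule gev_map_Pair[OF _ gev_map_linear[OF bounded_linear_snd s0]])
  then show ?thesis using assms(3) gev_map_subset by blast
qed

section \<open>Gevrey families of functions on the product\<close>

definition ugevM :: "'i set \<Rightarrow> ('i \<Rightarrow> 'a \<times> 'm::finite torus \<Rightarrow> complex) \<Rightarrow> bool" where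
  "ugevM I w \<longleftrightarrow> (\<forall>c\<in>analytic_charts A. ugev s I (\<lambda>i y. w i (tube_param c y)) (tube_domain c))"

lemma ugevM_mult: "ugevM I v \<Longrightarrow> ugevM I w \<Longrightarrow> ugevM I (\<lambda>i y. v i y * w i y)"
  unfolding ugevM_def by (auto intro!: ugev_mult[OF s1 open_tube_domain])

lemma ugevM_diff: "ugevM I v \<Longrightarrow> ugevM I w \<Longrightarrow> ugevM I (\<lambda>i y. v i y - w i y)"
  unfolding ugevM_def by (auto intro!: ugev_diff[OF s1 open_tube_domain])

lemma ugevM_constant: "ugevM I (\<lambda>i y. a)"
  unfolding ugevM_def by (auto intro!: ugev_constant)

lemma ugevM_sum: "finite J \<Longrightarrow> (\<And>j. j \<in> J \<Longrightarrow> ugevM I (w j)) \<Longrightarrow> ugevM I (\<lambda>i y. \<Sum>j\<in>J. w j i y)"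
  unfolding ugevM_def by (auto intro!: ugev_sum[OF open_tube_domain])

lemma ugevM_prod: "finite J \<Longrightarrow> (\<And>j. j \<in> J \<Longrightarrow> ugevM I (w j)) \<Longrightarrow> ugevM I (\<lambda>i y. \<Prod>j\<in>J. w j i y)"
  unfolding ugevM_def by (auto intro!: ugev_prod[OF s1 open_tube_domain])

definition extend0 ::
    "('a, 'n) chart \<Rightarrow> (real^'n) set \<Rightarrow> (real^'n \<Rightarrow> 'm::finite torus \<Rightarrow> complex) \<Rightarrow> 'a \<times> 'm torus \<Rightarrow> complex" where
  "extend0 c' B F y = (if fst y \<in> chart_inv c' ` B then F (snd c' (fst y)) (snd y) else 0)"

text \<open>The image of B and the complement of the image of C form an open cover, and the function
  is zero on the second set. The image of C is closed because compact subsets of a Hausdorff space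
  are.\<close>

lemma ugevM_extend0:
  fixes F :: "'i \<Rightarrow> real^'n \<Rightarrow> 'm::finite torus \<Rightarrow> complex"
  assumes c': "c' \<in> analytic_charts A" and B: "open B" "B \<subseteq> snd c' ` fst c'"
    and C: "compact C" "C \<subseteq> B"
    and F: "ugev s I (\<lambda>i y. F i (fst y) (torus_class (snd y))) (B \<times> UNIV)"
    and F0: "\<And>i t \<xi>. i \<in> I \<Longrightarrow> t \<in> B - C \<Longrightarrow> F i t \<xi> = 0"
  shows "ugevM I (\<lambda>i. extend0 c' B (F i))"
  unfolding ugevM_def
proof
  fix c assume c: "c \<in> analytic_charts A"
  have opB: "open (chart_inv c' ` B)" by (rule open_chart_inv_image[OF c' B])
  have "compact (chart_inv c' ` C)"
    using C B by (intro compact_continuous_image continuous_on_subset[OF chart(4)[OF c']]) auto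
  then have clC: "closed (chart_inv c' ` C)" by (rule compact_imp_closed)
  show "ugev s I (\<lambda>i y. extend0 c' B (F i) (tube_param c y)) (tube_domain c)"
  proof (rule ugev_local)
    fix y :: "(real^'n) \<times> (real^'m)" assume y: "y \<in> tube_domain c"
    show "\<exists>V. open V \<and> y \<in> V \<and> ugev s I (\<lambda>i y. extend0 c' B (F i) (tube_param c y)) V"
    proof (cases "chart_inv c (fst y) \<in> chart_inv c' ` B")
      case True
      define V where "V = {t \<in> snd c ` fst c. chart_inv c t \<in> chart_inv c' ` B} \<times> (UNIV :: (real^'m) set)"
      have V: "open V" "y \<in> V"
        using open_chart_vimage[OF c opB] True y by (auto simp: V_def tube_domain_def intro: open_Times)
      have sub: "V \<subseteq> overlap c c' \<times> (UNIV :: (real^'m) set)"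
      proof (rule subsetI)
        fix z assume "z \<in> V"
        then have "fst z \<in> overlap c c'"
          unfolding mem_overlap[OF c] using chart(6)[OF c'] B(2) by (auto simp: V_def)
        then show "z \<in> overlap c c' \<times> (UNIV :: (real^'m) set)" by (cases z) auto
      qed
      have "ugev s I (\<lambda>i y. F i (fst (transition c c' (fst y), snd y)) (torus_class (snd (transition c c' (fst y), snd y)))) V"
      proof (rule ugev_compose[OF s1 V(1) _ F gev_map_tube_transition[OF c c' sub]])
        show "open (B \<times> (UNIV :: (real^'m) set))" using B by (intro open_Times) auto
        show "(\<lambda>y. (transition c c' (fst y), snd y)) ` V \<subseteq> B \<times> UNIV"
        proof (rule image_subsetI)
          fix z assume "z \<in> V"
          then obtain b where "b \<in> B" "chart_inv c (fst z) = chart_inv c' b" by (auto simp: V_def)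
          then show "(transition c c' (fst z), snd z) \<in> B \<times> (UNIV :: (real^'m) set)"
            using chart(7)[OF c', of b] B(2) by (auto simp: transition_def)
        qed
      qed
      then have "ugev s I (\<lambda>i y. extend0 c' B (F i) (tube_param c y)) V"
        by (rule ugev_cong[OF V(1), rotated])
          (auto simp: V_def extend0_def tube_param_def transition_def case_prod_unfold)
      then show ?thesis using V by blast
    next
      case False
      define V where "V = {t \<in> snd c ` fst c. chart_inv c t \<in> - chart_inv c' ` C} \<times> (UNIV :: (real^'m) set)"
      have "y \<in> V" using False C(2) y by (auto simp: V_def tube_domain_def)
      moreover have "open V"
        using open_chart_vimage[OF c, of "- chart_inv c' ` C"] clC by (auto simp: V_def intro: open_Times)
      moreover have "ugev s I (\<lambda>i y. extend0 c' B (F i) (tube_param c y)) V"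
      proof (rule ugev_cong[OF \<open>open V\<close> _ ugev_constant[of _ _ 0]])
        fix i z assume i: "i \<in> I" and z: "z \<in> V"
        show "extend0 c' B (F i) (tube_param c z) = 0"
        proof (cases "chart_inv c (fst z) \<in> chart_inv c' ` B")
          case True
          then obtain b where b: "b \<in> B" "chart_inv c (fst z) = chart_inv c' b" by blast
          then have "b \<notin> C" using z by (auto simp: V_def)
          moreover have "snd c' (chart_inv c' b) = b" using b B(2) chart(7)[OF c'] by blast
          ultimately show ?thesis using b F0[OF i] by (simp add: extend0_def tube_param_def case_prod_unfold)
        qed (simp add: extend0_def tube_param_def case_prod_unfold)
      qed
      ultimately show ?thesis by blast
    qed
  qed
qed

section \<open>Sections of degree zero and one\<close>

text \<open>In degree zero the value is the same in all charts around the point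
  (\<open>scalar_eq\<close>), so an arbitrary one may be chosen. This passes from sections to plain
  functions, which can be cut off and translated without mentioning charts.\<close>

definition scalar :: "('a, 'm::finite, 'n) tube_section \<Rightarrow> 'a \<times> 'm torus \<Rightarrow> complex" where
  "scalar \<phi> y = \<phi> y (SOME c. c \<in> charts_at A (fst y)) []"

definition scalar_section :: "('a \<times> 'm::finite torus \<Rightarrow> complex) \<Rightarrow> ('a, 'm, 'n) tube_section" where
  "scalar_section w y c vs = (if c \<in> charts_at A (fst y) \<and> vs = [] then w y else 0)"

lemma charts_atI: "c \<in> analytic_charts A \<Longrightarrow> p \<in> fst c \<Longrightarrow> c \<in> charts_at A p"
  by (simp add: charts_at_def)

lemma scalar_eq:
  assumes "\<phi> (p, \<xi>) \<in> form_fibre A 0 p" "c \<in> charts_at A p"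
  shows "\<phi> (p, \<xi>) c [] = scalar \<phi> (p, \<xi>)"
proof -
  have "(SOME c. c \<in> charts_at A p) \<in> charts_at A p" by (rule someI_ex[OF charts_at_nonempty])
  moreover have "\<phi> (p, \<xi>) c [] = \<phi> (p, \<xi>) c' (map (jacobian c c' p) [])" if "c' \<in> charts_at A p" for c'
    using assms that unfolding form_fibre_def by blast
  ultimately show ?thesis by (simp add: scalar_def)
qed

lemma scalar_section_scalar:
  fixes \<phi> :: "('a, 'm::finite, 'n) tube_section"
  assumes "\<And>p \<xi>. \<phi> (p, \<xi>) \<in> form_fibre A 0 p"
  shows "scalar_section (scalar \<phi>) = \<phi>"
proof (intro ext)
  fix y :: "'a \<times> 'm torus" and c vs
  obtain p \<xi> where y: "y = (p, \<xi>)" by (cases y)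
  show "scalar_section (scalar \<phi>) y c vs = \<phi> y c vs"
  proof (cases "c \<in> charts_at A p")
    case True
    then have "vs \<noteq> [] \<Longrightarrow> \<phi> (p, \<xi>) c vs = 0"
      using assms[of p \<xi>] by (auto simp: form_fibre_def alternating_form_def)
    then show ?thesis using True scalar_eq[of \<phi> p \<xi> c, OF assms True] y by (auto simp: scalar_section_def)
  next
    case False
    then have "\<phi> (p, \<xi>) c = 0" using assms[of p \<xi>] unfolding form_fibre_def by blast
    then show ?thesis using False y by (simp add: scalar_section_def)
  qed
qed

lemma scalar_section_fibre: "scalar_section w (p, \<xi>) \<in> form_fibre A 0 p"
  by (auto simp: form_fibre_def scalar_section_def alternating_form_def fun_eq_iff)

lemma tube_coeff_scalar_section:
  assumes "c \<in> analytic_charts A" "y \<in> tube_domain c"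
  shows "tube_coeff (scalar_section w) c [] y = w (tube_param c y)"
  using assms chart(6)[OF assms(1)]
  by (auto simp: tube_coeff_def scalar_section_def tube_param_def tube_domain_def intro!: charts_atI split: prod.splits)

lemma frame_indices_0: "frame_indices 0 = {[]}"
  by (auto simp: frame_indices_def)

lemma frame_indices_1: "frame_indices 1 = (\<lambda>b. [b]) ` Basis"
proof -
  have "J \<in> (\<lambda>b. [b]) ` Basis" if "J \<in> frame_indices 1" for J :: "(real^'k) list"
    using that by (cases J) (auto simp: frame_indices_def)
  then show ?thesis by (auto simp: frame_indices_def)
qed

lemma gevrey_tube_sections_iff:
  "u \<in> gevrey_tube_sections A s q \<longleftrightarrow> (\<forall>p x. u (p, x) \<in> form_fibre A q p) \<and>
     (\<forall>c\<in>analytic_charts A. \<forall>J\<in>frame_indices q. gev s (tube_coeff u c J) (tube_domain c))"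
  unfolding gevrey_tube_sections_def by (simp add: gevrey_on_iff_gev[OF s0 open_tube_domain])

lemma scalar_section_gevrey:
  assumes "ugevM I w" "i \<in> I"
  shows "scalar_section (w i) \<in> gevrey_tube_sections A s 0"
  unfolding gevrey_tube_sections_iff
proof (intro conjI allI ballI)
  fix c and J :: "(real^'n) list" assume c: "c \<in> analytic_charts A" and J: "J \<in> frame_indices 0"
  have "gev s (\<lambda>y. w i (tube_param c y)) (tube_domain c)"
    using assms c by (intro gev_of_ugev[of s I "\<lambda>i y. w i (tube_param c y)"]) (auto simp: ugevM_def)
  then show "gev s (tube_coeff (scalar_section (w i)) c J) (tube_domain c)"
    by (rule ugev_cong[OF open_tube_domain[OF c], rotated])
      (use J tube_coeff_scalar_section[OF c] in \<open>auto simp: frame_indices_0\<close>)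
qed (rule scalar_section_fibre)

text \<open>The sections themselves are the indices, so that a bounded set of test sections is its
  own family.\<close>

definition ugev1 :: "('a, 'm::finite, 'n) tube_section set \<Rightarrow> bool" where
  "ugev1 I \<longleftrightarrow> (\<forall>c\<in>analytic_charts A. \<forall>b\<in>Basis. ugev s I (\<lambda>g. tube_coeff g c [b]) (tube_domain c))"

lemma ugev1_single: "g \<in> gevrey_tube_sections A s 1 \<Longrightarrow> ugev1 {g}"
  unfolding ugev1_def gevrey_tube_sections_iff frame_indices_1
  using ugev_reindex[of s "{()}" _ "\<lambda>_. _"] by (auto simp: ugev_def)

lemma tube_coeff_add: "tube_coeff (u + v) c J = (\<lambda>y. tube_coeff u c J y + tube_coeff v c J y)"
  by (simp add: tube_coeff_def fun_eq_iff)

lemma tube_coeff_scale: "tube_coeff (section_scale a u) c J = (\<lambda>y. a * tube_coeff u c J y)"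
  by (simp add: tube_coeff_def section_scale_def fun_eq_iff)

lemma form_fibreD:
  assumes "u \<in> form_fibre A q p"
  shows "c \<notin> charts_at A p \<Longrightarrow> u c = 0"
    and "c \<in> charts_at A p \<Longrightarrow> alternating_form q (u c)"
    and "c \<in> charts_at A p \<Longrightarrow> c' \<in> charts_at A p \<Longrightarrow> u c vs = u c' (map (jacobian c c' p) vs)"
  using assms unfolding form_fibre_def by blast+

lemma form_fibreI:
  assumes "\<And>c. c \<notin> charts_at A p \<Longrightarrow> u c = 0"
    and "\<And>c. c \<in> charts_at A p \<Longrightarrow> alternating_form q (u c)"
    and "\<And>c c' vs. c \<in> charts_at A p \<Longrightarrow> c' \<in> charts_at A p \<Longrightarrow>
      u c vs = u c' (map (jacobian c c' p) vs)"
  shows "u \<in> form_fibre A q p"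
  using assms unfolding form_fibre_def by blast

lemma form_fibre_add:
  assumes u: "u \<in> form_fibre A q p" and v: "v \<in> form_fibre A q p"
  shows "u + v \<in> form_fibre A q p"
proof (rule form_fibreI)
  fix c c' vs assume "c \<in> charts_at A p" "c' \<in> charts_at A p"
  then show "(u + v) c vs = (u + v) c' (map (jacobian c c' p) vs)"
    unfolding plus_fun_apply by (intro arg_cong2[of _ _ _ _ "(+)"] form_fibreD(3)[OF u] form_fibreD(3)[OF v])
next
  fix c assume "c \<in> charts_at A p"
  then have "alternating_form q (u c)" "alternating_form q (v c)"
    using form_fibreD(2) u v by blast+
  then show "alternating_form q ((u + v) c)"
    unfolding alternating_form_def plus_fun_apply by (simp add: linear_compose_add)
next
  fix c assume "c \<notin> charts_at A p"
  then show "(u + v) c = 0" using form_fibreD(1)[OF u] form_fibreD(1)[OF v] by (simp add: plus_fun_apply)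
qed

lemma form_fibre_scale:
  assumes u: "u \<in> form_fibre A q p"
  shows "(\<lambda>c vs. a * u c vs) \<in> form_fibre A q p"
proof (rule form_fibreI)
  fix c c' vs assume "c \<in> charts_at A p" "c' \<in> charts_at A p"
  then show "a * u c vs = a * u c' (map (jacobian c c' p) vs)"
    by (intro arg_cong2[of _ _ _ _ "(*)"] refl form_fibreD(3)[OF u])
next
  fix c assume "c \<in> charts_at A p"
  then have "alternating_form q (u c)" using form_fibreD(2)[OF u] by blast
  moreover have "linear (\<lambda>v. a * f v)" if "linear f" for f :: "real^'n \<Rightarrow> complex"
    using linear_compose[OF that bounded_linear.linear[OF bounded_linear_mult_right[of a]]] by (simp add: o_def)
  ultimately show "alternating_form q (\<lambda>vs. a * u c vs)"
    unfolding alternating_form_def by simp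
next
  fix c assume "c \<notin> charts_at A p"
  then show "(\<lambda>vs. a * u c vs) = 0" using form_fibreD(1)[OF u] by (simp add: fun_eq_iff)
qed

lemma section_support_scale: "section_support (section_scale a u) \<subseteq> section_support u"
  unfolding section_support_def
  by (intro closure_mono) (auto simp: section_scale_def fun_eq_iff)

lemma section_support_add: "section_support (u + v) \<subseteq> section_support u \<union> section_support v"
  unfolding section_support_def closure_Un[symmetric] by (intro closure_mono) auto

lemma closed_section_support: "closed (section_support u)"
  by (simp add: section_support_def)

lemma not_in_section_support: "y \<notin> section_support u \<Longrightarrow> u y = 0"
  unfolding section_support_def using closure_subset[of "{y. u y \<noteq> 0}"] by blast

lemma gevrey_test_add:
  assumes "u \<in> gevrey_test_sections A s q" "v \<in> gevrey_test_sections A s q"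
  shows "u + v \<in> gevrey_test_sections A s q"
  unfolding gevrey_test_sections_def
proof (intro CollectI conjI)
  have "section_support (u + v) = section_support (u + v) \<inter> (section_support u \<union> section_support v)"
    using section_support_add by blast
  then show "compact (section_support (u + v))"
    using assms closed_Int_compact[OF closed_section_support compact_Un] unfolding gevrey_test_sections_def
    by (metis (no_types, lifting) mem_Collect_eq)
  have uv: "u \<in> gevrey_tube_sections A s q" "v \<in> gevrey_tube_sections A s q"
    using assms by (auto simp: gevrey_test_sections_def)
  show "u + v \<in> gevrey_tube_sections A s q"
    unfolding gevrey_tube_sections_iff tube_coeff_add
    using uv unfolding gevrey_tube_sections_iff
    by (auto intro!: ugev_add[OF open_tube_domain] form_fibre_add)
qed

lemma gevrey_test_scale:
  assumes "u \<in> gevrey_test_sections A s q"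
  shows "section_scale a u \<in> gevrey_test_sections A s q"
  unfolding gevrey_test_sections_def
proof (intro CollectI conjI)
  have "section_support (section_scale a u) = section_support (section_scale a u) \<inter> section_support u"
    using section_support_scale by blast
  then show "compact (section_support (section_scale a u))"
    using assms closed_Int_compact[OF closed_section_support] unfolding gevrey_test_sections_def
    by (metis (no_types, lifting) mem_Collect_eq)
  have u: "u \<in> gevrey_tube_sections A s q"
    using assms by (auto simp: gevrey_test_sections_def)
  then show "section_scale a u \<in> gevrey_tube_sections A s q"
    unfolding gevrey_tube_sections_iff tube_coeff_scale
    by (auto intro!: ugev_cmult[OF s1 open_tube_domain] form_fibre_scale simp: section_scale_def)
qed

end

section \<open>The operator in coordinates\<close>

lemma sum_apply2: "(\<Sum>k\<in>S. f k) c vs = (\<Sum>k\<in>S. f k c vs)"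
  by (induction S rule: infinite_finite_induct) (auto simp: plus_fun_def zero_fun_def)

lemma gev_map_translate: "s \<ge> 0 \<Longrightarrow> gev_map s (\<lambda>x. x + a) U"
proof -
  assume "s \<ge> 0"
  then have "gev_map s (\<lambda>x. x + a) UNIV"
    by (intro gev_map_add[OF open_UNIV] gev_map_const gev_map_linear bounded_linear_ident)
  then show ?thesis using gev_map_subset by blast
qed

locale tube_complex = analytic_manifold A s
  for A :: "('a::{t2_space, second_countable_topology}, 'n::finite) chart set" and s :: real +
  fixes \<omega> :: "'m::finite \<Rightarrow> 'a \<Rightarrow> ('a, 'n) form_value"
  assumes \<omega>_gevrey: "\<And>k. gevrey_one_form A s (\<omega> k)"
    and \<omega>_real: "\<And>k. real_form (\<omega> k)"
    and \<omega>_closed: "\<And>k. closed_form A (\<omega> k)"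
begin

lemma \<omega>_fibre: "\<omega> k p \<in> form_fibre A 1 p"
  using \<omega>_gevrey by (simp add: gevrey_one_form_def)

lemma gev_\<omega>:
  assumes "c \<in> analytic_charts A" "b \<in> Basis"
  shows "gev s (\<lambda>t. \<omega> k (chart_inv c t) c [b]) (snd c ` fst c)"
proof -
  have "gevrey_on s (\<lambda>t. \<omega> k (chart_inv c t) c [b]) (snd c ` fst c)"
    using \<omega>_gevrey[of k] assms unfolding gevrey_one_form_def by blast
  then show ?thesis using gevrey_on_iff_gev[OF s0 chart(2)[OF assms(1)]] by blast
qed

lemma gev_\<omega>_fst:
  fixes U :: "((real^'n) \<times> 'x::euclidean_space) set"
  assumes "c \<in> analytic_charts A" "b \<in> Basis" "U \<subseteq> (snd c ` fst c) \<times> UNIV" "open U"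
  shows "gev s (\<lambda>y. \<omega> k (chart_inv c (fst y)) c [b]) U"
  by (rule ugev_compose[OF s1 assms(4) chart(2)[OF assms(1)] gev_\<omega>[OF assms(1,2)] gev_map_linear[OF bounded_linear_fst s0]])
    (use assms(3) in auto)

lemma \<omega>_symmetric:
  assumes c: "c \<in> analytic_charts A" and t: "t \<in> snd c ` fst c"
  shows "dir_deriv a (\<lambda>t. \<omega> k (chart_inv c t) c [b]) t = dir_deriv b (\<lambda>t. \<omega> k (chart_inv c t) c [a]) t"
proof -
  have "ext_deriv A (\<omega> k) (chart_inv c t) c [a, b] = 0"
    using \<omega>_closed[of k] by (simp add: closed_form_def)
  moreover have "c \<in> charts_at A (chart_inv c t)" using c t chart(6) charts_atI by blast
  ultimately show ?thesis
    using chart(7)[OF c t] by (simp add: ext_deriv_def drop_nth_def)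
qed

lemma tube_L_coeff:
  assumes c: "c \<in> analytic_charts A" and y: "y \<in> tube_domain c"
  shows "tube_coeff (tube_L A \<omega> \<phi>) c [v] y = dir_deriv (v, 0) (tube_coeff \<phi> c []) y
     + (\<Sum>k\<in>UNIV. \<omega> k (chart_inv c (fst y)) c [v] * dir_deriv (0, axis k 1) (tube_coeff \<phi> c []) y)"
proof -
  obtain t x where tx: "y = (t, x)" by (cases y)
  have t: "t \<in> snd c ` fst c" using y tx by (simp add: tube_domain_def)
  have "c \<in> charts_at A (chart_inv c t)" using c t chart(6) charts_atI by blast
  then have 1: "deriv_t A \<phi> (chart_inv c t, torus_class x) c [v] = dir_deriv (v, 0) (tube_coeff \<phi> c []) y"
    using chart(7)[OF c t]
    by (simp add: deriv_t_def ext_deriv_def drop_nth_def dir_deriv_def tube_coeff_def tube_param_def tx)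
  have 2: "partial_x k \<phi> (chart_inv c t, torus_class x) c [] = dir_deriv (0, axis k 1) (tube_coeff \<phi> c []) y" for k
    by (simp add: partial_x_def dir_deriv_def tube_coeff_def tube_param_def tx)
  have "tube_coeff (tube_L A \<omega> \<phi>) c [v] y = deriv_t A \<phi> (chart_inv c t, torus_class x) c [v]
      + (\<Sum>k\<in>UNIV. wedge1 (\<omega> k (chart_inv c t)) (partial_x k \<phi> (chart_inv c t, torus_class x)) c [v])"
    by (simp add: tube_coeff_def tube_L_def tube_param_def tx sum_apply2)
  also have "\<dots> = dir_deriv (v, 0) (tube_coeff \<phi> c []) y
     + (\<Sum>k\<in>UNIV. \<omega> k (chart_inv c (fst y)) c [v] * dir_deriv (0, axis k 1) (tube_coeff \<phi> c []) y)"
    unfolding 1 by (simp add: wedge1_def drop_nth_def 2) (simp add: tx)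
  finally show ?thesis .
qed

lemma gev_tube_L_coeff:
  assumes \<phi>: "\<phi> \<in> gevrey_tube_sections A s 0" and c: "c \<in> analytic_charts A" and b: "b \<in> Basis"
  shows "gev s (tube_coeff (tube_L A \<omega> \<phi>) c [b]) (tube_domain c)"
proof -
  note op = open_tube_domain[OF c]
  have g: "gev s (tube_coeff \<phi> c []) (tube_domain c)"
    using \<phi> c unfolding gevrey_tube_sections_iff by (auto simp: frame_indices_0)
  have "gev s (\<lambda>y. dir_deriv (b, 0) (tube_coeff \<phi> c []) y
     + (\<Sum>k\<in>UNIV. \<omega> k (chart_inv c (fst y)) c [b] * dir_deriv (0, axis k 1) (tube_coeff \<phi> c []) y)) (tube_domain c)"
    by (intro ugev_add[OF op] ugev_sum[OF op finite] ugev_mult[OF s1 op] gev_\<omega>_fst[OF c b _ op] ugev_dir_deriv[OF s0 g])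
      (use b in \<open>auto simp: Basis_prod_def tube_domain_def axis_in_Basis_iff\<close>)
  then show ?thesis by (rule ugev_cong[OF op, rotated]) (rule tube_L_coeff[OF c])
qed

lemma scalar_tube_param:
  assumes "\<phi> \<in> gevrey_tube_sections A s 0" "c \<in> analytic_charts A" "y \<in> tube_domain c"
  shows "tube_coeff \<phi> c [] y = scalar \<phi> (tube_param c y)"
proof -
  have "chart_inv c (fst y) \<in> fst c" using assms chart(6)[OF assms(2)] by (auto simp: tube_domain_def)
  moreover have "\<phi> (chart_inv c (fst y), torus_class (snd y)) \<in> form_fibre A 0 (chart_inv c (fst y))"
    using assms(1) unfolding gevrey_tube_sections_iff by blast
  ultimately have "\<phi> (chart_inv c (fst y), torus_class (snd y)) c [] = scalar \<phi> (chart_inv c (fst y), torus_class (snd y))"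
    using scalar_eq[of \<phi> "chart_inv c (fst y)" "torus_class (snd y)" c] charts_atI[OF assms(2)] by blast
  then show ?thesis by (simp add: tube_coeff_def tube_param_def case_prod_unfold)
qed

text \<open>Changing charts composes the coefficient of \<phi> with the map (transition, identity),
  so the chain rule inserts the Jacobian into the t-derivative and leaves the x-derivatives alone;
  the coefficients of \<omega> transform with the same Jacobian.\<close>

lemma tube_L_chart_change:
  assumes \<phi>: "\<phi> \<in> gevrey_tube_sections A s 0"
    and c: "c \<in> charts_at A p" and c': "c' \<in> charts_at A p"
  shows "tube_L A \<omega> \<phi> (p, \<xi>) c [v] = tube_L A \<omega> \<phi> (p, \<xi>) c' [jacobian c c' p v]"
proof -
  obtain x where x: "\<xi> = torus_class x" using torus_class_cases .
  have ch: "c \<in> analytic_charts A" "p \<in> fst c" "c' \<in> analytic_charts A" "p \<in> fst c'"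
    using c c' by (auto simp: charts_at_def)
  define t where "t = snd c p"
  have t: "t \<in> overlap c c'" "chart_inv c t = p"
    using ch chart(5)[OF ch(1)] by (auto simp: t_def overlap_def)
  define t' where "t' = transition c c' t"
  have t': "t' = snd c' p" using t by (simp add: t'_def transition_def)
  have y: "(t, x) \<in> tube_domain c" "tube_param c (t, x) = (p, \<xi>)"
    using ch t x by (auto simp: tube_domain_def t_def tube_param_def)
  have y': "(t', x) \<in> tube_domain c'" "tube_param c' (t', x) = (p, \<xi>)"
    using ch t' x chart(5)[OF ch(3)] by (auto simp: tube_domain_def tube_param_def)
  let ?\<Phi> = "\<lambda>y :: (real^'n) \<times> (real^'m). (transition c c' (fst y), snd y)"
  have "((\<lambda>y :: (real^'n) \<times> (real^'m). transition c c' (fst y)) has_derivative (\<lambda>w. jacobian c c' p (fst w))) (at (t, x))"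
    using has_derivative_compose[OF has_derivative_fst[OF has_derivative_ident], of "transition c c'" "jacobian c c' p" "(t, x)" UNIV]
      jacobian(1)[OF ch(1,3) t(1)] t(2) by simp
  then have D\<Phi>: "(?\<Phi> has_derivative (\<lambda>w. (jacobian c c' p (fst w), snd w))) (at (t, x))"
    by (intro has_derivative_Pair has_derivative_snd has_derivative_ident)
  have d': "(tube_coeff \<phi> c' []) differentiable (at (t', x))"
    using \<phi> ch y' unfolding gevrey_tube_sections_iff
    by (auto simp: frame_indices_0 ugev_def intro!: smooth_on_imp_differentiable[of _ "tube_domain c'"])
  have "((\<lambda>y. tube_coeff \<phi> c' [] (?\<Phi> y)) has_derivative
      (\<lambda>w. dir_deriv (jacobian c c' p (fst w), snd w) (tube_coeff \<phi> c' []) (t', x))) (at (t, x))"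
    using has_derivative_compose[OF D\<Phi>, of "tube_coeff \<phi> c' []"] has_derivative_dir_deriv[OF d']
    by (simp add: t'_def)
  then have "(tube_coeff \<phi> c [] has_derivative
      (\<lambda>w. dir_deriv (jacobian c c' p (fst w), snd w) (tube_coeff \<phi> c' []) (t', x))) (at (t, x))"
  proof (rule has_derivative_transform_within_open)
    show "open (overlap c c' \<times> (UNIV :: (real^'m) set))" by (intro open_Times open_overlap ch open_UNIV)
    fix z :: "(real^'n) \<times> (real^'m)" assume "z \<in> overlap c c' \<times> UNIV"
    then have z: "fst z \<in> overlap c c'" by auto
    have "z \<in> tube_domain c" "?\<Phi> z \<in> tube_domain c'"
      using z transition(1)[OF ch(1,3) z] by (auto simp: tube_domain_def overlap_def mem_Times_iff)
    then show "tube_coeff \<phi> c' [] (?\<Phi> z) = tube_coeff \<phi> c [] z"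
      using scalar_tube_param[OF \<phi>] ch transition(2)[OF ch(1,3) z]
      by (simp add: tube_param_def case_prod_unfold)
  qed (use t in auto)
  note D = dir_deriv_eq[OF this]
  have \<omega>: "\<omega> k p c [v] = \<omega> k p c' [jacobian c c' p v]" for k
    using form_fibreD(3)[OF \<omega>_fibre c c', of k "[v]"] by simp
  have "tube_L A \<omega> \<phi> (p, \<xi>) c [v] = tube_coeff (tube_L A \<omega> \<phi>) c [v] (t, x)"
    by (simp add: tube_coeff_def y)
  also have "\<dots> = tube_coeff (tube_L A \<omega> \<phi>) c' [jacobian c c' p v] (t', x)"
  proof -
    have "chart_inv c' t' = p" using chart(5)[OF ch(3,4)] t' by simp
    moreover have "jacobian c c' p 0 = 0"
      using linear_0[OF has_derivative_linear[OF jacobian(1)[OF ch(1,3) t(1)]]] t(2) by simp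
    ultimately show ?thesis
      unfolding tube_L_coeff[OF ch(1) y(1)] tube_L_coeff[OF ch(3) y'(1)] D \<omega>[symmetric]
      by (simp add: t(2) \<omega>)
  qed
  finally show ?thesis by (simp add: tube_coeff_def y')
qed

lemma tube_L_fibre:
  assumes \<phi>: "\<phi> \<in> gevrey_tube_sections A s 0"
  shows "tube_L A \<omega> \<phi> (p, \<xi>) \<in> form_fibre A 1 p"
proof (rule form_fibreI)
  have fib: "\<phi> (p, \<xi>) \<in> form_fibre A 0 p" for p \<xi>
    using \<phi> unfolding gevrey_tube_sections_iff by blast
  have z: "\<phi> (p, \<xi>) c vs = 0" if "vs \<noteq> []" for p \<xi> c vs
  proof (cases "c \<in> charts_at A p")
    case True
    then show ?thesis using form_fibreD(2)[OF fib, of c p \<xi>] that by (auto simp: alternating_form_def)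
  next
    case False
    then show ?thesis using form_fibreD(1)[OF fib, of c p \<xi>] by simp
  qed
  \<comment> \<open>Removing one entry from a list of length other than 1 never leaves the empty
    list, and only there can a section of degree zero be nonzero.\<close>
  have len: "tube_L A \<omega> \<phi> (p, \<xi>) c vs = 0" if "length vs \<noteq> 1" for c vs
  proof -
    have ne: "drop_nth i vs \<noteq> []" if "i < length vs" for i
      using that \<open>length vs \<noteq> 1\<close> by (auto simp: drop_nth_def)
    then have "ext_deriv A (\<lambda>p'. \<phi> (p', \<xi>)) p c vs = 0"
      unfolding ext_deriv_def by (auto simp: z dir_deriv_const intro!: sum.neutral)
    moreover have "wedge1 (\<omega> k p) (partial_x k \<phi> (p, \<xi>)) c vs = 0" for k
      unfolding wedge1_def partial_x_def using ne by (auto simp: z intro!: sum.neutral)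
    ultimately show ?thesis by (simp add: tube_L_def deriv_t_def sum_apply2)
  qed
  show "tube_L A \<omega> \<phi> (p, \<xi>) c = 0" if c: "c \<notin> charts_at A p" for c
  proof
    fix vs
    have "wedge1 (\<omega> k p) (partial_x k \<phi> (p, \<xi>)) c vs = 0" for k
      using form_fibreD(1)[OF \<omega>_fibre c, of k] by (simp add: wedge1_def)
    then show "tube_L A \<omega> \<phi> (p, \<xi>) c vs = 0 vs"
      using c by (simp add: tube_L_def deriv_t_def ext_deriv_def sum_apply2)
  qed
  show "tube_L A \<omega> \<phi> (p, \<xi>) c vs = tube_L A \<omega> \<phi> (p, \<xi>) c' (map (jacobian c c' p) vs)"
    if c: "c \<in> charts_at A p" "c' \<in> charts_at A p" for c c' vs
  proof (cases "length vs = 1")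
    case True
    then obtain v where "vs = [v]" by (cases vs) auto
    then show ?thesis using tube_L_chart_change[OF \<phi> c] by simp
  qed (simp add: len)
  show "alternating_form 1 (tube_L A \<omega> \<phi> (p, \<xi>) c)" if c: "c \<in> charts_at A p" for c
    unfolding alternating_form_def
  proof (intro conjI allI impI)
    fix vs :: "(real^'n) list" and i :: nat assume vs: "length vs = 1" "i < 1"
    obtain x where x: "\<xi> = torus_class x" using torus_class_cases .
    have ch: "c \<in> analytic_charts A" "p \<in> fst c" using c by (auto simp: charts_at_def)
    have y: "(snd c p, x) \<in> tube_domain c" "tube_param c (snd c p, x) = (p, \<xi>)"
      using ch chart(5)[OF ch] x by (auto simp: tube_domain_def tube_param_def)
    have d: "(tube_coeff \<phi> c []) differentiable (at (snd c p, x))"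
      using \<phi> ch y unfolding gevrey_tube_sections_iff
      by (auto simp: frame_indices_0 ugev_def intro!: smooth_on_imp_differentiable[of _ "tube_domain c"])
    have l1: "linear (\<lambda>v. dir_deriv (v, 0) (tube_coeff \<phi> c []) (snd c p, x))"
    proof -
      have "linear (\<lambda>v :: real^'n. (v, 0 :: real^'m))" by (auto simp: linear_iff)
      from linear_compose[OF this has_derivative_linear[OF has_derivative_dir_deriv[OF d]]]
      show ?thesis by (simp add: o_def)
    qed
    have l2: "linear (\<lambda>v. \<omega> k p c [v])" for k
    proof -
      have "\<forall>vs i. length vs = 1 \<longrightarrow> i < 1 \<longrightarrow> linear (\<lambda>v. \<omega> k p c (vs[i := v]))"
        using form_fibreD(2)[OF \<omega>_fibre c, of k] unfolding alternating_form_def by blast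
      from this[rule_format, of "[0]" 0] show ?thesis by simp
    qed
    have "linear (\<lambda>v. \<omega> k p c [v] * z)" for k z
      using linear_compose[OF l2 bounded_linear.linear[OF bounded_linear_mult_left[of z]]] by (simp add: o_def)
    then have "linear (\<lambda>v. dir_deriv (v, 0) (tube_coeff \<phi> c []) (snd c p, x)
       + (\<Sum>k\<in>UNIV. \<omega> k p c [v] * dir_deriv (0, axis k 1) (tube_coeff \<phi> c []) (snd c p, x)))"
      by (intro linear_compose_add l1 linear_compose_sum) auto
    moreover have "tube_L A \<omega> \<phi> (p, \<xi>) c [v] = dir_deriv (v, 0) (tube_coeff \<phi> c []) (snd c p, x)
       + (\<Sum>k\<in>UNIV. \<omega> k p c [v] * dir_deriv (0, axis k 1) (tube_coeff \<phi> c []) (snd c p, x))" for v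
      using tube_L_coeff[OF ch(1) y(1), of \<phi> v] y(2) chart(5)[OF ch] by (simp add: tube_coeff_def[of "tube_L A \<omega> \<phi>"])
    moreover obtain w where "vs = [w]" using vs by (cases vs) auto
    ultimately show "linear (\<lambda>v. tube_L A \<omega> \<phi> (p, \<xi>) c (vs[i := v]))" using vs by simp
  qed (auto simp: len)
qed

text \<open>Off its closed support \<phi> vanishes on a neighbourhood, and with it all its
  derivatives.\<close>

lemma tube_L_support: 
  assumes \<phi>: "\<phi> \<in> gevrey_tube_sections A s 0"
  shows "section_support (tube_L A \<omega> \<phi>) \<subseteq> section_support \<phi>"
  unfolding section_support_def[of "tube_L A \<omega> \<phi>"]
proof (rule closure_minimal[OF _ closed_section_support], rule subsetI, rule ccontr)
  fix y assume y: "y \<in> {y. tube_L A \<omega> \<phi> y \<noteq> 0}" and ny: "y \<notin> section_support \<phi>"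
  obtain p \<xi> where p: "y = (p, \<xi>)" by (cases y)
  have fib: "tube_L A \<omega> \<phi> (p, \<xi>) \<in> form_fibre A 1 p" by (rule tube_L_fibre[OF \<phi>])
  have "tube_L A \<omega> \<phi> (p, \<xi>) c vs = 0" for c vs
  proof (cases "c \<in> charts_at A p \<and> length vs = 1")
    case True
    then have ch: "c \<in> analytic_charts A" "p \<in> fst c" by (auto simp: charts_at_def)
    obtain v where v: "vs = [v]" using True by (cases vs) auto
    obtain x where x: "\<xi> = torus_class x" using torus_class_cases .
    have yd: "(snd c p, x) \<in> tube_domain c" "tube_param c (snd c p, x) = (p, \<xi>)"
      using ch chart(5)[OF ch] x by (auto simp: tube_domain_def tube_param_def)
    define V where "V = {z \<in> tube_domain c. tube_param c z \<in> - section_support \<phi>}"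
    have V: "open V" unfolding V_def
      by (rule open_tube_vimage[OF ch(1)]) (simp add: closed_section_support open_Compl)
    have "(snd c p, x) \<in> V" using yd ny p by (simp add: V_def)
    then have "dir_deriv w (tube_coeff \<phi> c []) (snd c p, x) = dir_deriv w (\<lambda>_. 0) (snd c p, x)" for w
      by (rule dir_deriv_cong[OF V]) (auto simp: V_def tube_coeff_def not_in_section_support)
    then show ?thesis
      using tube_L_coeff[OF ch(1) yd(1), of \<phi> v] yd(2) v
      by (simp add: tube_coeff_def[of "tube_L A \<omega> \<phi>"] dir_deriv_const)
  next
    case False
    show ?thesis
    proof (cases "c \<in> charts_at A p")
      case True
      with False form_fibreD(2)[OF fib this] show ?thesis unfolding alternating_form_def by blast
    qed (use form_fibreD(1)[OF fib, of c] in simp)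
  qed
  then have "tube_L A \<omega> \<phi> y = 0" by (auto simp: p fun_eq_iff)
  then show False using y by simp
qed

lemma tube_L_test:
  assumes "\<phi> \<in> gevrey_test_sections A s 0"
  shows "tube_L A \<omega> \<phi> \<in> gevrey_test_sections A s 1"
proof -
  have \<phi>: "\<phi> \<in> gevrey_tube_sections A s 0" and K: "compact (section_support \<phi>)"
    using assms by (auto simp: gevrey_test_sections_def)
  have "section_support (tube_L A \<omega> \<phi>) = section_support (tube_L A \<omega> \<phi>) \<inter> section_support \<phi>"
    using tube_L_support[OF \<phi>] by blast
  then have "compact (section_support (tube_L A \<omega> \<phi>))"
    using closed_Int_compact[OF closed_section_support K] by metis
  moreover have "tube_L A \<omega> \<phi> \<in> gevrey_tube_sections A s 1"
    unfolding gevrey_tube_sections_iff frame_indices_1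
    using tube_L_fibre[OF \<phi>] gev_tube_L_coeff[OF \<phi>] by auto
  ultimately show ?thesis by (simp add: gevrey_test_sections_def)
qed

section \<open>Local solution by integration along segments\<close>

text \<open>On a convex coordinate domain \<open>\<omega>\<^sub>k = d\<psi>\<^sub>k\<close>, and the shear \<open>x \<mapsto> x + \<psi>(t)\<close> turns the operator into
  the exterior derivative in \<open>t\<close>.  It preserves the torus because \<open>\<psi>\<close> is real.\<close>

context
  fixes c :: "('a, 'n) chart" and q :: "real^'n" and B :: "(real^'n) set"
  assumes c: "c \<in> analytic_charts A" and B: "open B" "convex B" "q \<in> B" "B \<subseteq> snd c ` fst c"
begin

text \<open>Line integrals carry a parameter; here it is a dummy real variable, which
  \<open>\<psi>\<close> sets to 0.\<close>

definition primitive :: "'m \<Rightarrow> (real^'n) \<times> real \<Rightarrow> complex" where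
  "primitive k = line_integral q (\<lambda>b y. \<omega> k (chart_inv c (fst y)) c [b])"

definition \<psi> :: "real^'n \<Rightarrow> real^'m" where
  "\<psi> t = (\<chi> k. Re (primitive k (t, 0)))"

lemma open_B_UNIV: "open (B \<times> (UNIV :: 'x::euclidean_space set))"
  using B by (intro open_Times) auto

lemma gev_\<omega>_B: "b \<in> Basis \<Longrightarrow> gev s (\<lambda>y :: (real^'n) \<times> real. \<omega> k (chart_inv c (fst y)) c [b]) (B \<times> UNIV)"
  by (rule gev_\<omega>_fst[OF c _ _ open_B_UNIV]) (use B in auto)

text \<open>The coefficients of \<open>\<omega> k\<close> are real, so the real part taken in
  \<open>\<psi>\<close> loses nothing.\<close>

lemma of_real_\<psi>: "t \<in> B \<Longrightarrow> complex_of_real (\<psi> t $ k) = primitive k (t, 0)"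
proof -
  assume t: "t \<in> B"
  have "primitive k (t, 0) \<in> \<real>"
    unfolding primitive_def
  proof (rule line_integral_real[OF B(1-3) _ _ t])
    show "continuous_on (B \<times> UNIV) (\<lambda>y :: (real^'n) \<times> real. \<omega> k (chart_inv c (fst y)) c [b])" if "b \<in> Basis" for b
      using gev_\<omega>_B[OF that] by (auto simp: ugev_def intro!: smooth_on_imp_continuous_on)
    show "\<omega> k (chart_inv c (fst y)) c [b] \<in> \<real>" for b and y :: "(real^'n) \<times> real"
      using \<omega>_real[of k] unfolding real_form_def by blast
  qed
  then show ?thesis by (simp add: \<psi>_def)
qed

lemma gev_primitive: "gev s (\<lambda>t. primitive k (t, 0)) B"
proof -
  have "gev s (primitive k) (B \<times> UNIV)"
    unfolding primitive_def by (rule ugev_line_integral[OF B(1-3) s1 gev_\<omega>_B])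
  then show ?thesis
    by (rule ugev_compose[OF s1 B(1) open_B_UNIV])
      (auto intro: gev_map_Pair gev_map_linear[OF bounded_linear_ident s0] gev_map_const)
qed

lemma gev_map_\<psi>: "gev_map s \<psi> B"
  unfolding gev_map_def
proof
  fix k :: "real^'m" assume "k \<in> Basis"
  then obtain i where i: "k = axis i 1" by (auto simp: Basis_vec_def)
  show "gev s (\<lambda>t. complex_of_real (\<psi> t \<bullet> k)) B"
    by (rule ugev_cong[OF B(1) _ gev_primitive[of i]]) (simp add: i inner_axis of_real_\<psi>)
qed

text \<open>The Poincare lemma in the form \<open>dir_deriv_line_integral\<close>; its symmetry
  hypothesis is the closedness of \<open>\<omega> k\<close>.\<close>

lemma dir_deriv_\<psi>:
  assumes b: "b \<in> Basis" and t: "t \<in> B"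
  shows "dir_deriv b (\<lambda>t. complex_of_real (\<psi> t $ k)) t = \<omega> k (chart_inv c t) c [b]"
proof -
  have "dir_deriv b (\<lambda>t. complex_of_real (\<psi> t $ k)) t = dir_deriv b (\<lambda>t. primitive k (t, 0)) t"
    by (rule dir_deriv_cong[OF B(1) t]) (rule of_real_\<psi>)
  also have "\<dots> = dir_deriv (b, 0) (primitive k) (t, 0)" by (simp add: dir_deriv_def)
  also have "\<dots> = \<omega> k (chart_inv c (fst (t, 0 :: real))) c [b]"
    unfolding primitive_def
  proof (rule dir_deriv_line_integral[OF B(1-3) s1 gev_\<omega>_B _ b t])
    fix a b :: "real^'n" and y :: "(real^'n) \<times> real" assume "y \<in> B \<times> UNIV"
    then have "fst y \<in> snd c ` fst c" using B by auto
    from \<omega>_symmetric[OF c this, of a k b]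
    show "dir_deriv (a, 0) (\<lambda>y :: (real^'n) \<times> real. \<omega> k (chart_inv c (fst y)) c [b]) y
        = dir_deriv (b, 0) (\<lambda>y :: (real^'n) \<times> real. \<omega> k (chart_inv c (fst y)) c [a]) y"
      by (simp add: dir_deriv_def)
  qed
  finally show ?thesis by simp
qed

lemma \<psi>_center: "\<psi> q = 0"
  by (simp add: \<psi>_def primitive_def line_integral_center[OF B(1-3)] vec_eq_iff)

definition sheared :: "('a, 'm, 'n) tube_section \<Rightarrow> (real^'n) list \<Rightarrow> (real^'n) \<times> (real^'m) \<Rightarrow> complex" where
  "sheared g vs y = tube_coeff g c vs (fst y, snd y + \<psi> (fst y))"

lemma gev_map_shear:
  "gev_map s (\<lambda>y :: (real^'n) \<times> (real^'m). (fst y, snd y + \<psi> (fst y))) (B \<times> UNIV)"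
  "gev_map s (\<lambda>y :: (real^'n) \<times> (real^'m). (fst y, snd y - \<psi> (fst y))) (B \<times> UNIV)"
proof -
  have 1: "gev_map s (\<lambda>y :: (real^'n) \<times> (real^'m). \<psi> (fst y)) (B \<times> UNIV)"
    by (rule gev_map_compose[OF s1 open_B_UNIV B(1) gev_map_\<psi> gev_map_linear[OF bounded_linear_fst s0]]) auto
  have 2: "gev_map s (\<lambda>y :: (real^'n) \<times> (real^'m). - \<psi> (fst y)) (B \<times> UNIV)"
    by (rule gev_map_compose[OF s1 open_B_UNIV open_UNIV gev_map_linear[OF bounded_linear_minus[OF bounded_linear_ident] s0] 1]) auto
  show "gev_map s (\<lambda>y :: (real^'n) \<times> (real^'m). (fst y, snd y + \<psi> (fst y))) (B \<times> UNIV)"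
    by (intro gev_map_Pair gev_map_add[OF open_B_UNIV] 1 gev_map_linear[OF bounded_linear_fst s0] gev_map_linear[OF bounded_linear_snd s0])
  have "gev_map s (\<lambda>y :: (real^'n) \<times> (real^'m). (fst y, snd y + - \<psi> (fst y))) (B \<times> UNIV)"
    by (intro gev_map_Pair gev_map_add[OF open_B_UNIV] 2 gev_map_linear[OF bounded_linear_fst s0] gev_map_linear[OF bounded_linear_snd s0])
  then show "gev_map s (\<lambda>y :: (real^'n) \<times> (real^'m). (fst y, snd y - \<psi> (fst y))) (B \<times> UNIV)" by simp
qed

lemma B_domain: "B \<times> UNIV \<subseteq> (tube_domain c :: ((real^'n) \<times> (real^'m)) set)"
  using B by (auto simp: tube_domain_def)

lemma ugev_sheared:
  assumes "ugev s I (\<lambda>g. tube_coeff g c vs) (tube_domain c)"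
  shows "ugev s I (\<lambda>g. sheared g vs) (B \<times> UNIV)"
  unfolding sheared_def[abs_def]
  by (rule ugev_compose[OF s1 open_B_UNIV open_tube_domain[OF c] assms gev_map_shear(1)])
    (use B_domain in auto)

text \<open>The integral is formed in sheared coordinates, where the point (t, x) has second
  component \<open>x - \<psi> t\<close>. The choice of a representative x is justified by
  \<open>local_solution_class\<close>.\<close>

definition local_solution :: "('a, 'm, 'n) tube_section \<Rightarrow> real^'n \<Rightarrow> 'm torus \<Rightarrow> complex" where
  "local_solution g t \<xi> = line_integral q (\<lambda>b. sheared g [b]) (t, (SOME x. \<xi> = torus_class x) - \<psi> t)"

lemma torus_class_add: "torus_class x = torus_class y \<Longrightarrow> torus_class (x + h) = torus_class (y + h)"
  by (metis torus_translate_class)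

text \<open>Two representatives differ by a period, and a section over the torus has the same
  coefficients along the two translated segments.\<close>

lemma local_solution_class:
  "local_solution g t (torus_class x) = line_integral q (\<lambda>b. sheared g [b]) (t, x - \<psi> t)"
proof -
  have "torus_class x = torus_class (SOME z. torus_class x = torus_class z)"
    by (rule someI[of _ x]) simp
  then have "torus_class ((SOME z. torus_class x = torus_class z) + h) = torus_class (x + h)" for h
    using torus_class_add by metis
  note * = this[of "- \<psi> t + _"]
  show ?thesis
    unfolding local_solution_def
  proof (rule line_integral_cong[OF B(1-3)])
    fix b r
    show "sheared g [b] (line_point q (r, t, (SOME z. torus_class x = torus_class z) - \<psi> t))
        = sheared g [b] (line_point q (r, t, x - \<psi> t))"
      using *[of "\<psi> (q + r *\<^sub>R (t - q))"]
      by (simp add: sheared_def line_point_def tube_coeff_def tube_param_def algebra_simps)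
  qed
qed

lemma ugev_local_solution:
  assumes "ugev1 I"
  shows "ugev s I (\<lambda>g y. local_solution g (fst y) (torus_class (snd y))) (B \<times> UNIV)"
proof -
  have "ugev s I (\<lambda>g. line_integral q (\<lambda>b. sheared g [b])) (B \<times> UNIV)"
    using assms c by (intro ugev_line_integral[OF B(1-3) s1] ugev_sheared) (simp add: ugev1_def)
  moreover have "(\<lambda>y. (fst y, snd y - \<psi> (fst y))) ` (B \<times> UNIV) \<subseteq> B \<times> UNIV" by auto
  ultimately show ?thesis
    using ugev_compose[OF s1 open_B_UNIV open_B_UNIV _ gev_map_shear(2)] by (simp add: local_solution_class)
qed

lemma continuous_sheared:
  assumes "g \<in> gevrey_test_sections A s 1" "b \<in> Basis"
  shows "continuous_on (B \<times> UNIV) (sheared g [b])"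
proof -
  have "ugev1 {g}" using assms by (intro ugev1_single) (simp add: gevrey_test_sections_def)
  then have "ugev s {g} (\<lambda>g. sheared g [b]) (B \<times> UNIV)"
    using assms c by (intro ugev_sheared) (simp add: ugev1_def)
  then show ?thesis by (auto simp: ugev_def intro: smooth_on_imp_continuous_on)
qed

lemma local_solution_add:
  assumes "g \<in> gevrey_test_sections A s 1" "g' \<in> gevrey_test_sections A s 1" "t \<in> B"
  shows "local_solution (g + g') t \<xi> = local_solution g t \<xi> + local_solution g' t \<xi>"
proof -
  have "(\<lambda>b. sheared (g + g') [b]) = (\<lambda>b y. sheared g [b] y + sheared g' [b] y)"
    by (simp add: sheared_def tube_coeff_add fun_eq_iff)
  then show ?thesis
    using line_integral_add[OF B(1-3) continuous_sheared[OF assms(1)] continuous_sheared[OF assms(2)] assms(3)]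
    by (simp add: local_solution_def)
qed

lemma local_solution_scale: "local_solution (section_scale a g) t \<xi> = a * local_solution g t \<xi>"
proof -
  have "(\<lambda>b. sheared (section_scale a g) [b]) = (\<lambda>b y. a * sheared g [b] y)"
    by (simp add: sheared_def tube_coeff_scale fun_eq_iff)
  then show ?thesis by (simp add: local_solution_def line_integral_scale[OF B(1-3)])
qed

text \<open>Segments from q to points of the convex set B stay in B, so the integral reads g only
  over the part of M parametrised by B.\<close>

lemma local_solution_zero:
  assumes "\<And>p \<xi>. p \<in> chart_inv c ` B \<Longrightarrow> g (p, \<xi>) = 0" "t \<in> B"
  shows "local_solution g t \<xi> = 0"
proof -
  have "local_solution g t \<xi> = line_integral q (\<lambda>b y. 0) (t, (SOME x. \<xi> = torus_class x) - \<psi> t)"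
    unfolding local_solution_def
  proof (rule line_integral_cong[OF B(1-3)])
    fix b and r :: real assume "r \<in> {0..1}"
    from line_point_in[OF B(1-3) assms(2) this]
    have "fst (line_point q (r, t, (SOME x. \<xi> = torus_class x) - \<psi> t)) \<in> B" by (metis mem_Times_iff)
    then show "sheared g [b] (line_point q (r, t, (SOME x. \<xi> = torus_class x) - \<psi> t)) = 0"
      using assms(1) by (simp add: sheared_def tube_coeff_def tube_param_def)
  qed
  then show ?thesis by (simp add: line_integral_def line_integrand_def)
qed

text \<open>By the chain rule the t-gradient of \<phi>(t, x + \<psi>(t)) is the sheared form of
  \<L>\<phi>, because the derivatives of \<psi> are the coefficients of \<omega>. Its line integral
  is a difference of endpoint values. At q the shear is the identity, so undoing the shear at t
  leaves the torus shift by -\<psi>(t) in the value at q.\<close>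

lemma local_solution_tube_L:
  assumes \<phi>: "\<phi> \<in> gevrey_test_sections A s 0" and t: "t \<in> B"
  shows "local_solution (tube_L A \<omega> \<phi>) t \<xi>
     = scalar \<phi> (chart_inv c t, \<xi>) - scalar \<phi> (chart_inv c q, torus_translate (- \<psi> t) \<xi>)"
proof -
  obtain x where x: "\<xi> = torus_class x" using torus_class_cases .
  have \<phi>': "\<phi> \<in> gevrey_tube_sections A s 0" using \<phi> by (simp add: gevrey_test_sections_def)
  have g: "gev s (tube_coeff \<phi> c []) (tube_domain c)"
    using \<phi>' c unfolding gevrey_tube_sections_iff by (auto simp: frame_indices_0)
  then have sg: "smooth_on (tube_coeff \<phi> c []) (tube_domain c)" by (simp add: ugev_def)
  have "gev s (sheared \<phi> []) (B \<times> UNIV)"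
    using ugev_sheared[of "{\<phi>}" "[]"] g by (simp add: ugev_def)
  then have sm: "smooth_on (sheared \<phi> []) (B \<times> UNIV)" by (simp add: ugev_def)
  have grad: "dir_deriv (b, 0) (sheared \<phi> []) y = sheared (tube_L A \<omega> \<phi>) [b] y"
    if b: "b \<in> Basis" and y: "y \<in> B \<times> UNIV" for b y
  proof -
    let ?\<Phi> = "\<lambda>y :: (real^'n) \<times> (real^'m). (fst y, snd y + \<psi> (fst y))"
    have fy: "fst y \<in> B" using y by auto
    have \<Phi>y: "?\<Phi> y \<in> tube_domain c" using fy B_domain by auto
    obtain D where D: "(\<psi> has_derivative D) (at (fst y))"
      using gev_map_differentiable[OF gev_map_\<psi> fy] by (auto simp: differentiable_def)
    have "complex_of_real (D b $ k) = \<omega> k (chart_inv c (fst y)) c [b]" for k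
    proof -
      have "((\<lambda>t. complex_of_real (\<psi> t $ k)) has_derivative (\<lambda>v. complex_of_real (D v $ k))) (at (fst y))"
        by (intro has_derivative_of_real bounded_linear.has_derivative[OF bounded_linear_vec_nth D])
      from dir_deriv_eq[OF this, of b] dir_deriv_\<psi>[OF b fy] show ?thesis by simp
    qed
    note Db = this
    have D2: "((\<lambda>y :: (real^'n) \<times> (real^'m). \<psi> (fst y)) has_derivative (\<lambda>v. D (fst v))) (at y)"
      using has_derivative_compose[OF has_derivative_fst[OF has_derivative_ident], of \<psi> D y UNIV] D by simp
    have "(?\<Phi> has_derivative (\<lambda>v. (fst v, snd v + D (fst v)))) (at y)"
      by (intro has_derivative_Pair has_derivative_add D2 has_derivative_fst has_derivative_snd has_derivative_ident)
    note comp = has_derivative_compose[OF this has_derivative_dir_deriv[OF smooth_on_imp_differentiable[OF sg \<Phi>y]]]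
    have "dir_deriv (b, 0) (sheared \<phi> []) y
        = dir_deriv (fst (b, 0 :: real^'m), snd (b, 0 :: real^'m) + D (fst (b, 0 :: real^'m))) (tube_coeff \<phi> c []) (?\<Phi> y)"
      unfolding sheared_def[abs_def] by (rule dir_deriv_eq[OF comp])
    also have "\<dots> = dir_deriv (b, D b) (tube_coeff \<phi> c []) (?\<Phi> y)" by simp
    also have "(b, D b) = (b, 0) + (\<Sum>k\<in>UNIV. (D b $ k) *\<^sub>R (0, axis k 1))"
      by (simp add: prod_eq_iff fst_sum snd_sum basis_expansion flip: scalar_mult_eq_scaleR)
    also have "dir_deriv \<dots> (tube_coeff \<phi> c []) (?\<Phi> y)
       = dir_deriv (b, 0) (tube_coeff \<phi> c []) (?\<Phi> y)
         + (\<Sum>k\<in>UNIV. (D b $ k) *\<^sub>R dir_deriv (0, axis k 1) (tube_coeff \<phi> c []) (?\<Phi> y))"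
    proof -
      have lin: "linear (\<lambda>v. dir_deriv v (tube_coeff \<phi> c []) (?\<Phi> y))"
        using has_derivative_linear[OF has_derivative_dir_deriv[OF smooth_on_imp_differentiable[OF sg \<Phi>y]]] .
      show ?thesis by (simp only: linear_add[OF lin] linear_sum[OF lin] linear_scale[OF lin])
    qed
    also have "\<dots> = sheared (tube_L A \<omega> \<phi>) [b] y"
      by (simp add: sheared_def tube_L_coeff[OF c \<Phi>y] scaleR_conv_of_real Db)
    finally show ?thesis .
  qed
  have "local_solution (tube_L A \<omega> \<phi>) t \<xi>
      = line_integral q (\<lambda>b. dir_deriv (b, 0) (sheared \<phi> [])) (t, x - \<psi> t)"
    unfolding x local_solution_class
    by (rule line_integral_cong[OF B(1-3)]) (simp add: grad line_point_in[OF B(1-3) t])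
  also have "\<dots> = sheared \<phi> [] (t, x - \<psi> t) - sheared \<phi> [] (q, x - \<psi> t)"
    by (rule line_integral_gradient[OF B(1-3) sm t])
  also have "\<dots> = scalar \<phi> (chart_inv c t, \<xi>) - scalar \<phi> (chart_inv c q, torus_translate (- \<psi> t) \<xi>)"
  proof -
    have "(t, x) \<in> tube_domain c" "(q, x - \<psi> t) \<in> tube_domain c" using t B B_domain by blast+
    then show ?thesis
      using scalar_tube_param[OF \<phi>' c, of "(t, x)"] scalar_tube_param[OF \<phi>' c, of "(q, x - \<psi> t)"]
      by (simp add: sheared_def \<psi>_center tube_param_def x)
  qed
  finally show ?thesis .
qed

end

end

section \<open>Transport between points and escape to infinity\<close>

context tube_complex
begin

definition vanishes_off :: "'a set \<Rightarrow> ('a, 'm, 'n) tube_section \<Rightarrow> bool" where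
  "vanishes_off K g \<longleftrightarrow> (\<forall>p \<xi>. p \<notin> K \<longrightarrow> g (p, \<xi>) = 0)"

definition linear_functional :: "(('a, 'm, 'n) tube_section \<Rightarrow> 'm torus \<Rightarrow> complex) \<Rightarrow> bool" where
  "linear_functional T \<longleftrightarrow>
     (\<forall>g\<in>gevrey_test_sections A s 1. \<forall>g'\<in>gevrey_test_sections A s 1. \<forall>\<xi>. T (g + g') \<xi> = T g \<xi> + T g' \<xi>) \<and>
     (\<forall>a. \<forall>g\<in>gevrey_test_sections A s 1. \<forall>\<xi>. T (section_scale a g) \<xi> = a * T g \<xi>)"

text \<open>The last clause expresses that the chain along which T integrates avoids K: sections
  carried by K are not seen.\<close>

definition transport :: "'a set \<Rightarrow> (('a, 'm, 'n) tube_section \<Rightarrow> 'm torus \<Rightarrow> complex) \<Rightarrow> bool" where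
  "transport K T \<longleftrightarrow> linear_functional T \<and>
     (\<forall>I. ugev1 I \<longrightarrow> ugev s I (\<lambda>g x. T g (torus_class x)) UNIV) \<and>
     (\<forall>g \<xi>. vanishes_off K g \<longrightarrow> T g \<xi> = 0)"

text \<open>The shift a is what the shears leave behind: -\<psi>(t) for a single segment, and the
  sum of such terms along a chain.\<close>

definition transports ::
    "('a, 'm, 'n) tube_section itself \<Rightarrow> 'a set \<Rightarrow> 'a \<Rightarrow> 'a \<Rightarrow> (('a, 'm, 'n) tube_section \<Rightarrow> 'm torus \<Rightarrow> complex) \<Rightarrow> real^'m \<Rightarrow> bool" where
  "transports _ K p q T a \<longleftrightarrow> transport K T \<and> (\<forall>\<phi>\<in>gevrey_test_sections A s 0. \<forall>\<xi>.
     scalar \<phi> (p, \<xi>) = T (tube_L A \<omega> \<phi>) \<xi> + scalar \<phi> (q, torus_translate a \<xi>))"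

definition joinable :: "'a set \<Rightarrow> 'a \<Rightarrow> 'a \<Rightarrow> bool" where
  "joinable K p q \<longleftrightarrow> (\<exists>T a. transports TYPE(('a, 'm, 'n) tube_section) K p q T a)"

lemma ugev_translate:
  assumes "ugev s I (\<lambda>g x. T g (torus_class x)) UNIV"
  shows "ugev s I (\<lambda>g x. T g (torus_translate a (torus_class x))) UNIV"
  using ugev_compose[OF s1 open_UNIV open_UNIV assms gev_map_translate[OF s0, of a UNIV]] by simp

lemma transport_translate: "transport K T \<Longrightarrow> transport K (\<lambda>g \<xi>. T g (torus_translate a \<xi>))"
  unfolding transport_def linear_functional_def by (intro conjI allI impI ugev_translate) simp_all

lemma transport_add: "transport K T \<Longrightarrow> transport K S \<Longrightarrow> transport K (\<lambda>g \<xi>. T g \<xi> + S g \<xi>)"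
  unfolding transport_def linear_functional_def
  by (auto intro!: ugev_add[OF open_UNIV] simp: algebra_simps)

lemma transport_uminus: "transport K T \<Longrightarrow> transport K (\<lambda>g \<xi>. - T g \<xi>)"
  unfolding transport_def linear_functional_def
  using ugev_cmult[OF s1 open_UNIV, of _ "\<lambda>g x. T g (torus_class x)" "-1"] by simp

lemma joinable_refl: "joinable K p p"
  unfolding joinable_def transports_def
  by (intro exI[of _ "\<lambda>_ _. 0"] exI[of _ 0]) (auto simp: transport_def linear_functional_def ugev_constant)

lemma joinable_sym:
  assumes "joinable K p q"
  shows "joinable K q p"
proof -
  obtain T a where T: "transport K T" and \<phi>: "\<And>\<phi> \<xi>. \<phi> \<in> gevrey_test_sections A s 0 \<Longrightarrow>
     scalar \<phi> (p, \<xi>) = T (tube_L A \<omega> \<phi>) \<xi> + scalar \<phi> (q, torus_translate a \<xi>)"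
    using assms unfolding joinable_def transports_def by blast
  have "transport K (\<lambda>g \<xi>. - T g (torus_translate (- a) \<xi>))"
    by (rule transport_uminus[OF transport_translate[OF T]])
  moreover have "scalar \<phi> (q, \<xi>) = - T (tube_L A \<omega> \<phi>) (torus_translate (- a) \<xi>) + scalar \<phi> (p, torus_translate (- a) \<xi>)"
    if "\<phi> \<in> gevrey_test_sections A s 0" for \<phi> \<xi>
    using \<phi>[OF that, of "torus_translate (- a) \<xi>"] by (simp add: torus_translate_translate)
  ultimately show ?thesis unfolding joinable_def transports_def by blast
qed

text \<open>The second integral is evaluated at the torus point already shifted by a, and the shifts
  add up; translating the argument preserves all clauses of \<open>transport\<close>.\<close>

lemma joinable_trans:
  assumes "joinable K p q" "joinable K q r"
  shows "joinable K p r"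
proof -
  obtain T a where T: "transport K T" and \<phi>: "\<And>\<phi> \<xi>. \<phi> \<in> gevrey_test_sections A s 0 \<Longrightarrow>
     scalar \<phi> (p, \<xi>) = T (tube_L A \<omega> \<phi>) \<xi> + scalar \<phi> (q, torus_translate a \<xi>)"
    using assms(1) unfolding joinable_def transports_def by blast
  obtain S b where S: "transport K S" and \<phi>': "\<And>\<phi> \<xi>. \<phi> \<in> gevrey_test_sections A s 0 \<Longrightarrow>
     scalar \<phi> (q, \<xi>) = S (tube_L A \<omega> \<phi>) \<xi> + scalar \<phi> (r, torus_translate b \<xi>)"
    using assms(2) unfolding joinable_def transports_def by blast
  have "transport K (\<lambda>g \<xi>. T g \<xi> + S g (torus_translate a \<xi>))"
    by (rule transport_add[OF T transport_translate[OF S]])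
  moreover have "scalar \<phi> (p, \<xi>) = T (tube_L A \<omega> \<phi>) \<xi> + S (tube_L A \<omega> \<phi>) (torus_translate a \<xi>)
      + scalar \<phi> (r, torus_translate (a + b) \<xi>)" if "\<phi> \<in> gevrey_test_sections A s 0" for \<phi> \<xi>
    using \<phi>[OF that] \<phi>'[OF that] by (simp add: torus_translate_translate)
  ultimately show ?thesis unfolding joinable_def transports_def by blast
qed

lemma joinable_center:
  assumes c: "c \<in> analytic_charts A" and B: "open B" "convex B" "q \<in> B" "B \<subseteq> snd c ` fst c"
    and K: "chart_inv c ` B \<inter> K = {}" and t: "t \<in> B"
  shows "joinable K (chart_inv c t) (chart_inv c q)"
proof -
  note loc = c B
  let ?T = "\<lambda>g. local_solution c q g t"
  have "ugev s I (\<lambda>g x. ?T g (torus_class x)) UNIV" if "ugev1 I" for I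
  proof -
    have "gev_map s (\<lambda>x :: real^'m. (t, x)) UNIV"
      by (intro gev_map_Pair gev_map_const gev_map_linear[OF bounded_linear_ident s0])
    moreover have "(\<lambda>x :: real^'m. (t, x)) ` UNIV \<subseteq> B \<times> UNIV" using t by auto
    ultimately show ?thesis
      using ugev_compose[OF s1 open_UNIV open_B_UNIV[OF loc] ugev_local_solution[OF loc \<open>ugev1 I\<close>]] by fastforce
  qed
  moreover have "linear_functional ?T"
    unfolding linear_functional_def using local_solution_add[OF loc] local_solution_scale[OF loc] t by auto
  moreover have "?T g \<xi> = 0" if "vanishes_off K g" for g \<xi>
    by (rule local_solution_zero[OF loc _ t]) (use that K in \<open>auto simp: vanishes_off_def\<close>)
  ultimately have "transport K ?T" by (simp add: transport_def)
  then show ?thesis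
    unfolding joinable_def transports_def
    by (intro exI[of _ ?T] exI[of _ "- \<psi> c q t"]) (auto simp: local_solution_tube_L[OF loc _ t])
qed

lemma joinable_neighbourhood:
  assumes "closed K" "p \<notin> K"
  obtains N where "open N" "p \<in> N" "N \<inter> K = {}" "\<forall>p'\<in>N. joinable K p' p"
proof -
  obtain c where "c \<in> A" and pc: "p \<in> fst c" using atlas_cover .
  then have c: "c \<in> analytic_charts A" using atlas_subset by blast
  let ?U = "{t \<in> snd c ` fst c. chart_inv c t \<in> - K}"
  have "open ?U" by (rule open_chart_vimage[OF c]) (simp add: assms open_Compl)
  moreover have "snd c p \<in> ?U" using pc assms chart(5)[OF c pc] by auto
  ultimately obtain e where e: "e > 0" "ball (snd c p) e \<subseteq> ?U" using open_contains_ball by blast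
  define B where "B = ball (snd c p) e"
  have B: "open B" "convex B" "snd c p \<in> B" "B \<subseteq> snd c ` fst c" "chart_inv c ` B \<inter> K = {}"
    using e by (auto simp: B_def)
  show thesis
  proof (rule that[of "chart_inv c ` B"])
    show "open (chart_inv c ` B)" by (rule open_chart_inv_image[OF c B(1,4)])
    show "p \<in> chart_inv c ` B" using B(3) chart(5)[OF c pc] by (metis image_eqI)
    show "\<forall>p'\<in>chart_inv c ` B. joinable K p' p"
      using joinable_center[OF c B] chart(5)[OF c pc] by auto
  qed (fact B(5))
qed

text \<open>Every point outside K has a neighbourhood outside K whose points are all joinable to it,
  so a class and its complement in the complement of K are both open. Classes are thus unions of
  components of the complement of K.\<close>

lemma open_joinable_class:
  assumes "closed K"
  shows "open {q. q \<notin> K \<and> joinable K p q}" and "open {q. q \<notin> K \<and> \<not> joinable K p q}"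
proof -
  have "\<exists>N. open N \<and> q \<in> N \<and> N \<subseteq> {q. q \<notin> K \<and> joinable K p q}" if q: "q \<notin> K" "joinable K p q" for q
  proof -
    obtain N where "open N" "q \<in> N" "N \<inter> K = {}" "\<forall>q'\<in>N. joinable K q' q"
      using joinable_neighbourhood[OF assms q(1)] .
    then show ?thesis using joinable_trans[OF q(2)] joinable_sym by (intro exI[of _ N]) blast
  qed
  then show "open {q. q \<notin> K \<and> joinable K p q}" by (subst open_subopen) blast
  have "\<exists>N. open N \<and> q \<in> N \<and> N \<subseteq> {q. q \<notin> K \<and> \<not> joinable K p q}" if q: "q \<notin> K" "\<not> joinable K p q" for q
  proof -
    obtain N where "open N" "q \<in> N" "N \<inter> K = {}" "\<forall>q'\<in>N. joinable K q' q"
      using joinable_neighbourhood[OF assms q(1)] .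
    then show ?thesis using joinable_trans q(2) by (intro exI[of _ N]) blast
  qed
  then show "open {q. q \<notin> K \<and> \<not> joinable K p q}" by (subst open_subopen) blast
qed

end

section \<open>Exhaustions, hulls and infinite chains\<close>

locale exhausted_tube_complex = tube_complex A s \<omega>
  for A :: "('a::{t2_space, second_countable_topology}, 'n::finite) chart set" and s :: real
    and \<omega> :: "'m::finite \<Rightarrow> 'a \<Rightarrow> ('a, 'n) form_value" +
  fixes E :: "nat \<Rightarrow> 'a set"
  assumes conn: "connected (UNIV :: 'a set)" and noncompact: "\<not> compact (UNIV :: 'a set)"
    and E: "\<And>l. compact (E l)" "\<And>l. E l \<subseteq> interior (E (Suc l))" "(\<Union>l. E l) = UNIV"
begin

lemma E_mono: "l \<le> l' \<Longrightarrow> E l \<subseteq> E l'"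
  by (rule lift_Suc_mono_le[of E]) (rule order_trans[OF E(2) interior_subset])

lemma compact_in_E:
  assumes "compact K"
  obtains l where "K \<subseteq> interior (E l)"
proof -
  have "K \<subseteq> (\<Union>l. interior (E l))"
  proof
    fix x
    have "x \<in> (\<Union>l. E l)" using E(3) by simp
    then obtain l where "x \<in> E l" by blast
    then have "x \<in> interior (E (Suc l))" by (rule subsetD[OF E(2)])
    then show "x \<in> (\<Union>l. interior (E l))" by blast
  qed
  then obtain T where T: "finite T" "K \<subseteq> (\<Union>l\<in>T. interior (E l))"
    using compactE_image[OF assms, of UNIV "\<lambda>l. interior (E l)"] by auto
  have "interior (E l) \<subseteq> interior (E (Max T))" if "l \<in> T" for l
    using that T(1) by (intro interior_mono E_mono) simp
  then show thesis using T(2) that by blast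
qed

lemma clopen_UNIV: "open D \<Longrightarrow> open (- D) \<Longrightarrow> p \<in> D \<Longrightarrow> D = (UNIV :: 'a set)"
  using conn unfolding connected_clopen by (auto simp: openin_open_eq closed_def)

text \<open>Only the finitely many classes of \<open>- K\<close> that meet the frontier of a compact neighbourhood of \<open>K\<close>
  can leave this neighbourhood; the relatively compact ones among them are absorbed into the hull.\<close>

lemma escape_hull:
  assumes K: "compact K"
  shows "\<exists>K'. compact K' \<and> K \<subseteq> K' \<and> (K = {} \<longrightarrow> K' = {}) \<and>
    (\<forall>p L. p \<notin> K' \<longrightarrow> compact L \<longrightarrow> (\<exists>q. q \<notin> L \<and> joinable K p q))"
proof -
  define C where "C p = {q. q \<notin> K \<and> joinable K p q}" for p
  have clK: "closed K" using K by (rule compact_imp_closed)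
  have opC: "open (C p)" for p unfolding C_def by (rule open_joinable_class[OF clK])
  have opN: "open {q. q \<notin> K \<and> \<not> joinable K p q}" for p by (rule open_joinable_class[OF clK])
  show ?thesis
  proof (cases "K = {}")
    \<comment> \<open>Here all points are joinable by connectedness, and M is not compact, so the
      empty set is its own hull. This makes level 0 available at every point when levels are chosen
      in \<open>left_inverse_exists\<close>.\<close>
    case True
    have "C p = UNIV" for p
    proof (rule clopen_UNIV[OF opC])
      show "open (- C p)" using opN[of p] True by (simp add: C_def Collect_neg_eq)
      show "p \<in> C p" using True joinable_refl by (simp add: C_def)
    qed
    then have "joinable K p q" for p q unfolding C_def by blast
    moreover have "\<exists>q. q \<notin> L" if "compact L" for L :: "'a set" using noncompact that by (metis UNIV_eq_I)
    ultimately show ?thesis using True by (intro exI[of _ "{}"]) auto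
  next
    case False
    obtain l where l: "K \<subseteq> interior (E l)" using compact_in_E[OF K] .
    define F where "F = E l - interior (E l)"
    have F: "compact F" unfolding F_def by (intro compact_diff E(1)) simp
    have "F \<subseteq> (\<Union>p\<in>F. C p)" using l joinable_refl by (auto simp: C_def F_def)
    then obtain T where T: "T \<subseteq> F" "finite T" "F \<subseteq> (\<Union>p\<in>T. C p)"
      using compactE_image[OF F, of F C] opC by blast
    \<comment> \<open>The classes from which no chain escapes, among the finitely many that cover
      the frontier of \<open>E l\<close>.\<close>
    define T' where "T' = {p \<in> T. \<exists>L. compact L \<and> C p \<subseteq> L}"
    have "\<forall>p\<in>T'. \<exists>L. compact L \<and> C p \<subseteq> L" by (simp add: T'_def)
    then obtain L where L: "\<forall>p\<in>T'. compact (L p) \<and> C p \<subseteq> L p" by metis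
    define K' where "K' = E l \<union> (\<Union>p\<in>T'. L p)"
    have "compact K'" unfolding K'_def using E(1) L T(2) by (intro compact_Un compact_UN) (auto simp: T'_def)
    moreover have "K \<subseteq> K'" using l interior_subset by (auto simp: K'_def)
    moreover have "\<not> C p \<subseteq> M" if p: "p \<notin> K'" and M: "compact M" for p M
    proof
      assume sub: "C p \<subseteq> M"
      have pK: "p \<notin> K" "p \<notin> E l" using p l interior_subset by (auto simp: K'_def)
      show False
      proof (cases "C p \<inter> F = {}")
        case False
        then obtain f where f: "f \<in> C p" "f \<in> F" by blast
        then obtain i where i: "i \<in> T" "f \<in> C i" using T(3) by blast
        have "joinable K i f" "joinable K p f" using f(1) i(2) by (simp_all add: C_def)
        then have ip: "joinable K i p" and pi: "joinable K p i"
          using joinable_trans[OF _ joinable_sym] by blast+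
        have "C i \<subseteq> C p" using joinable_trans[OF pi] by (auto simp: C_def)
        then have "i \<in> T'" using i(1) sub M by (auto simp: T'_def)
        moreover have "p \<in> C i" using ip pK by (simp add: C_def)
        ultimately show False using L p by (auto simp: K'_def)
      next
        case True
        \<comment> \<open>A class that misses the frontier of \<open>E l\<close> is cut by it into
          two pieces. The outer piece D would be open and closed in M, hence all of M, which
          contradicts that K is nonempty and disjoint from the class.\<close>
        define D where "D = C p - E l"
        have "closed (E l)" using E(1) by (rule compact_imp_closed)
        then have "open D" unfolding D_def using opC by (rule open_Diff[rotated])
        moreover have "- D = interior (E l) \<union> {q. q \<notin> K \<and> \<not> joinable K p q}"
          using True l interior_subset[of "E l"] by (auto simp: D_def C_def F_def)
        then have "open (- D)" using opN by (simp add: open_Un)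
        moreover have "p \<in> D" using pK joinable_refl by (simp add: D_def C_def)
        ultimately have "D = UNIV" by (rule clopen_UNIV)
        then show False using \<open>K \<noteq> {}\<close> by (auto simp: D_def C_def)
      qed
    qed
    ultimately show ?thesis using False unfolding C_def by (intro exI[of _ K']) blast
  qed
qed

text \<open>The exhaustion with the empty set put in front: at level 0 nothing has to be avoided, so
  a chain can start at any point of M. From level 1 on the index is one higher than that of
  \<open>E\<close>.\<close>

definition EE :: "nat \<Rightarrow> 'a set" where
  "EE l = (case l of 0 \<Rightarrow> {} | Suc l \<Rightarrow> E l)"

definition ehull :: "nat \<Rightarrow> 'a set" where
  "ehull l = (SOME K'. compact K' \<and> EE l \<subseteq> K' \<and> (EE l = {} \<longrightarrow> K' = {}) \<and>
    (\<forall>p L. p \<notin> K' \<longrightarrow> compact L \<longrightarrow> (\<exists>q. q \<notin> L \<and> joinable (EE l) p q)))"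

lemma EE_mono: "l \<le> l' \<Longrightarrow> EE l \<subseteq> EE l'"
  using E_mono by (auto simp: EE_def split: nat.splits)

lemma ehull: "compact (ehull l)" "EE l \<subseteq> ehull l" "ehull 0 = {}"
  "p \<notin> ehull l \<Longrightarrow> compact L \<Longrightarrow> \<exists>q. q \<notin> L \<and> joinable (EE l) p q"
proof -
  have *: "compact (EE l)" for l using E(1) by (simp add: EE_def split: nat.splits)
  have **: "compact (ehull l) \<and> EE l \<subseteq> ehull l \<and> (EE l = {} \<longrightarrow> ehull l = {}) \<and>
    (\<forall>p L. p \<notin> ehull l \<longrightarrow> compact L \<longrightarrow> (\<exists>q. q \<notin> L \<and> joinable (EE l) p q))" for l
    unfolding ehull_def by (rule someI_ex[OF escape_hull[OF *]])
  show "compact (ehull l)" "EE l \<subseteq> ehull l" "p \<notin> ehull l \<Longrightarrow> compact L \<Longrightarrow> \<exists>q. q \<notin> L \<and> joinable (EE l) p q"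
    using **[of l] by blast+
  show "ehull 0 = {}" using **[of 0] by (simp add: EE_def)
qed

text \<open>A transport along an infinite chain, with no value left over at its end. Uniform bounds
  are asked only for families carried by one \<open>E l\<close>, since such a family sees boundedly
  many links.\<close>

definition escapes :: "'a set \<Rightarrow> 'a \<Rightarrow> (('a, 'm, 'n) tube_section \<Rightarrow> 'm torus \<Rightarrow> complex) \<Rightarrow> bool" where
  "escapes K p S \<longleftrightarrow> linear_functional S \<and>
     (\<forall>I l. ugev1 I \<longrightarrow> (\<forall>g\<in>I. vanishes_off (E l) g) \<longrightarrow> ugev s I (\<lambda>g x. S g (torus_class x)) UNIV) \<and>
     (\<forall>g \<xi>. vanishes_off K g \<longrightarrow> S g \<xi> = 0) \<and>
     (\<forall>\<phi>\<in>gevrey_test_sections A s 0. \<forall>\<xi>. scalar \<phi> (p, \<xi>) = S (tube_L A \<omega> \<phi>) \<xi>)"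

lemma vanishes_off_mono: "vanishes_off K g \<Longrightarrow> K \<subseteq> K' \<Longrightarrow> vanishes_off K' g"
  unfolding vanishes_off_def by blast

lemma vanishes_off_support: "section_support g \<subseteq> K \<times> UNIV \<Longrightarrow> vanishes_off K g"
  unfolding vanishes_off_def using not_in_section_support[of _ g] by blast

lemma test_vanishes_off:
  assumes "g \<in> gevrey_test_sections A s q"
  obtains l where "vanishes_off (E l) g"
proof -
  have "compact (fst ` section_support g)"
    using assms by (intro compact_continuous_image continuous_intros) (simp add: gevrey_test_sections_def)
  then obtain l where "fst ` section_support g \<subseteq> interior (E l)" using compact_in_E by blast
  then have "section_support g \<subseteq> E l \<times> UNIV" using interior_subset[of "E l"] by force
  then show thesis using that vanishes_off_support by blast
qed

lemma vanishes_off_add: "vanishes_off K g \<Longrightarrow> vanishes_off K g' \<Longrightarrow> vanishes_off K (g + g')"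
  by (simp add: vanishes_off_def)

lemma vanishes_off_scale: "vanishes_off K g \<Longrightarrow> vanishes_off K (section_scale a g)"
  by (simp add: vanishes_off_def section_scale_def fun_eq_iff)

text \<open>Link n avoids \<open>EE (i + n)\<close>, so all but finitely many links vanish on a
  section of compact support. The n-th point lies outside \<open>ehull (i + n)\<close>, hence
  finally outside the support of a given \<phi>, where the remaining value of \<phi> is
  zero.\<close>

lemma escape_exists:
  assumes p: "p \<notin> ehull i"
  shows "\<exists>S. escapes (EE i) p S"
proof -
  have "\<exists>f. \<forall>n. (f n \<notin> ehull (i + n) \<and> (n = 0 \<longrightarrow> f n = p)) \<and> joinable (EE (i + n)) (f n) (f (Suc n))"
  proof (rule dependent_nat_choice)
    fix x n assume "x \<notin> ehull (i + n) \<and> (n = 0 \<longrightarrow> x = p)"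
    then show "\<exists>y. (y \<notin> ehull (i + Suc n) \<and> (Suc n = 0 \<longrightarrow> y = p)) \<and> joinable (EE (i + n)) x y"
      \<comment> \<open>The escape target is chosen outside the next hull, which is compact, so that
        the chain can be continued from it.\<close>
      using ehull(4)[of x "i + n" "ehull (i + Suc n)"] ehull(1) by auto
  qed (use p in auto)
  then obtain f where f: "\<And>n. f n \<notin> ehull (i + n)" "f 0 = p" "\<And>n. joinable (EE (i + n)) (f n) (f (Suc n))"
    by blast
  then have "\<forall>n. \<exists>T a. transports TYPE(('a, 'm, 'n) tube_section) (EE (i + n)) (f n) (f (Suc n)) T a"
    unfolding joinable_def by blast
  then obtain T a where Ta: "\<And>n. transports TYPE(('a, 'm, 'n) tube_section) (EE (i + n)) (f n) (f (Suc n)) (T n) (a n)"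
    by metis
  then have T: "\<And>n. transport (EE (i + n)) (T n)"
    and \<phi>: "\<And>n \<phi> \<xi>. \<phi> \<in> gevrey_test_sections A s 0 \<Longrightarrow>
      scalar \<phi> (f n, \<xi>) = T n (tube_L A \<omega> \<phi>) \<xi> + scalar \<phi> (f (Suc n), torus_translate (a n) \<xi>)"
    unfolding transports_def by blast+
  define b where "b n = (\<Sum>k<n. a k)" for n
  define S where "S g \<xi> = (\<Sum>n. T n g (torus_translate (b n) \<xi>))" for g \<xi>
  have T0: "T n g \<xi> = 0" if "vanishes_off (EE (i + n)) g" for n g \<xi>
    using T[of n] that unfolding transport_def by blast
  have S_fin: "S g \<xi> = (\<Sum>n<N. T n g (torus_translate (b n) \<xi>))"
    if "vanishes_off (EE (i + N)) g" for g \<xi> N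
    unfolding S_def
  proof (rule suminf_finite)
    fix n assume "n \<notin> {..<N}"
    then have "i + N \<le> i + n" by simp
    then show "T n g (torus_translate (b n) \<xi>) = 0" by (rule T0[OF vanishes_off_mono[OF that EE_mono]])
  qed simp
  \<comment> \<open>\<open>EE (i + Suc l)\<close> is \<open>E (i + l)\<close>, one index lower, and
    contains \<open>E l\<close>.\<close>
  have E_EE: "vanishes_off (EE (i + Suc l)) g" if "vanishes_off (E l) g" for l g
    using that by (rule vanishes_off_mono) (use E_mono[of l "i + l"] in \<open>simp add: EE_def\<close>)
  have lin: "linear_functional S"
    unfolding linear_functional_def
  proof (intro conjI ballI allI)
    fix g g' :: "('a, 'm, 'n) tube_section" and \<xi>
    assume g: "g \<in> gevrey_test_sections A s 1" "g' \<in> gevrey_test_sections A s 1"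
    obtain l l' where l: "vanishes_off (E l) g" and l': "vanishes_off (E l') g'" using g test_vanishes_off by metis
    then have v: "vanishes_off (EE (i + Suc (max l l'))) g" "vanishes_off (EE (i + Suc (max l l'))) g'"
      using vanishes_off_mono[OF l E_mono, of "max l l'"] vanishes_off_mono[OF l' E_mono, of "max l l'"] E_EE by simp_all
    show "S (g + g') \<xi> = S g \<xi> + S g' \<xi>"
      unfolding S_fin[OF v(1)] S_fin[OF v(2)] S_fin[OF vanishes_off_add[OF v]]
      using T g unfolding transport_def linear_functional_def by (simp add: sum.distrib)
  next
    fix \<alpha> and g :: "('a, 'm, 'n) tube_section" and \<xi> assume g: "g \<in> gevrey_test_sections A s 1"
    obtain l where "vanishes_off (E l) g" using g test_vanishes_off by metis
    then have v: "vanishes_off (EE (i + Suc l)) g" by (rule E_EE)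
    show "S (section_scale \<alpha> g) \<xi> = \<alpha> * S g \<xi>"
      unfolding S_fin[OF v] S_fin[OF vanishes_off_scale[OF v]]
      using T g unfolding transport_def linear_functional_def by (simp add: sum_distrib_left distrib_left)
  qed
  moreover have "ugev s I (\<lambda>g x. S g (torus_class x)) UNIV"
    if I: "ugev1 I" and l: "\<forall>g\<in>I. vanishes_off (E l) g" for I l
  proof (rule ugev_cong[OF open_UNIV])
    show "S g (torus_class x) = (\<Sum>n<Suc l. T n g (torus_translate (b n) (torus_class x)))" if "g \<in> I" for g x
      by (rule S_fin) (use l that E_EE in blast)
    show "ugev s I (\<lambda>g x. \<Sum>n<Suc l. T n g (torus_translate (b n) (torus_class x))) UNIV"
      using T I unfolding transport_def by (intro ugev_sum[OF open_UNIV] ugev_translate) auto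
  qed
  moreover have "S g \<xi> = 0" if "vanishes_off (EE i) g" for g \<xi>
    using S_fin[of 0 g \<xi>] that by simp
  moreover have "scalar \<phi> (p, \<xi>) = S (tube_L A \<omega> \<phi>) \<xi>" if \<phi>G: "\<phi> \<in> gevrey_test_sections A s 0" for \<phi> \<xi>
  proof -
    have ind: "scalar \<phi> (p, \<xi>) = (\<Sum>n<N. T n (tube_L A \<omega> \<phi>) (torus_translate (b n) \<xi>))
        + scalar \<phi> (f N, torus_translate (b N) \<xi>)" for N
    proof (induction N)
      case 0
      show ?case using f(2) by (simp add: b_def)
    next
      case (Suc N)
      have "scalar \<phi> (f N, torus_translate (b N) \<xi>) = T N (tube_L A \<omega> \<phi>) (torus_translate (b N) \<xi>)
          + scalar \<phi> (f (Suc N), torus_translate (b (Suc N)) \<xi>)"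
        using \<phi>[OF \<phi>G, of N "torus_translate (b N) \<xi>"] by (simp add: torus_translate_translate b_def)
      with Suc show ?case by simp
    qed
    obtain l where l: "vanishes_off (E l) \<phi>" using test_vanishes_off[OF \<phi>G] .
    obtain l' where l': "vanishes_off (E l') (tube_L A \<omega> \<phi>)" using test_vanishes_off[OF tube_L_test[OF \<phi>G]] .
    define N where "N = Suc (max l l')"
    have v: "vanishes_off (EE (i + N)) \<phi>" "vanishes_off (EE (i + N)) (tube_L A \<omega> \<phi>)"
      unfolding N_def
      using vanishes_off_mono[OF l E_mono, of "max l l'"] vanishes_off_mono[OF l' E_mono, of "max l l'"] E_EE by simp_all
    have "f N \<notin> EE (i + N)" using f(1) ehull(2) by blast
    then have "scalar \<phi> (f N, torus_translate (b N) \<xi>) = 0"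
      using v(1) by (simp add: scalar_def vanishes_off_def)
    then show ?thesis using ind[of N] S_fin[OF v(2)] by simp
  qed
  ultimately show ?thesis unfolding escapes_def by blast
qed

end

section \<open>A left inverse of the operator on functions\<close>

text \<open>Three concentric cubes are used below: radius r for covering M, 2 r for the support of
  the cutoff, and 3 r for the domain of the local solution.\<close>

definition cube :: "real^'n \<Rightarrow> real \<Rightarrow> (real^'n) set" where
  "cube q r = {t. \<forall>i. \<bar>t $ i - q $ i\<bar> \<le> r}"

definition open_cube :: "real^'n \<Rightarrow> real \<Rightarrow> (real^'n) set" where
  "open_cube q r = {t. \<forall>i. \<bar>t $ i - q $ i\<bar> < r}"

lemma cube_cbox: "cube q r = cbox (q - vec r) (q + vec r)"
  by (auto simp: cube_def mem_box_cart abs_le_iff algebra_simps)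

lemma open_cube_box: "open_cube q r = box (q - vec r) (q + vec r)"
  by (auto simp: open_cube_def mem_box_cart abs_less_iff algebra_simps)

lemma compact_cube: "compact (cube q r)" by (simp add: cube_cbox)

lemma open_cube: "open (open_cube q r)" "convex (open_cube q r)" "r > 0 \<Longrightarrow> q \<in> open_cube q r"
  by (simp_all add: open_cube_box open_box convex_box) (simp add: mem_box_cart)

lemma cube_mono: "r < r' \<Longrightarrow> cube q r \<subseteq> open_cube q r'" "open_cube q r \<subseteq> cube q r"
  by (auto simp: cube_def open_cube_def intro: le_less_trans less_imp_le)

lemma cube_subset_ball:
  fixes q :: "real^'n"
  assumes "e > 0"
  shows "cube q (e / (2 * CARD('n))) \<subseteq> ball q e"
proof
  fix t assume t: "t \<in> cube q (e / (2 * CARD('n)))"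
  have "norm (t - q) \<le> (\<Sum>i\<in>UNIV. \<bar>(t - q) $ i\<bar>)" by (rule norm_le_l1_cart)
  also have "\<dots> \<le> (\<Sum>i\<in>(UNIV :: 'n set). e / (2 * CARD('n)))"
    using t by (intro sum_mono) (simp add: cube_def)
  also have "\<dots> = e / 2" by simp
  finally show "t \<in> ball q e" using assms by (simp add: dist_norm norm_minus_commute)
qed

text \<open>A partition of unity without division: as soon as one of the first N functions X i
  equals 1 at a point, the weights there add up to 1.\<close>

lemma sum_telescoping_partition:
  fixes X :: "nat \<Rightarrow> complex"
  shows "(\<Sum>j<N. (\<Prod>i<j. 1 - X i) * X j) = 1 - (\<Prod>i<N. 1 - X i)"
  by (induction N) (auto simp: algebra_simps)

context exhausted_tube_complex
begin

lemma cube_at: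
  assumes "closed K" "p \<notin> K"
  shows "\<exists>c r. c \<in> A \<and> p \<in> fst c \<and> r > 0 \<and> cube (snd c p) (3 * r) \<subseteq> {t \<in> snd c ` fst c. chart_inv c t \<in> - K}"
proof -
  obtain c where c: "c \<in> A" "p \<in> fst c" using atlas_cover .
  then have c': "c \<in> analytic_charts A" using atlas_subset by blast
  let ?U = "{t \<in> snd c ` fst c. chart_inv c t \<in> - K}"
  have "open ?U" by (rule open_chart_vimage[OF c']) (simp add: assms open_Compl)
  moreover have "snd c p \<in> ?U" using c assms chart(5)[OF c' c(2)] by auto
  ultimately obtain e where e: "e > 0" "ball (snd c p) e \<subseteq> ?U" using open_contains_ball by blast
  define r where "r = e / (2 * CARD('n)) / 3"
  have "r > 0" using e by (simp add: r_def)
  moreover have "cube (snd c p) (3 * r) \<subseteq> ?U"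
    using cube_subset_ball[OF e(1), of "snd c p"] e(2) by (simp add: r_def)
  ultimately show ?thesis using c by blast
qed

text \<open>M is the union of the compact rings between consecutive sets of the exhaustion. Each
  ring is covered by finitely many cubes that keep away from the exhaustion two levels further in,
  so a given \<open>E l\<close> is met by finitely many cubes only.\<close>

lemma locally_finite_cubes:
  "\<exists>c q r. (\<forall>j::nat. c j \<in> A \<and> r j > 0 \<and> cube (q j) (3 * r j) \<subseteq> snd (c j) ` fst (c j)) \<and>
     (\<forall>p. \<exists>j. p \<in> fst (c j) \<and> snd (c j) p \<in> cube (q j) (r j)) \<and>
     (\<forall>l. \<exists>N. \<forall>j\<ge>N. chart_inv (c j) ` cube (q j) (3 * r j) \<inter> E l = {})"
proof -
  define ring where "ring l = E l - interior (EE l)" for l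
  have ring: "compact (ring l)" for l
    unfolding ring_def by (intro compact_diff E(1)) simp
  \<comment> \<open>For l \<le> 1 truncated subtraction makes \<open>EE (l - 1)\<close> empty. For l
    \<ge> 2 it is \<open>E (l - 2)\<close>, which lies in the interior of \<open>E (l - 1)\<close>,
    that is of \<open>EE l\<close>.\<close>
  have avoid: "p \<notin> EE (l - 1)" if p: "p \<in> ring l" for l p
  proof (cases "l - 1")
    case 0
    then show ?thesis by (simp add: EE_def)
  next
    case (Suc m)
    then have "l = Suc (Suc m)" by simp
    then have "EE (l - 1) = E m" "EE l = E (Suc m)" by (simp_all add: EE_def)
    then show ?thesis using p E(2)[of m] by (auto simp: ring_def)
  qed
  have clEE: "closed (EE l)" for l
    using compact_imp_closed[OF E(1)] by (simp add: EE_def split: nat.splits)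
  define Q where "Q l p c r \<longleftrightarrow> c \<in> A \<and> p \<in> fst c \<and> r > 0 \<and>
      cube (snd c p) (3 * r) \<subseteq> {t \<in> snd c ` fst c. chart_inv c t \<in> - EE (l - 1)}" for l p c r
  have "\<exists>c r. Q l p c r" if "p \<in> ring l" for l p
    unfolding Q_def by (rule cube_at[OF clEE avoid[OF that]])
  then have "\<forall>x. \<exists>y. snd x \<in> ring (fst x) \<longrightarrow> Q (fst x) (snd x) (fst y) (snd y)" by simp
  then obtain f where "\<forall>x. snd x \<in> ring (fst x) \<longrightarrow> Q (fst x) (snd x) (fst (f x)) (snd (f x))"
    by (rule choice[THEN exE])
  then have f: "p \<in> ring l \<Longrightarrow> Q l p (fst (f (l, p))) (snd (f (l, p)))" for l p by simp
  define c where "c l p = fst (f (l, p))" for l p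
  define r where "r l p = snd (f (l, p))" for l p
  have "\<And>l p. p \<in> ring l \<Longrightarrow> Q l p (c l p) (r l p)" unfolding c_def r_def by (rule f)
  then have cr: "\<And>l p. p \<in> ring l \<Longrightarrow> c l p \<in> A \<and> p \<in> fst (c l p) \<and> r l p > 0 \<and>
      cube (snd (c l p) p) (3 * r l p) \<subseteq> {t \<in> snd (c l p) ` fst (c l p). chart_inv (c l p) t \<in> - EE (l - 1)}"
    unfolding Q_def .
  define N where "N l p = chart_inv (c l p) ` open_cube (snd (c l p) p) (r l p)" for l p
  have an: "c l p \<in> analytic_charts A" if "p \<in> ring l" for l p
    using cr[OF that] atlas_subset by blast
  have sub: "cube (snd (c l p) p) (r l p) \<subseteq> snd (c l p) ` fst (c l p)"
    "cube (snd (c l p) p) (3 * r l p) \<subseteq> snd (c l p) ` fst (c l p)" if "p \<in> ring l" for l p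
  proof -
    show 3: "cube (snd (c l p) p) (3 * r l p) \<subseteq> snd (c l p) ` fst (c l p)" using cr[OF that] by blast
    have "r l p > 0" using cr[OF that] by blast
    then have "r l p < 3 * r l p" by simp
    then have "cube (snd (c l p) p) (r l p) \<subseteq> cube (snd (c l p) p) (3 * r l p)"
      by (rule order_trans[OF cube_mono(1) cube_mono(2)])
    with 3 show "cube (snd (c l p) p) (r l p) \<subseteq> snd (c l p) ` fst (c l p)" by simp
  qed
  have opN: "open (N l p)" if "p \<in> ring l" for l p
    unfolding N_def using open_chart_inv_image[OF an[OF that] open_cube(1)] sub(1)[OF that] cube_mono(2) by blast
  have inN: "p \<in> N l p" if "p \<in> ring l" for l p
  proof -
    have "r l p > 0" "p \<in> fst (c l p)" using cr[OF that] by blast+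
    then show ?thesis
      unfolding N_def using open_cube(3)[of "r l p"] chart(5)[OF an[OF that], of p, symmetric]
      by (intro image_eqI[where x = "snd (c l p) p"]) simp_all
  qed
  have "\<forall>l. \<exists>F. F \<subseteq> ring l \<and> finite F \<and> ring l \<subseteq> (\<Union>p\<in>F. N l p)"
  proof
    fix l
    have "ring l \<subseteq> (\<Union>p\<in>ring l. N l p)" using inN by blast
    then show "\<exists>F. F \<subseteq> ring l \<and> finite F \<and> ring l \<subseteq> (\<Union>p\<in>F. N l p)"
      using compactE_image[OF ring[of l], of "ring l" "N l"] opN by metis
  qed
  then obtain F where F: "\<And>l. F l \<subseteq> ring l" "\<And>l. finite (F l)" "\<And>l. ring l \<subseteq> (\<Union>p\<in>F l. N l p)"
    by metis
  define J where "J = Sigma UNIV F"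
  have J: "p \<in> ring l" if "(l, p) \<in> J" for l p using that F(1) by (auto simp: J_def)
  have cov: "\<exists>l p'. (l, p') \<in> J \<and> p \<in> N l p'" for p
  proof -
    have "\<exists>l. p \<in> E l" using E(3) by blast
    then have l: "p \<in> E (LEAST l. p \<in> E l)" by (rule LeastI_ex)
    have "p \<notin> interior (EE (LEAST l. p \<in> E l))"
    proof (cases "LEAST l. p \<in> E l")
      case (Suc m)
      then have "p \<notin> E m" using not_less_Least[of m "\<lambda>l. p \<in> E l"] by simp
      then show ?thesis using Suc interior_subset by (auto simp: EE_def)
    qed (simp add: EE_def)
    with l have "p \<in> ring (LEAST l. p \<in> E l)" by (simp add: ring_def)
    then show ?thesis using F(3) unfolding J_def by blast
  qed
  \<comment> \<open>Finitely many compact cubes would make M compact; hence the countable index set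
    can be enumerated bijectively by the natural numbers.\<close>
  have "infinite J"
  proof
    assume fin: "finite J"
    have "compact (chart_inv (c l p) ` cube (snd (c l p) p) (r l p))" if "(l, p) \<in> J" for l p
      by (rule compact_continuous_image[OF continuous_on_subset[OF chart(4)[OF an[OF J[OF that]]] sub(1)[OF J[OF that]]] compact_cube])
    then have "compact (\<Union>(l, p)\<in>J. chart_inv (c l p) ` cube (snd (c l p) p) (r l p))"
      using fin by (intro compact_UN) auto
    moreover have "(\<Union>(l, p)\<in>J. chart_inv (c l p) ` cube (snd (c l p) p) (r l p)) = UNIV"
    proof -
      have "p \<in> (\<Union>(l, p)\<in>J. chart_inv (c l p) ` cube (snd (c l p) p) (r l p))" for p
        using cov[of p] cube_mono(2) unfolding N_def by fast
      then show ?thesis by blast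
    qed
    ultimately show False using noncompact by simp
  qed
  moreover have "countable J" unfolding J_def using F(2) by (intro countable_SIGMA) (auto intro: countable_finite)
  ultimately have bij: "bij_betw (from_nat_into J) UNIV J" by (intro bij_betw_from_nat_into)
  define e where "e = from_nat_into J"
  have inj: "inj e" and rng: "range e = J" using bij by (simp_all add: e_def bij_betw_def)
  have e: "e j \<in> J" "inj e" "i \<in> J \<Longrightarrow> \<exists>j. e j = i" for i j
    using inj unfolding rng[symmetric] by (auto intro: sym)
  have ej: "snd (e j) \<in> ring (fst (e j))" for j using J[of "fst (e j)" "snd (e j)"] e(1) by simp
  let ?c = "\<lambda>j. c (fst (e j)) (snd (e j))" and ?r = "\<lambda>j. r (fst (e j)) (snd (e j))"
  let ?q = "\<lambda>j. snd (?c j) (snd (e j))"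
  have "\<forall>j. ?c j \<in> A \<and> ?r j > 0 \<and> cube (?q j) (3 * ?r j) \<subseteq> snd (?c j) ` fst (?c j)"
    using cr[OF ej] sub(2)[OF ej] by blast
  moreover have "\<exists>j. p \<in> fst (?c j) \<and> snd (?c j) p \<in> cube (?q j) (?r j)" for p
  proof -
    obtain l p' where lp: "(l, p') \<in> J" "p \<in> N l p'" using cov by blast
    then obtain j where j: "e j = (l, p')" using e(3) by blast
    obtain t where t: "t \<in> open_cube (snd (c l p') p') (r l p')" "p = chart_inv (c l p') t"
      using lp(2) by (auto simp: N_def)
    then have t': "t \<in> cube (snd (c l p') p') (r l p')" using cube_mono(2) by blast
    then have "t \<in> snd (c l p') ` fst (c l p')" using sub(1)[OF J[OF lp(1)]] by blast
    then have "p \<in> fst (c l p')" "snd (c l p') p = t"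
      using chart(6,7)[OF an[OF J[OF lp(1)]]] t(2) by auto
    then show ?thesis using t' j by (intro exI[of _ j]) simp
  qed
  moreover have "\<exists>M. \<forall>j\<ge>M. chart_inv (?c j) ` cube (?q j) (3 * ?r j) \<inter> E l = {}" for l
  proof -
    have "finite (e -` Sigma {..<l + 2} F)"
      by (rule finite_vimageI[OF _ e(2)]) (use F(2) in auto)
    then obtain M where M: "\<forall>j\<in>e -` Sigma {..<l + 2} F. j < M" using finite_nat_set_iff_bounded by blast
    have "chart_inv (?c j) ` cube (?q j) (3 * ?r j) \<inter> E l = {}" if "j \<ge> M" for j
    proof -
      \<comment> \<open>The bound l + 2 suffices: from that ring on,
        \<open>EE (fst (e j) - 1)\<close> contains \<open>EE (Suc l)\<close>, which is
        \<open>E l\<close>.\<close>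
      have "e j \<notin> Sigma {..<l + 2} F" using M that by (auto simp: not_less[symmetric])
      then have "l + 2 \<le> fst (e j)" using e(1)[of j] by (cases "e j") (auto simp: J_def)
      then have "E l \<subseteq> EE (fst (e j) - 1)" using EE_mono[of "Suc l" "fst (e j) - 1"] by (simp add: EE_def)
      then show ?thesis using cr[OF ej[of j]] by auto
    qed
    then show ?thesis by blast
  qed
  ultimately show ?thesis by (intro exI[of _ ?c] exI[of _ ?q] exI[of _ ?r]) blast
qed

text \<open>The function \<open>X\<close> is a cutoff on one cube and \<open>w g\<close> is the
  cutoff times a formula that recovers \<phi> when g = \<L>\<phi>. A section not seen by the chain
  and vanishing over the cube gives \<open>w g = 0\<close>; this is the source of local
  finiteness.\<close>

lemma box_piece:
  assumes c: "c \<in> analytic_charts A" and r: "r > 0" and sub: "cube q (3 * r) \<subseteq> snd c ` fst c"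
    and S: "escapes K (chart_inv c q) S"
  shows "\<exists>X w. (\<forall>I :: ('a, 'm, 'n) tube_section set. ugevM I (\<lambda>_. X)) \<and>
    (\<forall>I l. ugev1 I \<longrightarrow> (\<forall>g\<in>I. vanishes_off (E l) g) \<longrightarrow> ugevM I w) \<and>
    (\<forall>g K' y. vanishes_off K g \<longrightarrow> vanishes_off K' g \<longrightarrow> chart_inv c ` cube q (3 * r) \<inter> K' = {} \<longrightarrow> w g y = 0) \<and>
    (\<forall>\<phi>\<in>gevrey_test_sections A s 0. \<forall>y. w (tube_L A \<omega> \<phi>) y = X y * scalar \<phi> y) \<and>
    (\<forall>g p \<xi>. p \<notin> chart_inv c ` cube q (2 * r) \<longrightarrow> w g (p, \<xi>) = 0) \<and>
    (\<forall>p \<xi>. p \<in> fst c \<longrightarrow> snd c p \<in> cube q r \<longrightarrow> X (p, \<xi>) = 1) \<and>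
    (\<forall>p. linear_functional (\<lambda>g \<xi>. w g (p, \<xi>)))"
proof -
  define B where "B = open_cube q (3 * r)"
  have B: "open B" "convex B" "q \<in> B" "B \<subseteq> snd c ` fst c"
    using open_cube(1,2)[of q "3 * r"] open_cube(3)[of "3 * r" q] r sub cube_mono(2)[of q "3 * r"]
    by (auto simp: B_def)
  note loc = c B
  have C: "compact (cube q (2 * r))" "cube q (2 * r) \<subseteq> B"
    using compact_cube cube_mono(1)[of "2 * r" "3 * r"] r by (auto simp: B_def)
  obtain \<kappa> :: "real^'n \<Rightarrow> complex" where \<kappa>: "gev s \<kappa> UNIV"
    "\<forall>t. (\<forall>i. \<bar>t $ i - q $ i\<bar> \<le> r) \<longrightarrow> \<kappa> t = 1" "\<forall>t i. \<bar>t $ i - q $ i\<bar> \<ge> 2 * r \<longrightarrow> \<kappa> t = 0"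
    using gevrey_box_cutoff[OF s r, of q] by blast
  have \<kappa>0: "\<kappa> t = 0" if t: "t \<notin> cube q (2 * r)" for t
  proof -
    obtain i where "\<not> \<bar>t $ i - q $ i\<bar> \<le> 2 * r" using t by (auto simp: cube_def)
    then show ?thesis using \<kappa>(3)[rule_format, of t i] by simp
  qed
  define X where "X = (extend0 c B (\<lambda>t \<xi>. \<kappa> t) :: 'a \<times> 'm torus \<Rightarrow> complex)"
  \<comment> \<open>The local solution determines \<phi> up to its value at the centre, at the torus
    point shifted back by \<psi>; the functional S supplies that value.\<close>
  define G where "G g t \<xi> = local_solution c q g t \<xi> + S g (torus_translate (- \<psi> c q t) \<xi>)" for g t \<xi>
  define w where "w g = extend0 c B (\<lambda>t \<xi>. \<kappa> t * G g t \<xi>)" for g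
  have Sl: "linear_functional S" and Su: "\<And>I l. ugev1 I \<Longrightarrow> \<forall>g\<in>I. vanishes_off (E l) g \<Longrightarrow>
      ugev s I (\<lambda>g x. S g (torus_class x)) UNIV"
    and S0: "\<And>g \<xi>. vanishes_off K g \<Longrightarrow> S g \<xi> = 0"
    and S\<phi>: "\<And>\<phi> \<xi>. \<phi> \<in> gevrey_test_sections A s 0 \<Longrightarrow> scalar \<phi> (chart_inv c q, \<xi>) = S (tube_L A \<omega> \<phi>) \<xi>"
    using S unfolding escapes_def by blast+
  have opBU: "open (B \<times> (UNIV :: (real^'m) set))" using B by (intro open_Times) auto
  have g\<kappa>: "gev s (\<lambda>y :: (real^'n) \<times> (real^'m). \<kappa> (fst y)) (B \<times> UNIV)"
    by (rule ugev_compose[OF s1 opBU open_UNIV \<kappa>(1) gev_map_linear[OF bounded_linear_fst s0]]) auto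
  have 1: "ugevM I (\<lambda>_. X)" for I :: "('a, 'm, 'n) tube_section set"
    unfolding X_def
    by (rule ugevM_extend0[OF c B(1,4) C]) (use ugev_of_gev[OF g\<kappa>] \<kappa>0 in auto)
  have 2: "ugevM I w" if I: "ugev1 I" "\<forall>g\<in>I. vanishes_off (E l) g" for I l
    unfolding w_def
  proof (rule ugevM_extend0[OF c B(1,4) C])
    have sh: "gev_map s (\<lambda>y :: (real^'n) \<times> (real^'m). snd (fst y, snd y - \<psi> c q (fst y))) (B \<times> UNIV)"
      by (rule gev_map_compose[OF s1 opBU open_UNIV gev_map_linear[OF bounded_linear_snd s0] gev_map_shear(2)[OF loc]]) auto
    have "ugev s I (\<lambda>g y. S g (torus_class (snd (fst y, snd y - \<psi> c q (fst y))))) (B \<times> UNIV)"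
      by (rule ugev_compose[OF s1 opBU open_UNIV Su[OF I] sh]) auto
    then have "ugev s I (\<lambda>g y. G g (fst y) (torus_class (snd y))) (B \<times> UNIV)"
      unfolding G_def by (intro ugev_add[OF opBU ugev_local_solution[OF loc I(1)]]) simp
    then show "ugev s I (\<lambda>g y. \<kappa> (fst y) * G g (fst y) (torus_class (snd y))) (B \<times> UNIV)"
      by (intro ugev_mult[OF s1 opBU ugev_of_gev[OF g\<kappa>]])
  qed (use \<kappa>0 in auto)
  have inB: "snd c p \<in> B" "chart_inv c (snd c p) = p" if p: "p \<in> chart_inv c ` B" for p
  proof -
    obtain t where t: "t \<in> B" "p = chart_inv c t" using p by blast
    then have "t \<in> snd c ` fst c" using B(4) by blast
    then show "snd c p \<in> B" "chart_inv c (snd c p) = p" using t chart(5-7)[OF c] by auto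
  qed
  have 3: "linear_functional (\<lambda>g \<xi>. w g (p, \<xi>))" for p
    using Sl local_solution_add[OF loc] local_solution_scale[OF loc] inB(1)[of p]
    unfolding linear_functional_def w_def extend0_def G_def by (auto simp: algebra_simps)
  have 4: "w g y = 0"
    if "vanishes_off K g" "vanishes_off K' g" "chart_inv c ` cube q (3 * r) \<inter> K' = {}" for g K' y
  proof -
    have "g (p, \<xi>) = 0" if "p \<in> chart_inv c ` B" for p \<xi>
      using that \<open>vanishes_off K' g\<close> \<open>chart_inv c ` cube q (3 * r) \<inter> K' = {}\<close> cube_mono(2)[of q "3 * r"]
      unfolding vanishes_off_def B_def by blast
    then have "G g t \<xi> = 0" if "t \<in> B" for t \<xi>
      using local_solution_zero[OF loc _ that] S0[OF \<open>vanishes_off K g\<close>] by (simp add: G_def)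
    then show ?thesis using inB(1) by (simp add: w_def extend0_def)
  qed
  have 5: "w (tube_L A \<omega> \<phi>) y = X y * scalar \<phi> y" if \<phi>: "\<phi> \<in> gevrey_test_sections A s 0" for \<phi> y
  proof -
    have "G (tube_L A \<omega> \<phi>) t \<xi> = scalar \<phi> (chart_inv c t, \<xi>)" if "t \<in> B" for t \<xi>
      using local_solution_tube_L[OF loc \<phi> that] S\<phi>[OF \<phi>, symmetric] by (simp add: G_def)
    then show ?thesis using inB[of "fst y"] by (cases y) (auto simp: w_def X_def extend0_def)
  qed
  have 6: "w g (p, \<xi>) = 0" if "p \<notin> chart_inv c ` cube q (2 * r)" for g p \<xi>
  proof (cases "p \<in> chart_inv c ` B")
    case True
    then have "snd c p \<notin> cube q (2 * r)" using inB(2)[OF True] that by (metis image_eqI)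
    then show ?thesis by (simp add: w_def extend0_def \<kappa>0)
  qed (simp add: w_def extend0_def)
  have 7: "X (p, \<xi>) = 1" if "p \<in> fst c" "snd c p \<in> cube q r" for p \<xi>
  proof -
    have "snd c p \<in> B" using that(2) cube_mono(1)[of r "3 * r" q] r by (auto simp: B_def)
    then have "p \<in> chart_inv c ` B" using chart(5)[OF c that(1)] by (metis image_eqI)
    then show ?thesis using \<kappa>(2) that(2) by (simp add: X_def extend0_def cube_def)
  qed
  show ?thesis
    by (rule exI[of _ X], rule exI[of _ w]) (use 1 2 3 4 5 6 7 in blast)
qed

text \<open>Cubes far out miss \<open>E l\<close>, and so do their chains because the levels tend to
  infinity. Hence for j \<ge> N l the j-th piece kills every section carried by \<open>E l\<close>.
  As N depends on l alone, the sum is uniformly finite there, and its values are supported in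
  finitely many cubes.\<close>

lemma left_inverse_exists:
  "\<exists>Sol. (\<forall>p. linear_functional (\<lambda>g \<xi>. Sol g (p, \<xi>))) \<and>
     (\<forall>I l. ugev1 I \<longrightarrow> (\<forall>g\<in>I. vanishes_off (E l) g) \<longrightarrow> ugevM I Sol) \<and>
     (\<forall>l. \<exists>C. compact C \<and> (\<forall>g p \<xi>. vanishes_off (E l) g \<longrightarrow> p \<notin> C \<longrightarrow> Sol g (p, \<xi>) = 0)) \<and>
     (\<forall>\<phi>\<in>gevrey_test_sections A s 0. Sol (tube_L A \<omega> \<phi>) = scalar \<phi>)"
proof -
  obtain c q r where cqr: "\<And>j::nat. c j \<in> A \<and> r j > 0 \<and> cube (q j) (3 * r j) \<subseteq> snd (c j) ` fst (c j)"
    and cov: "\<And>p. \<exists>j. p \<in> fst (c j) \<and> snd (c j) p \<in> cube (q j) (r j)"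
    and lf: "\<And>l. \<exists>N. \<forall>j\<ge>N. chart_inv (c j) ` cube (q j) (3 * r j) \<inter> E l = {}"
    using locally_finite_cubes by metis
  have c: "c j \<in> analytic_charts A" for j using cqr atlas_subset by blast
  define p where "p j = chart_inv (c j) (q j)" for j
  \<comment> \<open>The bound by j makes the set finite, so that the maximum exists, and 0 always
    belongs to it because \<open>ehull 0\<close> is empty.\<close>
  define lev where "lev j = Max {i. i \<le> j \<and> p j \<notin> ehull i}" for j
  have lev: "p j \<notin> ehull (lev j)" for j
  proof -
    have "finite {i. i \<le> j \<and> p j \<notin> ehull i}" by simp
    moreover have "0 \<in> {i. i \<le> j \<and> p j \<notin> ehull i}" by (simp add: ehull(3))
    ultimately have "lev j \<in> {i. i \<le> j \<and> p j \<notin> ehull i}" unfolding lev_def by (intro Max_in) auto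
    then show ?thesis by simp
  qed
  have lev_ge: "\<exists>N. \<forall>j\<ge>N. m \<le> lev j" for m
  proof -
    obtain l where l: "ehull m \<subseteq> interior (E l)" using compact_in_E[OF ehull(1)] .
    obtain N where N: "\<And>j. j \<ge> N \<Longrightarrow> chart_inv (c j) ` cube (q j) (3 * r j) \<inter> E l = {}" using lf by blast
    have "m \<le> lev j" if "j \<ge> max N m" for j
    proof -
      have "q j \<in> cube (q j) (3 * r j)" using cqr[of j] by (simp add: cube_def)
      then have "p j \<notin> E l" using N[of j] that by (auto simp: p_def)
      then have "p j \<notin> ehull m" using l interior_subset by blast
      then show ?thesis unfolding lev_def using that by (intro Max_ge) auto
    qed
    then show ?thesis by blast
  qed
  have "\<forall>j. \<exists>S. escapes (EE (lev j)) (p j) S" using escape_exists[OF lev] by blast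
  then obtain S where S: "\<And>j. escapes (EE (lev j)) (chart_inv (c j) (q j)) (S j)" unfolding p_def by metis
  define P where "P j X w \<longleftrightarrow> (\<forall>I :: ('a, 'm, 'n) tube_section set. ugevM I (\<lambda>_. X)) \<and>
    (\<forall>I l. ugev1 I \<longrightarrow> (\<forall>g\<in>I. vanishes_off (E l) g) \<longrightarrow> ugevM I w) \<and>
    (\<forall>g K' y. vanishes_off (EE (lev j)) g \<longrightarrow> vanishes_off K' g \<longrightarrow>
        chart_inv (c j) ` cube (q j) (3 * r j) \<inter> K' = {} \<longrightarrow> w g y = 0) \<and>
    (\<forall>\<phi>\<in>gevrey_test_sections A s 0. \<forall>y. w (tube_L A \<omega> \<phi>) y = X y * scalar \<phi> y) \<and>
    (\<forall>g p \<xi>. p \<notin> chart_inv (c j) ` cube (q j) (2 * r j) \<longrightarrow> w g (p, \<xi>) = 0) \<and>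
    (\<forall>p \<xi>. p \<in> fst (c j) \<longrightarrow> snd (c j) p \<in> cube (q j) (r j) \<longrightarrow> X (p, \<xi>) = 1) \<and>
    (\<forall>p. linear_functional (\<lambda>g \<xi>. w g (p, \<xi>)))"
    for j and X :: "'a \<times> 'm torus \<Rightarrow> complex" and w :: "('a, 'm, 'n) tube_section \<Rightarrow> 'a \<times> 'm torus \<Rightarrow> complex"
  have "\<exists>X w. P j X w" for j
    unfolding P_def by (rule box_piece[OF c _ _ S]) (use cqr in auto)
  then obtain X w where P: "\<And>j. P j (X j) (w j)" by metis
  have X': "\<forall>I :: ('a, 'm, 'n) tube_section set. ugevM I (\<lambda>_. X j)"
    and w': "\<forall>I l. ugev1 I \<longrightarrow> (\<forall>g\<in>I. vanishes_off (E l) g) \<longrightarrow> ugevM I (w j)"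
    and w0': "\<forall>g K' y. vanishes_off (EE (lev j)) g \<longrightarrow> vanishes_off K' g \<longrightarrow>
        chart_inv (c j) ` cube (q j) (3 * r j) \<inter> K' = {} \<longrightarrow> w j g y = 0"
    and w\<phi>': "\<forall>\<phi>\<in>gevrey_test_sections A s 0. \<forall>y. w j (tube_L A \<omega> \<phi>) y = X j y * scalar \<phi> y"
    and wsupp': "\<forall>g p \<xi>. p \<notin> chart_inv (c j) ` cube (q j) (2 * r j) \<longrightarrow> w j g (p, \<xi>) = 0"
    and X1': "\<forall>p \<xi>. p \<in> fst (c j) \<longrightarrow> snd (c j) p \<in> cube (q j) (r j) \<longrightarrow> X j (p, \<xi>) = 1"
    and wl': "\<forall>p. linear_functional (\<lambda>g \<xi>. w j g (p, \<xi>))" for j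
    using P[of j] unfolding P_def by - (elim conjE, assumption)+
  note X = X'[rule_format] and w = w'[THEN spec, THEN spec, THEN mp, THEN mp] and w0 = w0'[rule_format] and w\<phi> = w\<phi>'[rule_format]
    and wsupp = wsupp'[rule_format] and X1 = X1'[rule_format] and wl = wl'[rule_format]
  have "\<exists>N. \<forall>j\<ge>N. \<forall>g y. vanishes_off (E l) g \<longrightarrow> w j g y = 0" for l
  proof -
    obtain N where N: "\<And>j. j \<ge> N \<Longrightarrow> chart_inv (c j) ` cube (q j) (3 * r j) \<inter> E l = {}" using lf by blast
    obtain M where M: "\<And>j. j \<ge> M \<Longrightarrow> Suc l \<le> lev j" using lev_ge by blast
    have "w j g y = 0" if "j \<ge> max N M" "vanishes_off (E l) g" for j g y
    proof (rule w0[OF _ that(2) N])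
      have "E l \<subseteq> EE (lev j)" using EE_mono[OF M[of j]] that(1) by (simp add: EE_def)
      then show "vanishes_off (EE (lev j)) g" by (rule vanishes_off_mono[OF that(2)])
    qed (use that in simp)
    then show ?thesis by blast
  qed
  then obtain N where N: "\<And>l j g y. j \<ge> N l \<Longrightarrow> vanishes_off (E l) g \<Longrightarrow> w j g y = 0" by metis
  \<comment> \<open>The telescoping weights; the factor X j is already part of
    \<open>w j\<close>.\<close>
  define Sol where "Sol g y = (\<Sum>j. (\<Prod>i<j. 1 - X i y) * w j g y)" for g y
  have Sol: "Sol g y = (\<Sum>j<M. (\<Prod>i<j. 1 - X i y) * w j g y)" if "vanishes_off (E l) g" "M \<ge> N l" for g y l M
    unfolding Sol_def by (rule suminf_finite) (use N[OF _ that(1)] that(2) in auto)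
  have "linear_functional (\<lambda>g \<xi>. Sol g (p, \<xi>))" for p
    unfolding linear_functional_def
  proof (intro conjI ballI allI)
    fix g g' :: "('a, 'm, 'n) tube_section" and \<xi>
    assume g: "g \<in> gevrey_test_sections A s 1" "g' \<in> gevrey_test_sections A s 1"
    obtain l l' where l: "vanishes_off (E l) g" and l': "vanishes_off (E l') g'" using g test_vanishes_off by metis
    define m where "m = max l l'"
    have v: "vanishes_off (E m) g" "vanishes_off (E m) g'"
      using vanishes_off_mono[OF l E_mono] vanishes_off_mono[OF l' E_mono] by (simp_all add: m_def)
    show "Sol (g + g') (p, \<xi>) = Sol g (p, \<xi>) + Sol g' (p, \<xi>)"
      unfolding Sol[OF v(1) order_refl] Sol[OF v(2) order_refl] Sol[OF vanishes_off_add[OF v] order_refl]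
      using wl g unfolding linear_functional_def by (simp add: sum.distrib distrib_left)
  next
    fix \<alpha> and g :: "('a, 'm, 'n) tube_section" and \<xi> assume g: "g \<in> gevrey_test_sections A s 1"
    obtain l where l: "vanishes_off (E l) g" using g test_vanishes_off by metis
    have "w j (section_scale \<alpha> g) (p, \<xi>) = \<alpha> * w j g (p, \<xi>)" for j
      using wl[of j p] g unfolding linear_functional_def by blast
    then show "Sol (section_scale \<alpha> g) (p, \<xi>) = \<alpha> * Sol g (p, \<xi>)"
      unfolding Sol[OF l order_refl] Sol[OF vanishes_off_scale[OF l] order_refl]
      by (simp add: sum_distrib_left mult.left_commute)
  qed
  moreover have "ugevM I Sol" if I: "ugev1 I" "\<forall>g\<in>I. vanishes_off (E l) g" for I l
  proof -
    have "ugevM I (\<lambda>g y. \<Sum>j<N l. (\<Prod>i<j. 1 - X i y) * w j g y)"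
      by (intro ugevM_sum ugevM_mult ugevM_prod ugevM_diff ugevM_constant X w[OF I] finite_lessThan)
    moreover have "Sol g = (\<lambda>y. \<Sum>j<N l. (\<Prod>i<j. 1 - X i y) * w j g y)" if "g \<in> I" for g
      using Sol[of l g "N l"] I(2) that by blast
    ultimately show ?thesis
      unfolding ugevM_def
    proof (intro ballI)
      fix c assume c: "c \<in> analytic_charts A"
        and eq: "\<And>g. g \<in> I \<Longrightarrow> Sol g = (\<lambda>y. \<Sum>j<N l. (\<Prod>i<j. 1 - X i y) * w j g y)"
        and u: "\<forall>c\<in>analytic_charts A. ugev s I (\<lambda>g y. \<Sum>j<N l. (\<Prod>i<j. 1 - X i (tube_param c y)) * w j g (tube_param c y)) (tube_domain c)"
      show "ugev s I (\<lambda>g y. Sol g (tube_param c y)) (tube_domain c)"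
        by (rule ugev_cong[OF open_tube_domain[OF c] _ u[rule_format, OF c]]) (simp add: eq)
    qed
  qed
  moreover have "\<exists>C. compact C \<and> (\<forall>g p \<xi>. vanishes_off (E l) g \<longrightarrow> p \<notin> C \<longrightarrow> Sol g (p, \<xi>) = 0)" for l
  proof (intro exI conjI allI impI)
    show "compact (\<Union>j<N l. chart_inv (c j) ` cube (q j) (2 * r j))"
    proof (intro compact_UN finite_lessThan compact_continuous_image compact_cube)
      fix j
      have "cube (q j) (2 * r j) \<subseteq> snd (c j) ` fst (c j)"
        using cqr[of j] cube_mono(1)[of "2 * r j" "3 * r j" "q j"] cube_mono(2)[of "q j" "3 * r j"] by auto
      then show "continuous_on (cube (q j) (2 * r j)) (chart_inv (c j))"
        by (rule continuous_on_subset[OF chart(4)[OF c]])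
    qed
    fix g p \<xi> assume "vanishes_off (E l) g" and p: "p \<notin> (\<Union>j<N l. chart_inv (c j) ` cube (q j) (2 * r j))"
    then show "Sol g (p, \<xi>) = 0" using Sol[of l g "N l"] wsupp by (auto intro!: sum.neutral)
  qed
  moreover have "Sol (tube_L A \<omega> \<phi>) = scalar \<phi>" if \<phi>: "\<phi> \<in> gevrey_test_sections A s 0" for \<phi>
  proof
    fix y :: "'a \<times> 'm torus"
    obtain l where l: "vanishes_off (E l) (tube_L A \<omega> \<phi>)" using test_vanishes_off[OF tube_L_test[OF \<phi>]] .
    obtain k where k: "fst y \<in> fst (c k)" "snd (c k) (fst y) \<in> cube (q k) (r k)" using cov by blast
    \<comment> \<open>Large enough to exhaust the sum on sections carried by \<open>E l\<close> and
      to include the cube k, where \<open>X k\<close> is 1 at y and annihilates the remainder of the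
      telescoping sum.\<close>
    define M where "M = max (N l) (Suc k)"
    have "Sol (tube_L A \<omega> \<phi>) y = (\<Sum>j<M. (\<Prod>i<j. 1 - X i y) * X j y) * scalar \<phi> y"
      using Sol[OF l, of M y] w\<phi>[OF \<phi>] by (simp add: M_def sum_distrib_right mult.assoc)
    also have "(\<Prod>i<M. 1 - X i y) = 0"
      using X1[OF k, of "snd y"] by (intro prod_zero) (auto intro!: bexI[of _ k] simp: M_def)
    then have "(\<Sum>j<M. (\<Prod>i<j. 1 - X i y) * X j y) = 1" by (simp add: sum_telescoping_partition)
    finally show "Sol (tube_L A \<omega> \<phi>) y = scalar \<phi> y" by simp
  qed
  ultimately show ?thesis by blast
qed

end

section \<open>The steps of the inductive limit\<close>

lemma deriv_bound_sum:
  fixes C h :: real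
  assumes "open S" "y \<in> S" "finite K" "C \<ge> 0" "h \<ge> 0"
    and "\<And>k. k \<in> K \<Longrightarrow> smooth_on (f k) S" "\<And>k. k \<in> K \<Longrightarrow> deriv_bound s (f k) y C h"
  shows "deriv_bound s (\<lambda>x. \<Sum>k\<in>K. f k x) y (card K * C) h"
  using assms(3,6,7)
proof (induction K)
  case empty
  show ?case using assms(5) by (simp add: deriv_bound_0)
next
  case (insert k K)
  have "smooth_on (\<lambda>x. \<Sum>k\<in>K. f k x) S"
    using insert by (auto simp: smooth_on_iff_smoothN intro!: smoothN_sum[OF assms(1)])
  then have "deriv_bound s (\<lambda>x. f k x + (\<Sum>k\<in>K. f k x)) y (C + card K * C) (max h h)"
    using insert assms by (intro deriv_bound_add[OF assms(1,2)]) auto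
  then show ?case using insert by (simp add: algebra_simps)
qed

lemma iter_deriv_cmult:
  assumes "open S" "smooth_on f S" "bs \<in> lists Basis" "x \<in> S"
  shows "iter_deriv bs (\<lambda>x. a * f x) x = a * iter_deriv bs f x"
  using assms(3,4)
proof (induction bs arbitrary: x)
  case (Cons b bs)
  have "iter_deriv (b # bs) (\<lambda>x. a * f x) x = dir_deriv b (\<lambda>x. a * iter_deriv bs f x) x"
    by (simp, rule dir_deriv_cong[OF assms(1)]) (use Cons in auto)
  also have "\<dots> = a * dir_deriv b (iter_deriv bs f) x"
    using dir_deriv_mult[of "\<lambda>_. a" x "iter_deriv bs f" b] Cons assms(2)
    by (simp add: smooth_on_def dir_deriv_const)
  finally show ?case by simp
qed simp

lemma gevrey_norm_cmult_le:
  assumes "open S" "smooth_on f S" "K \<subseteq> S"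
  shows "gevrey_norm s K h (\<lambda>x. a * f x) \<le> ennreal (cmod a) * gevrey_norm s K h f"
  unfolding gevrey_norm_def[of s K h "\<lambda>x. a * f x"]
proof (intro SUP_least)
  fix bs :: "'a list" and x assume bs: "bs \<in> lists Basis" and x: "x \<in> K"
  let ?d = "h ^ length bs * real (multi_fact bs) powr s"
  have "ennreal (norm (iter_deriv bs (\<lambda>x. a * f x) x) / ?d) = ennreal (cmod a) * ennreal (norm (iter_deriv bs f x) / ?d)"
    using iter_deriv_cmult[OF assms(1,2) bs, of x a] x assms(3)
    by (subst ennreal_mult'[symmetric]) (auto simp: norm_mult)
  also have "\<dots> \<le> ennreal (cmod a) * gevrey_norm s K h f"
    unfolding gevrey_norm_def by (intro mult_left_mono SUP_upper2[OF bs] SUP_upper2[OF x]) auto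
  finally show "ennreal (norm (iter_deriv bs (\<lambda>x. a * f x) x) / ?d) \<le> ennreal (cmod a) * gevrey_norm s K h f" .
qed

lemma finite_frame_indices: "finite (frame_indices q :: (real^'n) list set)"
proof -
  have "frame_indices q = {xs. set xs \<subseteq> (Basis :: (real^'n) set) \<and> length xs = q}"
    by (auto simp: frame_indices_def in_lists_conv_set)
  then show ?thesis by (simp add: finite_lists_length_eq)
qed

context tube_complex
begin

lemma chart_pieceD:
  assumes "chart_pieces A L P" "(c, K') \<in> P"
  shows "c \<in> analytic_charts A" "compact K'" "K' \<subseteq> tube_domain c"
  using assms unfolding chart_pieces_def by auto

lemma gevrey_norm_le_section_norm:
  assumes "finite P" "(c, K') \<in> P" "J \<in> frame_indices q"
  shows "gevrey_norm s K' h (tube_coeff u c J) \<le> section_norm s q P h u"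
proof -
  have "gevrey_norm s K' h (tube_coeff u c J) \<le> (\<Sum>J\<in>frame_indices q. gevrey_norm s K' h (tube_coeff u c J))"
    using assms(3) by (intro member_le_sum) (auto simp: finite_frame_indices)
  also have "\<dots> \<le> (\<Sum>x\<in>P. case x of (c, K') \<Rightarrow> \<Sum>J\<in>frame_indices q. gevrey_norm s K' h (tube_coeff u c J))"
    using member_le_sum[of "(c, K')" P "\<lambda>(c, K'). \<Sum>J\<in>frame_indices q. gevrey_norm s K' h (tube_coeff u c J)"] assms(1,2)
    by simp
  finally show ?thesis by (simp add: section_norm_def)
qed

lemma section_norm_scale_le:
  fixes u :: "('a, 'm, 'n) tube_section"
  assumes P: "chart_pieces A L P" and u: "u \<in> smooth_tube_sections A q"
  shows "section_norm s q P h (section_scale a u) \<le> ennreal (cmod a) * section_norm s q P h u"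
  unfolding section_norm_def sum_distrib_left tube_coeff_scale case_prod_unfold
proof (intro sum_mono)
  fix x and J :: "(real^'n) list" assume x: "x \<in> P" and J: "J \<in> frame_indices q"
  then have x': "fst x \<in> analytic_charts A" "snd x \<subseteq> tube_domain (fst x)"
    using chart_pieceD[OF P, of "fst x" "snd x"] by auto
  show "gevrey_norm s (snd x) h (\<lambda>y. a * tube_coeff u (fst x) J y)
      \<le> ennreal (cmod a) * gevrey_norm s (snd x) h (tube_coeff u (fst x) J)"
    using u x' J
    by (intro gevrey_norm_cmult_le[OF open_tube_domain[OF x'(1)]]) (auto simp: smooth_tube_sections_def)
qed

text \<open>The transformation law of coefficients with Gevrey factors a. It carries information
  from the charts of the pieces, the only ones in which a step norm gives bounds, to an arbitrary
  chart.\<close>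

definition coeff_change ::
    "nat \<Rightarrow> ('a, 'n) chart \<Rightarrow> ('a, 'n) chart \<Rightarrow> (real^'n) list \<Rightarrow>
      ((real^'n) list \<Rightarrow> (real^'n) \<times> (real^'m) \<Rightarrow> complex) \<Rightarrow> bool" where
  "coeff_change q c c' J a \<longleftrightarrow>
     (\<forall>J'\<in>frame_indices q. gev s (a J') (overlap c c' \<times> UNIV)) \<and>
     (\<forall>g :: ('a, 'm, 'n) tube_section. (\<forall>p x. g (p, x) \<in> form_fibre A q p) \<longrightarrow>
        (\<forall>y\<in>overlap c c' \<times> UNIV. tube_coeff g c J y =
           (\<Sum>J'\<in>frame_indices q. a J' y * tube_coeff g c' J' (transition c c' (fst y), snd y))))"

lemma overlap_charts_at:
  assumes "c \<in> analytic_charts A" "c' \<in> analytic_charts A" "t \<in> overlap c c'"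
  shows "c \<in> charts_at A (chart_inv c t)" "c' \<in> charts_at A (chart_inv c t)"
  using assms mem_overlap[OF assms(1)] chart(6)[OF assms(1)] charts_atI by blast+

lemma coeff_change_0:
  assumes c: "c \<in> analytic_charts A" and c': "c' \<in> analytic_charts A"
  shows "coeff_change 0 c c' [] (\<lambda>_ _. 1)"
  unfolding coeff_change_def frame_indices_0
proof (intro conjI ballI allI impI)
  show "gev s (\<lambda>_. 1) (overlap c c' \<times> UNIV)" for J' :: "(real^'n) list" by (rule ugev_constant)
  fix g :: "('a, 'm, 'n) tube_section" and y :: "(real^'n) \<times> (real^'m)"
  assume g: "\<forall>p x. g (p, x) \<in> form_fibre A 0 p" and y: "y \<in> overlap c c' \<times> UNIV"
  then have t: "fst y \<in> overlap c c'" by auto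
  have "g (chart_inv c (fst y), torus_class (snd y)) c []
      = g (chart_inv c (fst y), torus_class (snd y)) c' (map (jacobian c c' (chart_inv c (fst y))) [])"
    by (rule form_fibreD(3)[OF g[rule_format] overlap_charts_at[OF c c' t]])
  then show "tube_coeff g c [] y = (\<Sum>J'\<in>{[]}. 1 * tube_coeff g c' J' (transition c c' (fst y), snd y))"
    using transition(2)[OF c c' t] by (simp add: tube_coeff_def tube_param_def case_prod_unfold)
qed

lemma coeff_change_1:
  assumes c: "c \<in> analytic_charts A" and c': "c' \<in> analytic_charts A" and b: "b \<in> Basis"
  shows "coeff_change 1 c c' [b]
    (\<lambda>J' y. dir_deriv b (\<lambda>t. complex_of_real (transition c c' t \<bullet> hd J')) (fst y))"
  unfolding coeff_change_def frame_indices_1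
proof (intro conjI ballI allI impI)
  fix J' :: "(real^'n) list" assume "J' \<in> (\<lambda>b. [b]) ` Basis"
  then have "gev s (\<lambda>t. complex_of_real (transition c c' t \<bullet> hd J')) (overlap c c')"
    using gev_map_transition[OF c c'] by (auto simp: gev_map_def)
  note d = ugev_dir_deriv[OF s0 this b]
  show "gev s (\<lambda>y :: (real^'n) \<times> (real^'m). dir_deriv b (\<lambda>t. complex_of_real (transition c c' t \<bullet> hd J')) (fst y)) (overlap c c' \<times> UNIV)"
    by (rule ugev_compose[OF s1 _ open_overlap[OF c c'] d gev_map_linear[OF bounded_linear_fst s0]])
      (auto intro!: open_Times open_overlap c c')
next
  fix g :: "('a, 'm, 'n) tube_section" and y :: "(real^'n) \<times> (real^'m)"
  assume g: "\<forall>p x. g (p, x) \<in> form_fibre A 1 p" and y: "y \<in> overlap c c' \<times> UNIV"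
  then have t: "fst y \<in> overlap c c'" by auto
  let ?p = "chart_inv c (fst y)" let ?g = "g (?p, torus_class (snd y))"
  let ?j = "jacobian c c' ?p b"
  have "?g c [b] = ?g c' [?j]"
    using form_fibreD(3)[OF g[rule_format] overlap_charts_at[OF c c' t], of "torus_class (snd y)" "[b]"] by simp
  also have "\<dots> = (\<Sum>k\<in>Basis. complex_of_real (?j \<bullet> k) * ?g c' [k])"
  proof -
    have "alternating_form 1 (?g c')" using form_fibreD(2)[OF g[rule_format] overlap_charts_at(2)[OF c c' t]] .
    then have "\<forall>vs i. length vs = 1 \<longrightarrow> i < 1 \<longrightarrow> linear (\<lambda>v. ?g c' (vs[i := v]))"
      unfolding alternating_form_def by blast
    from this[rule_format, of "[0]" 0] have lin: "linear (\<lambda>v. ?g c' [v])" by simp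
    have "?g c' [\<Sum>k\<in>Basis. (?j \<bullet> k) *\<^sub>R k] = (\<Sum>k\<in>Basis. complex_of_real (?j \<bullet> k) * ?g c' [k])"
      by (simp only: linear_sum[OF lin] linear_scale[OF lin]) (simp add: scaleR_conv_of_real)
    then show ?thesis by (simp add: euclidean_representation)
  qed
  also have "\<dots> = (\<Sum>k\<in>Basis. dir_deriv b (\<lambda>t. complex_of_real (transition c c' t \<bullet> k)) (fst y) * ?g c' [k])"
    by (simp add: jacobian(2)[OF c c' t])
  finally show "tube_coeff g c [b] y = (\<Sum>J'\<in>(\<lambda>b. [b]) ` Basis.
      dir_deriv b (\<lambda>t. complex_of_real (transition c c' t \<bullet> hd J')) (fst y) * tube_coeff g c' J' (transition c c' (fst y), snd y))"
    using transition(2)[OF c c' t]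
    by (simp add: sum.reindex inj_on_def tube_coeff_def tube_param_def case_prod_unfold)
qed

text \<open>A piece contains some representative of a torus point, not all of them, so bounds must
  be moved by periods.\<close>

lemma deriv_bound_periodic:
  fixes g :: "('a, 'm, 'n) tube_section"
  assumes "deriv_bound s (tube_coeff g c J) (t, x') C h" "torus_class x = torus_class x'"
  shows "deriv_bound s (tube_coeff g c J) (t, x) C h"
proof -
  let ?w = "(0, x' - x)"
  have "torus_class (z + (x' - x)) = torus_class z" for z
    using arg_cong[OF assms(2), of "torus_translate (z - x)"] by (simp add: algebra_simps)
  then have "(\<lambda>y. tube_coeff g c J (y + ?w)) = tube_coeff g c J"
    by (simp add: fun_eq_iff tube_coeff_def tube_param_def)
  then have "iter_deriv bs (tube_coeff g c J) (t, x) = iter_deriv bs (tube_coeff g c J) (t, x')" for bs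
    using iter_deriv_shift[of bs "tube_coeff g c J" ?w "(t, x)"] by simp
  then show ?thesis using assms(1) by (simp add: deriv_bound_def)
qed

lemma step_piece_bound:
  fixes P :: "(('a, 'n) chart \<times> ((real^'n) \<times> (real^'m)) set) set"
  assumes P: "chart_pieces A L P" and h: "h > 0" and B: "B \<ge> 0"
    and I: "\<And>g. g \<in> I \<Longrightarrow> g \<in> smooth_tube_sections A q \<and> section_norm s q P h g \<le> ennreal B"
    and c: "c \<in> analytic_charts A" and piece: "(c', K') \<in> P" and a: "coeff_change q c c' J a"
    and V: "compact V" "V \<subseteq> tube_domain c"
  shows "\<exists>C\<ge>0. \<exists>h>0. \<forall>g\<in>I. \<forall>y\<in>V. tube_param c y \<in> tube_param c' ` K' \<longrightarrow>
    deriv_bound s (tube_coeff g c J) y C h"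
proof -
  note c' = chart_pieceD[OF P piece]
  have finP: "finite P" using P by (simp add: chart_pieces_def)
  define D where "D = overlap c c' \<times> (UNIV :: (real^'m) set)"
  define \<Phi> where "\<Phi> y = (transition c c' (fst y), snd y)" for y :: "(real^'n) \<times> (real^'m)"
  have opD: "open D" unfolding D_def by (intro open_Times open_overlap c c'(1) open_UNIV)
  have gm: "gev_map s \<Phi> D"
    unfolding \<Phi>_def[abs_def] D_def by (rule gev_map_tube_transition[OF c c'(1) order_refl])
  have img: "\<Phi> ` D \<subseteq> tube_domain c'"
  proof (rule image_subsetI)
    fix y assume "y \<in> D"
    then have "fst y \<in> overlap c c'" by (auto simp: D_def)
    from transition(1)[OF c c'(1) this] show "\<Phi> y \<in> tube_domain c'"
      by (auto simp: \<Phi>_def tube_domain_def overlap_def)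
  qed
  define Q where "Q = chart_inv c' ` fst ` K'"
  have "compact Q"
    unfolding Q_def
  proof (intro compact_continuous_image continuous_intros c'(2))
    show "continuous_on (fst ` K') (chart_inv c')"
      by (rule continuous_on_subset[OF chart(4)[OF c'(1)]]) (use c'(3) in \<open>auto simp: tube_domain_def\<close>)
  qed
  then have clQ: "closed Q" by (rule compact_imp_closed)
  \<comment> \<open>The part of V over the projection of the piece to M. The projection is compact,
    hence closed, so Z is a compact subset of the overlap and the transition map has uniform
    constants on it, although V itself may leave the overlap.\<close>
  define Z where "Z = V \<inter> (\<lambda>y. chart_inv c (fst y)) -` Q"
  have "continuous_on V (\<lambda>y. chart_inv c (fst y))"
    by (rule continuous_on_compose2[OF chart(4)[OF c]]) (use V in \<open>auto simp: tube_domain_def intro!: continuous_intros\<close>)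
  then have "closed Z" unfolding Z_def
    by (rule continuous_closed_preimage[OF _ compact_imp_closed[OF V(1)] clQ])
  then have Zc: "compact Z" using V(1) closed_Int_compact[of Z V] by (simp add: Z_def Int_absorb2)
  have ZD: "Z \<subseteq> D"
  proof
    fix y assume y: "y \<in> Z"
    then have "chart_inv c (fst y) \<in> fst c'"
      using chart(6)[OF c'(1)] c'(3) by (auto simp: Z_def Q_def tube_domain_def)
    moreover have "fst y \<in> snd c ` fst c" using y V by (auto simp: Z_def tube_domain_def)
    ultimately show "y \<in> D" using mem_overlap[OF c] by (cases y) (simp add: D_def)
  qed
  obtain A1 b1 where 1: "A1 \<ge> 0" "b1 > 0" "\<forall>i\<in>(Basis \<times> Basis) \<times> {()}. \<forall>y\<in>Z.
      deriv_bound s ((\<lambda>((k, i), _). dir_deriv i (\<lambda>z. complex_of_real (\<Phi> z \<bullet> k))) i) y A1 b1"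
    using ugev_compact[OF gev_map_derivs[OF s0 gm] Zc ZD] .
  have "ugev s (frame_indices q \<times> {()}) (\<lambda>(J', _). a J') D"
    using a unfolding coeff_change_def D_def by (intro ugev_finite finite_frame_indices) blast
  then obtain A2 b2 where 2: "A2 \<ge> 0" "b2 > 0" "\<forall>i\<in>frame_indices q \<times> {()}. \<forall>y\<in>Z.
      deriv_bound s ((\<lambda>(J', _). a J') i) y A2 b2"
    using ugev_compact[OF _ Zc ZD] by blast
  define H where "H = 2 * b1 + 2 * DIM((real^'n) \<times> (real^'m)) * A1 * h"
  have H: "H > 0" unfolding H_def using 1 h by (intro add_pos_nonneg) auto
  define C where "C = real (card (frame_indices q :: (real^'n) list set)) * (2 * A2 * B)"
  have "deriv_bound s (tube_coeff g c J) y C (2 * b2 + H)"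
    if g: "g \<in> I" and y: "y \<in> V" "tube_param c y \<in> tube_param c' ` K'" for g y
  proof -
    obtain y' where y': "y' \<in> K'" "tube_param c y = tube_param c' y'" using y by blast
    then have eq: "chart_inv c (fst y) = chart_inv c' (fst y')" "torus_class (snd y) = torus_class (snd y')"
      by (simp_all add: tube_param_def case_prod_unfold)
    have yZ: "y \<in> Z" using y y' eq by (auto simp: Z_def Q_def)
    have yD: "y \<in> D" using yZ ZD by blast
    have "fst y' \<in> snd c' ` fst c'" using y'(1) c'(3) by (auto simp: tube_domain_def)
    then have \<Phi>y: "\<Phi> y = (fst y', snd y)" using eq(1) chart(7)[OF c'(1)] by (simp add: \<Phi>_def transition_def)
    have gs: "g \<in> smooth_tube_sections A q" "section_norm s q P h g \<le> ennreal B" using I[OF g] by auto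
    have sm: "smooth_on (tube_coeff g c' J') (tube_domain c')" if "J' \<in> frame_indices q" for J'
      using gs(1) c'(1) that by (simp add: smooth_tube_sections_def)
    have smD: "smooth_on (\<lambda>y. tube_coeff g c' J' (\<Phi> y)) D" if "J' \<in> frame_indices q" for J'
      by (rule smooth_on_compose[OF opD gev_map_smooth[OF gm] img sm[OF that]])
    have sma: "smooth_on (a J') D" if "J' \<in> frame_indices q" for J'
      using a that unfolding coeff_change_def D_def by (auto simp: ugev_def)
    have trm: "deriv_bound s (\<lambda>y. a J' y * tube_coeff g c' J' (\<Phi> y)) y (2 * A2 * B) (2 * b2 + H)"
      if J': "J' \<in> frame_indices q" for J'
    proof (rule deriv_bound_mult[OF s1 opD yD sma[OF J'] smD[OF J']])
      show "deriv_bound s (a J') y A2 b2" using 2(3)[rule_format, of "(J', ())" y] J' yZ by simp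
      have "gevrey_norm s K' h (tube_coeff g c' J') \<le> ennreal B"
        using gevrey_norm_le_section_norm[OF finP piece J', of h g] gs(2) by (rule order_trans)
      then have "deriv_bound s (tube_coeff g c' J') y' B h"
        by (rule deriv_bound_of_gevrey_norm[OF s0 h B _ y'(1)])
      then have "deriv_bound s (tube_coeff g c' J') (\<Phi> y) B h"
        unfolding \<Phi>y using deriv_bound_periodic[OF _ eq(2)] by (cases y') simp
      then show "deriv_bound s (\<lambda>y. tube_coeff g c' J' (\<Phi> y)) y B H"
        unfolding H_def
      proof (rule deriv_bound_compose[OF s1 opD yD gev_map_smooth[OF gm] img sm[OF J'], rotated 6])
        show "deriv_bound s (dir_deriv i (\<lambda>z. complex_of_real (\<Phi> z \<bullet> k))) y A1 b1"
          if "k \<in> Basis" "i \<in> Basis" for k i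
          using 1(3)[rule_format, of "((k, i), ())" y] that yZ by simp
      qed (use 1 h B in auto)
    qed (use 2 B H in auto)
    have "deriv_bound s (\<lambda>y. \<Sum>J'\<in>frame_indices q. a J' y * tube_coeff g c' J' (\<Phi> y)) y C (2 * b2 + H)"
      unfolding C_def
      by (rule deriv_bound_sum[OF opD yD finite_frame_indices _ _ smooth_on_mult[OF opD sma smD] trm])
        (use 2 B H in auto)
    then show ?thesis
    proof (rule deriv_bound_cong[OF opD yD, rotated])
      have "\<forall>p x. g (p, x) \<in> form_fibre A q p" using gs(1) by (simp add: smooth_tube_sections_def)
      then show "tube_coeff g c J z = (\<Sum>J'\<in>frame_indices q. a J' z * tube_coeff g c' J' (\<Phi> z))" if "z \<in> D" for z
        using a that unfolding coeff_change_def D_def \<Phi>_def by blast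
    qed
  qed
  moreover have "C \<ge> 0" "2 * b2 + H > 0" using 2 B H by (auto simp: C_def)
  ultimately show ?thesis by blast
qed

text \<open>Over L some piece controls the coefficients, after a change of chart; finitely many
  pieces give common constants. Off L the sections vanish locally. The bounds depend on the sections
  through B only.\<close>

lemma step_ugev:
  fixes P :: "(('a, 'n) chart \<times> ((real^'n) \<times> (real^'m)) set) set"
  assumes P: "chart_pieces A L P" and h: "h > 0" and B: "B \<ge> 0"
    and I: "\<And>g. g \<in> I \<Longrightarrow> g \<in> section_step A s q L P h \<and> section_norm s q P h g \<le> ennreal B"
    and c: "c \<in> analytic_charts A" and J: "J \<in> frame_indices q"
    and a: "\<And>c'. c' \<in> analytic_charts A \<Longrightarrow> \<exists>a. coeff_change q c c' J a"
  shows "ugev s I (\<lambda>g. tube_coeff g c J) (tube_domain c)"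
  unfolding ugev_def
proof (intro conjI ballI)
  fix g assume "g \<in> I"
  then show "smooth_on (tube_coeff g c J) (tube_domain c)"
    using I c J unfolding section_step_def smooth_tube_sections_def by blast
next
  fix y0 :: "(real^'n) \<times> (real^'m)" assume "y0 \<in> tube_domain c"
  then obtain e where e: "e > 0" "cball y0 e \<subseteq> tube_domain c"
    using open_tube_domain[OF c] open_contains_cball by blast
  have finP: "finite P" using P by (simp add: chart_pieces_def)
  have I': "\<And>g. g \<in> I \<Longrightarrow> g \<in> smooth_tube_sections A q \<and> section_norm s q P h g \<le> ennreal B"
    using I by (auto simp: section_step_def)
  have "\<forall>x\<in>P. \<exists>Ch. fst Ch \<ge> 0 \<and> snd Ch > 0 \<and> (\<forall>g\<in>I. \<forall>y\<in>cball y0 e.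
      tube_param c y \<in> tube_param (fst x) ` snd x \<longrightarrow> deriv_bound s (tube_coeff g c J) y (fst Ch) (snd Ch))"
  proof
    fix x assume x: "x \<in> P"
    then have piece: "(fst x, snd x) \<in> P" by simp
    obtain a' where "coeff_change q c (fst x) J a'" using a[OF chart_pieceD(1)[OF P piece]] by blast
    from step_piece_bound[OF P h B I' c piece this compact_cball e(2)]
    show "\<exists>Ch. fst Ch \<ge> 0 \<and> snd Ch > 0 \<and> (\<forall>g\<in>I. \<forall>y\<in>cball y0 e.
      tube_param c y \<in> tube_param (fst x) ` snd x \<longrightarrow> deriv_bound s (tube_coeff g c J) y (fst Ch) (snd Ch))"
      by auto
  qed
  from bchoice[OF this] obtain f where f: "\<forall>x\<in>P. fst (f x) \<ge> 0 \<and> snd (f x) > 0 \<and> (\<forall>g\<in>I. \<forall>y\<in>cball y0 e.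
      tube_param c y \<in> tube_param (fst x) ` snd x \<longrightarrow> deriv_bound s (tube_coeff g c J) y (fst (f x)) (snd (f x)))"
    by blast
  define C where "C = (\<Sum>x\<in>P. fst (f x))"
  define h' where "h' = 1 + (\<Sum>x\<in>P. snd (f x))"
  have "(\<Sum>x\<in>P. snd (f x)) \<ge> 0" by (rule sum_nonneg) (use f in \<open>auto intro: less_imp_le\<close>)
  moreover have "C \<ge> 0" unfolding C_def by (rule sum_nonneg) (use f in auto)
  ultimately have C: "C \<ge> 0" "h' > 0" unfolding h'_def by simp_all
  have "deriv_bound s (tube_coeff g c J) y C h'" if g: "g \<in> I" and y: "y \<in> ball y0 e" for g y
  proof (cases "tube_param c y \<in> L")
    case True
    moreover have "L \<subseteq> (\<Union>x\<in>P. tube_param (fst x) ` snd x)"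
      using P by (simp add: chart_pieces_def case_prod_unfold)
    ultimately obtain x where x: "x \<in> P" "tube_param c y \<in> tube_param (fst x) ` snd x" by blast
    have "y \<in> cball y0 e" using y by simp
    then have "deriv_bound s (tube_coeff g c J) y (fst (f x)) (snd (f x))"
      using f x g by blast
    moreover have "fst (f x) \<le> C" "snd (f x) \<le> (\<Sum>x\<in>P. snd (f x))"
      unfolding C_def by (rule member_le_sum; use x finP f in \<open>auto intro: less_imp_le\<close>)+
    ultimately show ?thesis
      using f x C by (intro deriv_bound_mono[of s _ y "fst (f x)" "snd (f x)" C h']) (auto simp: h'_def less_imp_le)
  next
    case False
    \<comment> \<open>The closed support of g is contained in L, so off L the section is zero on a
      whole neighbourhood and the bound is trivial.\<close>
    define W where "W = {z \<in> tube_domain c. tube_param c z \<in> - section_support g}"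
    have W: "open W" unfolding W_def
      by (rule open_tube_vimage[OF c]) (simp add: closed_section_support open_Compl)
    have "section_support g \<subseteq> L" using I[OF g] by (simp add: section_step_def)
    then have "y \<in> W" using False y e ball_subset_cball by (auto simp: W_def)
    then show ?thesis
      by (rule deriv_bound_cong[OF W _ _ deriv_bound_0])
        (use C in \<open>auto simp: W_def tube_coeff_def not_in_section_support\<close>)
  qed
  then show "\<exists>C\<ge>0. \<exists>h>0. \<exists>V. open V \<and> y0 \<in> V \<and> (\<forall>i\<in>I. \<forall>y\<in>V. deriv_bound s (tube_coeff i c J) y C h)"
    using C e by (intro exI[of _ C] conjI exI[of _ h'] exI[of _ "ball y0 e"]) auto
qed

lemma coeff_change_exists:
  assumes "q \<le> 1" "c \<in> analytic_charts A" "c' \<in> analytic_charts A" "J \<in> frame_indices q"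
  shows "\<exists>a. coeff_change q c c' J a"
proof (cases "q = 0")
  case True
  then have "J = []" using assms(4) by (simp add: frame_indices_0)
  then show ?thesis using True coeff_change_0[OF assms(2,3)] by blast
next
  case False
  then have q: "q = 1" using assms by simp
  obtain b where "b \<in> Basis" "J = [b]"
    using assms(4) unfolding q frame_indices_1 by blast
  with q show ?thesis using coeff_change_1[OF assms(2,3)] by blast
qed

text \<open>A step asks for smoothness and a finite norm on finitely many pieces, a test section for
  Gevrey bounds in every analytic chart; \<open>step_ugev\<close> for the family consisting of g
  alone bridges the two.\<close>

lemma step_subset_test:
  fixes P :: "(('a, 'n) chart \<times> ((real^'n) \<times> (real^'m)) set) set"
  assumes "chart_pieces A L P" "compact L" "h > 0" "q \<le> 1"
  shows "section_step A s q L P h \<subseteq> gevrey_test_sections A s q"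
proof
  fix g assume g: "g \<in> section_step A s q L P h"
  obtain B where B: "B \<ge> 0" "section_norm s q P h g = ennreal B"
    using g unfolding section_step_def by (cases "section_norm s q P h g") auto
  have u: "ugev s {g} (\<lambda>g. tube_coeff g c J) (tube_domain c)" if "c \<in> analytic_charts A" "J \<in> frame_indices q" for c J
    by (rule step_ugev[OF assms(1,3) B(1) _ that coeff_change_exists[OF assms(4) that(1) _ that(2)]])
      (use g B in auto)
  have "g \<in> gevrey_tube_sections A s q"
    unfolding gevrey_tube_sections_iff
    using g gev_of_ugev[OF u] by (auto simp: section_step_def smooth_tube_sections_def)
  moreover have "compact (section_support g)"
    using closed_Int_compact[OF closed_section_support assms(2), of g] g
    by (simp add: section_step_def Int_absorb2)
  ultimately show "g \<in> gevrey_test_sections A s q" by (simp add: gevrey_test_sections_def)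
qed

end

section \<open>Global solvability\<close>

context tube_complex
begin

lemma scalar_section_add: "scalar_section (\<lambda>y. v y + w y) = scalar_section v + scalar_section w"
  by (simp add: scalar_section_def fun_eq_iff)

lemma scalar_section_scale: "scalar_section (\<lambda>y. a * w y) = section_scale a (scalar_section w)"
  by (simp add: scalar_section_def section_scale_def fun_eq_iff)

lemma scalar_section_support:
  assumes "compact C" "\<And>p \<xi>. p \<notin> C \<Longrightarrow> w (p, \<xi>) = 0"
  shows "section_support (scalar_section w :: ('a, 'm, 'n) tube_section) \<subseteq> C \<times> UNIV"
    and "compact (section_support (scalar_section w :: ('a, 'm, 'n) tube_section))"
proof -
  have "closed (C \<times> (UNIV :: 'm torus set))"
    using assms(1) by (intro closed_Times compact_imp_closed) auto
  moreover have "scalar_section w (p, \<xi>) = (0 :: ('a, 'n) form_value)" if "p \<notin> C" for p and \<xi> :: "'m torus"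
    using assms(2)[OF that] by (simp add: scalar_section_def fun_eq_iff)
  then have "{y. (scalar_section w :: ('a, 'm, 'n) tube_section) y \<noteq> 0} \<subseteq> C \<times> UNIV" by force
  ultimately show sub: "section_support (scalar_section w :: ('a, 'm, 'n) tube_section) \<subseteq> C \<times> UNIV"
    unfolding section_support_def by (intro closure_minimal)
  show "compact (section_support (scalar_section w :: ('a, 'm, 'n) tube_section))"
    using closed_Int_compact[OF closed_section_support compact_Times[OF assms(1) compact_torus]] sub
    by (metis Int_absorb2)
qed

lemma section_norm_scalar_section_le:
  fixes P :: "(('a, 'n) chart \<times> ((real^'n) \<times> (real^'m)) set) set" and C h :: real
  assumes P: "chart_pieces A L P" and C: "C \<ge> 0" "h > 0"
    and w: "\<And>c K' y. (c, K') \<in> P \<Longrightarrow> y \<in> K' \<Longrightarrow> deriv_bound s (\<lambda>y. w (tube_param c y)) y C h"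
  shows "section_norm s 0 P (h * DIM((real^'n) \<times> (real^'m)) powr s) (scalar_section w) \<le> ennreal (card P * C)"
proof -
  have "gevrey_norm s K' (h * DIM((real^'n) \<times> (real^'m)) powr s) (tube_coeff (scalar_section w) c []) \<le> ennreal C"
    if piece: "(c, K') \<in> P" for c K'
  proof (rule gevrey_norm_le_of_deriv_bound[OF s0 C(2,1)])
    fix y assume y: "y \<in> K'"
    note c = chart_pieceD[OF P piece]
    show "deriv_bound s (tube_coeff (scalar_section w) c []) y C h"
    proof (rule deriv_bound_cong[OF open_tube_domain[OF c(1)] _ _ w[OF piece y]])
      show "y \<in> tube_domain c" using c(3) y by blast
      show "tube_coeff (scalar_section w) c [] x = w (tube_param c x)" if "x \<in> tube_domain c" for x
        by (rule tube_coeff_scalar_section[OF c(1) that])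
    qed
  qed
  then have "section_norm s 0 P (h * DIM((real^'n) \<times> (real^'m)) powr s) (scalar_section w) \<le> (\<Sum>x\<in>P. ennreal C)"
    unfolding section_norm_def frame_indices_0 by (intro sum_mono) auto
  also have "\<dots> = ennreal (card P * C)"
    using C(1) by (simp add: ennreal_mult' ennreal_of_nat_eq_real_of_nat)
  finally show ?thesis .
qed

lemma step_scale:
  fixes P :: "(('a, 'n) chart \<times> ((real^'n) \<times> (real^'m)) set) set"
  assumes "chart_pieces A L P" "g \<in> section_step A s q L P h"
  shows "section_scale a g \<in> section_step A s q L P h"
proof -
  have g: "g \<in> smooth_tube_sections A q" "section_support g \<subseteq> L" "section_norm s q P h g < \<infinity>"
    using assms(2) by (auto simp: section_step_def)
  have "smooth_on (tube_coeff (section_scale a g) c J) (tube_domain c)"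
    if "c \<in> analytic_charts A" "J \<in> frame_indices q" for c J
  proof -
    have "smooth_on (tube_coeff g c J) (tube_domain c)"
      using g(1) that by (simp add: smooth_tube_sections_def)
    then show ?thesis
      unfolding tube_coeff_scale
      by (intro smooth_on_mult[OF open_tube_domain[OF that(1)]]) (simp_all add: smooth_on_iff_smoothN smoothN_const)
  qed
  then have "section_scale a g \<in> smooth_tube_sections A q"
    using g(1) form_fibre_scale[of "g (p, x)" q p a for p x]
    by (auto simp: smooth_tube_sections_def section_scale_def)
  moreover have "section_norm s q P h (section_scale a g) < \<infinity>"
    using section_norm_scale_le[OF assms(1) g(1), of h a] g(3)
    by (metis ennreal_mult_less_top ennreal_less_top infinity_ennreal_def order_le_less_trans)
  ultimately show ?thesis using section_support_scale g(2) by (auto simp: section_step_def)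
qed

end

section \<open>Continuity of the left inverse and the duality argument\<close>

locale test_space = exhausted_tube_complex A s \<omega> "\<lambda>l. fst ` K l"
  for A :: "('a::{t2_space, second_countable_topology}, 'n::finite) chart set" and s :: real
    and \<omega> :: "'m::finite \<Rightarrow> 'a \<Rightarrow> ('a, 'n) form_value"
    and K :: "nat \<Rightarrow> ('a \<times> 'm torus) set" +
  fixes P :: "nat \<Rightarrow> (('a, 'n) chart \<times> ((real^'n) \<times> (real^'m)) set) set"
  assumes K: "compact_exhaustion K" and P: "\<And>l. chart_pieces A (K l) (P l)"
begin

abbreviation G :: "nat \<Rightarrow> ('a, 'm, 'n) tube_section set" where
  "G q \<equiv> gevrey_test_sections A s q"

abbreviation step :: "nat \<Rightarrow> nat \<times> real \<Rightarrow> ('a, 'm, 'n) tube_section set" where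
  "step q i \<equiv> section_step A s q (K (fst i)) (P (fst i)) (snd i)"

abbreviation step_norm :: "nat \<Rightarrow> nat \<times> real \<Rightarrow> ('a, 'm, 'n) tube_section \<Rightarrow> ennreal" where
  "step_norm q i \<equiv> section_norm s q (P (fst i)) (snd i)"

lemma compact_K: "compact (K l)"
  using K by (simp add: compact_exhaustion_def)

lemma openin_test:
  "openin (gevrey_test_topology A s K P q) W \<longleftrightarrow> W \<subseteq> G q \<and> (\<forall>u\<in>W. \<exists>V. absolutely_convex V \<and> V \<subseteq> G q \<and>
     (\<forall>i\<in>UNIV \<times> {0<..}. \<exists>\<epsilon>>0. {v \<in> step q i. step_norm q i v < \<epsilon>} \<subseteq> V) \<and> (\<lambda>v. u + v) ` V \<subseteq> W)"
  unfolding openin_gevrey_test_topology inductive_limit_open_def case_prod_unfold ..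

lemma absolutely_convex_G: "absolutely_convex (G q)"
  unfolding absolutely_convex_def by (auto intro: gevrey_test_add gevrey_test_scale)

lemma topspace_test:
  assumes "q \<le> 1"
  shows "topspace (gevrey_test_topology A s K P q) = G q"
proof
  show "topspace (gevrey_test_topology A s K P q) \<subseteq> G q"
    using openin_topspace[of "gevrey_test_topology A s K P q"] unfolding openin_test by blast
  have "openin (gevrey_test_topology A s K P q) (G q)"
    unfolding openin_test
  proof (intro conjI ballI order_refl exI[of _ "G q"])
    fix i :: "nat \<times> real" assume "i \<in> UNIV \<times> {0<..}"
    then have "step q i \<subseteq> G q"
      by (intro step_subset_test[OF P compact_K _ assms]) auto
    then show "\<exists>\<epsilon>>0. {v \<in> step q i. step_norm q i v < \<epsilon>} \<subseteq> G q" by (intro exI[of _ 1]) auto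
  qed (auto intro: gevrey_test_add absolutely_convex_G)
  then show "G q \<subseteq> topspace (gevrey_test_topology A s K P q)" by (rule openin_subset)
qed

lemma compact_in_K:
  assumes "compact C"
  obtains l where "C \<subseteq> K l"
proof -
  have int: "K l \<subseteq> interior (K (Suc l))" for l using K by (simp add: compact_exhaustion_def)
  have mono: "l \<le> l' \<Longrightarrow> K l \<subseteq> K l'" for l l'
    by (rule lift_Suc_mono_le[of K]) (rule order_trans[OF int interior_subset])
  have "C \<subseteq> (\<Union>l. interior (K l))"
  proof
    fix x
    have "x \<in> (\<Union>l. K l)" using K by (simp add: compact_exhaustion_def)
    then obtain l where "x \<in> K l" by blast
    then show "x \<in> (\<Union>l. interior (K l))" using int by blast
  qed
  then obtain T where T: "finite T" "C \<subseteq> (\<Union>l\<in>T. interior (K l))"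
    using compactE_image[OF assms, of UNIV "\<lambda>l. interior (K l)"] by auto
  have "interior (K l) \<subseteq> K (Max T)" if "l \<in> T" for l
    using order_trans[OF interior_subset mono[of l "Max T"]] that T(1) by simp
  then show thesis using T(2) that by blast
qed

text \<open>The unit ball of the step is used as the index family, so all bounds on its image are
  uniform. The image is supported in one compact set times the torus, thus in a single
  \<open>K l'\<close>, whose finitely many pieces yield one rate and one bound.\<close>

lemma left_inverse_continuous:
  assumes Sol: "\<And>p. linear_functional (\<lambda>g \<xi>. Sol g (p, \<xi>))"
      "\<And>I l. ugev1 I \<Longrightarrow> \<forall>g\<in>I. vanishes_off (fst ` K l) g \<Longrightarrow> ugevM I Sol"
      "\<And>l. \<exists>C. compact C \<and> (\<forall>g p \<xi>. vanishes_off (fst ` K l) g \<longrightarrow> p \<notin> C \<longrightarrow> Sol g (p, \<xi>) = 0)"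
    and i: "i \<in> UNIV \<times> {0<..}"
  shows "\<exists>i'\<in>UNIV \<times> {0<..}. \<exists>M\<ge>0. \<forall>g\<in>step 1 i. step_norm 1 i g \<le> 1 \<longrightarrow>
     scalar_section (Sol g) \<in> step 0 i' \<and> step_norm 0 i' (scalar_section (Sol g)) \<le> ennreal M"
proof -
  obtain l h where i: "i = (l, h)" "h > 0" using i by auto
  define I where "I = {g \<in> step 1 i. step_norm 1 i g \<le> 1}"
  have I: "ugev1 I"
    unfolding ugev1_def
  proof (intro ballI)
    fix c and b :: "real^'n" assume c: "c \<in> analytic_charts A" and b: "b \<in> Basis"
    then have J: "[b] \<in> frame_indices 1" unfolding frame_indices_1 using b by blast
    show "ugev s I (\<lambda>g. tube_coeff g c [b]) (tube_domain c)"
      by (rule step_ugev[OF P[of l] i(2) zero_le_one _ c J coeff_change_exists[OF order_refl c _ J]])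
        (auto simp: I_def i)
  qed
  have van: "\<forall>g\<in>I. vanishes_off (fst ` K l) g"
  proof
    fix g assume "g \<in> I"
    then have "section_support g \<subseteq> K l" by (simp add: I_def i section_step_def)
    then have "section_support g \<subseteq> fst ` K l \<times> UNIV" by force
    then show "vanishes_off (fst ` K l) g" by (rule vanishes_off_support)
  qed
  have SolI: "ugevM I Sol" by (rule Sol(2)[OF I van])
  obtain C where C: "compact C" "\<And>g p \<xi>. vanishes_off (fst ` K l) g \<Longrightarrow> p \<notin> C \<Longrightarrow> Sol g (p, \<xi>) = 0"
  proof -
    obtain C where "compact C" "\<forall>g p \<xi>. vanishes_off (fst ` K l) g \<longrightarrow> p \<notin> C \<longrightarrow> Sol g (p, \<xi>) = 0"
      using Sol(3)[of l] by (elim exE conjE)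
    then show thesis by (intro that) auto
  qed
  obtain l' where l': "C \<times> UNIV \<subseteq> K l'" using compact_in_K[OF compact_Times[OF C(1) compact_torus]] .
  have finP: "finite (P l')" using P[of l'] by (simp add: chart_pieces_def)
  have "\<forall>x\<in>P l'. \<exists>Ch. fst Ch \<ge> 0 \<and> snd Ch > 0 \<and>
      (\<forall>g\<in>I. \<forall>y\<in>snd x. deriv_bound s (\<lambda>y. Sol g (tube_param (fst x) y)) y (fst Ch) (snd Ch))"
  proof
    fix x assume "x \<in> P l'"
    then have "(fst x, snd x) \<in> P l'" by simp
    note c = chart_pieceD[OF P this]
    obtain C h where "C \<ge> 0" "h > 0"
      "\<forall>g\<in>I. \<forall>y\<in>snd x. deriv_bound s (\<lambda>y. Sol g (tube_param (fst x) y)) y C h"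
      using ugev_compact[OF SolI[unfolded ugevM_def, rule_format, OF c(1)] c(2,3)] .
    then show "\<exists>Ch. fst Ch \<ge> 0 \<and> snd Ch > 0 \<and>
        (\<forall>g\<in>I. \<forall>y\<in>snd x. deriv_bound s (\<lambda>y. Sol g (tube_param (fst x) y)) y (fst Ch) (snd Ch))"
      by (intro exI[of _ "(C, h)"]) simp
  qed
  from bchoice[OF this] obtain f where f: "\<forall>x\<in>P l'. fst (f x) \<ge> 0 \<and> snd (f x) > 0 \<and>
      (\<forall>g\<in>I. \<forall>y\<in>snd x. deriv_bound s (\<lambda>y. Sol g (tube_param (fst x) y)) y (fst (f x)) (snd (f x)))"
    by blast
  define C' where "C' = (\<Sum>x\<in>P l'. fst (f x))"
  define h' where "h' = 1 + (\<Sum>x\<in>P l'. snd (f x))"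
  have "(\<Sum>x\<in>P l'. snd (f x)) \<ge> 0" by (rule sum_nonneg) (use f in \<open>auto intro: less_imp_le\<close>)
  moreover have "C' \<ge> 0" unfolding C'_def by (rule sum_nonneg) (use f in auto)
  ultimately have C': "C' \<ge> 0" "h' > 0" unfolding h'_def by simp_all
  have bd: "deriv_bound s (\<lambda>y. Sol g (tube_param c y)) y C' h'"
    if g: "g \<in> I" and x: "(c, K') \<in> P l'" and y: "y \<in> K'" for g c K' y
  proof -
    have "deriv_bound s (\<lambda>y. Sol g (tube_param c y)) y (fst (f (c, K'))) (snd (f (c, K')))"
      using f g x y by force
    moreover have "fst (f (c, K')) \<le> C'" "snd (f (c, K')) \<le> (\<Sum>x\<in>P l'. snd (f x))"
      unfolding C'_def by (rule member_le_sum; use x finP f in \<open>auto intro: less_imp_le\<close>)+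
    moreover have "0 < snd (f (c, K'))" using f x by blast
    ultimately show ?thesis
      using C' by (intro deriv_bound_mono[of s _ y "fst (f (c, K'))" "snd (f (c, K'))" C' h']) (auto simp: h'_def less_imp_le)
  qed
  \<comment> \<open>The dimension factor is the cost of returning from
    \<open>fact (length bs)\<close> to \<open>multi_fact bs\<close>.\<close>
  define H where "H = h' * DIM((real^'n) \<times> (real^'m)) powr s"
  have H: "H > 0" unfolding H_def using C'(2) DIM_positive[where 'a="(real^'n) \<times> (real^'m)"]
    by (simp del: DIM_prod DIM_cart)
  have "scalar_section (Sol g) \<in> step 0 (l', H) \<and>
      step_norm 0 (l', H) (scalar_section (Sol g)) \<le> ennreal (card (P l') * C')" if g: "g \<in> I" for g
  proof
    show nrm: "step_norm 0 (l', H) (scalar_section (Sol g)) \<le> ennreal (card (P l') * C')"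
      unfolding H_def fst_conv snd_conv
      by (rule section_norm_scalar_section_le[OF P C' bd[OF g]])
    have "vanishes_off (fst ` K l) g" using van g by blast
    then have "section_support (scalar_section (Sol g) :: ('a, 'm, 'n) tube_section) \<subseteq> C \<times> UNIV"
      by (intro scalar_section_support(1)[OF C(1)]) (rule C(2))
    then have "section_support (scalar_section (Sol g) :: ('a, 'm, 'n) tube_section) \<subseteq> K l'"
      using l' by (rule order_trans)
    moreover have "scalar_section (Sol g) \<in> smooth_tube_sections A 0"
    proof -
      have "scalar_section (Sol g) \<in> gevrey_tube_sections A s 0" by (rule scalar_section_gevrey[OF SolI g])
      then show ?thesis unfolding gevrey_tube_sections_iff smooth_tube_sections_def by (auto simp: ugev_def)
    qed
    moreover have "step_norm 0 (l', H) (scalar_section (Sol g)) < \<infinity>"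
      using nrm by (rule order_le_less_trans) simp
    ultimately show "scalar_section (Sol g) \<in> step 0 (l', H)" by (simp add: section_step_def)
  qed
  moreover have "real (card (P l')) * C' \<ge> 0" using C' by simp
  ultimately show ?thesis using H
    by (intro bexI[of _ "(l', H)"] exI[of _ "card (P l') * C'"]) (auto simp: I_def)
qed

text \<open>The sign \<sigma> in u is the one in the formal transpose and squares to 1. Continuity
  of u is checked by pulling back an absolutely convex neighbourhood under the left inverse R: since
  R maps unit balls of steps into balls of steps, the preimage contains a ball of each step.\<close>

lemma surjective:
  assumes f: "f \<in> ultradistributions A s K P CARD('n)"
  shows "\<exists>u\<in>ultradistributions A s K P (CARD('n) - 1). ultra_L A s \<omega> (CARD('n) - 1) u = f"
proof -
  \<comment> \<open>The test sections have degree 1 for u and degree 0 for f;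
    \<open>CARD('n)\<close> is positive, so the natural subtractions behave.\<close>
  have n: "CARD('n) - (CARD('n) - 1) = 1" "CARD('n) - (CARD('n) - 1) - 1 = 0" "CARD('n) - CARD('n) = 0"
    using zero_less_card_finite[where 'a='n] by linarith+
  have f_ext: "f \<in> extensional (G 0)"
    and f_add: "\<And>\<phi> \<phi>'. \<phi> \<in> G 0 \<Longrightarrow> \<phi>' \<in> G 0 \<Longrightarrow> f (\<phi> + \<phi>') = f \<phi> + f \<phi>'"
    and f_scale: "\<And>a \<phi>. \<phi> \<in> G 0 \<Longrightarrow> f (section_scale a \<phi>) = a * f \<phi>"
    and f_cont: "continuous_map (gevrey_test_topology A s K P 0) euclidean f"
    using f unfolding ultradistributions_def Let_def n by blast+
  obtain Sol where Sol: "\<And>p. linear_functional (\<lambda>g \<xi>. Sol g (p, \<xi>))"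
      "\<And>I l. ugev1 I \<Longrightarrow> \<forall>g\<in>I. vanishes_off (fst ` K l) g \<Longrightarrow> ugevM I Sol"
      "\<And>l. \<exists>C. compact C \<and> (\<forall>g p \<xi>. vanishes_off (fst ` K l) g \<longrightarrow> p \<notin> C \<longrightarrow> Sol g (p, \<xi>) = 0)"
      "\<And>\<phi>. \<phi> \<in> G 0 \<Longrightarrow> Sol (tube_L A \<omega> \<phi>) = scalar \<phi>"
    using left_inverse_exists by (elim exE conjE) blast
  define R where "R g = (scalar_section (Sol g) :: ('a, 'm, 'n) tube_section)" for g
  have R_add: "R (g + g') = R g + R g'" if "g \<in> G 1" "g' \<in> G 1" for g g'
  proof -
    have "Sol (g + g') y = Sol g y + Sol g' y" for y
      using Sol(1)[of "fst y"] that unfolding linear_functional_def by (cases y) simp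
    then have "Sol (g + g') = (\<lambda>y. Sol g y + Sol g' y)" by blast
    then show ?thesis by (simp add: R_def scalar_section_add)
  qed
  have R_scale: "R (section_scale a g) = section_scale a (R g)" if "g \<in> G 1" for a g
  proof -
    have "Sol (section_scale a g) y = a * Sol g y" for y
      using Sol(1)[of "fst y"] that unfolding linear_functional_def by (cases y) simp
    then have "Sol (section_scale a g) = (\<lambda>y. a * Sol g y)" by blast
    then show ?thesis by (simp add: R_def scalar_section_scale)
  qed
  have R_G: "R g \<in> G 0" if g: "g \<in> G 1" for g
  proof -
    obtain l where l: "vanishes_off (fst ` K l) g" using test_vanishes_off[OF g] .
    have "ugev1 {g}" using g by (intro ugev1_single) (simp add: gevrey_test_sections_def)
    then have "ugevM {g} Sol" using Sol(2) l by blast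
    then have "R g \<in> gevrey_tube_sections A s 0" unfolding R_def by (rule scalar_section_gevrey) simp
    moreover obtain C where "compact C" "\<forall>g p \<xi>. vanishes_off (fst ` K l) g \<longrightarrow> p \<notin> C \<longrightarrow> Sol g (p, \<xi>) = 0"
      using Sol(3)[of l] by (elim exE conjE)
    then have C: "compact C" "\<And>p \<xi>. p \<notin> C \<Longrightarrow> Sol g (p, \<xi>) = 0" using l by auto
    moreover have "compact (section_support (R g))"
      unfolding R_def by (rule scalar_section_support(2)[OF C(1)]) (rule C(2))
    ultimately show ?thesis by (simp add: gevrey_test_sections_def)
  qed
  have R_L: "R (tube_L A \<omega> \<phi>) = \<phi>" if \<phi>: "\<phi> \<in> G 0" for \<phi>
  proof -
    have "\<phi> (p, \<xi>) \<in> form_fibre A 0 p" for p \<xi>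
      using \<phi> unfolding gevrey_test_sections_def gevrey_tube_sections_iff by blast
    then show ?thesis by (simp add: R_def Sol(4)[OF \<phi>] scalar_section_scalar)
  qed
  define \<sigma> :: complex where "\<sigma> = (-1) ^ (CARD('n) - 1 + 1)"
  have \<sigma>: "\<sigma> * \<sigma> = 1" "cmod \<sigma> = 1" by (simp_all add: \<sigma>_def norm_power flip: power_mult_distrib)
  define u where "u = (\<lambda>g\<in>G 1. \<sigma> * f (R g))"
  have u_add: "u (g + g') = u g + u g'" if "g \<in> G 1" "g' \<in> G 1" for g g'
    using that by (simp add: u_def gevrey_test_add R_add f_add R_G distrib_left)
  have u_scale: "u (section_scale a g) = a * u g" if "g \<in> G 1" for a g
    using that by (simp add: u_def gevrey_test_scale R_scale f_scale R_G)
  have zero: "0 \<in> G 0" if "\<phi> \<in> G 0" for \<phi> :: "('a, 'm, 'n) tube_section"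
  proof -
    have "section_scale 0 \<phi> = 0" by (simp add: section_scale_def fun_eq_iff)
    then show ?thesis using gevrey_test_scale[OF that, of 0] by simp
  qed
  have open_pre: "openin (gevrey_test_topology A s K P 1) {g \<in> G 1. u g \<in> W}" if W: "open W" for W
    unfolding openin_test
  proof (intro conjI ballI)
    fix g0 assume g0: "g0 \<in> {g \<in> G 1. u g \<in> W}"
    obtain e where e: "e > 0" "ball (u g0) e \<subseteq> W" using W g0 open_contains_ball by blast
    have "openin (gevrey_test_topology A s K P 0) {\<phi> \<in> G 0. f \<phi> \<in> ball 0 e}"
      using f_cont unfolding continuous_map topspace_test[OF zero_le_one]
      by (elim conjE allE[of _ "ball 0 e"] impE) auto
    moreover have "0 \<in> {\<phi> \<in> G 0. f \<phi> \<in> ball 0 e}"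
    proof -
      have z: "0 \<in> G 0" using zero[OF R_G] g0 by blast
      have "section_scale 0 0 = (0 :: ('a, 'm, 'n) tube_section)" by (simp add: section_scale_def fun_eq_iff)
      then have "f 0 = 0" using f_scale[OF z, of 0] by simp
      then show ?thesis using z e by simp
    qed
    ultimately obtain V where V: "absolutely_convex V" "V \<subseteq> G 0"
      "\<forall>i\<in>UNIV \<times> {0<..}. \<exists>\<epsilon>>0. {v \<in> step 0 i. step_norm 0 i v < \<epsilon>} \<subseteq> V"
      "(\<lambda>v. 0 + v) ` V \<subseteq> {\<phi> \<in> G 0. f \<phi> \<in> ball 0 e}"
      unfolding openin_test by meson
    define V' where "V' = {g \<in> G 1. R g \<in> V}"
    have "absolutely_convex V'"
      unfolding absolutely_convex_def
    proof (intro ballI allI impI)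
      fix v w a b assume v: "v \<in> V'" and w: "w \<in> V'" and ab: "cmod a + cmod b \<le> 1"
      have G: "v \<in> G 1" "w \<in> G 1" using v w by (auto simp: V'_def)
      have "R (section_scale a v + section_scale b w) = section_scale a (R v) + section_scale b (R w)"
        by (simp only: R_add[OF gevrey_test_scale[OF G(1)] gevrey_test_scale[OF G(2)]] R_scale[OF G(1)] R_scale[OF G(2)])
      also have "\<dots> \<in> V" using V(1) v w ab unfolding absolutely_convex_def V'_def by blast
      finally show "section_scale a v + section_scale b w \<in> V'"
        using G by (simp add: V'_def gevrey_test_add gevrey_test_scale)
    qed
    moreover have "\<exists>\<epsilon>>0. {v \<in> step 1 i. step_norm 1 i v < \<epsilon>} \<subseteq> V'" if i: "i \<in> UNIV \<times> {0<..}" for i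
    proof -
      obtain i' M where i': "i' \<in> UNIV \<times> {0<..}" "M \<ge> 0" and
        bd: "\<And>g. g \<in> step 1 i \<Longrightarrow> step_norm 1 i g \<le> 1 \<Longrightarrow> R g \<in> step 0 i' \<and> step_norm 0 i' (R g) \<le> ennreal M"
      proof -
        have "\<exists>i'\<in>UNIV \<times> {0<..}. \<exists>M\<ge>0. \<forall>g\<in>step 1 i. step_norm 1 i g \<le> 1 \<longrightarrow>
            scalar_section (Sol g) \<in> step 0 i' \<and> step_norm 0 i' (scalar_section (Sol g)) \<le> ennreal M"
        proof (rule left_inverse_continuous[where Sol = Sol, OF Sol(1)])
          fix I l assume "ugev1 I" "\<forall>g\<in>I. vanishes_off (fst ` K l) g"
          then show "ugevM I Sol" by (rule Sol(2))
        qed (rule Sol(3), rule i)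
        then show thesis unfolding R_def[symmetric] by (elim bexE exE conjE) (rule that, auto)
      qed
      obtain \<epsilon> where \<epsilon>: "\<epsilon> > 0" "{v \<in> step 0 i'. step_norm 0 i' v < \<epsilon>} \<subseteq> V" using V(3) i'(1) by blast
      \<comment> \<open>The radius \<epsilon> is an extended number and may be infinite; the scaling
        needs a positive real one below it.\<close>
      obtain d where d: "0 < d" "ennreal d < \<epsilon>"
      proof (cases \<epsilon>)
        case (real r)
        then have "0 < r / 2" "ennreal (r / 2) < \<epsilon>" using \<epsilon>(1) by (auto intro: ennreal_lessI)
        then show ?thesis by (rule that)
      next
        case top
        then show ?thesis by (intro that[of 1]) auto
      qed
      \<comment> \<open>A section of norm below \<delta> has norm at most 1 after division by
        \<delta>, so its image has norm at most \<delta> M \<le> d. The summand 1 prevents division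
        by zero.\<close>
      define \<delta> where "\<delta> = d / (M + 1)"
      have \<delta>: "\<delta> > 0" "\<delta> * M \<le> d" using d i'(2) by (auto simp: \<delta>_def field_simps)
      have "g \<in> V'" if g: "g \<in> step 1 i" "step_norm 1 i g < ennreal \<delta>" for g
      proof -
        have gG: "g \<in> G 1" using step_subset_test[OF P compact_K _ order_refl] g(1) i by force
        define g' where "g' = section_scale (complex_of_real (1 / \<delta>)) g"
        have g'G: "g' \<in> G 1" unfolding g'_def by (rule gevrey_test_scale[OF gG])
        have gs: "g \<in> smooth_tube_sections A 1" using g(1) by (simp add: section_step_def)
        have "step_norm 1 i g' \<le> ennreal (cmod (complex_of_real (1 / \<delta>))) * step_norm 1 i g"
          unfolding g'_def by (rule section_norm_scale_le[OF P gs])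
        also have "\<dots> \<le> ennreal (cmod (complex_of_real (1 / \<delta>))) * ennreal \<delta>"
          using g(2) by (intro mult_left_mono) auto
        also have "\<dots> = 1" using \<delta>(1) by (simp add: norm_divide flip: ennreal_mult)
        finally have g': "R g' \<in> step 0 i'" "step_norm 0 i' (R g') \<le> ennreal M"
          using bd[of g'] step_scale[OF P g(1)] unfolding g'_def by blast+
        have "g = section_scale (complex_of_real \<delta>) g'"
          using \<delta>(1) by (simp add: g'_def section_scale_def fun_eq_iff)
        then have Rg: "R g = section_scale (complex_of_real \<delta>) (R g')" using R_scale[OF g'G] by simp
        have Rs: "R g' \<in> smooth_tube_sections A 0" using g'(1) by (simp add: section_step_def)
        have "step_norm 0 i' (R g) \<le> ennreal (cmod (complex_of_real \<delta>)) * step_norm 0 i' (R g')"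
          unfolding Rg by (rule section_norm_scale_le[OF P Rs])
        also have "\<dots> \<le> ennreal \<delta> * ennreal M" using g'(2) \<delta>(1) by (intro mult_mono) auto
        also have "\<dots> = ennreal (\<delta> * M)" using \<delta>(1) i'(2) by (simp add: ennreal_mult)
        also have "\<dots> \<le> ennreal d" using \<delta>(2) by (rule ennreal_leI)
        also have "\<dots> < \<epsilon>" by (rule d(2))
        finally have "R g \<in> V" using \<epsilon>(2) step_scale[OF P g'(1)] Rg by auto
        then show ?thesis using gG by (simp add: V'_def)
      qed
      then show ?thesis using \<delta>(1) by (intro exI[of _ "ennreal \<delta>"]) auto
    qed
    moreover have "(\<lambda>v. g0 + v) ` V' \<subseteq> {g \<in> G 1. u g \<in> W}"
    proof (rule image_subsetI)
      fix v assume v: "v \<in> V'"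
      then have vG: "v \<in> G 1" and "f (R v) \<in> ball 0 e" using V(4) by (auto simp: V'_def)
      then have "cmod (u v) < e" using \<sigma>(2) by (simp add: u_def norm_mult)
      then have "u (g0 + v) \<in> ball (u g0) e" using u_add[of g0 v] g0 vG by (simp add: dist_norm)
      then show "g0 + v \<in> {g \<in> G 1. u g \<in> W}" using e(2) g0 vG gevrey_test_add by blast
    qed
    moreover have "V' \<subseteq> G 1" by (auto simp: V'_def)
    ultimately show "\<exists>V. absolutely_convex V \<and> V \<subseteq> G 1 \<and>
       (\<forall>i\<in>UNIV \<times> {0<..}. \<exists>\<epsilon>>0. {v \<in> step 1 i. step_norm 1 i v < \<epsilon>} \<subseteq> V) \<and>
       (\<lambda>v. g0 + v) ` V \<subseteq> {g \<in> G 1. u g \<in> W}" by blast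
  qed auto
  have "u \<in> ultradistributions A s K P (CARD('n) - 1)"
    unfolding ultradistributions_def Let_def n
  proof (intro CollectI conjI ballI allI)
    show "u \<in> extensional (G 1)" by (simp add: u_def)
    show "continuous_map (gevrey_test_topology A s K P 1) euclidean u"
      unfolding continuous_map topspace_test[OF order_refl] using open_pre by simp
  qed (auto intro: u_add u_scale)
  moreover have "ultra_L A s \<omega> (CARD('n) - 1) u = f"
  proof
    fix \<phi>
    show "ultra_L A s \<omega> (CARD('n) - 1) u \<phi> = f \<phi>"
    proof (cases "\<phi> \<in> G 0")
      case True
      have L: "tube_L A \<omega> \<phi> \<in> G 1" by (rule tube_L_test[OF True])
      have "ultra_L A s \<omega> (CARD('n) - 1) u \<phi> = u (section_scale \<sigma> (tube_L A \<omega> \<phi>))"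
        unfolding ultra_L_def n \<sigma>_def using True by simp
      also have "\<dots> = \<sigma> * (\<sigma> * f (R (tube_L A \<omega> \<phi>)))" using u_scale[OF L] L by (simp add: u_def)
      also have "\<dots> = f \<phi>" using \<sigma>(1) R_L[OF True] by (simp flip: mult.assoc)
      finally show ?thesis .
    next
      case False
      then show ?thesis using f_ext unfolding ultra_L_def n by (simp add: extensional_def)
    qed
  qed
  ultimately show ?thesis by blast
qed

end

theorem theorem4p11:
  fixes A :: "('a::{t2_space, second_countable_topology}, 'n::finite) chart set"
    and \<omega> :: "'m::finite \<Rightarrow> 'a \<Rightarrow> ('a, 'n) form_value"
    and s :: real
    and K :: "nat \<Rightarrow> ('a \<times> 'm torus) set"
    and P :: "nat \<Rightarrow> (('a, 'n) chart \<times> ((real^'n) \<times> (real^'m)) set) set"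
  assumes "s > 1"
    and "oriented_analytic_atlas A"
    and "connected (UNIV :: 'a set)"
    and "\<not> compact (UNIV :: 'a set)"
    and "\<And>k. gevrey_one_form A s (\<omega> k)"
    and "\<And>k. real_form (\<omega> k)"
    and "\<And>k. closed_form A (\<omega> k)"
    and "compact_exhaustion K"
    and "\<And>l. chart_pieces A (K l) (P l)"
  shows "\<forall>f\<in>ultradistributions A s K P CARD('n).
           \<exists>u\<in>ultradistributions A s K P (CARD('n) - 1). ultra_L A s \<omega> (CARD('n) - 1) u = f"
proof -
  have K: "\<And>l. compact (K l)" "\<And>l. K l \<subseteq> interior (K (Suc l))" "(\<Union>l. K l) = UNIV"
    using assms(8) by (auto simp: compact_exhaustion_def)
  interpret test_space A s \<omega> K P
  proof
    show "analytic_atlas A" using assms(2) by (simp add: oriented_analytic_atlas_def)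
    show "compact (fst ` K l)" for l
      by (intro compact_continuous_image continuous_intros K(1))
    \<comment> \<open>The projection to M is an open map, so the image of an interior is
      open.\<close>
    show "fst ` K l \<subseteq> interior (fst ` K (Suc l))" for l
    proof (rule order_trans[OF image_mono[OF K(2)]], rule interior_maximal)
      show "open (fst ` interior (K (Suc l)))" by (rule open_image_fst) simp
    qed (use interior_subset in blast)
    have "(\<Union>l. fst ` K l) = fst ` (\<Union>l. K l)" by blast
    then show "(\<Union>l. fst ` K l) = UNIV" unfolding K(3) by simp
  qed (use assms in auto)
  show ?thesis using surjective by blast
qed

end
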